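(* Let $g$ be a bounded real function of $t\ge0$, let $s>\frac52$ and $u_0\in E^s_{2,2}$. Assume that for some $x_0\in\mathbb{R}$ one has $u_{0xx}(x)\ge0$ for $x\le x_0$, $u_{0xx}(x)\le0$ for $x\ge x_0$, and $u_{0x}(x_0)>0$. Then the corresponding solution $u$ of the Cauchy problem $$u_t+uu_x=\int_{-\infty}^{x}\tfrac12u_x^2(t,z)\,dz+g(t),\qquad u(0,x)=u_0(x),\quad x\in\mathbb{R},$$ exists globally in time.
   Context: All functions are real-valued on $\mathbb{R}$. For $s\ge2$, $E^s_{2,2}=L^\infty(\mathbb{R})\cap\dot H^1(\mathbb{R})\cap\dot H^s(\mathbb{R})$, i.e. the space of bounded functions $u$ with $u_x\in H^{s-1}(\mathbb{R})$, normed by $\|u\|_{L^\infty}+\|u_x\|_{H^{s-1}}$; and $\bar E^s_{2,2}=L^\infty\cap\dot H^{s-1}$, i.e. bounded functions $u$ with $|D|^{s-2}u_x\in L^2$, with the corresponding norm. The corresponding solution is the unique solution in $C([0,T];E^s_{2,2})\cap C^1([0,T];\bar E^s_{2,2})$; its maximal existence time $T^*\in(0,\infty]$ is the supremum of the $T>0$ for which it exists on $[0,T]$. "Exists globally in time" means $T^*=\infty$.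
   Formalization: The function g is additionally assumed continuous on t ≥ 0; a solution in the stated class, with the equation holding at every time, forces g to be continuous, so the claim fails for a bounded discontinuous g. *)

theory Defs
  imports "HOL-Analysis.Analysis"
begin

definition test_function :: "(real \<Rightarrow> real) \<Rightarrow> bool" where
  "test_function \<phi> \<longleftrightarrow>
     (\<forall>n x. ((deriv ^^ n) \<phi>) field_differentiable (at x)) \<and> compact (closure {x. \<phi> x \<noteq> 0})"

text \<open>Unitary normalisation, so that Plancherel's identity carries no constant.\<close>

definition fourier_L1 :: "(real \<Rightarrow> real) \<Rightarrow> real \<Rightarrow> complex" where
  "fourier_L1 \<phi> \<xi> =
     (LINT x|lborel. complex_of_real (\<phi> x) * cis (- (x * \<xi>))) / complex_of_real (sqrt (2 * pi))"

text \<open>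
  The Fourier transform of a function \<open>f\<close> (square integrable, or merely bounded) in the sense of
  tempered distributions: on the open set \<open>U\<close> it is represented by the locally integrable
  function \<open>F\<close>. Such an \<open>F\<close> is unique almost everywhere on \<open>U\<close>.
  For \<open>f\<close> in \<open>L\<^sup>2\<close> one takes \<open>U = UNIV\<close>.
\<close>

definition has_fourier_on :: "real set \<Rightarrow> (real \<Rightarrow> real) \<Rightarrow> (real \<Rightarrow> complex) \<Rightarrow> bool" where
  "has_fourier_on U f F \<longleftrightarrow>
     F \<in> borel_measurable borel \<and>
     (\<forall>K. compact K \<and> K \<subseteq> U \<longrightarrow> set_integrable lborel K F) \<and>
     (\<forall>\<phi>. test_function \<phi> \<and> closure {x. \<phi> x \<noteq> 0} \<subseteq> U \<longrightarrow>
        (LINT x|lborel. complex_of_real (f x) * fourier_L1 \<phi> x) =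
        (LINT \<xi>|lborel. F \<xi> * complex_of_real (\<phi> \<xi>)))"

definition fourier_on :: "real set \<Rightarrow> (real \<Rightarrow> real) \<Rightarrow> real \<Rightarrow> complex" where
  "fourier_on U f = (SOME F. has_fourier_on U f F)"

text \<open>The inhomogeneous Sobolev space \<open>H\<^sup>r\<close> on the line, for \<open>r \<ge> 0\<close>.\<close>

definition sobolev :: "real \<Rightarrow> (real \<Rightarrow> real) set" where
  "sobolev r = {f. f \<in> borel_measurable borel \<and> integrable lborel (\<lambda>x. (f x)\<^sup>2) \<and>
     (\<exists>F. has_fourier_on UNIV f F \<and>
          integrable lborel (\<lambda>\<xi>. (1 + \<xi>\<^sup>2) powr r * (cmod (F \<xi>))\<^sup>2))}"

definition sobolev_norm :: "real \<Rightarrow> (real \<Rightarrow> real) \<Rightarrow> real" where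
  "sobolev_norm r f =
     sqrt (LINT \<xi>|lborel. (1 + \<xi>\<^sup>2) powr r * (cmod (fourier_on UNIV f \<xi>))\<^sup>2)"

text \<open>
  \<open>|D|\<^sup>\<sigma> u\<^sub>x \<in> L\<^sup>2\<close> for a bounded function \<open>u\<close> and \<open>\<sigma> \<ge> 0\<close>, together with the \<open>L\<^sup>2\<close> norm of
  \<open>|D|\<^sup>\<sigma> u\<^sub>x\<close>. The multiplier \<open>\<i> \<xi> |\<xi>|\<^sup>\<sigma>\<close> vanishes at the origin, which
  is why only the Fourier transform of \<open>u\<close> off the origin enters; for instance, constants
  have norm zero.
\<close>

definition frac_deriv_L2 :: "real \<Rightarrow> (real \<Rightarrow> real) \<Rightarrow> bool" where
  "frac_deriv_L2 \<sigma> u \<longleftrightarrow> (\<exists>F. has_fourier_on (- {0}) u F \<and>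
     integrable lborel (\<lambda>\<xi>. (cmod (of_real (\<bar>\<xi>\<bar> powr \<sigma>) * (\<i> * of_real \<xi> * F \<xi>)))\<^sup>2))"

definition frac_deriv_norm :: "real \<Rightarrow> (real \<Rightarrow> real) \<Rightarrow> real" where
  "frac_deriv_norm \<sigma> u = sqrt (LINT \<xi>|lborel.
     (cmod (of_real (\<bar>\<xi>\<bar> powr \<sigma>) * (\<i> * of_real \<xi> * fourier_on (- {0}) u \<xi>)))\<^sup>2)"

definition sup_norm :: "(real \<Rightarrow> real) \<Rightarrow> real" where
  "sup_norm u = (SUP x. \<bar>u x\<bar>)"

text \<open>
  The space \<open>E\<^sup>s\<^sub>2\<^sub>,\<^sub>2\<close> of bounded functions with \<open>u\<^sub>x\<close> in \<open>H\<^sup>s\<^sup>-\<^sup>1\<close>, and its companion, the bounded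
  functions with \<open>|D|\<^sup>s\<^sup>-\<^sup>2 u\<^sub>x\<close> in \<open>L\<^sup>2\<close>, for \<open>s \<ge> 2\<close>.
  Every equivalence class in the first contains exactly one
  \<open>C\<^sup>1\<close> function (its distributional derivative lies in \<open>H\<^sup>1\<close>, hence is continuous), and every
  class in the second exactly one continuous function. The elements below are these
  representatives; in particular \<open>deriv u\<close> is the distributional derivative and
  the supremum is the \<open>L\<^sup>\<infinity>\<close> norm. For \<open>s > 5/2\<close> elements of the first space are \<open>C\<^sup>2\<close>.
\<close>

definition E_space :: "real \<Rightarrow> (real \<Rightarrow> real) set" where
  "E_space s = {u. bounded (range u) \<and> u C1_differentiable_on UNIV \<and> deriv u \<in> sobolev (s - 1)}"

definition E_norm :: "real \<Rightarrow> (real \<Rightarrow> real) \<Rightarrow> real" where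
  "E_norm s u = sup_norm u + sobolev_norm (s - 1) (deriv u)"

definition Ebar_space :: "real \<Rightarrow> (real \<Rightarrow> real) set" where
  "Ebar_space s = {u. bounded (range u) \<and> continuous_on UNIV u \<and> frac_deriv_L2 (s - 2) u}"

definition Ebar_norm :: "real \<Rightarrow> (real \<Rightarrow> real) \<Rightarrow> real" where
  "Ebar_norm s u = sup_norm u + frac_deriv_norm (s - 2) u"

definition C0_into ::
  "real set \<Rightarrow> (real \<Rightarrow> real) set \<Rightarrow> ((real \<Rightarrow> real) \<Rightarrow> real) \<Rightarrow> (real \<Rightarrow> real \<Rightarrow> real) \<Rightarrow> bool"
where
  "C0_into I X nrm u \<longleftrightarrow> (\<forall>t\<in>I. u t \<in> X) \<and>
     (\<forall>t\<in>I. ((\<lambda>\<tau>. nrm (\<lambda>x. u \<tau> x - u t x)) \<longlongrightarrow> 0) (at t within I))"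

text \<open>\<open>u\<close> is in \<open>C\<^sup>1(I; X)\<close> with time derivative \<open>ut\<close>; one-sided at the endpoints of \<open>I\<close>.\<close>

definition C1_into ::
  "real set \<Rightarrow> (real \<Rightarrow> real) set \<Rightarrow> ((real \<Rightarrow> real) \<Rightarrow> real) \<Rightarrow>
   (real \<Rightarrow> real \<Rightarrow> real) \<Rightarrow> (real \<Rightarrow> real \<Rightarrow> real) \<Rightarrow> bool"
where
  "C1_into I X nrm u ut \<longleftrightarrow> C0_into I X nrm u \<and> C0_into I X nrm ut \<and>
     (\<forall>t\<in>I. ((\<lambda>\<tau>. nrm (\<lambda>x. (u \<tau> x - u t x) / (\<tau> - t) - ut t x)) \<longlongrightarrow> 0) (at t within I))"

text \<open>
  Solutions on \<open>[0,T]\<close>, where \<open>u t x\<close> is the value at time \<open>t\<close> and position \<open>x\<close>. As the equation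
  holds at every time and \<open>u\<^sub>t\<close> is continuous in time, a solution on \<open>[0,T]\<close>
  can exist only if \<open>g\<close> is continuous on \<open>[0,T]\<close>.
\<close>

definition is_solution ::
  "(real \<Rightarrow> real) \<Rightarrow> real \<Rightarrow> (real \<Rightarrow> real) \<Rightarrow> real \<Rightarrow> (real \<Rightarrow> real \<Rightarrow> real) \<Rightarrow> bool"
where
  "is_solution g s u0 T u \<longleftrightarrow>
     C0_into {0..T} (E_space s) (E_norm s) u \<and>
     (\<exists>ut. C1_into {0..T} (Ebar_space s) (Ebar_norm s) u ut \<and>
        (\<forall>t\<in>{0..T}. \<forall>x. ut t x + u t x * deriv (u t) x =
           (LBINT z:{..x}. 1/2 * (deriv (u t) z)\<^sup>2) + g t)) \<and>
     u 0 = u0"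

definition corresponding_solution ::
  "(real \<Rightarrow> real) \<Rightarrow> real \<Rightarrow> (real \<Rightarrow> real) \<Rightarrow> real \<Rightarrow> (real \<Rightarrow> real \<Rightarrow> real) \<Rightarrow> bool"
where
  "corresponding_solution g s u0 T u \<longleftrightarrow> is_solution g s u0 T u \<and>
     (\<forall>w. is_solution g s u0 T w \<longrightarrow> (\<forall>t\<in>{0..T}. w t = u t))"

definition max_existence_time :: "(real \<Rightarrow> real) \<Rightarrow> real \<Rightarrow> (real \<Rightarrow> real) \<Rightarrow> ereal" where
  "max_existence_time g s u0 =
     Sup {ereal T |T. 0 < T \<and> (\<exists>u. corresponding_solution g s u0 T u)}"

end

theory Submission
  imports Defs "HOL-Probability.Probability" "HOL-Computational_Algebra.Polynomial"
begin

text \<open>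
  Write \<open>v = u\<^sub>x\<close>. Along a characteristic \<open>v\<close> obeys \<open>v' = - v\<^sup>2 / 2\<close>, and the energy of \<open>v\<close> to the left
  of the characteristic is conserved. Hence the flow and the velocity along it are explicit: from
  the label \<open>y\<close> they are quadratic and affine in time up to primitives of \<open>g\<close>, and \<open>v\<close> becomes
  \<open>v0 / (1 + t v0 / 2)\<close>. The unimodal function \<open>v0\<close> is square integrable, hence nonnegative, so that
  the denominator never vanishes and the flow is an increasing diffeomorphism for all times.

  What remains is that the explicit function lies in the prescribed spaces and is the only
  solution. For the first point, composition with the inverse flow and multiplication by smooth
  functions are bounded on \<open>L\<^sup>2\<close> and \<open>H\<^sup>2\<close>, hence by interpolation on the fractional spaces in
  between, and \<open>H\<^sup>r\<close> is an algebra. For the second, a given solution determines Lagrangian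
  labels by the explicit formulas; the defects between its velocity and energy and those predicted
  from the labels are transported by it and vanish initially, so they vanish by a maximum principle.
\<close>

section \<open>Square integrable functions and the Fourier transform\<close>

text \<open>The order \<open>r = s - 1\<close> of \<open>u\<^sub>x\<close> is an arbitrary real
  above 3/2, and this shapes the proof. The inverse flow is only as smooth as \<open>v0\<close>, so
  composition with it has to be controlled at the same fractional order as its own Jacobian: the
  chain rule peels off one derivative at a time until an order below 2 is left, where interpolation
  applies. Continuity of the composition in time combines bounds uniform in time with density of
  smooth functions. Neither \<open>u0\<close> nor the energy decays, so products with them fall
  outside the algebra property and need an argument of their own. The equation differentiated in
  space is v_t + u v_x = - v^2 / 2. Its solution along characteristics makes the Jacobian of the
  flow the perfect square (1 + t v0 / 2)^2, which cancels the denominator of v^2; this is why the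
  energy is conserved. In the uniqueness part a given solution is never followed along its
  characteristics: its labels are written down as an Eulerian function, and constancy along the flow
  becomes a linear transport equation.\<close>

definition sqn :: "(real \<Rightarrow> complex) \<Rightarrow> ennreal" where
  "sqn F = (\<integral>\<^sup>+x. ennreal ((cmod (F x))\<^sup>2) \<partial>lborel)"

definition L2 :: "(real \<Rightarrow> complex) \<Rightarrow> bool" where
  "L2 F \<longleftrightarrow> F \<in> borel_measurable borel \<and> sqn F < \<infinity>"

definition fhat :: "(real \<Rightarrow> complex) \<Rightarrow> real \<Rightarrow> complex" where
  "fhat F x = (LINT y|lborel. F y * cis (- (x * y))) / complex_of_real (sqrt (2 * pi))"

definition ift :: "(real \<Rightarrow> complex) \<Rightarrow> real \<Rightarrow> complex" where
  "ift F x = fhat F (- x)"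

lemma fourier_L1_eq: "fourier_L1 \<phi> = fhat (\<lambda>x. of_real (\<phi> x))"
  unfolding fourier_L1_def fhat_def by (simp add: fun_eq_iff mult.commute)

lemma L2_measurable [measurable_dest]: "L2 F \<Longrightarrow> F \<in> borel_measurable borel"
  by (simp add: L2_def)

lemma cmod_add_sq: "(cmod (a + b))\<^sup>2 \<le> 2 * (cmod a)\<^sup>2 + 2 * (cmod b)\<^sup>2"
proof -
  have "(cmod (a + b))\<^sup>2 \<le> (cmod a + cmod b)\<^sup>2"
    by (simp add: norm_triangle_ineq power_mono)
  also have "\<dots> \<le> 2 * (cmod a)\<^sup>2 + 2 * (cmod b)\<^sup>2"
    using sum_squares_bound[of "cmod a" "cmod b"] by (simp add: power2_sum)
  finally show ?thesis .
qed

lemma sqn_weighted_add: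
  assumes [measurable]: "F \<in> borel_measurable borel" "G \<in> borel_measurable borel" "w \<in> borel_measurable borel"
  shows "(\<integral>\<^sup>+x. w x * ennreal ((cmod (F x + G x))\<^sup>2) \<partial>lborel)
     \<le> 2 * (\<integral>\<^sup>+x. w x * ennreal ((cmod (F x))\<^sup>2) \<partial>lborel) + 2 * (\<integral>\<^sup>+x. w x * ennreal ((cmod (G x))\<^sup>2) \<partial>lborel)"
proof -
  have "(\<integral>\<^sup>+x. w x * ennreal ((cmod (F x + G x))\<^sup>2) \<partial>lborel)
     \<le> (\<integral>\<^sup>+x. 2 * (w x * ennreal ((cmod (F x))\<^sup>2)) + 2 * (w x * ennreal ((cmod (G x))\<^sup>2)) \<partial>lborel)"
  proof (rule nn_integral_mono)
    fix x
    have "ennreal ((cmod (F x + G x))\<^sup>2) \<le> ennreal (2 * (cmod (F x))\<^sup>2 + 2 * (cmod (G x))\<^sup>2)"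
      by (intro ennreal_leI cmod_add_sq)
    also have "\<dots> = 2 * ennreal ((cmod (F x))\<^sup>2) + 2 * ennreal ((cmod (G x))\<^sup>2)"
      by (simp add: ennreal_plus ennreal_mult'')
    finally show "w x * ennreal ((cmod (F x + G x))\<^sup>2)
       \<le> 2 * (w x * ennreal ((cmod (F x))\<^sup>2)) + 2 * (w x * ennreal ((cmod (G x))\<^sup>2))"
      by (metis (no_types, lifting) distrib_left mult.left_commute mult_left_mono zero_le)
  qed
  also have "\<dots> = 2 * (\<integral>\<^sup>+x. w x * ennreal ((cmod (F x))\<^sup>2) \<partial>lborel) + 2 * (\<integral>\<^sup>+x. w x * ennreal ((cmod (G x))\<^sup>2) \<partial>lborel)"
    by (simp add: nn_integral_add nn_integral_cmult)
  finally show ?thesis .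
qed

lemma sqn_add:
  assumes "F \<in> borel_measurable borel" "G \<in> borel_measurable borel"
  shows "sqn (\<lambda>x. F x + G x) \<le> 2 * sqn F + 2 * sqn G"
  using sqn_weighted_add[OF assms, of "\<lambda>_. 1"] by (simp add: sqn_def)

lemma sqn_cmult: "F \<in> borel_measurable borel \<Longrightarrow> sqn (\<lambda>x. c * F x) = ennreal ((cmod c)\<^sup>2) * sqn F"
  unfolding sqn_def by (simp add: norm_mult power_mult_distrib ennreal_mult' nn_integral_cmult)

lemma L2_add: "L2 F \<Longrightarrow> L2 G \<Longrightarrow> L2 (\<lambda>x. F x + G x)"
  unfolding L2_def
  by (auto intro!: le_less_trans[OF sqn_add] simp: ennreal_mult_less_top)

lemma L2_cmult: "L2 F \<Longrightarrow> L2 (\<lambda>x. c * F x)"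
  unfolding L2_def by (auto simp: sqn_cmult ennreal_mult_less_top)

lemma L2_diff: "L2 F \<Longrightarrow> L2 G \<Longrightarrow> L2 (\<lambda>x. F x - G x)"
  using L2_add[of F "\<lambda>x. (-1) * G x"] L2_cmult[of G "-1"] by simp

lemma L2_bound:
  assumes "L2 F" "G \<in> borel_measurable borel" "\<And>x. cmod (G x) \<le> cmod (F x)"
  shows "L2 G"
proof -
  have "sqn G \<le> sqn F" unfolding sqn_def
    by (intro nn_integral_mono ennreal_leI power_mono assms) auto
  with assms show ?thesis by (auto simp: L2_def)
qed

text \<open>Cauchy-Schwarz for the bilinear pairing, without a conjugate: the transform is
  characterised below by a bilinear multiplication formula, so conjugates are inserted by hand where
  positivity is wanted.\<close>

lemma L2_C_S:
  assumes "L2 F" "L2 G"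
  shows "integrable lborel (\<lambda>x. F x * G x)"
    and "(ennreal (cmod (LINT x|lborel. F x * G x)))\<^sup>2 \<le> sqn F * sqn G"
proof -
  note [measurable] = assms[THEN L2_measurable]
  have "(\<integral>\<^sup>+x. ennreal (cmod (F x)) * ennreal (cmod (G x)) \<partial>lborel)\<^sup>2
     \<le> (\<integral>\<^sup>+x. (ennreal (cmod (F x)))\<^sup>2 \<partial>lborel) * (\<integral>\<^sup>+x. (ennreal (cmod (G x)))\<^sup>2 \<partial>lborel)"
    by (rule Cauchy_Schwarz_nn_integral) auto
  then have *: "(\<integral>\<^sup>+x. ennreal (cmod (F x * G x)) \<partial>lborel)\<^sup>2 \<le> sqn F * sqn G"
    by (simp add: sqn_def norm_mult ennreal_mult' ennreal_power)
  also have "\<dots> < \<infinity>" using assms by (auto simp: L2_def ennreal_mult_less_top)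
  finally have fin: "(\<integral>\<^sup>+x. ennreal (cmod (F x * G x)) \<partial>lborel) < \<infinity>"
    by (simp add: power_less_top_ennreal)
  then show i: "integrable lborel (\<lambda>x. F x * G x)"
    by (intro integrableI_bounded) auto
  have "ennreal (cmod (LINT x|lborel. F x * G x)) \<le> (\<integral>\<^sup>+x. ennreal (cmod (F x * G x)) \<partial>lborel)"
    using integral_norm_bound_ennreal[OF i] .
  then have "(ennreal (cmod (LINT x|lborel. F x * G x)))\<^sup>2 \<le> (\<integral>\<^sup>+x. ennreal (cmod (F x * G x)) \<partial>lborel)\<^sup>2"
    by (intro power_mono) auto
  with * show "(ennreal (cmod (LINT x|lborel. F x * G x)))\<^sup>2 \<le> sqn F * sqn G" by (rule order_trans[rotated])
qed

section \<open>The transform of integrable functions and the multiplication formula\<close>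

lemma cis_lipschitz: "cmod (cis a - cis b) \<le> \<bar>a - b\<bar>"
proof -
  have "cmod (cis a - cis b) = cmod (cis (a - b) - 1)"
    by (metis cis_divide cis_zero diff_divide_distrib div_self cis_neq_zero norm_cis norm_divide div_by_1)
  also have "\<dots> \<le> \<bar>a - b\<bar>"
    using iexp_approx1[of "a - b" 0] by (simp add: cis_conv_exp)
  finally show ?thesis .
qed

lemma integrable_cis [simp]:
  assumes "integrable lborel F"
  shows "integrable lborel (\<lambda>y. F y * cis (a * y))" "integrable lborel (\<lambda>y. F y * cis (-(a * y)))"
proof -
  note [measurable] = borel_measurable_integrable[OF assms]
  have [measurable]: "cis \<in> borel_measurable borel" by (intro borel_measurable_continuous_onI continuous_intros)
  show "integrable lborel (\<lambda>y. F y * cis (a * y))" "integrable lborel (\<lambda>y. F y * cis (-(a * y)))"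
    by (rule Bochner_Integration.integrable_bound[OF assms], measurable, simp add: norm_mult)+
qed

lemma cis_measurable [measurable]: "cis \<in> borel_measurable borel"
  by (intro borel_measurable_continuous_onI continuous_intros)

lemma ift_eq: "ift F x = (LINT y|lborel. F y * cis (x * y)) / complex_of_real (sqrt (2 * pi))"
  by (simp add: ift_def fhat_def)

lemma fhat_bound: "integrable lborel F \<Longrightarrow> cmod (fhat F x) \<le> (LINT y|lborel. cmod (F y)) / sqrt (2 * pi)"
  unfolding fhat_def
  by (auto simp: norm_divide norm_mult intro!: divide_right_mono order_trans[OF integral_norm_bound])

lemma isCont_fhat:
  assumes "integrable lborel F"
  shows "isCont (fhat F) x"
proof -
  have [measurable]: "F \<in> borel_measurable borel" using assms by auto
  have "isCont (\<lambda>x. LINT y|lborel. F y * cis (- (x * y))) x"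
    unfolding continuous_at_sequentially comp_def
  proof safe
    fix X :: "nat \<Rightarrow> real" assume X: "X \<longlonglongrightarrow> x"
    show "(\<lambda>n. LINT y|lborel. F y * cis (- (X n * y))) \<longlonglongrightarrow> (LINT y|lborel. F y * cis (- (x * y)))"
    proof (rule integral_dominated_convergence[where w="\<lambda>y. cmod (F y)"])
      show "integrable lborel (\<lambda>y. cmod (F y))" using assms by simp
      show "AE y in lborel. (\<lambda>n. F y * cis (- (X n * y))) \<longlonglongrightarrow> F y * cis (- (x * y))"
        using X by (auto intro!: tendsto_intros isCont_tendsto_compose[of _ cis] continuous_intros)
    qed (auto simp: norm_mult)
  qed
  then show ?thesis unfolding fhat_def by (intro continuous_intros) auto
qed

lemma continuous_fhat: "integrable lborel F \<Longrightarrow> continuous_on UNIV (fhat F)"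
  by (simp add: continuous_at_imp_continuous_on isCont_fhat)

lemma continuous_ift: "integrable lborel F \<Longrightarrow> continuous_on UNIV (ift F)"
  unfolding ift_def
  by (rule continuous_on_compose2[OF continuous_fhat]) (auto intro!: continuous_intros)

lemma fhat_measurable [measurable]: "integrable lborel F \<Longrightarrow> fhat F \<in> borel_measurable borel"
  by (simp add: borel_measurable_continuous_onI continuous_fhat)

lemma ift_measurable [measurable]: "integrable lborel F \<Longrightarrow> ift F \<in> borel_measurable borel"
  by (simp add: borel_measurable_continuous_onI continuous_ift)

lemma fhat_diff: "integrable lborel F \<Longrightarrow> integrable lborel G \<Longrightarrow> fhat (\<lambda>y. F y - G y) x = fhat F x - fhat G x"
  unfolding fhat_def by (simp add: left_diff_distrib diff_divide_distrib)

lemma fhat_cmult: "fhat (\<lambda>y. c * F y) x = c * fhat F x"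
  unfolding fhat_def by (simp add: mult.assoc)

lemma lborel_integrable_product:
  fixes f g :: "real \<Rightarrow> complex"
  assumes "integrable lborel f" "integrable lborel g" and K: "case_prod K \<in> borel_measurable (borel \<Otimes>\<^sub>M borel)"
    and "\<And>x y. cmod (K x y) \<le> 1"
  shows "integrable (lborel \<Otimes>\<^sub>M lborel) (\<lambda>(x, y). f x * g y * K x y)"
proof -
  have [measurable]: "f \<in> borel_measurable borel" "g \<in> borel_measurable borel" using assms by auto
  have [measurable]: "(\<lambda>p. K (fst p) (snd p)) \<in> borel_measurable (borel \<Otimes>\<^sub>M borel)" using K by (simp add: case_prod_beta')
  have m: "(\<lambda>(x, y). f x * g y * K x y) \<in> borel_measurable (lborel \<Otimes>\<^sub>M lborel)"
    unfolding case_prod_beta' by measurable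
  have "integrable (lborel \<Otimes>\<^sub>M lborel) (\<lambda>(x, y). f x * g y)"
    by (rule lborel_pair.Fubini_integrable) (use assms in \<open>auto simp: norm_mult\<close>)
  then show ?thesis
  proof (rule Bochner_Integration.integrable_bound[OF _ m], intro AE_I2)
    fix p :: "real \<times> real"
    show "cmod (case p of (x, y) \<Rightarrow> f x * g y * K x y) \<le> cmod (case p of (x, y) \<Rightarrow> f x * g y)"
      using assms(4)[of "fst p" "snd p"]
      by (auto simp: case_prod_beta' norm_mult mult_left_le)
  qed
qed

text \<open>Fubini, as the kernel is symmetric in its two variables. The identity carries the
  transform from one factor to the other, and it is what the definition of \<open>ft\<close> demands
  of a square integrable function.\<close>

lemma fhat_multiplication:
  assumes f: "integrable lborel f" and g: "integrable lborel g"
  shows "(LINT x|lborel. f x * fhat g x) = (LINT y|lborel. fhat f y * g y)"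
proof -
  have i: "integrable (lborel \<Otimes>\<^sub>M lborel) (\<lambda>(x, y). f x * g y * cis (- (x * y)))"
    by (rule lborel_integrable_product[OF f g]) (auto simp: case_prod_beta')
  have "(LINT x|lborel. LINT y|lborel. f x * g y * cis (- (x * y))) = (LINT y|lborel. LINT x|lborel. f x * g y * cis (- (x * y)))"
    using lborel_pair.Fubini_integral[of "\<lambda>x y. f x * g y * cis (- (x * y))"] i by (simp add: case_prod_beta')
  moreover have "(LINT y|lborel. f x * g y * cis (- (x * y))) = f x * fhat g x * sqrt (2 * pi)" for x
    unfolding fhat_def by (simp add: mult.assoc)
  moreover have "(LINT x|lborel. f x * g y * cis (- (x * y))) = fhat f y * g y * sqrt (2 * pi)" for y
  proof -
    have "(LINT x|lborel. f x * g y * cis (- (x * y))) = (LINT x|lborel. g y * (f x * cis (- (y * x))))"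
      by (simp add: mult_ac)
    also have "\<dots> = g y * (LINT x|lborel. f x * cis (- (y * x)))" by (rule integral_mult_right_zero)
    finally show ?thesis by (simp add: fhat_def mult_ac)
  qed
  ultimately show ?thesis by simp
qed

lemma ift_multiplication:
  assumes f: "integrable lborel f" and g: "integrable lborel g"
  shows "(LINT x|lborel. f x * ift g x) = (LINT y|lborel. ift f y * g y)"
proof -
  have [measurable]: "f \<in> borel_measurable borel" "g \<in> borel_measurable borel" using f g by auto
  have g': "integrable lborel (\<lambda>y. g (- y))" using lborel_integrable_real_affine[of g "-1" 0] g by simp
  have "ift g x = fhat (\<lambda>y. g (- y)) x" for x
    unfolding ift_eq fhat_def
    using lborel_integral_real_affine[of "-1" "\<lambda>y. g y * cis (x * y)" 0] by simp
  then have "(LINT x|lborel. f x * ift g x) = (LINT y|lborel. fhat f y * g (- y))"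
    using fhat_multiplication[OF f g'] by simp
  also have "\<dots> = (LINT y|lborel. ift f y * g y)"
    unfolding ift_def using lborel_integral_real_affine[of "-1" "\<lambda>y. fhat f y * g (-y)" 0] by simp
  finally show ?thesis .
qed

lemma cnj_measurable [measurable]: "cnj \<in> borel_measurable borel"
  by (intro borel_measurable_continuous_onI continuous_intros)

section \<open>Gaussian regularisation and Plancherel's identity for continuous integrable
  functions\<close>

lemma integrable_std_normal [simp]: "integrable lborel std_normal_density"
  using integrable_normal_moment[of 1 0 0] by simp

lemma gauss_char:
  "(LINT z|lborel. complex_of_real (std_normal_density z) * cis (t * z)) = of_real (exp (- t\<^sup>2 / 2))"
proof -
  have "char std_normal_distribution t = (LINT z|lborel. std_normal_density z *\<^sub>R cis (t * z))"
    unfolding char_def by (subst integral_density) (auto simp: cis_conv_exp)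
  then show ?thesis by (simp add: char_std_normal_distribution scaleR_conv_of_real)
qed

lemma integrable_gauss:
  fixes \<epsilon> :: real
  assumes "\<epsilon> > 0"
  shows "integrable lborel (\<lambda>x. exp (- (\<epsilon> * x)\<^sup>2 / 2))"
proof -
  have "integrable lborel (\<lambda>x::real. sqrt (2 * pi) * std_normal_density (0 + \<epsilon> * x))"
    using lborel_integrable_real_affine[of std_normal_density \<epsilon> 0] assms by simp
  then show ?thesis by (simp add: std_normal_density_def)
qed

lemma fhat_gauss:
  assumes "\<epsilon> > 0"
  shows "fhat (\<lambda>y. of_real (exp (- (\<epsilon> * y)\<^sup>2 / 2)) * cis (a * y)) x
     = of_real (sqrt (2 * pi) / \<epsilon> * std_normal_density ((x - a) / \<epsilon>))"
proof -
  have e: "exp (- (\<epsilon> * y)\<^sup>2 / 2) = sqrt (2 * pi) * std_normal_density (\<epsilon> * y)" for y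
    by (simp add: std_normal_density_def)
  have c: "cis (a * y) * cis (- (x * y)) = cis ((a - x) / \<epsilon> * (\<epsilon> * y))" for y
  proof -
    have "a * y - x * y = (a - x) / \<epsilon> * (\<epsilon> * y)" using assms by (simp add: field_simps)
    then show ?thesis by (simp add: cis_mult)
  qed
  have "(LINT y|lborel. complex_of_real (std_normal_density y) * cis ((a - x) / \<epsilon> * y))
    = \<epsilon> *\<^sub>R (LINT y|lborel. complex_of_real (std_normal_density (\<epsilon> * y)) * cis ((a - x) / \<epsilon> * (\<epsilon> * y)))"
    using lborel_integral_real_affine[of \<epsilon> "\<lambda>y. complex_of_real (std_normal_density y) * cis ((a - x) / \<epsilon> * y)" 0] assms
    by simp
  then have "(LINT y|lborel. complex_of_real (std_normal_density (\<epsilon> * y)) * cis ((a - x) / \<epsilon> * (\<epsilon> * y)))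
    = of_real (exp (- ((x - a) / \<epsilon>)\<^sup>2 / 2) / \<epsilon>)"
    unfolding gauss_char using assms by (simp add: scaleR_conv_of_real field_simps power2_commute)
  then have "(LINT y|lborel. of_real (exp (- (\<epsilon> * y)\<^sup>2 / 2)) * cis (a * y) * cis (- (x * y)))
    = sqrt (2 * pi) * of_real (exp (- ((x - a) / \<epsilon>)\<^sup>2 / 2) / \<epsilon>)"
    unfolding e c[symmetric] by (simp add: mult.assoc)
  then show ?thesis
    unfolding fhat_def by (simp add: std_normal_density_def)
qed

lemma integrable_gauss_cis:
  "\<epsilon> > 0 \<Longrightarrow> integrable lborel (\<lambda>y. complex_of_real (exp (- (\<epsilon> * y)\<^sup>2 / 2)) * cis (a * y))"
  by (intro integrable_cis integrable_of_real integrable_gauss)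

text \<open>The transform of a modulated Gaussian is a Gaussian density of width \<epsilon> centred
  at \<open>a\<close>. Moving the transform off \<open>f\<close> therefore turns the damped
  inversion integral into an average of \<open>f\<close> around \<open>a\<close>; letting \<epsilon>
  shrink gives both Plancherel's identity and the inversion formula.\<close>

lemma gauss_smoothing:
  assumes f: "integrable lborel f" and "\<epsilon> > 0"
  shows "ift (\<lambda>y. fhat f y * of_real (exp (- (\<epsilon> * y)\<^sup>2 / 2))) a
    = (LINT z|lborel. f (a + \<epsilon> * z) * of_real (std_normal_density z))"
proof -
  have "(LINT y|lborel. fhat f y * of_real (exp (- (\<epsilon> * y)\<^sup>2 / 2)) * cis (a * y))
     = (LINT y|lborel. fhat f y * (of_real (exp (- (\<epsilon> * y)\<^sup>2 / 2)) * cis (a * y)))"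
    by (simp add: mult.assoc)
  also have "\<dots> = (LINT x|lborel. f x * of_real (sqrt (2 * pi) / \<epsilon> * std_normal_density ((x - a) / \<epsilon>)))"
    using fhat_multiplication[OF f integrable_gauss_cis[OF assms(2), of a]]
    by (simp only: fhat_gauss[OF assms(2)])
  also have "\<dots> = \<epsilon> *\<^sub>R (LINT z|lborel. f (a + \<epsilon> * z) * of_real (sqrt (2 * pi) / \<epsilon> * std_normal_density z))"
    using lborel_integral_real_affine[of \<epsilon> "\<lambda>x. f x * of_real (sqrt (2 * pi) / \<epsilon> * std_normal_density ((x - a) / \<epsilon>))" a] assms
    by simp
  also have "\<dots> = sqrt (2 * pi) * (LINT z|lborel. f (a + \<epsilon> * z) * of_real (std_normal_density z))"
  proof -
    have "(LINT z|lborel. f (a + \<epsilon> * z) * of_real (sqrt (2 * pi) / \<epsilon> * std_normal_density z))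
       = (LINT z|lborel. of_real (sqrt (2 * pi) / \<epsilon>) * (f (a + \<epsilon> * z) * of_real (std_normal_density z)))"
      by (simp add: mult_ac)
    also have "\<dots> = of_real (sqrt (2 * pi) / \<epsilon>) * (LINT z|lborel. f (a + \<epsilon> * z) * of_real (std_normal_density z))"
      by (rule integral_mult_right_zero)
    finally show ?thesis using assms by (simp add: scaleR_conv_of_real)
  qed
  finally show ?thesis by (simp add: ift_eq)
qed

lemma fhat_reflect: "fhat (\<lambda>y. F (- y)) x = ift F x"
  unfolding ift_eq fhat_def using lborel_integral_real_affine[of "-1" "\<lambda>y. F y * cis (x * y)" 0] by simp

lemma cnj_fhat: "cnj (fhat f x) = ift (\<lambda>y. cnj (f y)) x"
  unfolding fhat_def ift_eq by (simp add: cis_cnj flip: Bochner_Integration.integral_cnj)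

lemma gauss_average_tendsto:
  assumes c: "continuous_on UNIV f" and b: "\<And>x. cmod (f x) \<le> M"
  shows "(\<lambda>n. LINT z|lborel. f (a + inverse (real (Suc n)) * z) * of_real (std_normal_density z)) \<longlonglongrightarrow> f a"
proof -
  have [measurable]: "f \<in> borel_measurable borel" using c by (rule borel_measurable_continuous_onI)
  have ic: "isCont f x" for x using c by (simp add: continuous_on_eq_continuous_at)
  have "(\<lambda>n. LINT z|lborel. f (a + inverse (real (Suc n)) * z) * of_real (std_normal_density z))
    \<longlonglongrightarrow> (LINT z|lborel. f a * of_real (std_normal_density z))"
  proof (rule integral_dominated_convergence[where w="\<lambda>z. M * std_normal_density z"])
    show "AE x in lborel. (\<lambda>n. f (a + inverse (real (Suc n)) * x) * of_real (std_normal_density x))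
       \<longlonglongrightarrow> f a * of_real (std_normal_density x)"
    proof (intro AE_I2 tendsto_intros isCont_tendsto_compose[OF ic])
      fix x
      show "(\<lambda>n. a + inverse (real (Suc n)) * x) \<longlonglongrightarrow> a"
        using tendsto_add[OF tendsto_const tendsto_mult[OF LIMSEQ_inverse_real_of_nat tendsto_const], of a x] by simp
    qed
  qed (auto simp: norm_mult b intro!: mult_right_mono)
  then show ?thesis
    using gauss_char[of 0] by simp
qed

lemma sqn_eq_integral:
  assumes "integrable lborel (\<lambda>x. F x * cnj (F x))"
  shows "sqn F = ennreal (Re (LINT x|lborel. F x * cnj (F x)))"
proof -
  have *: "F x * cnj (F x) = of_real ((cmod (F x))\<^sup>2)" for x by (rule complex_norm_square[symmetric])
  have i: "integrable lborel (\<lambda>x. (cmod (F x))\<^sup>2)"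
    using integrable_Re[OF assms] unfolding * by simp
  show ?thesis
    unfolding sqn_def * by (subst nn_integral_eq_integral[OF i]) (auto simp del: of_real_power)
qed

lemma L2_of_bounded_integrable:
  assumes f: "integrable lborel f" and b: "\<And>x. cmod (f x) \<le> M"
  shows "L2 f"
proof -
  have "sqn f \<le> (\<integral>\<^sup>+x. ennreal M * ennreal (cmod (f x)) \<partial>lborel)"
    unfolding sqn_def
  proof (rule nn_integral_mono)
    fix x
    have "0 \<le> M" using b[of 0] norm_ge_zero order_trans by blast
    then show "ennreal ((cmod (f x))\<^sup>2) \<le> ennreal M * ennreal (cmod (f x))"
      using b[of x] by (simp add: power2_eq_square mult_right_mono flip: ennreal_mult')
  qed
  also have "\<dots> = ennreal M * (\<integral>\<^sup>+x. ennreal (cmod (f x)) \<partial>lborel)"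
    using f by (intro nn_integral_cmult) auto
  also have "\<dots> < \<infinity>" using f by (auto simp: integrable_iff_bounded ennreal_mult_less_top)
  finally show ?thesis using f by (auto simp: L2_def)
qed

text \<open>The damped square of \<open>fhat f\<close> equals the pairing of a Gaussian average of
  \<open>f\<close> with \<open>cnj f\<close>. On the transform side the damping is removed by
  monotone convergence, since square integrability of \<open>fhat f\<close> is part of the claim; on
  the other side by dominated convergence, where continuity and boundedness of \<open>f\<close> give
  the pointwise limit and the majorant.\<close>

lemma Plancherel_bounded_L1:
  assumes f: "integrable lborel f" and c: "continuous_on UNIV f" and b: "\<And>x. cmod (f x) \<le> M"
  shows "sqn (fhat f) = sqn f"
proof -
  define h where "h = (\<lambda>n. inverse (real (Suc n)))"
  have hpos: "h n > 0" for n by (simp add: h_def)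
  define g where "g = (\<lambda>n y. exp (- (h n * y)\<^sup>2 / 2))"
  have [measurable]: "f \<in> borel_measurable borel" "fhat f \<in> borel_measurable borel" "\<And>n. g n \<in> borel_measurable borel"
    using f by (auto simp: g_def)
  have M: "0 \<le> M" using b[of 0] norm_ge_zero order_trans by blast
  have cf: "integrable lborel (\<lambda>x. cnj (f x))" using f by simp
  have gi: "integrable lborel (g n)" for n unfolding g_def by (rule integrable_gauss[OF hpos])
  obtain C where C: "\<And>x. cmod (fhat f x) \<le> C" using fhat_bound[OF f] by blast
  have Cp: "0 \<le> C" using C[of 0] norm_ge_zero order_trans by blast
  have fg: "integrable lborel (\<lambda>y. fhat f y * of_real (g n y))" for n
  proof (rule Bochner_Integration.integrable_bound[of _ "\<lambda>y. C * g n y"])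
    show "AE x in lborel. norm (fhat f x * of_real (g n x)) \<le> norm (C * g n x)"
      using C Cp by (auto simp: norm_mult abs_mult intro!: mult_mono)
  qed (use gi in auto)
  have key: "(LINT y|lborel. fhat f y * of_real (g n y) * cnj (fhat f y))
    = (LINT a|lborel. (LINT z|lborel. f (a + h n * z) * of_real (std_normal_density z)) * cnj (f a))" for n
    using ift_multiplication[OF fg[of n] cf] unfolding cnj_fhat[symmetric] g_def gauss_smoothing[OF f hpos] .
  have avg: "cmod (LINT z|lborel. f (a + h n * z) * of_real (std_normal_density z)) \<le> M" for a n
  proof -
    have "cmod (LINT z|lborel. f (a + h n * z) * of_real (std_normal_density z)) \<le> (LINT z|lborel. M * std_normal_density z)"
      by (rule order_trans[OF integral_norm_bound], rule integral_mono')
        (auto simp: norm_mult b M abs_mult intro!: mult_right_mono)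
    then show ?thesis by simp
  qed
  have "(\<lambda>n. LINT a|lborel. (LINT z|lborel. f (a + h n * z) * of_real (std_normal_density z)) * cnj (f a))
    \<longlonglongrightarrow> (LINT a|lborel. f a * cnj (f a))"
  proof (rule integral_dominated_convergence[where w="\<lambda>a. M * cmod (f a)"])
    show "AE x in lborel. (\<lambda>n. (LINT z|lborel. f (x + h n * z) * of_real (std_normal_density z)) * cnj (f x)) \<longlonglongrightarrow> f x * cnj (f x)"
      unfolding h_def by (intro AE_I2 tendsto_intros gauss_average_tendsto[OF c b])
    show "AE x in lborel. norm ((LINT z|lborel. f (x + h n * z) * of_real (std_normal_density z)) * cnj (f x)) \<le> M * cmod (f x)" for n
      by (auto simp: norm_mult intro!: mult_right_mono avg)
  qed (use f in auto)
  then have "(\<lambda>n. ennreal (Re (LINT y|lborel. fhat f y * of_real (g n y) * cnj (fhat f y))))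
     \<longlonglongrightarrow> ennreal (Re (LINT a|lborel. f a * cnj (f a)))"
    unfolding key by (intro tendsto_ennrealI tendsto_Re)
  moreover have "integrable lborel (\<lambda>x. f x * cnj (f x))"
    by (rule L2_C_S[OF L2_of_bounded_integrable[OF f b] L2_of_bounded_integrable[OF cf]]) (use b in auto)
  moreover have "ennreal (Re (LINT y|lborel. fhat f y * of_real (g n y) * cnj (fhat f y)))
     = (\<integral>\<^sup>+y. ennreal ((cmod (fhat f y))\<^sup>2 * g n y) \<partial>lborel)" for n
  proof -
    have eq: "fhat f y * of_real (g n y) * cnj (fhat f y) = of_real ((cmod (fhat f y))\<^sup>2 * g n y)" for y
      by (metis complex_norm_square mult.assoc mult.commute of_real_mult)
    have "integrable lborel (\<lambda>y. fhat f y * of_real (g n y) * cnj (fhat f y))"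
    proof (rule Bochner_Integration.integrable_bound[OF integrable_mult_right[OF fg[of n], of "of_real C"]], simp, intro AE_I2)
      fix x
      show "norm (fhat f x * of_real (g n x) * cnj (fhat f x)) \<le> norm (of_real C * (fhat f x * of_real (g n x)))"
        using mult_right_mono[OF C[of x], of "cmod (fhat f x) * \<bar>g n x\<bar>"] Cp by (simp add: norm_mult mult_ac)
    qed
    then have i: "integrable lborel (\<lambda>y. (cmod (fhat f y))\<^sup>2 * g n y)"
      using integrable_Re unfolding eq by (metis (no_types, lifting) Re_complex_of_real Bochner_Integration.integrable_cong)
    have "(\<integral>\<^sup>+y. ennreal ((cmod (fhat f y))\<^sup>2 * g n y) \<partial>lborel) = ennreal (LINT y|lborel. (cmod (fhat f y))\<^sup>2 * g n y)"
      by (rule nn_integral_eq_integral[OF i]) (auto simp: g_def)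
    then show ?thesis unfolding eq integral_complex_of_real Re_complex_of_real by (rule sym)
  qed
  moreover have "(\<lambda>n. \<integral>\<^sup>+y. ennreal ((cmod (fhat f y))\<^sup>2 * g n y) \<partial>lborel) \<longlonglongrightarrow> sqn (fhat f)"
    unfolding sqn_def
  proof (rule nn_integral_LIMSEQ)
    show "incseq (\<lambda>n y. ennreal ((cmod (fhat f y))\<^sup>2 * g n y))"
    proof (intro incseq_SucI le_funI ennreal_leI mult_left_mono)
      fix n y
      have "(h (Suc n))\<^sup>2 \<le> (h n)\<^sup>2" by (intro power_mono) (auto simp: h_def field_simps)
      then have "(h (Suc n))\<^sup>2 * y\<^sup>2 \<le> (h n)\<^sup>2 * y\<^sup>2" by (rule mult_right_mono) simp
      then show "g n y \<le> g (Suc n) y" by (simp add: g_def power_mult_distrib)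
    qed simp
    fix y
    have "(\<lambda>n. exp (- (h n * y)\<^sup>2 / 2)) \<longlonglongrightarrow> exp (- (0 * y)\<^sup>2 / 2)"
      unfolding h_def by (intro tendsto_intros LIMSEQ_inverse_real_of_nat) auto
    then have "(\<lambda>n. (cmod (fhat f y))\<^sup>2 * g n y) \<longlonglongrightarrow> (cmod (fhat f y))\<^sup>2 * 1"
      unfolding g_def by (intro tendsto_intros) simp
    then show "(\<lambda>n. ennreal ((cmod (fhat f y))\<^sup>2 * g n y)) \<longlonglongrightarrow> ennreal ((cmod (fhat f y))\<^sup>2)"
      by (intro tendsto_ennrealI) simp
  qed auto
  ultimately have "sqn (fhat f) = ennreal (Re (LINT a|lborel. f a * cnj (f a)))"
    by (auto intro: LIMSEQ_unique)
  then show ?thesis using sqn_eq_integral[OF \<open>integrable lborel (\<lambda>x. f x * cnj (f x))\<close>] by simp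
qed

lemma ennreal_tendsto_0I:
  assumes "\<And>e. e > 0 \<Longrightarrow> \<forall>\<^sub>F x in F. f x \<le> ennreal e"
  shows "(f \<longlongrightarrow> 0) F"
proof (rule order_tendstoI)
  fix a :: ennreal assume "0 < a"
  then obtain b where b: "0 < b" "b < a" using dense by blast
  then obtain e where e: "b = ennreal e" "e \<ge> 0" by (cases b) auto
  with b have "e > 0" by simp
  from assms[OF this] show "\<forall>\<^sub>F x in F. f x < a"
    using b e by (auto elim!: eventually_mono intro: le_less_trans)
qed simp

text \<open>Piecewise linear rather than an indicator, so that a truncated continuous function stays
  continuous and \<open>Plancherel_bounded_L1\<close> applies to it.\<close>

definition cutoff :: "nat \<Rightarrow> real \<Rightarrow> real" where
  "cutoff n x = max 0 (min 1 (real n + 1 - \<bar>x\<bar>))"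

lemma cutoff_bounds: "0 \<le> cutoff n x" "cutoff n x \<le> 1" by (auto simp: cutoff_def)

lemma continuous_cutoff: "continuous_on UNIV (cutoff n)"
  unfolding cutoff_def by (intro continuous_intros)

lemma cutoff_measurable [measurable]: "cutoff n \<in> borel_measurable borel"
  by (intro borel_measurable_continuous_onI continuous_cutoff)

lemma cutoff_zero: "\<bar>x\<bar> \<ge> real n + 1 \<Longrightarrow> cutoff n x = 0" by (simp add: cutoff_def)

lemma cutoff_mono: "m \<le> n \<Longrightarrow> cutoff m x \<le> cutoff n x" by (auto simp: cutoff_def)

lemma cutoff_tendsto: "(\<lambda>n. cutoff n x) \<longlonglongrightarrow> 1"
proof (rule tendsto_eventually)
  obtain N where "\<bar>x\<bar> \<le> real N" using real_arch_simple by blast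
  then have "cutoff n x = 1" if "n \<ge> N" for n using that by (auto simp: cutoff_def min_def max_def)
  then show "\<forall>\<^sub>F n in sequentially. cutoff n x = 1" by (auto simp: eventually_sequentially)
qed

lemma integrable_compact_support:
  fixes f :: "real \<Rightarrow> complex"
  assumes c: "continuous_on UNIV f" and z: "\<And>x. \<bar>x\<bar> \<ge> R \<Longrightarrow> f x = 0"
  shows "integrable lborel f" and "\<exists>M. \<forall>x. cmod (f x) \<le> M"
proof -
  have "compact (f ` {-R..R})" using c by (intro compact_continuous_image) (auto intro: continuous_on_subset)
  then obtain M where M: "\<And>x. x \<in> {-R..R} \<Longrightarrow> cmod (f x) \<le> M"
    by (meson bounded_iff compact_imp_bounded image_eqI)
  have "cmod (f x) \<le> max 0 M" for x
  proof (cases "\<bar>x\<bar> \<ge> R")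
    case False
    then have "x \<in> {-R..R}" by auto
    then show ?thesis using M[of x] by simp
  qed (simp add: z)
  then show "\<exists>M. \<forall>x. cmod (f x) \<le> M" by blast
  have "set_integrable lborel {-R..R} f"
    using c by (intro borel_integrable_atLeastAtMost') (auto intro: continuous_on_subset)
  moreover have "(\<lambda>x. indicator {-R..R} x *\<^sub>R f x) = f"
    using z by (auto simp: fun_eq_iff indicator_def)
  ultimately show "integrable lborel f" by (simp add: set_integrable_def)
qed

lemma cutoff_integrable:
  fixes f :: "real \<Rightarrow> complex"
  assumes c: "continuous_on UNIV f"
  shows "integrable lborel (\<lambda>x. of_real (cutoff n x) * f x)"
    and "\<exists>M. \<forall>x. cmod (of_real (cutoff n x) * f x) \<le> M"
    and "continuous_on UNIV (\<lambda>x. of_real (cutoff n x) * f x)"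
proof -
  show *: "continuous_on UNIV (\<lambda>x. of_real (cutoff n x) * f x)"
    by (intro continuous_intros c continuous_on_of_real continuous_cutoff)
  show "integrable lborel (\<lambda>x. of_real (cutoff n x) * f x)" "\<exists>M. \<forall>x. cmod (of_real (cutoff n x) * f x) \<le> M"
    by (rule integrable_compact_support[OF *, of "real n + 1"]; simp add: cutoff_zero)+
qed

lemma sqn_reflect: "F \<in> borel_measurable borel \<Longrightarrow> sqn (\<lambda>x. F (- x)) = sqn F"
  unfolding sqn_def using nn_integral_real_affine[of "\<lambda>x. ennreal ((cmod (F x))\<^sup>2)" "-1" 0] by simp

lemma cutoff_sqn_tendsto:
  assumes [measurable]: "f \<in> borel_measurable borel"
  shows "(\<lambda>n. \<integral>\<^sup>+x. ennreal (cutoff n x * (cmod (f x))\<^sup>2) \<partial>lborel) \<longlonglongrightarrow> sqn f"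
    unfolding sqn_def
proof (rule nn_integral_LIMSEQ)
  show "incseq (\<lambda>n x. ennreal (cutoff n x * (cmod (f x))\<^sup>2))"
    by (intro incseq_SucI le_funI ennreal_leI mult_right_mono cutoff_mono) auto
  fix x
  have "(\<lambda>n. cutoff n x * (cmod (f x))\<^sup>2) \<longlonglongrightarrow> 1 * (cmod (f x))\<^sup>2"
    by (intro tendsto_intros cutoff_tendsto)
  then show "(\<lambda>n. ennreal (cutoff n x * (cmod (f x))\<^sup>2)) \<longlonglongrightarrow> ennreal ((cmod (f x))\<^sup>2)"
    by (intro tendsto_ennrealI) simp
qed simp

text \<open>Duality, because Plancherel is known so far for continuous functions and
  \<open>F\<close> may be discontinuous. Pairing \<open>ift F\<close> with its own truncated
  conjugate \<psi> gives a number \<alpha> with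
  \<open>\<alpha>\<^sup>2 \<le> \<alpha> * sqn F\<close>, as Plancherel does hold for the continuous
  \<psi>. Division by \<alpha> bounds the truncated norm uniformly in the truncation.\<close>

lemma sqn_ift_le:
  assumes F: "integrable lborel F" and "L2 F"
  shows "sqn (ift F) \<le> sqn F"
proof (rule LIMSEQ_le_const2[OF cutoff_sqn_tendsto])
  show [measurable]: "ift F \<in> borel_measurable borel" using F by simp
  have c: "continuous_on UNIV (\<lambda>x. cnj (ift F x))" by (intro continuous_intros continuous_ift F)
  have "(\<integral>\<^sup>+x. ennreal (cutoff n x * (cmod (ift F x))\<^sup>2) \<partial>lborel) \<le> sqn F" for n
  proof -
    define \<psi> where "\<psi> = (\<lambda>x. of_real (cutoff n x) * cnj (ift F x))"
    obtain M where \<psi>: "integrable lborel \<psi>" "continuous_on UNIV \<psi>" "\<And>x. cmod (\<psi> x) \<le> M"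
      using cutoff_integrable[OF c, of n] unfolding \<psi>_def by blast
    have "L2 \<psi>" using L2_of_bounded_integrable \<psi> by blast
    have eq: "\<psi> x * ift F x = of_real (cutoff n x * (cmod (ift F x))\<^sup>2)" for x
      unfolding \<psi>_def by (metis complex_norm_square mult.assoc mult.commute of_real_mult)
    obtain B where B: "\<And>x. cmod (ift F x) \<le> B" using fhat_bound[OF F] unfolding ift_def by blast
    have Bp: "0 \<le> B" using B[of 0] norm_ge_zero order_trans by blast
    have "integrable lborel (\<lambda>x. \<psi> x * ift F x)"
      by (rule Bochner_Integration.integrable_bound[OF integrable_mult_right[OF \<psi>(1), of "of_real B"]])
        (use \<psi>(1) B Bp in \<open>auto simp: norm_mult mult.commute[of B] intro!: mult_left_mono\<close>)
    then have i: "integrable lborel (\<lambda>x. cutoff n x * (cmod (ift F x))\<^sup>2)"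
      using integrable_Re unfolding eq by (metis (no_types, lifting) Re_complex_of_real Bochner_Integration.integrable_cong)
    define \<alpha> where "\<alpha> = (LINT x|lborel. cutoff n x * (cmod (ift F x))\<^sup>2)"
    have \<alpha>0: "\<alpha> \<ge> 0" unfolding \<alpha>_def by (intro integral_nonneg_AE) (auto simp: cutoff_bounds)
    have a: "(\<integral>\<^sup>+x. ennreal (cutoff n x * (cmod (ift F x))\<^sup>2) \<partial>lborel) = ennreal \<alpha>"
      unfolding \<alpha>_def by (rule nn_integral_eq_integral[OF i]) (auto simp: cutoff_bounds)
    have "of_real \<alpha> = (LINT x|lborel. \<psi> x * ift F x)"
      unfolding eq \<alpha>_def integral_complex_of_real ..
    also have "\<dots> = (LINT y|lborel. ift \<psi> y * F y)" by (rule ift_multiplication[OF \<psi>(1) F])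
    finally have \<alpha>: "of_real \<alpha> = (LINT y|lborel. ift \<psi> y * F y)" .
    have s: "sqn (ift \<psi>) = sqn \<psi>"
      using sqn_reflect[of "fhat \<psi>"] Plancherel_bounded_L1[OF \<psi>] \<psi>(1) by (simp add: ift_def[abs_def])
    have L: "L2 (ift \<psi>)" using s \<open>L2 \<psi>\<close> \<psi>(1) by (auto simp: L2_def)
    have "(ennreal \<alpha>)\<^sup>2 \<le> sqn \<psi> * sqn F"
      using L2_C_S(2)[OF L \<open>L2 F\<close>] \<alpha>0 unfolding \<alpha>[symmetric] s by simp
    also have "sqn \<psi> \<le> ennreal \<alpha>"
      unfolding a[symmetric] sqn_def \<psi>_def
    proof (intro nn_integral_mono ennreal_leI)
      fix x
      have "(cutoff n x)\<^sup>2 \<le> cutoff n x" using cutoff_bounds[of n x] by (simp add: power2_eq_square mult_left_le)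
      then show "(cmod (of_real (cutoff n x) * cnj (ift F x)))\<^sup>2 \<le> cutoff n x * (cmod (ift F x))\<^sup>2"
        by (simp add: norm_mult power_mult_distrib mult_right_mono)
    qed
    finally have "ennreal \<alpha> * ennreal \<alpha> \<le> ennreal \<alpha> * sqn F"
      by (simp add: power2_eq_square mult_right_mono)
    moreover obtain S where S: "sqn F = ennreal S" "S \<ge> 0" using \<open>L2 F\<close> by (cases "sqn F") (auto simp: L2_def)
    ultimately have "\<alpha> * \<alpha> \<le> \<alpha> * S" using \<alpha>0 by (simp flip: ennreal_mult)
    then have "\<alpha> \<le> S" using \<alpha>0 S by (cases "\<alpha> = 0") auto
    then show ?thesis unfolding a S by (simp add: ennreal_leI)
  qed
  then show "\<exists>N. \<forall>n\<ge>N. (\<integral>\<^sup>+x. ennreal (cutoff n x * (cmod (ift F x))\<^sup>2) \<partial>lborel) \<le> sqn F" by blast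
qed

lemma L2_ift: "integrable lborel F \<Longrightarrow> L2 F \<Longrightarrow> L2 (ift F)"
  using sqn_ift_le[of F] by (auto simp: L2_def)

lemma L2_fhat: "integrable lborel F \<Longrightarrow> L2 F \<Longrightarrow> L2 (fhat F)" and sqn_fhat_le: "integrable lborel F \<Longrightarrow> L2 F \<Longrightarrow> sqn (fhat F) \<le> sqn F"
proof -
  assume F: "integrable lborel F" "L2 F"
  have "sqn (fhat F) = sqn (ift F)" using sqn_reflect[of "fhat F"] F by (simp add: ift_def[abs_def])
  with sqn_ift_le[OF F] show "sqn (fhat F) \<le> sqn F" by simp
  then show "L2 (fhat F)" using F by (auto simp: L2_def)
qed

lemma sqn_liminf:
  assumes [measurable]: "\<And>n. F n \<in> borel_measurable borel" "G \<in> borel_measurable borel"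
    and lim: "AE x in lborel. (\<lambda>n. F n x) \<longlonglongrightarrow> G x" and b: "\<And>n. n \<ge> N \<Longrightarrow> sqn (F n) \<le> B"
  shows "sqn G \<le> B"
proof -
  have "sqn G = (\<integral>\<^sup>+x. liminf (\<lambda>n. ennreal ((cmod (F n x))\<^sup>2)) \<partial>lborel)"
    unfolding sqn_def
  proof (intro nn_integral_cong_AE, use lim in eventually_elim)
    fix x assume "(\<lambda>n. F n x) \<longlonglongrightarrow> G x"
    then have "(\<lambda>n. ennreal ((cmod (F n x))\<^sup>2)) \<longlonglongrightarrow> ennreal ((cmod (G x))\<^sup>2)"
      by (intro tendsto_ennrealI tendsto_intros)
    then show "ennreal ((cmod (G x))\<^sup>2) = liminf (\<lambda>n. ennreal ((cmod (F n x))\<^sup>2))"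
      by (rule lim_imp_Liminf[OF trivial_limit_sequentially, symmetric])
  qed
  also have "\<dots> \<le> liminf (\<lambda>n. sqn (F n))"
    unfolding sqn_def by (rule nn_integral_liminf) simp
  also have "\<dots> \<le> B"
    by (rule Liminf_le) (use b in \<open>auto simp: eventually_sequentially\<close>)
  finally show ?thesis .
qed

section \<open>Completeness of the space of square integrable functions\<close>

lemma summable_if_weighted_sq_bounded:
  fixes d :: "nat \<Rightarrow> complex"
  assumes "(\<Sum>k. ennreal (2 ^ k) * ennreal ((cmod (d k))\<^sup>2)) < \<infinity>"
  shows "summable d"
proof -
  obtain C where C: "(\<Sum>k. ennreal (2 ^ k) * ennreal ((cmod (d k))\<^sup>2)) = ennreal C" "C \<ge> 0"
    using assms by (cases "(\<Sum>k. ennreal (2 ^ k) * ennreal ((cmod (d k))\<^sup>2))") auto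
  have "cmod (d k) \<le> sqrt C * (sqrt (1/2)) ^ k" for k
  proof -
    have "ennreal (2 ^ k) * ennreal ((cmod (d k))\<^sup>2) \<le> (\<Sum>k. ennreal (2 ^ k) * ennreal ((cmod (d k))\<^sup>2))"
      using sum_le_suminf[of "\<lambda>k. ennreal (2 ^ k) * ennreal ((cmod (d k))\<^sup>2)" "{k}"] by simp
    then have "2 ^ k * (cmod (d k))\<^sup>2 \<le> C" using C by (simp flip: ennreal_mult)
    then have "(cmod (d k))\<^sup>2 \<le> C * (1/2) ^ k" by (simp add: field_simps)
    then have "sqrt ((cmod (d k))\<^sup>2) \<le> sqrt (C * (1/2) ^ k)" by (rule real_sqrt_le_mono)
    then show ?thesis by (simp add: real_sqrt_mult real_sqrt_power)
  qed
  moreover have "summable (\<lambda>k. sqrt C * (sqrt (1/2)) ^ k)"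
    by (intro summable_mult summable_geometric) (simp add: real_sqrt_lt_1_iff)
  ultimately show ?thesis using summable_comparison_test' by blast
qed

text \<open>Along a subsequence whose consecutive differences have squared norm at most
  \<open>(1/4) ^ k\<close>, the sum of squares weighted by \<open>2 ^ k\<close> is still integrable,
  so the telescoping series converges absolutely almost everywhere. By Fatou's lemma the pointwise
  limit of the subsequence is the norm limit of the full sequence.\<close>

lemma Riesz_Fischer:
  assumes L: "\<And>n. L2 (F n)"
    and Cauchy: "\<And>e. e > 0 \<Longrightarrow> \<exists>N. \<forall>m\<ge>N. \<forall>n\<ge>N. sqn (\<lambda>x. F m x - F n x) \<le> ennreal e"
  obtains G where "L2 G" "(\<lambda>n. sqn (\<lambda>x. F n x - G x)) \<longlonglongrightarrow> 0"
proof -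
  note [measurable] = L[THEN L2_measurable]
  have "\<exists>N. \<forall>m\<ge>N. \<forall>n\<ge>N. sqn (\<lambda>x. F m x - F n x) \<le> ennreal ((1/4) ^ k)" for k by (rule Cauchy) simp
  then obtain N where N: "\<And>k m n. m \<ge> N k \<Longrightarrow> n \<ge> N k \<Longrightarrow> sqn (\<lambda>x. F m x - F n x) \<le> ennreal ((1/4) ^ k)"
    by metis
  \<comment> \<open>Summing all thresholds up to \<open>k\<close> puts both \<open>s k\<close> and
    \<open>s (Suc k)\<close> above \<open>N k\<close>; adding \<open>k\<close> makes the indices
    unbounded.\<close>
  define s where "s k = (\<Sum>j\<le>k. N j) + k" for k
  have sN: "s k \<ge> N k" "s (Suc k) \<ge> N k" for k
    using sum_mono2[of "{..k}" "{k}" N] sum_mono2[of "{..Suc k}" "{k}" N] by (auto simp: s_def)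
  have sk: "s k \<ge> k" for k by (simp add: s_def)
  define d where "d = (\<lambda>k x. F (s (Suc k)) x - F (s k) x)"
  have [measurable]: "d k \<in> borel_measurable borel" for k unfolding d_def by simp
  have dk: "sqn (d k) \<le> ennreal ((1/4)^k)" for k unfolding d_def by (rule N) (rule sN)+
  have "(\<integral>\<^sup>+x. (\<Sum>k. ennreal (2 ^ k) * ennreal ((cmod (d k x))\<^sup>2)) \<partial>lborel) = (\<Sum>k. ennreal (2^k) * sqn (d k))"
    by (subst nn_integral_suminf) (auto simp: nn_integral_cmult sqn_def)
  also have "\<dots> \<le> (\<Sum>k. ennreal ((1/2)^k))"
  proof (intro suminf_le)
    fix k
    have "ennreal (2^k) * sqn (d k) \<le> ennreal (2^k) * ennreal ((1/4)^k)" by (intro mult_left_mono dk) auto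
    also have "\<dots> = ennreal ((1/2)^k)" by (simp flip: ennreal_mult power_mult_distrib)
    finally show "ennreal (2^k) * sqn (d k) \<le> ennreal ((1/2)^k)" .
  qed auto
  also have "\<dots> = ennreal (\<Sum>k. (1/2::real)^k)"
    by (rule suminf_ennreal2) (simp, rule summable_geometric, simp)
  also have "\<dots> < \<infinity>" by simp
  finally have "AE x in lborel. (\<Sum>k. ennreal (2 ^ k) * ennreal ((cmod (d k x))\<^sup>2)) \<noteq> \<infinity>"
    by (intro nn_integral_PInf_AE) auto
  then have conv: "AE x in lborel. convergent (\<lambda>k. F (s k) x)"
  proof eventually_elim
    fix x assume "(\<Sum>k. ennreal (2 ^ k) * ennreal ((cmod (d k x))\<^sup>2)) \<noteq> \<infinity>"
    then have "summable (\<lambda>k. d k x)" by (intro summable_if_weighted_sq_bounded) (simp add: less_top)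
    then have "convergent (\<lambda>n. (\<Sum>k<n. d k x))" by (simp add: summable_iff_convergent)
    moreover have "(\<Sum>k<n. d k x) = F (s n) x - F (s 0) x" for n
      unfolding d_def by (rule sum_lessThan_telescope)
    ultimately have "convergent (\<lambda>n. F (s n) x - F (s 0) x)" by simp
    then show "convergent (\<lambda>k. F (s k) x)"
      using convergent_add[OF _ convergent_const[of "F (s 0) x"]] by fastforce
  qed
  define G where "G = (\<lambda>x. lim (\<lambda>k. F (s k) x))"
  have [measurable]: "G \<in> borel_measurable borel" unfolding G_def by measurable
  have lim: "AE x in lborel. (\<lambda>k. F (s k) x) \<longlonglongrightarrow> G x"
    using conv unfolding G_def by eventually_elim (simp add: convergent_LIMSEQ_iff)
  have close: "\<exists>N. \<forall>n\<ge>N. sqn (\<lambda>x. F n x - G x) \<le> ennreal e" if "e > 0" for e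
  proof -
    obtain N where N: "\<And>m n. m \<ge> N \<Longrightarrow> n \<ge> N \<Longrightarrow> sqn (\<lambda>x. F m x - F n x) \<le> ennreal e" using Cauchy[OF \<open>e > 0\<close>] by metis
    have "sqn (\<lambda>x. F n x - G x) \<le> ennreal e" if "n \<ge> N" for n
    proof (rule sqn_liminf[of "\<lambda>k x. F n x - F (s k) x" _ N])
      show "AE x in lborel. (\<lambda>k. F n x - F (s k) x) \<longlonglongrightarrow> F n x - G x"
        using lim by eventually_elim (intro tendsto_intros)
      show "sqn (\<lambda>x. F n x - F (s k) x) \<le> ennreal e" if "k \<ge> N" for k
        using \<open>n \<ge> N\<close> N[of n "s k"] sk[of k] that by simp
    qed simp_all
    then show ?thesis by blast
  qed
  have "(\<lambda>n. sqn (\<lambda>x. F n x - G x)) \<longlonglongrightarrow> 0"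
    using close by (intro ennreal_tendsto_0I) (auto simp: eventually_sequentially)
  moreover have "L2 G"
  proof -
    obtain n where n: "sqn (\<lambda>x. F n x - G x) \<le> ennreal 1" using close[of 1] by auto
    have "L2 (\<lambda>x. F n x - G x)" using n by (auto simp: L2_def intro: le_less_trans)
    from L2_diff[OF L[of n] this] show ?thesis by simp
  qed
  ultimately show ?thesis using that by blast
qed

text \<open>The multiplication formula characterises the Plancherel transform, so that no limiting
  process enters the definition.\<close>

definition ft :: "(real \<Rightarrow> complex) \<Rightarrow> (real \<Rightarrow> complex) \<Rightarrow> bool" where
  "ft f F \<longleftrightarrow> L2 f \<and> L2 F \<and>
     (\<forall>\<psi>. integrable lborel \<psi> \<longrightarrow> L2 \<psi> \<longrightarrow>
        (LINT x|lborel. f x * fhat \<psi> x) = (LINT y|lborel. F y * \<psi> y))"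

section \<open>The Plancherel transform of continuous square integrable functions\<close>

lemma L2_pairing_tendsto:
  assumes L: "\<And>n. L2 (F n)" "L2 G" "L2 \<psi>" and lim: "(\<lambda>n. sqn (\<lambda>x. F n x - G x)) \<longlonglongrightarrow> 0"
  shows "(\<lambda>n. LINT x|lborel. F n x * \<psi> x) \<longlonglongrightarrow> (LINT x|lborel. G x * \<psi> x)"
proof -
  have d: "(LINT x|lborel. (F n x - G x) * \<psi> x) = (LINT x|lborel. F n x * \<psi> x) - (LINT x|lborel. G x * \<psi> x)" for n
    using L2_C_S(1)[OF L(1,3)] L2_C_S(1)[OF L(2,3)] by (simp add: left_diff_distrib)
  have "(\<lambda>n. sqn (\<lambda>x. F n x - G x) * sqn \<psi>) \<longlonglongrightarrow> 0 * sqn \<psi>"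
    using L(3) by (intro tendsto_mult_ennreal tendsto_const lim) (simp add: L2_def less_top[symmetric])
  then have lim': "(\<lambda>n. sqn (\<lambda>x. F n x - G x) * sqn \<psi>) \<longlonglongrightarrow> 0" by simp
  have "(\<lambda>n. (ennreal (cmod ((LINT x|lborel. F n x * \<psi> x) - (LINT x|lborel. G x * \<psi> x))))\<^sup>2) \<longlonglongrightarrow> 0"
  proof (rule tendsto_sandwich[OF _ _ tendsto_const])
    show "\<forall>\<^sub>F n in sequentially. (ennreal (cmod ((LINT x|lborel. F n x * \<psi> x) - (LINT x|lborel. G x * \<psi> x))))\<^sup>2
        \<le> sqn (\<lambda>x. F n x - G x) * sqn \<psi>"
      using L2_C_S(2)[OF L2_diff[OF L(1,2)] L(3), unfolded d] by (intro always_eventually allI)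
  qed (simp_all add: lim')
  then have "(\<lambda>n. ennreal ((cmod ((LINT x|lborel. F n x * \<psi> x) - (LINT x|lborel. G x * \<psi> x)))\<^sup>2)) \<longlonglongrightarrow> ennreal 0"
    by (simp add: ennreal_power)
  then have "(\<lambda>n. (cmod ((LINT x|lborel. F n x * \<psi> x) - (LINT x|lborel. G x * \<psi> x)))\<^sup>2) \<longlonglongrightarrow> 0"
    by (subst (asm) tendsto_ennreal_iff) auto
  then have "(\<lambda>n. cmod ((LINT x|lborel. F n x * \<psi> x) - (LINT x|lborel. G x * \<psi> x))) \<longlonglongrightarrow> 0"
    using tendsto_real_sqrt[of "\<lambda>n. (cmod ((LINT x|lborel. F n x * \<psi> x) - (LINT x|lborel. G x * \<psi> x)))\<^sup>2" 0] by simp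
  then show ?thesis by (simp add: tendsto_norm_zero_iff LIM_zero_iff)
qed

text \<open>Young's inequality with a free parameter. The factor 2 of \<open>sqn_add\<close> would
  spoil the isometry; here \<open>1 + d\<close> tends to 1 after the second term has been sent to
  zero.\<close>

lemma sqn_weighted_triangle:
  assumes [measurable]: "F \<in> borel_measurable borel" "G \<in> borel_measurable borel" and "d > 0"
  shows "sqn (\<lambda>x. F x + G x) \<le> ennreal (1 + d) * sqn F + ennreal (1 + 1/d) * sqn G"
proof -
  have "sqn (\<lambda>x. F x + G x) \<le> (\<integral>\<^sup>+x. ennreal (1 + d) * ennreal ((cmod (F x))\<^sup>2) + ennreal (1 + 1/d) * ennreal ((cmod (G x))\<^sup>2) \<partial>lborel)"
    unfolding sqn_def
  proof (rule nn_integral_mono)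
    fix x
    define a b where "a = cmod (F x)" "b = cmod (G x)"
    have "0 \<le> (sqrt d * a - b / sqrt d)\<^sup>2" by simp
    also have "\<dots> = d * a\<^sup>2 + b\<^sup>2 / d - 2 * a * b"
      using \<open>d > 0\<close> by (simp add: power2_diff power_mult_distrib power_divide)
    finally have "(a + b)\<^sup>2 \<le> (1 + d) * a\<^sup>2 + (1 + 1/d) * b\<^sup>2" by (simp add: power2_sum field_simps)
    moreover have "(cmod (F x + G x))\<^sup>2 \<le> (a + b)\<^sup>2"
      unfolding a_b_def by (intro power_mono norm_triangle_ineq) simp
    ultimately have "ennreal ((cmod (F x + G x))\<^sup>2) \<le> ennreal ((1 + d) * a\<^sup>2 + (1 + 1/d) * b\<^sup>2)"
      by (intro ennreal_leI) simp
    then show "ennreal ((cmod (F x + G x))\<^sup>2) \<le> ennreal (1 + d) * ennreal ((cmod (F x))\<^sup>2) + ennreal (1 + 1/d) * ennreal ((cmod (G x))\<^sup>2)"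
      using \<open>d > 0\<close> unfolding a_b_def[symmetric] by (simp add: ennreal_plus ennreal_mult del: ennreal_plus_if)
  qed
  also have "\<dots> = ennreal (1 + d) * sqn F + ennreal (1 + 1/d) * sqn G"
    unfolding sqn_def by (subst nn_integral_add) (auto simp: nn_integral_cmult)
  finally show ?thesis .
qed

lemma sqn_commute: "sqn (\<lambda>x. F x - G x) = sqn (\<lambda>x. G x - F x)"
  by (simp add: sqn_def norm_minus_commute)

text \<open>The limits are taken in a fixed order: \<open>n\<close> to infinity for fixed
  \<open>d\<close>, which removes the term with the large factor \<open>1 + 1/d\<close>, and only
  then \<open>d\<close> to zero.\<close>

lemma ennreal_le_of_weighted:
  fixes X Y :: ennreal
  assumes *: "\<And>d n. d > 0 \<Longrightarrow> n \<ge> N \<Longrightarrow> X \<le> ennreal (1 + d) * Y + ennreal (1 + 1/d) * e n"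
    and lim: "e \<longlonglongrightarrow> 0"
  shows "X \<le> Y"
proof (cases "Y = \<top>")
  case False
  have **: "X \<le> ennreal (1 + d) * Y" if "d > 0" for d
  proof (rule LIMSEQ_le_const)
    show "(\<lambda>n. ennreal (1 + d) * Y + ennreal (1 + 1/d) * e n) \<longlonglongrightarrow> ennreal (1 + d) * Y"
      using tendsto_add[OF tendsto_const ennreal_tendsto_cmult[OF _ lim], of "ennreal (1 + 1/d)" "ennreal (1 + d) * Y"] by simp
    show "\<exists>N. \<forall>n\<ge>N. X \<le> ennreal (1 + d) * Y + ennreal (1 + 1/d) * e n" using *[OF that] by blast
  qed
  obtain B' where B': "Y = ennreal B'" "B' \<ge> 0" using False by (cases Y) auto
  have "X < \<top>" using **[of 1] B' by (auto simp: ennreal_mult_less_top intro: le_less_trans)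
  then obtain S where S: "X = ennreal S" "S \<ge> 0" by (cases X) auto
  have "S \<le> B'"
  proof (rule field_le_epsilon)
    fix e :: real assume "e > 0"
    have "ennreal S \<le> ennreal (1 + e / (B' + 1)) * ennreal B'"
      using **[of "e / (B' + 1)"] \<open>e > 0\<close> B' unfolding S B'(1) by simp
    then have "S \<le> (1 + e / (B' + 1)) * B'"
      using B' \<open>e > 0\<close> by (subst (asm) ennreal_mult[symmetric]) auto
    also have "\<dots> \<le> B' + e"
      using B' \<open>e > 0\<close> by (simp add: field_simps)
    finally show "S \<le> B' + e" .
  qed
  then show ?thesis unfolding S B'(1) by (rule ennreal_leI)
qed simp

lemma sqn_limit_le:
  assumes [measurable]: "\<And>n. F n \<in> borel_measurable borel" "G \<in> borel_measurable borel"
    and lim: "(\<lambda>n. sqn (\<lambda>x. F n x - G x)) \<longlonglongrightarrow> 0"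
    and b: "\<And>n. n \<ge> N \<Longrightarrow> sqn (F n) \<le> B"
  shows "sqn G \<le> B"
proof (rule ennreal_le_of_weighted[OF _ lim])
  fix d :: real and n assume "d > 0" "n \<ge> N"
  have "sqn G \<le> ennreal (1 + d) * sqn (F n) + ennreal (1 + 1/d) * sqn (\<lambda>x. G x - F n x)"
    using sqn_weighted_triangle[of "F n" "\<lambda>x. G x - F n x" d] \<open>d > 0\<close> by simp
  also have "\<dots> \<le> ennreal (1 + d) * B + ennreal (1 + 1/d) * sqn (\<lambda>x. F n x - G x)"
    unfolding sqn_commute[of G] using \<open>n \<ge> N\<close> by (intro add_mono mult_left_mono b) auto
  finally show "sqn G \<le> ennreal (1 + d) * B + ennreal (1 + 1/d) * sqn (\<lambda>x. F n x - G x)" .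
qed

lemma sqn_limit_ge:
  assumes [measurable]: "\<And>n. F n \<in> borel_measurable borel" "G \<in> borel_measurable borel"
    and lim: "(\<lambda>n. sqn (\<lambda>x. F n x - G x)) \<longlonglongrightarrow> 0"
    and b: "\<And>n. n \<ge> N \<Longrightarrow> B \<le> sqn (F n)"
  shows "B \<le> sqn G"
proof (rule ennreal_le_of_weighted[OF _ lim])
  fix d :: real and n assume "d > 0" "n \<ge> N"
  have "B \<le> sqn (F n)" using b[OF \<open>n \<ge> N\<close>] .
  also have "\<dots> \<le> ennreal (1 + d) * sqn G + ennreal (1 + 1/d) * sqn (\<lambda>x. F n x - G x)"
    using sqn_weighted_triangle[of G "\<lambda>x. F n x - G x" d] \<open>d > 0\<close> by simp
  finally show "B \<le> ennreal (1 + d) * sqn G + ennreal (1 + 1/d) * sqn (\<lambda>x. F n x - G x)" .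
qed

text \<open>Truncation makes \<open>f\<close> integrable, Plancherel turns the Cauchy property of
  the truncations into that of their transforms, and completeness supplies the limit. The
  multiplication formula survives the limit because both pairings are continuous in the
  norm.\<close>

theorem ft_exists:
  assumes c: "continuous_on UNIV f" and L: "L2 f"
  obtains F where "ft f F" "sqn F = sqn f"
proof -
  note [measurable] = L[THEN L2_measurable]
  define fn where "fn = (\<lambda>n x. of_real (cutoff n x) * f x)"
  have fn: "integrable lborel (fn n)" "continuous_on UNIV (fn n)" "\<exists>M. \<forall>x. cmod (fn n x) \<le> M" for n
    unfolding fn_def by (rule cutoff_integrable[OF c])+
  have Lfn: "L2 (fn n)" for n using fn L2_of_bounded_integrable by blast
  define Fn where "Fn = (\<lambda>n. fhat (fn n))"
  have LFn: "L2 (Fn n)" for n unfolding Fn_def using fn Lfn L2_fhat by blast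
  have Fn_sqn: "sqn (Fn n) = sqn (fn n)" for n
    unfolding Fn_def using fn Plancherel_bounded_L1 by blast
  have Fd: "sqn (\<lambda>x. Fn m x - Fn n x) = sqn (\<lambda>x. fn m x - fn n x)" for m n
  proof -
    obtain M N where "\<And>x. cmod (fn m x) \<le> M" "\<And>x. cmod (fn n x) \<le> N" using fn by metis
    then have "cmod (fn m x - fn n x) \<le> M + N" for x by (meson add_mono norm_triangle_ineq4 order_trans)
    then have "sqn (fhat (\<lambda>x. fn m x - fn n x)) = sqn (\<lambda>x. fn m x - fn n x)"
      using fn by (intro Plancherel_bounded_L1 Bochner_Integration.integrable_diff continuous_intros) auto
    moreover have "fhat (\<lambda>x. fn m x - fn n x) = (\<lambda>x. Fn m x - Fn n x)"
      unfolding Fn_def by (intro ext fhat_diff fn)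
    ultimately show ?thesis by simp
  qed
  have lim: "(\<lambda>n. sqn (\<lambda>x. fn n x - f x)) \<longlonglongrightarrow> 0"
  proof -
    have "(\<lambda>n. sqn (\<lambda>x. fn n x - f x)) \<longlonglongrightarrow> (\<integral>\<^sup>+x. 0 \<partial>(lborel::real measure))"
      unfolding sqn_def
    proof (rule nn_integral_dominated_convergence[where w="\<lambda>x. ennreal ((cmod (f x))\<^sup>2)"])
      have eq: "cmod (fn n x - f x) = (1 - cutoff n x) * cmod (f x)" for n x
      proof -
        have "fn n x - f x = - (of_real (1 - cutoff n x) * f x)" by (simp add: fn_def algebra_simps)
        then show ?thesis by (simp only: norm_minus_cancel norm_mult norm_of_real) (simp add: cutoff_bounds)
      qed
      show "AE x in lborel. ennreal ((cmod (fn n x - f x))\<^sup>2) \<le> ennreal ((cmod (f x))\<^sup>2)" for n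
        unfolding eq by (auto intro!: ennreal_leI power_mono simp: cutoff_bounds mult_left_le_one_le)
      show "AE x in lborel. (\<lambda>n. ennreal ((cmod (fn n x - f x))\<^sup>2)) \<longlonglongrightarrow> 0"
      proof (rule AE_I2)
        fix x
        have "(\<lambda>n. ((1 - cutoff n x) * cmod (f x))\<^sup>2) \<longlonglongrightarrow> ((1 - 1) * cmod (f x))\<^sup>2"
          by (intro tendsto_intros cutoff_tendsto)
        then show "(\<lambda>n. ennreal ((cmod (fn n x - f x))\<^sup>2)) \<longlonglongrightarrow> 0"
          unfolding eq by (metis diff_self ennreal_0 mult_zero_left power_zero_numeral tendsto_ennrealI)
      qed
      show "(\<integral>\<^sup>+x. ennreal ((cmod (f x))\<^sup>2) \<partial>lborel) < \<infinity>"
        using L by (simp add: L2_def sqn_def)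
    qed (simp_all add: fn_def)
    then show ?thesis by simp
  qed
  have Cauchy: "\<exists>N. \<forall>m\<ge>N. \<forall>n\<ge>N. sqn (\<lambda>x. Fn m x - Fn n x) \<le> ennreal e" if "e > 0" for e
  proof -
    have "\<forall>\<^sub>F n in sequentially. sqn (\<lambda>x. fn n x - f x) < ennreal (e / 4)"
      using lim \<open>e > 0\<close> by (intro order_tendstoD) auto
    then obtain N where N: "\<And>n. n \<ge> N \<Longrightarrow> sqn (\<lambda>x. fn n x - f x) < ennreal (e / 4)"
      unfolding eventually_sequentially by blast
    have "sqn (\<lambda>x. fn m x - fn n x) \<le> ennreal e" if "m \<ge> N" "n \<ge> N" for m n
    proof -
      note [measurable] = Lfn[THEN L2_measurable]
      have "sqn (\<lambda>x. fn m x - fn n x) \<le> 2 * sqn (\<lambda>x. fn m x - f x) + 2 * sqn (\<lambda>x. fn n x - f x)"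
        using sqn_add[of "\<lambda>x. fn m x - f x" "\<lambda>x. f x - fn n x"] by (simp add: sqn_commute[of f])
      also have "\<dots> \<le> 2 * ennreal (e / 4) + 2 * ennreal (e / 4)"
        using N that by (intro add_mono mult_left_mono) (auto intro: less_imp_le)
      also have "\<dots> = ennreal e" using \<open>e > 0\<close>
        by (simp add: mult_2 flip: ennreal_plus)
      finally show ?thesis .
    qed
    then show ?thesis unfolding Fd by blast
  qed
  obtain F where F: "L2 F" "(\<lambda>n. sqn (\<lambda>x. Fn n x - F x)) \<longlonglongrightarrow> 0"
    using Riesz_Fischer[OF LFn Cauchy] by blast
  have "ft f F"
    unfolding ft_def
  proof (safe intro!: L F)
    fix \<psi> assume \<psi>: "integrable lborel \<psi>" "L2 \<psi>"
    have "(\<lambda>n. LINT x|lborel. fn n x * fhat \<psi> x) \<longlonglongrightarrow> (LINT x|lborel. f x * fhat \<psi> x)"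
      by (rule L2_pairing_tendsto[OF Lfn L L2_fhat[OF \<psi>] lim])
    moreover have "(\<lambda>n. LINT x|lborel. Fn n x * \<psi> x) \<longlonglongrightarrow> (LINT x|lborel. F x * \<psi> x)"
      by (rule L2_pairing_tendsto[OF LFn F(1) \<psi>(2) F(2)])
    moreover have "(LINT x|lborel. Fn n x * \<psi> x) = (LINT x|lborel. fn n x * fhat \<psi> x)" for n
      unfolding Fn_def using fhat_multiplication[OF fn(1) \<psi>(1)] by simp
    ultimately show "(LINT x|lborel. f x * fhat \<psi> x) = (LINT x|lborel. F x * \<psi> x)"
      using LIMSEQ_unique by simp
  qed
  moreover have "sqn F = sqn f"
  proof (rule antisym)
    have le: "sqn (fn n) \<le> sqn f" for n
      unfolding sqn_def fn_def
      by (intro nn_integral_mono ennreal_leI power_mono) (auto simp: norm_mult cutoff_bounds mult_left_le_one_le)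
    show "sqn F \<le> sqn f"
      by (rule sqn_limit_le[OF LFn[THEN L2_measurable] L2_measurable[OF F(1)] F(2)]) (simp add: Fn_sqn le)
    show "sqn f \<le> sqn F"
    proof (rule sqn_limit_le[OF Lfn[THEN L2_measurable] L2_measurable[OF L] lim])
      fix n
      have "sqn (fn n) \<le> sqn (Fn k)" if "k \<ge> n" for k
        unfolding Fn_sqn unfolding sqn_def fn_def using cutoff_mono[OF that]
        by (intro nn_integral_mono ennreal_leI power_mono) (auto simp: norm_mult cutoff_bounds intro!: mult_right_mono)
      then show "sqn (fn n) \<le> sqn F"
        by (rule sqn_limit_ge[OF LFn[THEN L2_measurable] L2_measurable[OF F(1)] F(2)])
    qed
  qed
  ultimately show ?thesis using that by blast
qed

section \<open>Test functions\<close>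

text \<open>The functions p(1/x) exp(-1/x), extended by zero to the left, are closed under
  differentiation, so smoothness follows from a single derivative computation. The choice
  \<open>p = 1\<close> is the classical bump.\<close>

definition bump :: "real poly \<Rightarrow> real \<Rightarrow> real" where
  "bump p x = (if x > 0 then poly p (1/x) * exp (- (1/x)) else 0)"

lemma poly_exp_tendsto_0: "((\<lambda>y. poly p y * exp (- y)) \<longlongrightarrow> (0::real)) at_top"
proof -
  have "((\<lambda>y::real. \<Sum>i\<le>degree p. coeff p i * (y ^ i / exp y)) \<longlongrightarrow> (\<Sum>i\<le>degree p. coeff p i * 0)) at_top"
    by (intro tendsto_intros tendsto_power_div_exp_0)
  moreover have "(\<Sum>i\<le>degree p. coeff p i * (y ^ i / exp y)) = poly p y * exp (- y)" for y :: real
    by (simp add: poly_altdef sum_distrib_right exp_minus divide_inverse mult.assoc)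
  ultimately show ?thesis by simp
qed

text \<open>With y = 1/x the chain rule gives y^2 (p(y) - p'(y)) exp(-y); the polynomial
  \<open>[:0, 0, 1:]\<close> is the factor y^2.\<close>

definition bump_deriv :: "real poly \<Rightarrow> real poly" where
  "bump_deriv p = (p - pderiv p) * [:0, 0, 1:]"

lemma DERIV_bump: "(bump p has_real_derivative bump (bump_deriv p) x) (at x)"
proof (cases x "0 :: real" rule: linorder_cases)
  case less
  have "((\<lambda>_. 0) has_real_derivative 0) (at x)" by simp
  then have "(bump p has_real_derivative 0) (at x)"
    by (rule has_field_derivative_transform_within_open[where S="{..<0}"]) (use less in \<open>auto simp: bump_def\<close>)
  then show ?thesis using less by (simp add: bump_def)
next
  case greater
  have "((\<lambda>x. poly p (1/x) * exp (- (1/x))) has_real_derivative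
     (poly (pderiv p) (1/x) * (- 1 / x\<^sup>2)) * exp (- (1/x)) + poly p (1/x) * (exp (- (1/x)) * (1 / x\<^sup>2))) (at x)"
    using greater by (auto intro!: derivative_eq_intros DERIV_chain2[OF poly_DERIV] simp: power2_eq_square field_simps)
  moreover have "(poly (pderiv p) (1/x) * (- 1 / x\<^sup>2)) * exp (- (1/x)) + poly p (1/x) * (exp (- (1/x)) * (1 / x\<^sup>2))
    = bump (bump_deriv p) x"
    using greater by (simp add: bump_def bump_deriv_def power2_eq_square field_simps)
  ultimately have "((\<lambda>x. poly p (1/x) * exp (- (1/x))) has_real_derivative bump (bump_deriv p) x) (at x)" by simp
  then show ?thesis
    by (rule has_field_derivative_transform_within_open[where S="{0<..}"]) (use greater in \<open>auto simp: bump_def\<close>)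
next
  case equal
  \<comment> \<open>The difference quotient at the origin is a function of the same family, with
    \<open>p\<close> multiplied by one more power of 1/y, and so decays from the right.\<close>
  have "((\<lambda>y. bump p y / y) \<longlongrightarrow> 0) (at_right 0)"
  proof -
    have "((\<lambda>y. poly (p * [:0, 1:]) (inverse y) * exp (- inverse y)) \<longlongrightarrow> (0::real)) (at_right 0)"
      by (rule filterlim_compose[OF poly_exp_tendsto_0 filterlim_inverse_at_top_right])
    then show ?thesis
      by (rule Lim_transform_eventually)
        (auto simp: bump_def eventually_at_filter field_simps inverse_eq_divide)
  qed
  moreover have "((\<lambda>y. bump p y / y) \<longlongrightarrow> 0) (at_left 0)"
    by (rule tendsto_eventually) (auto simp: bump_def eventually_at_filter)
  ultimately have "((\<lambda>y. bump p y / y) \<longlongrightarrow> 0) (at 0)" by (simp add: filterlim_split_at)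
  then show ?thesis unfolding equal
    by (simp add: has_field_derivative_iff bump_def)
qed

text \<open>A class that contains every \<open>itest\<close> and is stable under differentiation by
  the product rule, so that derivatives of all orders exist by induction.\<close>

inductive bumpy :: "real \<Rightarrow> real \<Rightarrow> real \<Rightarrow> (real \<Rightarrow> real) \<Rightarrow> bool" for n a b where
  gen: "bumpy n a b (\<lambda>x. bump p (n * (x - a)) * bump q (n * (b - x)))"
| add: "bumpy n a b f \<Longrightarrow> bumpy n a b g \<Longrightarrow> bumpy n a b (\<lambda>x. f x + g x)"

lemma bump_uminus: "bump (- p) x = - bump p x"
  by (simp add: bump_def)

lemma bump_smult: "bump (smult c p) x = c * bump p x"
  by (simp add: bump_def)

lemma bumpy_DERIV: "bumpy n a b f \<Longrightarrow> \<exists>f'. bumpy n a b f' \<and> (\<forall>x. (f has_real_derivative f' x) (at x))"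
proof (induction rule: bumpy.induct)
  case (gen p q)
  let ?f' = "\<lambda>x. bump (smult n (bump_deriv p)) (n * (x - a)) * bump q (n * (b - x))
              + bump p (n * (x - a)) * bump (smult (-n) (bump_deriv q)) (n * (b - x))"
  have "((\<lambda>x. bump p (n * (x - a)) * bump q (n * (b - x))) has_real_derivative ?f' x) (at x)" for x
    by (auto intro!: derivative_eq_intros DERIV_chain2[OF DERIV_bump] simp: bump_smult bump_uminus)
  moreover have "bumpy n a b ?f'" by (intro bumpy.intros)
  ultimately show ?case by blast
next
  case (add f g)
  then obtain f' g' where "bumpy n a b f'" "\<And>x. (f has_real_derivative f' x) (at x)"
      "bumpy n a b g'" "\<And>x. (g has_real_derivative g' x) (at x)" by blast
  then show ?case by (intro exI[of _ "\<lambda>x. f' x + g' x"] conjI bumpy.add allI DERIV_add)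
qed

lemma bumpy_higher_deriv: "bumpy n a b f \<Longrightarrow> bumpy n a b ((deriv ^^ k) f)"
proof (induction k)
  case (Suc k)
  then obtain f' where f': "bumpy n a b f'" "\<And>x. ((deriv ^^ k) f has_real_derivative f' x) (at x)"
    using bumpy_DERIV by blast
  then have "(deriv ^^ Suc k) f = f'" by (auto simp: DERIV_imp_deriv)
  with f' show ?case by simp
qed simp

lemma bumpy_smooth: "bumpy n a b f \<Longrightarrow> ((deriv ^^ k) f) field_differentiable (at x)"
  using bumpy_higher_deriv bumpy_DERIV field_differentiable_def by blast

text \<open>The exponents are inversely proportional to \<open>Suc n\<close>, so they tend to zero
  at each interior point and the test functions converge to the indicator of the open
  interval.\<close>

definition itest :: "real \<Rightarrow> real \<Rightarrow> nat \<Rightarrow> real \<Rightarrow> real" where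
  "itest a b n x = bump 1 (real (Suc n) * (x - a)) * bump 1 (real (Suc n) * (b - x))"

lemma itest_support: "closure {x. itest a b n x \<noteq> 0} \<subseteq> {a..b}"
  by (rule closure_minimal) (auto simp: itest_def bump_def zero_less_mult_iff split: if_splits)

lemma test_itest: "test_function (itest a b n)"
proof -
  have "bumpy (real (Suc n)) a b (itest a b n)" unfolding itest_def[abs_def] by (rule bumpy.gen)
  moreover have "compact (closure {x. itest a b n x \<noteq> 0})"
    using itest_support compact_Icc closed_closure by (metis compact_Int_closed inf.absorb_iff2)
  ultimately show ?thesis unfolding test_function_def using bumpy_smooth by blast
qed

lemma bump_1_bounds: "0 \<le> bump 1 x" "bump 1 x \<le> 1"
  by (auto simp: bump_def)

lemma itest_bounds: "0 \<le> itest a b n x" "itest a b n x \<le> indicator {a<..<b} x"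
proof -
  show "0 \<le> itest a b n x" by (simp add: itest_def bump_1_bounds)
  have "itest a b n x \<le> 1" unfolding itest_def by (intro mult_le_one bump_1_bounds)
  moreover have "itest a b n x = 0" if "x \<notin> {a<..<b}" using that by (auto simp: itest_def bump_def zero_less_mult_iff)
  ultimately show "itest a b n x \<le> indicator {a<..<b} x" by (cases "x \<in> {a<..<b}") auto
qed

lemma itest_tendsto: "(\<lambda>n. itest a b n x) \<longlonglongrightarrow> indicator {a<..<b} x"
proof (cases "x \<in> {a<..<b}")
  case False
  then have "itest a b n x = 0" for n by (auto simp: itest_def bump_def zero_less_mult_iff)
  then show ?thesis using False by simp
next
  case True
  have "(\<lambda>n. exp (- (inverse (real (Suc n)) / (x - a))) * exp (- (inverse (real (Suc n)) / (b - x)))) \<longlonglongrightarrow> exp (- (0 / (x - a))) * exp (- (0 / (b - x)))"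
    using True by (intro tendsto_intros LIMSEQ_inverse_real_of_nat) auto
  moreover have "itest a b n x = exp (- (inverse (real (Suc n)) / (x - a))) * exp (- (inverse (real (Suc n)) / (b - x)))" for n
    using True by (auto simp: itest_def bump_def zero_less_mult_iff inverse_eq_divide)
  ultimately show ?thesis using True by simp
qed

lemma itest_measurable [measurable]: "itest a b n \<in> borel_measurable borel"
proof -
  have "itest a b n field_differentiable (at x)" for x
    using test_itest[of a b n] unfolding test_function_def by (metis funpow_0)
  then show ?thesis
    by (intro borel_measurable_continuous_onI) (simp add: continuous_at_imp_continuous_on field_differentiable_imp_continuous_at)
qed

text \<open>The positive and the negative part of \<open>e\<close> are densities of two measures
  that agree on all right half-lines and are finite there, hence agree altogether. Uniqueness of
  densities makes the two parts equal, and since one of them is zero at each point, both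
  vanish.\<close>

lemma AE_zero_of_tail_integrals:
  fixes e :: "real \<Rightarrow> real"
  assumes i: "integrable lborel e" and z: "\<And>a. (LINT x|lborel. indicator {a<..} x * e x) = 0"
  shows "AE x in lborel. e x = 0"
proof -
  have [measurable]: "e \<in> borel_measurable borel" using i by simp
  define M where "M = density lborel (\<lambda>x. ennreal (max 0 (e x)))"
  define N where "N = density lborel (\<lambda>x. ennreal (max 0 (- e x)))"
  have ip: "integrable lborel (\<lambda>x. indicator {a<..} x * max 0 (e x))" "integrable lborel (\<lambda>x. indicator {a<..} x * max 0 (- e x))" for a
    by (rule Bochner_Integration.integrable_bound[OF i]; auto simp: indicator_def)+
  have eM: "emeasure M {a<..} = ennreal (LINT x|lborel. indicator {a<..} x * max 0 (e x))" for a
  proof -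
    have "emeasure M {a<..} = (\<integral>\<^sup>+x. ennreal (indicator {a<..} x * max 0 (e x)) \<partial>lborel)"
      unfolding M_def by (subst emeasure_density) (auto intro!: nn_integral_cong split: split_indicator)
    also have "\<dots> = ennreal (LINT x|lborel. indicator {a<..} x * max 0 (e x))"
      by (rule nn_integral_eq_integral[OF ip(1)]) auto
    finally show ?thesis .
  qed
  have eN: "emeasure N {a<..} = ennreal (LINT x|lborel. indicator {a<..} x * max 0 (- e x))" for a
  proof -
    have "emeasure N {a<..} = (\<integral>\<^sup>+x. ennreal (indicator {a<..} x * max 0 (- e x)) \<partial>lborel)"
      unfolding N_def by (subst emeasure_density) (auto intro!: nn_integral_cong split: split_indicator)
    also have "\<dots> = ennreal (LINT x|lborel. indicator {a<..} x * max 0 (- e x))"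
      by (rule nn_integral_eq_integral[OF ip(2)]) auto
    finally show ?thesis .
  qed
  have "M = N"
  proof (rule measure_eqI_lessThan)
    fix a
    have "(LINT x|lborel. indicator {a<..} x * max 0 (e x)) - (LINT x|lborel. indicator {a<..} x * max 0 (- e x)) = (LINT x|lborel. indicator {a<..} x * e x)"
      by (subst Bochner_Integration.integral_diff[OF ip, symmetric]) (auto intro!: Bochner_Integration.integral_cong simp: max_def indicator_def)
    then show "emeasure M {a<..} = emeasure N {a<..}" unfolding eM eN z by simp
    show "emeasure M {a<..} < \<infinity>" unfolding eM by simp
  qed (simp_all add: M_def N_def)
  then have "AE x in lborel. ennreal (max 0 (e x)) = ennreal (max 0 (- e x))"
    unfolding M_def N_def by (intro sigma_finite_measure.density_unique[OF sigma_finite_lborel]) auto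
  then show ?thesis by eventually_elim (auto simp: max_def split: if_splits)
qed

lemma AE_zero_of_interval_integrals:
  fixes D :: "real \<Rightarrow> complex"
  assumes i: "set_integrable lborel {c<..<d} D"
    and z: "\<And>a. c \<le> a \<Longrightarrow> a < d \<Longrightarrow> (LINT x:{a<..<d}|lborel. D x) = 0"
  shows "AE x in lborel. x \<in> {c<..<d} \<longrightarrow> D x = 0"
proof -
  have eq: "indicator {a<..} x *\<^sub>R (indicator {c<..<d} x *\<^sub>R D x) = indicator {max a c<..<d} x *\<^sub>R D x" for a x
    by (auto simp: indicator_def)
  have ii: "integrable lborel (\<lambda>x. indicator {c<..<d} x *\<^sub>R D x)" using i by (simp add: set_integrable_def)
  have ia: "integrable lborel (\<lambda>x. indicator {a<..} x *\<^sub>R (indicator {c<..<d} x *\<^sub>R D x))" for a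
  proof (rule Bochner_Integration.integrable_bound[OF ii])
    have [measurable]: "(\<lambda>x. indicator {c<..<d} x *\<^sub>R D x) \<in> borel_measurable borel" using ii by simp
    show "(\<lambda>x. indicator {a<..} x *\<^sub>R (indicator {c<..<d} x *\<^sub>R D x)) \<in> borel_measurable lborel" by measurable
  qed (auto simp: indicator_def)
  have za: "(LINT x|lborel. indicator {a<..} x *\<^sub>R (indicator {c<..<d} x *\<^sub>R D x)) = 0" for a
  proof (cases "max a c < d")
    case True
    then show ?thesis unfolding eq using z[of "max a c"] by (simp add: set_lebesgue_integral_def)
  next
    case False
    then have "{max a c<..<d} = {}" by auto
    then show ?thesis unfolding eq by simp
  qed
  have "AE x in lborel. Re (indicator {c<..<d} x *\<^sub>R D x) = 0"
  proof (rule AE_zero_of_tail_integrals)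
    show "(LINT x|lborel. indicator {a<..} x * Re (indicator {c<..<d} x *\<^sub>R D x)) = 0" for a
      using integral_Re[OF ia[of a]] za[of a] by (simp add: mult.assoc)
  qed (rule integrable_Re[OF ii])
  moreover have "AE x in lborel. Im (indicator {c<..<d} x *\<^sub>R D x) = 0"
  proof (rule AE_zero_of_tail_integrals)
    show "(LINT x|lborel. indicator {a<..} x * Im (indicator {c<..<d} x *\<^sub>R D x)) = 0" for a
      using integral_Im[OF ia[of a]] za[of a] by (simp add: mult.assoc)
  qed (rule integrable_Im[OF ii])
  ultimately show ?thesis by eventually_elim (auto simp: complex_eq_iff)
qed

text \<open>Test functions approximate indicators of intervals, so equal pairings give equal
  integrals over every \<open>{a<..<d}\<close>. The functions are only locally integrable, which is
  why all supports stay inside \<open>{c..d}\<close> and the limit is dominated by the restriction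
  to that interval.\<close>

lemma AE_unique_of_tests:
  fixes F G :: "real \<Rightarrow> complex"
  assumes F: "set_integrable lborel {c..d} F" and G: "set_integrable lborel {c..d} G"
    and eq: "\<And>\<phi>. test_function \<phi> \<Longrightarrow> closure {x. \<phi> x \<noteq> 0} \<subseteq> {c..d} \<Longrightarrow>
      (LINT x|lborel. F x * of_real (\<phi> x)) = (LINT x|lborel. G x * of_real (\<phi> x))"
  shows "AE x in lborel. x \<in> {c<..<d} \<longrightarrow> F x = G x"
proof -
  have lim: "(\<lambda>n. LINT x|lborel. H x * of_real (itest a d n x)) \<longlonglongrightarrow> (LINT x:{a<..<d}|lborel. H x)"
    if H: "set_integrable lborel {c..d} H" and a: "c \<le> a" for H :: "real \<Rightarrow> complex" and a
  proof -
    have H': "integrable lborel (\<lambda>x. indicator {c..d} x *\<^sub>R H x)" using H by (simp add: set_integrable_def)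
    have [measurable]: "(\<lambda>x. indicator {c..d} x *\<^sub>R H x) \<in> borel_measurable borel" using H' by auto
    have "(\<lambda>n. LINT x|lborel. (indicator {c..d} x *\<^sub>R H x) * of_real (itest a d n x)) \<longlonglongrightarrow>
       (LINT x|lborel. indicator {a<..<d} x *\<^sub>R (indicator {c..d} x *\<^sub>R H x))"
    proof (rule integral_dominated_convergence[where w="\<lambda>x. cmod (indicator {c..d} x *\<^sub>R H x)"])
      show "AE x in lborel. (\<lambda>n. (indicator {c..d} x *\<^sub>R H x) * of_real (itest a d n x)) \<longlonglongrightarrow> indicator {a<..<d} x *\<^sub>R (indicator {c..d} x *\<^sub>R H x)"
        unfolding scaleR_conv_of_real[of "indicator {a<..<d} _"] mult.commute[of "of_real (indicator {a<..<d} _)"]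
        by (intro AE_I2 tendsto_intros itest_tendsto)
      show "AE x in lborel. cmod ((indicator {c..d} x *\<^sub>R H x) * of_real (itest a d n x)) \<le> cmod (indicator {c..d} x *\<^sub>R H x)" for n
      proof (rule AE_I2)
        fix x
        have "\<bar>itest a d n x\<bar> \<le> 1" using itest_bounds[of a d n x] by (auto simp: indicator_def of_bool_def split: if_splits)
        then show "cmod ((indicator {c..d} x *\<^sub>R H x) * of_real (itest a d n x)) \<le> cmod (indicator {c..d} x *\<^sub>R H x)"
          by (simp add: norm_mult mult_left_le mult.assoc[symmetric])
      qed
      show "(\<lambda>x. indicator {a<..<d} x *\<^sub>R (indicator {c..d} x *\<^sub>R H x)) \<in> borel_measurable lborel"
        "\<And>n. (\<lambda>x. (indicator {c..d} x *\<^sub>R H x) * of_real (itest a d n x)) \<in> borel_measurable lborel"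
        by measurable
    qed (rule integrable_norm[OF H'])
    moreover have "(indicator {c..d} x *\<^sub>R H x) * of_real (itest a d n x) = H x * of_real (itest a d n x)" for x n
      using itest_bounds[of a d n x] a by (auto simp: indicator_def split: if_splits)
    moreover have "indicator {a<..<d} x *\<^sub>R (indicator {c..d} x *\<^sub>R H x) = indicator {a<..<d} x *\<^sub>R H x" for x
      using a by (auto simp: indicator_def)
    ultimately show ?thesis by (simp only: set_lebesgue_integral_def)
  qed
  have sub: "set_integrable lborel {a<..<d} H" if "set_integrable lborel {c..d} H" "c \<le> a" for H :: "real \<Rightarrow> complex" and a
    using that by (elim set_integrable_subset) auto
  have "AE x in lborel. x \<in> {c<..<d} \<longrightarrow> F x - G x = 0"
  proof (rule AE_zero_of_interval_integrals)
    show "set_integrable lborel {c<..<d} (\<lambda>x. F x - G x)"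
      using sub[OF F] sub[OF G] by (intro set_integral_diff) auto
    fix a assume a: "c \<le> a" "a < d"
    have "(LINT x|lborel. F x * of_real (itest a d n x)) = (LINT x|lborel. G x * of_real (itest a d n x))" for n
      using itest_support[of a d n] a by (intro eq test_itest) auto
    then have "(LINT x:{a<..<d}|lborel. F x) = (LINT x:{a<..<d}|lborel. G x)"
      using lim[OF F a(1)] lim[OF G a(1)] LIMSEQ_unique by simp
    then show "(LINT x:{a<..<d}|lborel. F x - G x) = 0"
      using sub[OF F a(1)] sub[OF G a(1)] by (simp add: set_integral_diff)
  qed
  then show ?thesis by simp
qed

section \<open>Differentiation and the Fourier transform\<close>

lemma fhat_inversion:
  assumes f: "integrable lborel f" and c: "continuous_on UNIV f" and b: "\<And>x. cmod (f x) \<le> M"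
    and h: "integrable lborel (fhat f)"
  shows "ift (fhat f) x = f x"
proof (rule LIMSEQ_unique)
  have [measurable]: "fhat f \<in> borel_measurable borel" using h by auto
  show "(\<lambda>n. LINT z|lborel. f (x + inverse (real (Suc n)) * z) * of_real (std_normal_density z)) \<longlonglongrightarrow> f x"
    by (rule gauss_average_tendsto[OF c b])
  have "(\<lambda>n. LINT y|lborel. fhat f y * of_real (exp (- (inverse (real (Suc n)) * y)\<^sup>2 / 2)) * cis (x * y))
      \<longlonglongrightarrow> (LINT y|lborel. fhat f y * of_real (exp (- (0 * y)\<^sup>2 / 2)) * cis (x * y))"
  proof (rule integral_dominated_convergence[where w="\<lambda>y. cmod (fhat f y)"])
    show "AE y in lborel. (\<lambda>n. fhat f y * of_real (exp (- (inverse (real (Suc n)) * y)\<^sup>2 / 2)) * cis (x * y))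
       \<longlonglongrightarrow> fhat f y * of_real (exp (- (0 * y)\<^sup>2 / 2)) * cis (x * y)"
      by (intro AE_I2 tendsto_intros LIMSEQ_inverse_real_of_nat) auto
  qed (use h in \<open>auto simp: norm_mult mult_left_le\<close>)
  then show "(\<lambda>n. LINT z|lborel. f (x + inverse (real (Suc n)) * z) * of_real (std_normal_density z)) \<longlonglongrightarrow> ift (fhat f) x"
    by (subst gauss_smoothing[OF f, symmetric]) (auto simp: ift_eq intro!: tendsto_intros)
qed

lemma has_vector_derivative_iff_LIM:
  fixes f :: "real \<Rightarrow> 'a::real_normed_vector"
  shows "(f has_vector_derivative f') (at x) \<longleftrightarrow> ((\<lambda>h. (f (x + h) - f x) /\<^sub>R h) \<longlongrightarrow> f') (at 0)"
proof -
  have "norm (f (x + h) - f x - h *\<^sub>R f') / norm h = norm ((f (x + h) - f x) /\<^sub>R h - f')" if "h \<noteq> 0" for h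
  proof -
    have "f (x + h) - f x - h *\<^sub>R f' = h *\<^sub>R ((f (x + h) - f x) /\<^sub>R h - f')"
      using that by (simp add: scaleR_diff_right)
    then show ?thesis using that by (simp only: norm_scaleR) simp
  qed
  then have "((\<lambda>h. norm (f (x + h) - f x - h *\<^sub>R f') / norm h) \<longlongrightarrow> 0) (at 0)
     \<longleftrightarrow> ((\<lambda>h. norm ((f (x + h) - f x) /\<^sub>R h - f')) \<longlongrightarrow> 0) (at 0)"
    by (intro Lim_cong_within) auto
  then show ?thesis
    by (simp add: has_vector_derivative_def has_derivative_at bounded_linear_scaleR_left tendsto_norm_zero_iff LIM_zero_iff)
qed

text \<open>Difference quotients of the character in \<open>x\<close> are bounded by
  \<open>\<bar>y\<bar>\<close> through \<open>cis_lipschitz\<close>, so the integrable function y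
  F(y) is the majorant.\<close>

lemma fhat_has_vector_derivative:
  assumes F: "integrable lborel F" and yF: "integrable lborel (\<lambda>y. of_real y * F y)"
  shows "(fhat F has_vector_derivative fhat (\<lambda>y. - \<i> * of_real y * F y) x) (at x)"
  unfolding has_vector_derivative_iff_LIM tendsto_at_iff_sequentially comp_def
proof safe
  fix X :: "nat \<Rightarrow> real" assume X: "\<forall>i. X i \<in> UNIV - {0}" "X \<longlonglongrightarrow> 0"
  have [measurable]: "F \<in> borel_measurable borel" using F by auto
  have "(\<lambda>n. LINT y|lborel. F y * ((cis (- ((x + X n) * y)) - cis (- (x * y))) /\<^sub>R X n)) \<longlonglongrightarrow>
      (LINT y|lborel. F y * (- \<i> * of_real y * cis (- (x * y))))"
  proof (rule integral_dominated_convergence[where w="\<lambda>y. cmod (of_real y * F y)"])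
    show "integrable lborel (\<lambda>y. cmod (of_real y * F y))" using yF by (rule integrable_norm)
    show "AE y in lborel. (\<lambda>n. F y * ((cis (- ((x + X n) * y)) - cis (- (x * y))) /\<^sub>R X n)) \<longlonglongrightarrow> F y * (- \<i> * of_real y * cis (- (x * y)))"
    proof (intro AE_I2 tendsto_mult tendsto_const)
      fix y
      have "((\<lambda>x. cis (- (x * y))) has_vector_derivative (- \<i> * of_real y * cis (- (x * y)))) (at x)"
        unfolding has_vector_derivative_complex_iff by (auto intro!: derivative_eq_intros)
      then show "(\<lambda>n. (cis (- ((x + X n) * y)) - cis (- (x * y))) /\<^sub>R X n) \<longlonglongrightarrow> (- \<i> * of_real y * cis (- (x * y)))"
        using X unfolding has_vector_derivative_iff_LIM tendsto_at_iff_sequentially comp_def by auto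
    qed
    show "AE y in lborel. cmod (F y * ((cis (- ((x + X n) * y)) - cis (- (x * y))) /\<^sub>R X n)) \<le> cmod (of_real y * F y)" for n
    proof (rule AE_I2)
      fix y
      have "cmod (cis (- ((x + X n) * y)) - cis (- (x * y))) \<le> \<bar>X n\<bar> * \<bar>y\<bar>"
        using cis_lipschitz[of "- ((x + X n) * y)" "- (x * y)"] by (simp add: algebra_simps abs_mult)
      moreover have "cmod ((cis (- ((x + X n) * y)) - cis (- (x * y))) /\<^sub>R X n)
          = cmod (cis (- ((x + X n) * y)) - cis (- (x * y))) / \<bar>X n\<bar>"
        unfolding norm_scaleR by (simp add: divide_inverse mult.commute)
      ultimately have "cmod ((cis (- ((x + X n) * y)) - cis (- (x * y))) /\<^sub>R X n) \<le> \<bar>y\<bar>"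
        using X(1) pos_divide_le_eq[of "\<bar>X n\<bar>"] by (simp add: mult.commute)
      from mult_left_mono[OF this, of "cmod (F y)"]
      show "cmod (F y * ((cis (- ((x + X n) * y)) - cis (- (x * y))) /\<^sub>R X n)) \<le> cmod (of_real y * F y)"
        unfolding norm_mult by (simp add: mult.commute)
    qed
  qed measurable
  moreover have "(LINT y|lborel. F y * ((cis (- ((x + X n) * y)) - cis (- (x * y))) /\<^sub>R X n)) / complex_of_real (sqrt (2 * pi))
     = (fhat F (x + X n) - fhat F x) /\<^sub>R X n" for n
  proof -
    have "F y * ((cis (- ((x + X n) * y)) - cis (- (x * y))) /\<^sub>R X n) = (F y * cis (- ((x + X n) * y)) - F y * cis (- (x * y))) /\<^sub>R X n" for y
      by (simp add: scaleR_conv_of_real algebra_simps)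
    then have "(LINT y|lborel. F y * ((cis (- ((x + X n) * y)) - cis (- (x * y))) /\<^sub>R X n))
       = (LINT y|lborel. F y * cis (- ((x + X n) * y)) - F y * cis (- (x * y))) /\<^sub>R X n"
      by (simp only: integral_scaleR_right)
    also have "(LINT y|lborel. F y * cis (- ((x + X n) * y)) - F y * cis (- (x * y)))
       = (LINT y|lborel. F y * cis (- ((x + X n) * y))) - (LINT y|lborel. F y * cis (- (x * y)))"
      by (intro Bochner_Integration.integral_diff integrable_cis F)
    finally show ?thesis
      unfolding fhat_def diff_divide_distrib[symmetric]
      by (simp only: scaleR_conv_of_real times_divide_eq_right)
  qed
  moreover have "(LINT y|lborel. F y * (- \<i> * of_real y * cis (- (x * y)))) / complex_of_real (sqrt (2 * pi)) = fhat (\<lambda>y. - \<i> * of_real y * F y) x"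
    unfolding fhat_def by (simp add: mult_ac)
  ultimately show "(\<lambda>n. (fhat F (x + X n) - fhat F x) /\<^sub>R X n) \<longlonglongrightarrow> fhat (\<lambda>y. - \<i> * of_real y * F y) x"
    using tendsto_divide[OF _ tendsto_const, of _ _ _ "complex_of_real (sqrt (2 * pi))"] by fastforce
qed

lemma ift_has_vector_derivative:
  assumes F: "integrable lborel F" and yF: "integrable lborel (\<lambda>y. of_real y * F y)"
  shows "(ift F has_vector_derivative ift (\<lambda>y. \<i> * of_real y * F y) x) (at x)"
proof -
  have "((fhat F \<circ> uminus) has_vector_derivative (- 1) *\<^sub>R fhat (\<lambda>y. - \<i> * of_real y * F y) (- x)) (at x)"
    by (rule vector_diff_chain_at[OF _ fhat_has_vector_derivative[OF F yF]]) (auto intro!: derivative_eq_intros)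
  moreover have "(- 1) *\<^sub>R fhat (\<lambda>y. - \<i> * of_real y * F y) (- x) = ift (\<lambda>y. \<i> * of_real y * F y) x"
    using fhat_cmult[of "-1" "\<lambda>y. - \<i> * of_real y * F y" "-x"] by (simp add: ift_def)
  ultimately show ?thesis by (simp add: ift_def[abs_def] comp_def)
qed

text \<open>Decay of \<open>k\<close> at infinity is not at hand, only integrability. Averaging k'
  over the translates by \<open>s\<close> in [0,1] leaves its integral unchanged, while Fubini and
  the fundamental theorem turn the average into the integral of \<open>k (x + 1) - k x\<close>,
  which is zero by translation invariance.\<close>

lemma integral_derivative_zero:
  fixes k k' :: "real \<Rightarrow> complex"
  assumes d: "\<And>x. (k has_vector_derivative k' x) (at x)" and c: "continuous_on UNIV k'"
    and k: "integrable lborel k" and k': "integrable lborel k'"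
  shows "(LINT x|lborel. k' x) = 0"
proof -
  have [measurable]: "k' \<in> borel_measurable borel" using k' by auto
  define f where "f = (\<lambda>s x. indicator {0..1} s *\<^sub>R k' (x + s))"
  have sh: "integrable lborel (\<lambda>x. k' (x + s))" for s
    using lborel_integrable_real_affine[OF k', of 1 s] by (simp add: add.commute)
  have shi: "(LINT x|lborel. k' (x + s)) = (LINT x|lborel. k' x)" "(LINT x|lborel. cmod (k' (x + s))) = (LINT x|lborel. cmod (k' x))" for s
    using lborel_integral_real_affine[of 1 k' s] lborel_integral_real_affine[of 1 "\<lambda>x. cmod (k' x)" s] by (simp_all add: add.commute)
  have i: "integrable (lborel \<Otimes>\<^sub>M lborel) (case_prod f)"
  proof (rule lborel_pair.Fubini_integrable)
    show "case_prod f \<in> borel_measurable (lborel \<Otimes>\<^sub>M lborel)" unfolding f_def by measurable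
    have "(LINT x|lborel. norm (case (s, x) of (s, x) \<Rightarrow> f s x)) = indicator {0..1} s *\<^sub>R (LINT x|lborel. cmod (k' x))" for s
      unfolding f_def by (simp add: shi)
    then show "integrable lborel (\<lambda>s. LINT x|lborel. norm (case (s, x) of (s, x) \<Rightarrow> f s x))" by simp
    show "AE s in lborel. integrable lborel (\<lambda>x. case (s, x) of (s, x) \<Rightarrow> f s x)"
      unfolding f_def using sh by auto
  qed
  have "(LINT s|lborel. LINT x|lborel. f s x) = (LINT x|lborel. LINT s|lborel. f s x)"
    using lborel_pair.Fubini_integral[of f] i by simp
  moreover have "(LINT x|lborel. f s x) = indicator {0..1} s *\<^sub>R (LINT x|lborel. k' x)" for s
    unfolding f_def using shi by simp
  moreover have "(LINT s|lborel. f s x) = k (x + 1) - k x" for x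
  proof -
    have "(LINT s|lborel. indicator {0..1} s *\<^sub>R k' (x + s)) = (k \<circ> (\<lambda>s. x + s)) 1 - (k \<circ> (\<lambda>s. x + s)) 0"
    proof (rule integral_FTC_atLeastAtMost)
      fix s :: real
      have "((k \<circ> (\<lambda>s. x + s)) has_vector_derivative 1 *\<^sub>R k' (x + s)) (at s)"
        by (rule vector_diff_chain_at[OF _ d]) (auto intro!: derivative_eq_intros)
      then show "((k \<circ> (\<lambda>s. x + s)) has_vector_derivative k' (x + s)) (at s within {0..1})"
        by (auto intro: has_vector_derivative_at_within)
    qed (auto intro!: continuous_on_compose2[OF c] continuous_intros)
    then show ?thesis by (simp add: f_def)
  qed
  moreover have "(LINT x|lborel. k (x + 1) - k x) = 0"
    using lborel_integrable_real_affine[OF k, of 1 1] lborel_integral_real_affine[of 1 k 1] k by (simp add: add.commute)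
  ultimately show ?thesis by simp
qed

lemma integral_by_parts_L1:
  fixes f g :: "real \<Rightarrow> complex"
  assumes f: "\<And>x. (f has_vector_derivative f' x) (at x)" "continuous_on UNIV f'"
    and g: "\<And>x. (g has_vector_derivative g' x) (at x)" "continuous_on UNIV g'"
    and i: "integrable lborel (\<lambda>x. f x * g x)" "integrable lborel (\<lambda>x. f' x * g x)" "integrable lborel (\<lambda>x. f x * g' x)"
  shows "(LINT x|lborel. f' x * g x) = - (LINT x|lborel. f x * g' x)"
proof -
  have cf: "continuous_on UNIV f" "continuous_on UNIV g"
    using has_vector_derivative_continuous[OF f(1)] has_vector_derivative_continuous[OF g(1)]
    by (simp_all add: continuous_at_imp_continuous_on)
  have "(LINT x|lborel. f x * g' x + f' x * g x) = 0"
    by (rule integral_derivative_zero[OF has_vector_derivative_mult[OF f(1) g(1)]])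
      (intro continuous_intros cf f g i Bochner_Integration.integrable_add)+
  then show ?thesis using i by (simp add: add_eq_0_iff)
qed

section \<open>Weighted norms\<close>

text \<open>The weight belongs to squared norms: \<open>Q r\<close> is the squared norm of order
  \<open>r\<close>, and \<open>wt r\<close> is the Japanese bracket to the power 2 r.\<close>

definition wt :: "real \<Rightarrow> real \<Rightarrow> real" where
  "wt r x = (1 + x\<^sup>2) powr r"

definition Q :: "real \<Rightarrow> (real \<Rightarrow> complex) \<Rightarrow> ennreal" where
  "Q r F = (\<integral>\<^sup>+x. ennreal (wt r x) * ennreal ((cmod (F x))\<^sup>2) \<partial>lborel)"

lemma one_plus_sq_pos: "0 < 1 + (x::real)\<^sup>2" by (simp add: add_pos_nonneg)

lemma wt_pos [simp]: "0 < wt r x" "0 \<le> wt r x" "wt r x \<noteq> 0"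
  using one_plus_sq_pos[of x] by (auto simp: wt_def less_imp_le)

lemma wt_add: "wt (r + r') x = wt r x * wt r' x" by (simp add: wt_def powr_add)

lemma wt_0 [simp]: "wt 0 x = 1" using one_plus_sq_pos[of x] by (simp add: wt_def)

lemma wt_1 [simp]: "wt 1 x = 1 + x\<^sup>2" using one_plus_sq_pos[of x] by (simp add: wt_def)

lemma wt_minus: "wt (- r) x = 1 / wt r x" by (simp add: wt_def powr_minus_divide)

lemma wt_mono: "r \<le> r' \<Longrightarrow> wt r x \<le> wt r' x" by (simp add: wt_def powr_mono)

lemma wt_measurable [measurable]: "wt r \<in> borel_measurable borel"
  unfolding wt_def[abs_def] by measurable

lemma continuous_wt [continuous_intros]: "continuous_on A (wt r)"
  unfolding wt_def[abs_def]
  by (intro continuous_on_powr' continuous_intros) (auto simp: less_imp_le one_plus_sq_pos add_nonneg_eq_0_iff)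

lemma Q_0: "Q 0 F = sqn F" by (simp add: Q_def sqn_def)

lemma Q_mono: "r \<le> r' \<Longrightarrow> Q r F \<le> Q r' F"
  unfolding Q_def by (intro nn_integral_mono mult_right_mono ennreal_leI wt_mono) auto

lemma Q_cong_AE: "AE x in lborel. F x = G x \<Longrightarrow> Q r F = Q r G"
  unfolding Q_def by (intro nn_integral_cong_AE) auto

lemma Q_add:
  assumes "F \<in> borel_measurable borel" "G \<in> borel_measurable borel"
  shows "Q r (\<lambda>x. F x + G x) \<le> 2 * Q r F + 2 * Q r G"
  unfolding Q_def by (rule sqn_weighted_add) (use assms in auto)

lemma Q_cmult: "F \<in> borel_measurable borel \<Longrightarrow> Q r (\<lambda>x. c * F x) = ennreal ((cmod c)\<^sup>2) * Q r F"
  unfolding Q_def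
  by (subst nn_integral_cmult[symmetric]) (auto simp: norm_mult power_mult_distrib ennreal_mult' mult_ac intro!: nn_integral_cong)

lemma Q_L2: "F \<in> borel_measurable borel \<Longrightarrow> r \<ge> 0 \<Longrightarrow> Q r F < \<infinity> \<Longrightarrow> L2 F"
  using Q_mono[of 0 r F] by (auto simp: L2_def Q_0)

text \<open>\<open>wt (r + 1)\<close> is \<open>wt r\<close> plus \<open>wt r\<close> times x^2, and
  \<open>\<i> * x\<close> is the symbol of differentiation. Through \<open>Sq_Suc\<close> this
  becomes the device by which regularity is raised one derivative at a time.\<close>

lemma Q_Suc:
  assumes [measurable]: "F \<in> borel_measurable borel"
  shows "Q (r + 1) F = Q r F + Q r (\<lambda>x. \<i> * of_real x * F x)"
  unfolding Q_def
proof (subst nn_integral_add[symmetric], measurable, intro nn_integral_cong)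
  fix x
  have e: "wt (r + 1) x * (cmod (F x))\<^sup>2 = wt r x * (cmod (F x))\<^sup>2 + wt r x * (cmod (\<i> * of_real x * F x))\<^sup>2"
    by (simp add: wt_add norm_mult power_mult_distrib algebra_simps)
  show "ennreal (wt (r + 1) x) * ennreal ((cmod (F x))\<^sup>2)
     = ennreal (wt r x) * ennreal ((cmod (F x))\<^sup>2) + ennreal (wt r x) * ennreal ((cmod (\<i> * of_real x * F x))\<^sup>2)"
    unfolding ennreal_mult'[symmetric, OF wt_pos(2)] e by (rule ennreal_plus) auto
qed

lemma nn_integral_wt_neg_finite:
  assumes "r > 1/2"
  shows "(\<integral>\<^sup>+x. ennreal (wt (- r) x) \<partial>lborel) < \<infinity>"
proof -
  have i: "integrable lborel (\<lambda>x. indicator {1..} x * x powr (-2 * r))"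
  proof -
    have "((\<lambda>x. x powr (-2 * r)) has_integral (-(1 powr (-2 * r + 1)) / (-2 * r + 1))) {1..}"
      using assms by (intro has_integral_powr_to_inf) auto
    then have "(\<lambda>x. x powr (-2 * r)) absolutely_integrable_on {1..}"
      by (intro nonnegative_absolutely_integrable_1) (auto simp: integrable_on_def)
    then have "set_integrable lebesgue {1..} (\<lambda>x. x powr (-2 * r))" .
    then have "integrable lebesgue (\<lambda>x. indicator {1..} x * x powr (-2 * r))" by (simp add: set_integrable_def)
    then show ?thesis by (subst (asm) integrable_completion) auto
  qed
  have i': "integrable lborel (\<lambda>x. indicator {..-1} x * (-x) powr (-2 * r))"
  proof -
    have "integrable lborel (\<lambda>x. indicator {1..} (0 + (-1) * x) * (0 + (-1) * x) powr (-2 * r))"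
      by (rule lborel_integrable_real_affine[OF i]) simp
    moreover have "indicator {1..} (0 + (-1) * x) = (indicator {..-1} x :: real)" for x :: real by (auto simp: indicator_def)
    ultimately show ?thesis by simp
  qed
  define k where "k = (\<lambda>x. indicator {-1..1} x + indicator {1..} x * x powr (-2 * r) + indicator {..-1} x * (-x) powr (-2 * r) :: real)"
  have k: "integrable lborel k" unfolding k_def
    by (intro Bochner_Integration.integrable_add i i') simp
  have "wt (- r) x \<le> k x" for x
  proof -
    have *: "(1 + x\<^sup>2) powr (- r) \<le> y powr (-2 * r)" if "y = \<bar>x\<bar>" "y \<ge> 1" for y
    proof -
      have "y powr (-2 * r) = (y\<^sup>2) powr (- r)" using that powr_powr[of y 2 "-r"] by (simp add: powr_numeral)
      moreover have "(1 + x\<^sup>2) powr (- r) \<le> (y\<^sup>2) powr (- r)"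
        using that assms by (intro powr_mono2') auto
      ultimately show ?thesis by simp
    qed
    have 1: "wt (- r) x \<le> 1" using wt_mono[of "-r" 0 x] assms by simp
    consider "x \<ge> 1" | "x \<le> -1" | "\<bar>x\<bar> < 1" by linarith
    then show ?thesis
    proof cases
      case 1
      then show ?thesis using *[of x] by (auto simp: k_def wt_def indicator_def)
    next
      case 2
      then show ?thesis using *[of "-x"] by (auto simp: k_def wt_def indicator_def)
    next
      case 3
      then show ?thesis using 1 by (auto simp: k_def indicator_def)
    qed
  qed
  then have "(\<integral>\<^sup>+x. ennreal (wt (- r) x) \<partial>lborel) \<le> (\<integral>\<^sup>+x. ennreal (norm (k x)) \<partial>lborel)"
    by (intro nn_integral_mono ennreal_leI) (simp add: order_trans[OF _ abs_ge_self])
  also have "\<dots> < \<infinity>" using k by (simp add: integrable_iff_bounded)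
  finally show ?thesis .
qed

text \<open>Cauchy-Schwarz after writing 1 as \<open>wt (- r / 2) x * wt (r / 2) x\<close>. As the
  first factor on the right is finite for r > 1/2, this is the Sobolev embedding: the transform is
  integrable, so the function is continuous and bounded.\<close>

lemma Q_embed_L1:
  assumes [measurable]: "F \<in> borel_measurable borel"
  shows "(\<integral>\<^sup>+x. ennreal (cmod (F x)) \<partial>lborel)\<^sup>2 \<le> (\<integral>\<^sup>+x. ennreal (wt (- r) x) \<partial>lborel) * Q r F"
proof -
  have "(\<integral>\<^sup>+x. ennreal (cmod (F x)) \<partial>lborel) = (\<integral>\<^sup>+x. ennreal (wt (- r / 2) x) * ennreal (wt (r / 2) x * cmod (F x)) \<partial>lborel)"
  proof (intro nn_integral_cong)
    fix x
    have "wt (- r / 2) x * (wt (r / 2) x * cmod (F x)) = cmod (F x)"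
      using wt_add[of "-r/2" "r/2" x] by simp
    then show "ennreal (cmod (F x)) = ennreal (wt (- r / 2) x) * ennreal (wt (r / 2) x * cmod (F x))"
      by (metis ennreal_mult' wt_pos(2))
  qed
  also have "(\<dots>)\<^sup>2 \<le> (\<integral>\<^sup>+x. (ennreal (wt (- r / 2) x))\<^sup>2 \<partial>lborel) * (\<integral>\<^sup>+x. (ennreal (wt (r / 2) x * cmod (F x)))\<^sup>2 \<partial>lborel)"
    by (rule Cauchy_Schwarz_nn_integral) auto
  also have "(\<integral>\<^sup>+x. (ennreal (wt (- r / 2) x))\<^sup>2 \<partial>lborel) = (\<integral>\<^sup>+x. ennreal (wt (- r) x) \<partial>lborel)"
    using wt_add[of "-r/2" "-r/2"] by (simp add: ennreal_power power2_eq_square ennreal_mult')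
  also have "(\<integral>\<^sup>+x. (ennreal (wt (r / 2) x * cmod (F x)))\<^sup>2 \<partial>lborel) = Q r F"
    unfolding Q_def
  proof (intro nn_integral_cong)
    fix x
    have "(wt (r / 2) x * cmod (F x))\<^sup>2 = wt r x * (cmod (F x))\<^sup>2"
      using wt_add[of "r/2" "r/2" x] by (simp add: power_mult_distrib power2_eq_square)
    moreover have "(ennreal (wt (r / 2) x * cmod (F x)))\<^sup>2 = ennreal ((wt (r / 2) x * cmod (F x))\<^sup>2)"
      by (rule ennreal_power) simp
    ultimately show "(ennreal (wt (r / 2) x * cmod (F x)))\<^sup>2 = ennreal (wt r x) * ennreal ((cmod (F x))\<^sup>2)"
      using ennreal_mult'[of "wt r x" "(cmod (F x))\<^sup>2"] by simp
  qed
  finally show ?thesis .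
qed

lemma Q_integrable:
  assumes [measurable]: "F \<in> borel_measurable borel" and r: "r > 1/2" and fin: "Q r F < \<infinity>"
  shows "integrable lborel F"
proof (rule integrableI_bounded)
  have "(\<integral>\<^sup>+x. ennreal (cmod (F x)) \<partial>lborel)\<^sup>2 < \<infinity>"
    using nn_integral_wt_neg_finite[OF r] fin
    by (intro le_less_trans[OF Q_embed_L1[of F r]]) (auto simp: ennreal_mult_less_top)
  then show "(\<integral>\<^sup>+x. ennreal (cmod (F x)) \<partial>lborel) < \<infinity>" by (simp add: power_less_top_ennreal)
qed simp

lemma L2_interval_integrable:
  assumes "L2 F" shows "set_integrable lborel {c..d::real} F"
proof -
  have "L2 (\<lambda>x. complex_of_real (indicator {c..d} x))"
  proof (rule L2_of_bounded_integrable)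
    show "integrable lborel (\<lambda>x. complex_of_real (indicator {c..d} x))"
      by (intro integrable_of_real integrable_real_indicator) (simp_all add: emeasure_lborel_Icc_eq)
    show "cmod (complex_of_real (indicator {c..d} x)) \<le> 1" for x by (simp add: indicator_def)
  qed
  from L2_C_S(1)[OF this assms] show ?thesis by (simp add: set_integrable_def scaleR_conv_of_real)
qed

lemma AE_unique_UNIV:
  fixes F G :: "real \<Rightarrow> complex"
  assumes "\<And>c d. set_integrable lborel {c..d} F" "\<And>c d. set_integrable lborel {c..d} G"
    and eq: "\<And>\<phi>. test_function \<phi> \<Longrightarrow> (LINT x|lborel. F x * of_real (\<phi> x)) = (LINT x|lborel. G x * of_real (\<phi> x))"
  shows "AE x in lborel. F x = G x"
proof -
  have "AE x in lborel. x \<in> {- real n<..<real n} \<longrightarrow> F x = G x" for n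
    by (rule AE_unique_of_tests) (use assms in auto)
  then have "AE x in lborel. \<forall>n. x \<in> {- real n<..<real n} \<longrightarrow> F x = G x" by (intro AE_all_countable[THEN iffD2] allI)
  then show ?thesis
  proof eventually_elim
    fix x assume *: "\<forall>n. x \<in> {- real n<..<real n} \<longrightarrow> F x = G x"
    obtain n where "\<bar>x\<bar> < real n" using reals_Archimedean2 by blast
    then show "F x = G x" using * by (auto simp: abs_less_iff minus_less_iff)
  qed
qed

text \<open>The punctured line is exhausted by the intervals from \<open>inverse (Suc n)\<close> to
  \<open>n\<close> and their mirror images, none of which touches the origin; the origin itself is a
  null set.\<close>

lemma AE_unique_off_zero:
  fixes F G :: "real \<Rightarrow> complex"
  assumes "\<And>c d. 0 \<notin> {c..d} \<Longrightarrow> set_integrable lborel {c..d} F" "\<And>c d. 0 \<notin> {c..d} \<Longrightarrow> set_integrable lborel {c..d} G"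
    and eq: "\<And>\<phi>. test_function \<phi> \<Longrightarrow> closure {x. \<phi> x \<noteq> 0} \<subseteq> - {0} \<Longrightarrow>
      (LINT x|lborel. F x * of_real (\<phi> x)) = (LINT x|lborel. G x * of_real (\<phi> x))"
  shows "AE x in lborel. F x = G x"
proof -
  have *: "AE x in lborel. x \<in> {c<..<d} \<longrightarrow> F x = G x" if "0 \<notin> {c..d}" for c d :: real
    using that by (intro AE_unique_of_tests assms) auto
  have "AE x in lborel. \<forall>n. (x \<in> {inverse (real (Suc n))<..<real n} \<longrightarrow> F x = G x) \<and> (x \<in> {-real n<..<-inverse (real (Suc n))} \<longrightarrow> F x = G x)"
    unfolding AE_all_countable by (intro allI AE_conjI *) (auto simp: not_le)
  moreover have "AE x in lborel. x \<noteq> (0::real)" by (rule AE_lborel_singleton)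
  ultimately show ?thesis
  proof eventually_elim
    fix x :: real assume *: "\<forall>n. (x \<in> {inverse (real (Suc n))<..<real n} \<longrightarrow> F x = G x) \<and> (x \<in> {-real n<..<-inverse (real (Suc n))} \<longrightarrow> F x = G x)" and "x \<noteq> 0"
    obtain m where m: "inverse (real (Suc m)) < \<bar>x\<bar>" using reals_Archimedean[of "\<bar>x\<bar>"] \<open>x \<noteq> 0\<close> by auto
    obtain n where n: "\<bar>x\<bar> < real n" using reals_Archimedean2 by blast
    define k where "k = max m n"
    have "inverse (real (Suc k)) \<le> inverse (real (Suc m))" by (intro le_imp_inverse_le) (auto simp: k_def)
    then have k: "inverse (real (Suc k)) < \<bar>x\<bar>" using m by linarith
    have "real n \<le> real k" by (simp add: k_def)
    then have k': "\<bar>x\<bar> < real k" using n by linarith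
    show "F x = G x"
    proof (cases "x > 0")
      case True
      then have "x \<in> {inverse (real (Suc k))<..<real k}" using k k' by (simp del: of_nat_Suc)
      then show ?thesis using *[THEN spec, of k] by blast
    next
      case False
      then have "x \<in> {-real k<..<-inverse (real (Suc k))}" using k k' by (simp del: of_nat_Suc)
      then show ?thesis using *[THEN spec, of k] by blast
    qed
  qed
qed

lemma test_function_props:
  assumes "test_function \<phi>"
  shows "\<And>x. (\<phi> has_real_derivative deriv \<phi> x) (at x)" "continuous_on UNIV \<phi>" "continuous_on UNIV (deriv \<phi>)"
    "\<exists>R. \<forall>x. \<bar>x\<bar> \<ge> R \<longrightarrow> \<phi> x = 0 \<and> deriv \<phi> x = 0"
proof -
  have s: "\<And>n x. ((deriv ^^ n) \<phi>) field_differentiable (at x)" and c: "compact (closure {x. \<phi> x \<noteq> 0})"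
    using assms by (auto simp: test_function_def)
  show d: "(\<phi> has_real_derivative deriv \<phi> x) (at x)" for x
    using s[of 0 x] by (simp add: field_differentiable_derivI)
  show "continuous_on UNIV \<phi>" using s[of 0] by (simp add: continuous_at_imp_continuous_on field_differentiable_imp_continuous_at)
  show "continuous_on UNIV (deriv \<phi>)" using s[of 1] by (simp add: continuous_at_imp_continuous_on field_differentiable_imp_continuous_at)
  obtain B where B: "\<And>x. x \<in> closure {x. \<phi> x \<noteq> 0} \<Longrightarrow> \<bar>x\<bar> \<le> B"
    using compact_imp_bounded[OF c] by (auto simp: bounded_iff)
  have z: "\<phi> x = 0" if "\<bar>x\<bar> > B" for x
  proof (rule ccontr)
    assume "\<phi> x \<noteq> 0"
    then have "x \<in> closure {x. \<phi> x \<noteq> 0}" by (intro subsetD[OF closure_subset]) simp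
    then show False using B[of x] that by simp
  qed
  have "deriv \<phi> x = 0" if "\<bar>x\<bar> > B" for x
  proof -
    have "(\<phi> has_real_derivative 0) (at x)"
      by (rule has_field_derivative_transform_within_open[of "\<lambda>_. 0" _ _ "{x. \<bar>x\<bar> > B}"])
        (use that z in \<open>auto intro!: open_Collect_less continuous_intros\<close>)
    then show ?thesis by (rule DERIV_imp_deriv)
  qed
  with z show "\<exists>R. \<forall>x. \<bar>x\<bar> \<ge> R \<longrightarrow> \<phi> x = 0 \<and> deriv \<phi> x = 0"
    by (intro exI[of _ "B + 1"]) auto
qed

text \<open>One classical derivative puts the transform into the weighted space of order 1, which
  exceeds 1/2, so the transform is integrable and inversion becomes available. It is stated for
  \<open>C\<^sup>1\<close> functions of compact support since it is applied later to the quotient of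
  a test function by its variable.\<close>

lemma fhat_deriv_compact:
  fixes h :: "real \<Rightarrow> real"
  assumes d: "\<And>x. (h has_real_derivative h' x) (at x)" and c: "continuous_on UNIV h'"
    and z: "\<And>x. \<bar>x\<bar> \<ge> R \<Longrightarrow> h x = 0" "\<And>x. \<bar>x\<bar> \<ge> R \<Longrightarrow> h' x = 0"
  shows "integrable lborel (\<lambda>x. complex_of_real (h x))" "L2 (\<lambda>x. complex_of_real (h x))"
    "integrable lborel (fhat (\<lambda>x. complex_of_real (h x)))"
    "continuous_on UNIV h" "\<exists>M. \<forall>x. cmod (complex_of_real (h x)) \<le> M"
proof -
  let ?f = "\<lambda>x. complex_of_real (h x)" and ?f' = "\<lambda>x. complex_of_real (h' x)"
  show c0: "continuous_on UNIV h" using d by (intro continuous_at_imp_continuous_on ballI DERIV_isCont)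
  then have cc: "continuous_on UNIV ?f" "continuous_on UNIV ?f'" using c by (auto intro!: continuous_intros)
  show i: "integrable lborel ?f" and bd: "\<exists>M. \<forall>x. cmod (?f x) \<le> M" using integrable_compact_support[OF cc(1), of R] z by auto
  have i': "integrable lborel ?f'" and bd': "\<exists>M. \<forall>x. cmod (?f' x) \<le> M" using integrable_compact_support[OF cc(2), of R] z by auto
  show L: "L2 ?f" using L2_of_bounded_integrable[OF i] bd by blast
  have L': "L2 ?f'" using L2_of_bounded_integrable[OF i'] bd' by blast
  have vd: "(?f has_vector_derivative ?f' x) (at x)" for x using d by (rule has_vector_derivative_of_real)
  have fd: "fhat ?f' x = \<i> * of_real x * fhat ?f x" for x
  proof -
    have vc: "((\<lambda>y. cis (- (x * y))) has_vector_derivative (- \<i> * of_real x * cis (- (x * y)))) (at y)" for y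
      unfolding has_vector_derivative_complex_iff by (auto intro!: derivative_eq_intros)
    have e: "?f y * (- \<i> * of_real x * cis (- (x * y))) = (- \<i> * of_real x) * (?f y * cis (- (x * y)))" for y by simp
    have "(LINT y|lborel. ?f' y * cis (- (x * y))) = - (LINT y|lborel. ?f y * (- \<i> * of_real x * cis (- (x * y))))"
      unfolding e
    proof (rule integral_by_parts_L1[OF vd cc(2) vc, unfolded e])
      show "continuous_on UNIV (\<lambda>y. - \<i> * of_real x * cis (- (x * y)))" by (intro continuous_intros)
      show "integrable lborel (\<lambda>y. - \<i> * of_real x * (?f y * cis (- (x * y))))"
        by (intro integrable_mult_right integrable_cis i)
    qed (intro integrable_cis i i')+
    also have "\<dots> = \<i> * of_real x * (LINT y|lborel. ?f y * cis (- (x * y)))"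
      unfolding e by (subst integral_mult_right_zero) simp
    finally show ?thesis by (simp add: fhat_def)
  qed
  have "Q 1 (fhat ?f) = Q 0 (fhat ?f) + Q 0 (\<lambda>x. \<i> * of_real x * fhat ?f x)" using Q_Suc[of "fhat ?f" 0] i by simp
  also have "\<dots> = sqn (fhat ?f) + sqn (fhat ?f')" using ext[of "fhat ?f'", OF fd] by (simp only: Q_0)
  also have "\<dots> < \<infinity>" using L2_fhat[OF i L] L2_fhat[OF i' L'] by (simp add: L2_def)
  finally show "integrable lborel (fhat ?f)" using i by (intro Q_integrable[of _ 1]) auto
qed

lemma test_function_transform:
  assumes "test_function \<phi>"
  shows "integrable lborel (\<lambda>x. complex_of_real (\<phi> x))" "L2 (\<lambda>x. complex_of_real (\<phi> x))"
    "integrable lborel (fhat (\<lambda>x. complex_of_real (\<phi> x)))"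
    "ift (fhat (\<lambda>x. complex_of_real (\<phi> x))) x = of_real (\<phi> x)"
    "integrable lborel (\<lambda>x. of_real x * complex_of_real (\<phi> x))" "L2 (\<lambda>x. of_real x * complex_of_real (\<phi> x))"
proof -
  obtain R where R: "\<And>x. \<bar>x\<bar> \<ge> R \<Longrightarrow> \<phi> x = 0" "\<And>x. \<bar>x\<bar> \<ge> R \<Longrightarrow> deriv \<phi> x = 0"
    using test_function_props(4)[OF assms] by blast
  note * = fhat_deriv_compact[OF test_function_props(1)[OF assms] test_function_props(3)[OF assms] R]
  show i: "integrable lborel (\<lambda>x. complex_of_real (\<phi> x))" "L2 (\<lambda>x. complex_of_real (\<phi> x))"
    "integrable lborel (fhat (\<lambda>x. complex_of_real (\<phi> x)))" using * by simp_all
  obtain M where "\<And>x. cmod (complex_of_real (\<phi> x)) \<le> M" using *(5) by blast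
  moreover have cc: "continuous_on UNIV (\<lambda>x. complex_of_real (\<phi> x))" using *(4) by (intro continuous_intros)
  ultimately show "ift (fhat (\<lambda>x. complex_of_real (\<phi> x))) x = of_real (\<phi> x)"
    by (intro fhat_inversion[OF i(1) _ _ i(3)])
  have ci: "continuous_on UNIV (\<lambda>x. of_real x * complex_of_real (\<phi> x))" by (intro continuous_intros cc)
  have "integrable lborel (\<lambda>x. of_real x * complex_of_real (\<phi> x))" "\<exists>M. \<forall>x. cmod (of_real x * complex_of_real (\<phi> x)) \<le> M"
    by (rule integrable_compact_support[OF ci, of R]; simp add: R)+
  then show "integrable lborel (\<lambda>x. of_real x * complex_of_real (\<phi> x))" "L2 (\<lambda>x. of_real x * complex_of_real (\<phi> x))"
    using L2_of_bounded_integrable by blast+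
qed

section \<open>Calculus of the Plancherel transform: uniqueness, inversion, derivatives\<close>

lemma ft_L2: "ft f F \<Longrightarrow> L2 f" "ft f F \<Longrightarrow> L2 F"
  by (simp_all add: ft_def)

lemma ft_test: "ft f F \<Longrightarrow> test_function \<phi> \<Longrightarrow> (LINT x|lborel. f x * fhat (\<lambda>x. of_real (\<phi> x)) x) = (LINT y|lborel. F y * of_real (\<phi> y))"
  using test_function_transform(1,2)[of \<phi>] by (simp add: ft_def)

lemma ft_unique_test:
  assumes F: "ft f F" and G: "\<And>c d. set_integrable lborel {c..d} G"
    and eq: "\<And>\<phi>. test_function \<phi> \<Longrightarrow> (LINT x|lborel. f x * fhat (\<lambda>x. of_real (\<phi> x)) x) = (LINT y|lborel. G y * of_real (\<phi> y))"
  shows "AE x in lborel. F x = G x"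
  by (rule AE_unique_UNIV[OF L2_interval_integrable[OF ft_L2(2)[OF F]] G]) (simp add: eq[symmetric] ft_test[OF F])

lemma ft_unique: "ft f F \<Longrightarrow> ft f G \<Longrightarrow> AE x in lborel. F x = G x"
  by (rule ft_unique_test[of f F]) (simp_all add: ft_test[of f G] ft_L2[of f G] L2_interval_integrable)

lemma sqn_cong_AE: "AE x in lborel. F x = G x \<Longrightarrow> sqn F = sqn G"
  using Q_cong_AE[of F G 0] by (simp add: Q_0)

lemma ft_cong_AE:
  assumes "ft f F" and eq: "AE x in lborel. F x = G x" and [measurable]: "G \<in> borel_measurable borel"
  shows "ft f G"
proof -
  have [measurable]: "F \<in> borel_measurable borel" using assms by (auto simp: ft_def L2_def)
  have "L2 G" using sqn_cong_AE[OF eq] assms by (auto simp: ft_def L2_def)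
  moreover have "(LINT y|lborel. F y * \<psi> y) = (LINT y|lborel. G y * \<psi> y)" if "integrable lborel \<psi>" for \<psi>
    using eq that by (intro integral_cong_AE) auto
  ultimately show ?thesis using assms by (auto simp: ft_def)
qed

lemma ft_Plancherel:
  assumes "continuous_on UNIV f" "ft f F" shows "sqn F = sqn f"
  using ft_exists[OF assms(1) ft_L2(1)[OF assms(2)]] ft_unique[OF assms(2)] sqn_cong_AE by metis

lemma ft_add:
  assumes "ft f F" "ft g G" shows "ft (\<lambda>x. f x + g x) (\<lambda>x. F x + G x)"
  using assms unfolding ft_def
  by (auto simp: L2_add distrib_right L2_C_S L2_fhat)

lemma ft_cmult:
  assumes "ft f F" shows "ft (\<lambda>x. c * f x) (\<lambda>x. c * F x)"
  using assms unfolding ft_def by (auto simp: L2_cmult mult.assoc)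

lemma ft_diff:
  assumes "ft f F" "ft g G" shows "ft (\<lambda>x. f x - g x) (\<lambda>x. F x - G x)"
  using ft_add[OF assms(1) ft_cmult[OF assms(2), of "-1"]] by simp

text \<open>A transform of \<open>ift F\<close> exists by continuity. It is identified with
  \<open>F\<close> by pairing with a test function \<phi>, which inversion recovers as
  \<open>ift (fhat \<phi>)\<close>.\<close>

lemma ft_ift:
  assumes F: "integrable lborel F" "L2 F"
  shows "ft (ift F) F"
proof -
  obtain F' where F': "ft (ift F) F'" using ft_exists[OF continuous_ift[OF F(1)] L2_ift[OF F]] by blast
  have "AE x in lborel. F' x = F x"
  proof (rule ft_unique_test[OF F' L2_interval_integrable[OF F(2)]])
    fix \<phi> assume "test_function \<phi>"
    note * = test_function_transform[OF this]
    show "(LINT x|lborel. ift F x * fhat (\<lambda>x. of_real (\<phi> x)) x) = (LINT y|lborel. F y * of_real (\<phi> y))"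
      using ift_multiplication[OF F(1) *(3)] by (simp add: *(4))
  qed
  then show ?thesis by (rule ft_cong_AE[OF F']) (use F in auto)
qed

lemma continuous_AE_eq:
  fixes f g :: "real \<Rightarrow> complex"
  assumes "continuous_on UNIV f" "continuous_on UNIV g" and ae: "AE x in lborel. f x = g x"
  shows "f x = g x"
proof (rule ccontr)
  assume "f x \<noteq> g x"
  have "open {x. f x \<noteq> g x}" using assms by (intro open_Collect_neq) auto
  then obtain e where e: "e > 0" "ball x e \<subseteq> {x. f x \<noteq> g x}" using \<open>f x \<noteq> g x\<close> unfolding open_contains_ball by blast
  have "AE y in lborel. y \<notin> ball x e" using ae by eventually_elim (use e in auto)
  then have "emeasure lborel (ball x e) = 0"
    by (subst (asm) AE_iff_measurable[of "ball x e"]) (auto simp: ball_def)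
  moreover have "ball x e = {x - e<..<x + e}" by (auto simp: dist_real_def)
  ultimately show False using e by simp
qed

text \<open>The difference of the two sides is continuous with transform zero, so it vanishes almost
  everywhere by Plancherel and then everywhere by continuity.\<close>

lemma ft_integrable_ift:
  assumes c: "continuous_on UNIV f" and f: "ft f F" and F: "integrable lborel F"
  shows "f x = ift F x"
proof (rule continuous_AE_eq[OF c continuous_ift[OF F]])
  have d: "ft (\<lambda>x. f x - ift F x) (\<lambda>x. F x - F x)" by (intro ft_diff f ft_ift F ft_L2(2)[OF f])
  have "sqn (\<lambda>x. f x - ift F x) = 0"
    using ft_Plancherel[OF continuous_on_diff[OF c continuous_ift[OF F]] d] by (simp add: sqn_def)
  then have "AE x in lborel. ennreal ((cmod (f x - ift F x))\<^sup>2) = 0"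
    unfolding sqn_def using ft_L2[OF f] F by (subst (asm) nn_integral_0_iff_AE) auto
  then show "AE x in lborel. f x = ift F x" by eventually_elim simp
qed

text \<open>Continuity of f' gives it a transform, which is identified by tests: integration by
  parts moves the derivative onto \<open>fhat \<phi>\<close>, where it becomes multiplication of
  \<phi> by the variable. The products are integrable by Cauchy-Schwarz, so
  \<open>integral_by_parts_L1\<close> leaves no boundary terms.\<close>

lemma ft_derivative:
  assumes d: "\<And>x. (f has_vector_derivative f' x) (at x)" and c: "continuous_on UNIV f'"
    and L: "L2 f'" and F: "ft f F"
  shows "ft f' (\<lambda>x. \<i> * of_real x * F x)"
proof -
  obtain F' where F': "ft f' F'" using ft_exists[OF c L] by blast
  have [measurable]: "F \<in> borel_measurable borel" using F by (auto simp: ft_def L2_def)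
  have Lf: "L2 f" using F by (rule ft_L2)
  have "AE x in lborel. F' x = \<i> * of_real x * F x"
  proof (rule ft_unique_test[OF F'])
    fix \<phi> assume t: "test_function \<phi>"
    let ?\<phi> = "\<lambda>x. complex_of_real (\<phi> x)"
    note * = test_function_transform[OF t]
    have i': "integrable lborel (\<lambda>y. - \<i> * of_real y * ?\<phi> y)" "L2 (\<lambda>y. - \<i> * of_real y * ?\<phi> y)"
      using integrable_mult_right[OF *(5), of "-\<i>"] L2_cmult[OF *(6), of "-\<i>"] by (simp_all add: mult.assoc)
    have "(LINT x|lborel. f' x * fhat ?\<phi> x) = - (LINT x|lborel. f x * fhat (\<lambda>y. - \<i> * of_real y * ?\<phi> y) x)"
      by (rule integral_by_parts_L1[OF d c fhat_has_vector_derivative[OF *(1,5)] continuous_fhat[OF i'(1)]])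
        (intro L2_C_S(1) Lf L L2_fhat * i')+
    also have "(LINT x|lborel. f x * fhat (\<lambda>y. - \<i> * of_real y * ?\<phi> y) x) = (LINT y|lborel. F y * (- \<i> * of_real y * ?\<phi> y))"
      using F i' by (simp add: ft_def)
    also have "- \<dots> = (LINT y|lborel. \<i> * of_real y * F y * ?\<phi> y)"
      by (subst Bochner_Integration.integral_minus[symmetric]) (simp add: mult_ac)
    finally show "(LINT x|lborel. f' x * fhat ?\<phi> x) = (LINT y|lborel. \<i> * of_real y * F y * ?\<phi> y)" .
  next
    fix c d :: real
    have "L2 (\<lambda>x. indicator {c..d} x *\<^sub>R F x)"
      by (rule L2_bound[OF ft_L2(2)[OF F]]) (auto simp: indicator_def)
    have "set_integrable lborel {c..d} F" by (rule L2_interval_integrable[OF ft_L2(2)[OF F]])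
    then have i: "integrable lborel (\<lambda>x. indicator {c..d} x *\<^sub>R F x)" by (simp add: set_integrable_def)
    have "integrable lborel (\<lambda>x. indicator {c..d} x *\<^sub>R (\<i> * of_real x * F x))"
    proof (rule Bochner_Integration.integrable_bound[OF integrable_mult_right[OF i, of "of_real (\<bar>c\<bar> + \<bar>d\<bar>)"]])
      show "AE x in lborel. cmod (indicator {c..d} x *\<^sub>R (\<i> * of_real x * F x)) \<le> cmod (of_real (\<bar>c\<bar> + \<bar>d\<bar>) * (indicator {c..d} x *\<^sub>R F x))"
        by (intro AE_I2) (auto simp: indicator_def norm_mult simp del: of_real_add intro!: mult_right_mono)
    qed measurable
    then show "set_integrable lborel {c..d} (\<lambda>x. \<i> * of_real x * F x)" by (simp add: set_integrable_def)
  qed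
  then show ?thesis by (rule ft_cong_AE[OF F']) simp
qed

section \<open>Sobolev norms of continuous functions\<close>

abbreviation cx :: "(real \<Rightarrow> real) \<Rightarrow> real \<Rightarrow> complex" where
  "cx f \<equiv> \<lambda>x. complex_of_real (f x)"

text \<open>Continuous representatives turn identities that hold almost everywhere into pointwise
  ones and let classical derivatives stand for weak ones.\<close>

definition CL2 :: "(real \<Rightarrow> real) \<Rightarrow> bool" where
  "CL2 f \<longleftrightarrow> continuous_on UNIV f \<and> L2 (cx f)"

definition FT :: "(real \<Rightarrow> real) \<Rightarrow> real \<Rightarrow> complex" where
  "FT f = (SOME F. ft (cx f) F)"

text \<open>The squared \<open>H\<^sup>r\<close> norm, extended-valued.\<close>

definition Sq :: "real \<Rightarrow> (real \<Rightarrow> real) \<Rightarrow> ennreal" where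
  "Sq r f = Q r (FT f)"

lemma CL2_continuous: "CL2 f \<Longrightarrow> continuous_on UNIV f" "CL2 f \<Longrightarrow> continuous_on UNIV (cx f)"
  by (auto simp: CL2_def intro!: continuous_intros)

lemma CL2_L2: "CL2 f \<Longrightarrow> L2 (cx f)" by (simp add: CL2_def)

lemma CL2_measurable [measurable_dest]: "CL2 f \<Longrightarrow> f \<in> borel_measurable borel"
  by (auto simp: CL2_def intro: borel_measurable_continuous_onI)

lemma ft_FT: "CL2 f \<Longrightarrow> ft (cx f) (FT f)"
proof -
  assume "CL2 f"
  then obtain F where "ft (cx f) F" using ft_exists[OF CL2_continuous(2) CL2_L2] by metis
  then show "ft (cx f) (FT f)" unfolding FT_def by (rule someI[of "ft (cx f)"])
qed

lemma FT_measurable [measurable_dest]: "CL2 f \<Longrightarrow> FT f \<in> borel_measurable borel"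
  by (drule ft_FT) (simp add: ft_def L2_def)

lemma FT_eq: "CL2 f \<Longrightarrow> ft (cx f) F \<Longrightarrow> AE x in lborel. FT f x = F x"
  by (rule ft_unique[OF ft_FT])

lemma Sq_eqI: "CL2 f \<Longrightarrow> ft (cx f) F \<Longrightarrow> Sq r f = Q r F"
  unfolding Sq_def by (intro Q_cong_AE FT_eq)

lemma Sq_0: "CL2 f \<Longrightarrow> Sq 0 f = sqn (cx f)"
  unfolding Sq_def Q_0 by (intro ft_Plancherel CL2_continuous ft_FT)

lemma Sq_mono: "r \<le> r' \<Longrightarrow> Sq r f \<le> Sq r' f"
  unfolding Sq_def by (rule Q_mono)

lemma Sq_finite_mono: "r \<le> r' \<Longrightarrow> Sq r' f < \<infinity> \<Longrightarrow> Sq r f < \<infinity>"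
  by (rule le_less_trans[OF Sq_mono])

lemma CL2_add: "CL2 f \<Longrightarrow> CL2 g \<Longrightarrow> CL2 (\<lambda>x. f x + g x)"
  using L2_add[of "cx f" "cx g"] by (auto simp: CL2_def intro!: continuous_intros)

lemma CL2_cmult: "CL2 f \<Longrightarrow> CL2 (\<lambda>x. c * f x)"
  using L2_cmult[of "cx f" "of_real c"] by (auto simp: CL2_def intro!: continuous_intros)

lemma CL2_diff: "CL2 f \<Longrightarrow> CL2 g \<Longrightarrow> CL2 (\<lambda>x. f x - g x)"
  using L2_diff[of "cx f" "cx g"] by (auto simp: CL2_def intro!: continuous_intros)

lemma CL2_zero: "CL2 (\<lambda>_. 0)"
  by (auto simp: CL2_def L2_def sqn_def)

lemma CL2_mult_bounded:
  assumes a: "continuous_on UNIV a" "\<And>x. \<bar>a x\<bar> \<le> M" and f: "CL2 f"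
  shows "CL2 (\<lambda>x. a x * f x)"
proof -
  have c: "continuous_on UNIV (\<lambda>x. a x * f x)" using a(1) CL2_continuous(1)[OF f] by (intro continuous_intros)
  have "L2 (\<lambda>x. of_real M * cx f x)" using f by (intro L2_cmult) (auto simp: CL2_def)
  then have "L2 (cx (\<lambda>x. a x * f x))"
  proof (rule L2_bound)
    show "cx (\<lambda>x. a x * f x) \<in> borel_measurable borel" by (intro borel_measurable_continuous_onI continuous_on_of_real c)
    fix x
    have "\<bar>a x\<bar> * \<bar>f x\<bar> \<le> \<bar>M\<bar> * \<bar>f x\<bar>" using a(2)[of x] by (intro mult_right_mono) auto
    then show "cmod (cx (\<lambda>x. a x * f x) x) \<le> cmod (of_real M * cx f x)" by (simp add: norm_mult abs_mult)
  qed
  with c show ?thesis by (simp add: CL2_def)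
qed

lemma ft_real_add: "CL2 f \<Longrightarrow> CL2 g \<Longrightarrow> ft (cx (\<lambda>x. f x + g x)) (\<lambda>x. FT f x + FT g x)"
  using ft_add[OF ft_FT ft_FT, of f g] by simp

lemma Sq_add: "CL2 f \<Longrightarrow> CL2 g \<Longrightarrow> Sq r (\<lambda>x. f x + g x) \<le> 2 * Sq r f + 2 * Sq r g"
  using Sq_eqI[OF CL2_add ft_real_add, of f g r] Q_add[OF FT_measurable FT_measurable, of f g r] by (simp add: Sq_def)

lemma Sq_cmult: "CL2 f \<Longrightarrow> Sq r (\<lambda>x. c * f x) = ennreal (c\<^sup>2) * Sq r f"
  using Sq_eqI[OF CL2_cmult, of f c _ r] ft_cmult[OF ft_FT, of f "of_real c"] Q_cmult[OF FT_measurable, of f r "of_real c"] by (simp add: Sq_def)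

lemma Sq_diff: "CL2 f \<Longrightarrow> CL2 g \<Longrightarrow> Sq r (\<lambda>x. f x - g x) \<le> 2 * Sq r f + 2 * Sq r g"
  using Sq_add[of f "\<lambda>x. (-1) * g x" r] CL2_cmult[of g "-1"] Sq_cmult[of g r "-1"] by simp

lemma Sq_add_finite: "CL2 f \<Longrightarrow> CL2 g \<Longrightarrow> Sq r f < \<infinity> \<Longrightarrow> Sq r g < \<infinity> \<Longrightarrow> Sq r (\<lambda>x. f x + g x) < \<infinity>"
  by (rule le_less_trans[OF Sq_add]) (auto simp: ennreal_mult_less_top)

lemma Sq_Suc:
  assumes f: "CL2 f" "CL2 f'" and d: "\<And>x. (f has_real_derivative f' x) (at x)"
  shows "Sq (r + 1) f = Sq r f + Sq r f'"
proof -
  have "ft (cx f') (\<lambda>x. \<i> * of_real x * FT f x)"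
    by (rule ft_derivative[OF has_vector_derivative_of_real[OF d] CL2_continuous(2)[OF f(2)] CL2_L2[OF f(2)] ft_FT[OF f(1)]])
  from Sq_eqI[OF f(2) this, of r] show ?thesis
    using Q_Suc[OF FT_measurable[OF f(1)], of r] by (simp add: Sq_def)
qed

lemma CL2_of_ift:
  assumes "integrable lborel F" "L2 F" "cx f = ift F"
  shows "CL2 f" "ft (cx f) F"
proof -
  have "f = (\<lambda>x. Re (ift F x))" by (simp add: assms(3)[symmetric] fun_eq_iff)
  moreover have "continuous_on UNIV (\<lambda>x. Re (ift F x))" by (intro continuous_intros continuous_ift assms)
  ultimately have "continuous_on UNIV f" by metis
  then show "CL2 f" using L2_ift[OF assms(1,2)] by (simp add: CL2_def assms(3)[symmetric])
  show "ft (cx f) F" unfolding assms(3) by (rule ft_ift[OF assms(1,2)])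
qed

lemma Sq_ift:
  assumes f: "CL2 f" and r: "r > 1/2" and fin: "Sq r f < \<infinity>"
  shows "integrable lborel (FT f)" "cx f = ift (FT f)"
proof -
  show i: "integrable lborel (FT f)" using Q_integrable[OF FT_measurable[OF f] r] fin by (simp add: Sq_def)
  show "cx f = ift (FT f)" by (intro ext ft_integrable_ift[OF CL2_continuous(2)[OF f] ft_FT[OF f] i])
qed

lemma ift_bound_ennreal:
  assumes "integrable lborel F"
  shows "ennreal (cmod (ift F x)) \<le> (\<integral>\<^sup>+x. ennreal (cmod (F x)) \<partial>lborel)"
proof -
  have "1 \<le> sqrt (2 * pi)" using pi_ge_two by (intro real_le_rsqrt) auto
  then have "(LINT y|lborel. cmod (F y)) / sqrt (2 * pi) \<le> (LINT y|lborel. cmod (F y)) / 1"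
    by (intro divide_left_mono) auto
  then have "cmod (ift F x) \<le> (LINT y|lborel. cmod (F y))"
    using fhat_bound[OF assms, of "-x"] by (simp add: ift_def)
  then have "ennreal (cmod (ift F x)) \<le> ennreal (LINT y|lborel. cmod (F y))" by (rule ennreal_leI)
  also have "\<dots> = (\<integral>\<^sup>+x. ennreal (cmod (F x)) \<partial>lborel)"
    using assms by (subst nn_integral_eq_integral) auto
  finally show ?thesis .
qed

text \<open>A squared constant for the embedding of \<open>H\<^sup>r\<close> into the bounded
  functions; it is not optimal, as the normalising factor \<open>1 / sqrt (2 * pi)\<close> is
  estimated by 1.\<close>

definition Kemb :: "real \<Rightarrow> ennreal" where
  "Kemb r = (\<integral>\<^sup>+x. ennreal (wt (- r) x) \<partial>lborel)"

lemma Kemb_finite: "r > 1/2 \<Longrightarrow> Kemb r < \<infinity>"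
  unfolding Kemb_def by (rule nn_integral_wt_neg_finite)

lemma Sq_sup:
  assumes f: "CL2 f" and r: "r > 1/2" and fin: "Sq r f < \<infinity>"
  shows "ennreal ((f x)\<^sup>2) \<le> Kemb r * Sq r f"
proof -
  have "ennreal \<bar>f x\<bar> \<le> (\<integral>\<^sup>+x. ennreal (cmod (FT f x)) \<partial>lborel)"
    using ift_bound_ennreal[OF Sq_ift(1)[OF assms], of x] fun_cong[OF Sq_ift(2)[OF assms], of x] by (metis norm_of_real)
  then have "(ennreal \<bar>f x\<bar>)\<^sup>2 \<le> (\<integral>\<^sup>+x. ennreal (cmod (FT f x)) \<partial>lborel)\<^sup>2"
    by (rule power_mono) simp
  also have "\<dots> \<le> Kemb r * Sq r f"
    unfolding Kemb_def Sq_def by (rule Q_embed_L1[OF FT_measurable[OF f]])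
  finally show ?thesis by (simp add: ennreal_power)
qed

lemma Sq_bounded:
  assumes f: "CL2 f" and r: "r > 1/2" and fin: "Sq r f < \<infinity>"
  obtains M where "M > 0" "\<And>x. \<bar>f x\<bar> \<le> M"
proof -
  have "Kemb r * Sq r f < \<top>" using Kemb_finite[OF r] fin by (simp add: ennreal_mult_less_top)
  then obtain K where K: "Kemb r * Sq r f = ennreal K" "K \<ge> 0" by (cases "Kemb r * Sq r f") auto
  have "\<bar>f x\<bar> \<le> sqrt K + 1" for x
  proof -
    have "(f x)\<^sup>2 \<le> K" using Sq_sup[OF assms, of x] K by simp
    then have "sqrt ((f x)\<^sup>2) \<le> sqrt K" by (rule real_sqrt_le_mono)
    then show ?thesis by simp
  qed
  moreover have "sqrt K + 1 > 0" using K by (simp add: add_nonneg_pos)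
  ultimately show ?thesis using that by blast
qed

text \<open>Above order 3/2 the transform multiplied by its variable is still integrable, so the
  inversion integral can be differentiated. The result is complex valued a priori; its imaginary
  part is the derivative of the zero function.\<close>

lemma Sq_C1:
  assumes f: "CL2 f" and r: "r > 3/2" and fin: "Sq r f < \<infinity>"
  obtains f' where "\<And>x. (f has_real_derivative f' x) (at x)" "CL2 f'" "Sq (r - 1) f' < \<infinity>"
proof -
  let ?G = "\<lambda>x. \<i> * of_real x * FT f x"
  note [measurable] = FT_measurable[OF f]
  have "Sq r f = Q (r - 1) (FT f) + Q (r - 1) ?G"
    using Q_Suc[of "FT f" "r - 1"] by (simp add: Sq_def)
  then have q: "Q (r - 1) ?G < \<infinity>" using fin by (auto simp: less_top)
  have i: "integrable lborel (FT f)" "cx f = ift (FT f)"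
    using Sq_ift[OF f _ fin] r by auto
  have iG: "integrable lborel ?G" by (rule Q_integrable[OF _ _ q]) (use r in auto)
  have LG: "L2 ?G" by (rule Q_L2[OF _ _ q]) (use r in auto)
  have ix: "integrable lborel (\<lambda>y. of_real y * FT f y)"
    using integrable_mult_right[OF iG, of "-\<i>"] by (simp add: mult.assoc[symmetric])
  have d: "(cx f has_vector_derivative ift ?G x) (at x)" for x
    unfolding i(2) by (rule ift_has_vector_derivative[OF i(1) ix])
  define f' where "f' = (\<lambda>x. Re (ift ?G x))"
  have df: "(f has_real_derivative f' x) (at x)" and im: "Im (ift ?G x) = 0" for x
  proof -
    have d': "((\<lambda>x. Re (cx f x)) has_field_derivative Re (ift ?G x)) (at x)" "((\<lambda>x. Im (cx f x)) has_field_derivative Im (ift ?G x)) (at x)"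
      using d[of x] unfolding has_vector_derivative_complex_iff by auto
    then show "(f has_real_derivative f' x) (at x)" by (simp add: f'_def)
    have "((\<lambda>x. 0) has_field_derivative Im (ift ?G x)) (at x)" using d'(2) by simp
    then show "Im (ift ?G x) = 0" using DERIV_const DERIV_unique by blast
  qed
  have e: "cx f' = ift ?G" by (auto simp: fun_eq_iff complex_eq_iff im f'_def)
  have "CL2 f'" by (rule CL2_of_ift[OF iG LG e])
  moreover have "Sq (r - 1) f' < \<infinity>"
    using Sq_eqI[OF CL2_of_ift[OF iG LG e], of "r - 1"] q by simp
  ultimately show ?thesis using that df by blast
qed

text \<open>The reflected conjugate of \<open>FT f\<close> satisfies the same multiplication formula
  because \<open>f\<close> is real. The symmetry ensures that real even multipliers, as used in
  \<open>smooth_split\<close>, keep a function real.\<close>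

lemma FT_hermitian:
  assumes f: "CL2 f"
  shows "AE x in lborel. cnj (FT f (- x)) = FT f x"
proof -
  note [measurable] = FT_measurable[OF f]
  let ?G = "\<lambda>x. cnj (FT f (- x))"
  have "sqn ?G = sqn (FT f)" using sqn_reflect[of "FT f"] by (simp add: sqn_def)
  then have LG: "L2 ?G" using ft_L2(2)[OF ft_FT[OF f]] by (simp add: L2_def)
  have "ft (cx f) ?G"
    unfolding ft_def
  proof (safe intro!: CL2_L2[OF f] LG)
    fix \<psi> assume i: "integrable lborel \<psi>" and L: "L2 \<psi>"
    have [measurable]: "\<psi> \<in> borel_measurable borel" using i by auto
    let ?\<psi> = "\<lambda>y. cnj (\<psi> (- y))"
    have i': "integrable lborel ?\<psi>" using lborel_integrable_real_affine[OF i, of "-1" 0] by simp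
    have L': "L2 ?\<psi>" using L sqn_reflect[of \<psi>] by (simp add: L2_def sqn_def)
    have h: "fhat ?\<psi> x = cnj (fhat \<psi> x)" for x
      using fhat_reflect[of "\<lambda>y. cnj (\<psi> y)" x] by (simp add: cnj_fhat)
    have "(LINT y|lborel. ?G y * \<psi> y) = (LINT y|lborel. cnj (FT f (- y) * ?\<psi> (- y)))" by simp
    also have "\<dots> = cnj (LINT y|lborel. FT f (- y) * ?\<psi> (- y))" by (rule Bochner_Integration.integral_cnj)
    also have "(LINT y|lborel. FT f (- y) * ?\<psi> (- y)) = (LINT y|lborel. FT f y * ?\<psi> y)"
      using lborel_integral_real_affine[of "-1" "\<lambda>y. FT f y * ?\<psi> y" 0] by simp
    also have "\<dots> = (LINT x|lborel. cx f x * fhat ?\<psi> x)"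
      using ft_FT[OF f] i' L' by (simp add: ft_def)
    also have "\<dots> = (LINT x|lborel. cnj (cx f x * fhat \<psi> x))" by (simp add: h)
    also have "\<dots> = cnj (LINT x|lborel. cx f x * fhat \<psi> x)" by (rule Bochner_Integration.integral_cnj)
    finally show "(LINT x|lborel. cx f x * fhat \<psi> x) = (LINT y|lborel. ?G y * \<psi> y)" by simp
  qed
  then have "AE x in lborel. FT f x = ?G x" by (rule FT_eq[OF f])
  then show ?thesis by eventually_elim simp
qed

lemma ift_real_even:
  assumes f: "CL2 f" and m [measurable]: "m \<in> borel_measurable borel" and even: "\<And>x. m (- x) = m x"
    and i: "integrable lborel (\<lambda>x. of_real (m x) * FT f x)"
  shows "cx (\<lambda>x. Re (ift (\<lambda>x. of_real (m x) * FT f x) x)) = ift (\<lambda>x. of_real (m x) * FT f x)"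
proof
  fix x
  note [measurable] = FT_measurable[OF f]
  let ?F = "\<lambda>x. of_real (m x) * FT f x"
  have "cnj (ift ?F x) = fhat (\<lambda>y. cnj (?F y)) x"
    using cnj_fhat[of ?F "-x"] by (simp add: ift_def)
  also have "\<dots> = ift (\<lambda>y. cnj (?F (- y))) x"
    using fhat_reflect[of "\<lambda>y. cnj (?F (- y))" x] by simp
  also have "\<dots> = ift ?F x"
    unfolding ift_eq
    by (intro arg_cong[where f="\<lambda>a. a / _"] integral_cong_AE)
      (use FT_hermitian[OF f] in \<open>auto simp: even elim: eventually_mono\<close>)
  finally show "cx (\<lambda>x. Re (ift ?F x)) x = ift ?F x" by (simp add: complex_eq_iff)
qed

section \<open>The algebra property\<close>

text \<open>Normalised so that \<open>ift\<close> turns convolution into the product without a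
  constant.\<close>

definition conv :: "(real \<Rightarrow> complex) \<Rightarrow> (real \<Rightarrow> complex) \<Rightarrow> real \<Rightarrow> complex" where
  "conv F G z = (LINT y|lborel. F (z - y) * G y) / complex_of_real (sqrt (2 * pi))"

lemma integrable_shift:
  fixes F :: "real \<Rightarrow> 'a::{banach, second_countable_topology}"
  assumes "integrable lborel F" shows "integrable lborel (\<lambda>z. F (z - y))"
  using lborel_integrable_real_affine[OF assms, of 1 "-y"] by simp

lemma integral_shift:
  fixes F :: "real \<Rightarrow> 'a::{banach, second_countable_topology}"
  shows "(LINT z|lborel. F (z - y)) = (LINT z|lborel. F z)"
  using lborel_integral_real_affine[of 1 F "-y"] by simp

lemma nn_integral_shift:
  fixes F :: "real \<Rightarrow> ennreal"
  shows "F \<in> borel_measurable borel \<Longrightarrow> (\<integral>\<^sup>+z. F (z - y) \<partial>lborel) = (\<integral>\<^sup>+z. F z \<partial>lborel)"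
  using nn_integral_real_affine[of F 1 "-y"] by simp

lemma conv_product_integrable:
  fixes F G :: "real \<Rightarrow> complex"
  assumes F: "integrable lborel F" and G: "integrable lborel G"
  shows "integrable (lborel \<Otimes>\<^sub>M lborel) (\<lambda>(y, z). F (z - y) * G y)"
proof (rule lborel_pair.Fubini_integrable)
  have [measurable]: "F \<in> borel_measurable borel" "G \<in> borel_measurable borel" using assms by auto
  show "(\<lambda>(y, z). F (z - y) * G y) \<in> borel_measurable (lborel \<Otimes>\<^sub>M lborel)" by measurable
  have "(LINT z|lborel. norm (case (y, z) of (y, z) \<Rightarrow> F (z - y) * G y)) = (LINT z|lborel. cmod (F z)) * cmod (G y)" for y
    using integral_shift[of "\<lambda>z. cmod (F z)" y] by (simp add: norm_mult)
  then show "integrable lborel (\<lambda>y. LINT z|lborel. norm (case (y, z) of (y, z) \<Rightarrow> F (z - y) * G y))"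
    using G by simp
  show "AE y in lborel. integrable lborel (\<lambda>z. case (y, z) of (y, z) \<Rightarrow> F (z - y) * G y)"
    using integrable_shift[OF F] by simp
qed

lemma conv_integrable:
  assumes F: "integrable lborel F" and G: "integrable lborel G"
  shows "integrable lborel (conv F G)"
  using lborel_pair.integrable_snd[OF conv_product_integrable[OF assms]]
  unfolding conv_def[abs_def] by simp

lemma ift_conv:
  assumes F: "integrable lborel F" and G: "integrable lborel G"
  shows "ift (conv F G) x = ift F x * ift G x"
proof -
  have [measurable]: "F \<in> borel_measurable borel" "G \<in> borel_measurable borel" using assms by auto
  have i: "integrable (lborel \<Otimes>\<^sub>M lborel) (\<lambda>(y, z). F (z - y) * G y * cis (x * z))"
    by (rule Bochner_Integration.integrable_bound[OF conv_product_integrable[OF assms]])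
      (auto simp: norm_mult case_prod_beta')
  have "(LINT z|lborel. LINT y|lborel. F (z - y) * G y * cis (x * z)) = (LINT y|lborel. LINT z|lborel. F (z - y) * G y * cis (x * z))"
    using lborel_pair.Fubini_integral[OF i] by simp
  moreover have "(LINT y|lborel. F (z - y) * G y * cis (x * z)) = (LINT y|lborel. F (z - y) * G y) * cis (x * z)" for z
    by (rule integral_mult_left_zero)
  moreover have "(LINT z|lborel. F (z - y) * G y * cis (x * z)) = (LINT z|lborel. F z * cis (x * z)) * (G y * cis (x * y))" for y
  proof -
    have "F (z - y) * G y * cis (x * z) = (F (z - y) * cis (x * (z - y))) * (G y * cis (x * y))" for z
    proof -
      have "cis (x * z) = cis (x * (z - y)) * cis (x * y)" by (simp add: cis_mult algebra_simps)
      then show ?thesis by simp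
    qed
    then have "(LINT z|lborel. F (z - y) * G y * cis (x * z)) = (LINT z|lborel. F (z - y) * cis (x * (z - y))) * (G y * cis (x * y))"
      by (simp only: integral_mult_left_zero)
    also have "(LINT z|lborel. F (z - y) * cis (x * (z - y))) = (LINT z|lborel. F z * cis (x * z))"
      by (rule integral_shift[of "\<lambda>z. F z * cis (x * z)"])
    finally show ?thesis .
  qed
  ultimately have e: "(LINT z|lborel. (LINT y|lborel. F (z - y) * G y) * cis (x * z)) = (LINT z|lborel. F z * cis (x * z)) * (LINT y|lborel. G y * cis (x * y))"
    by (simp only: integral_mult_right_zero)
  have "(LINT z|lborel. conv F G z * cis (x * z)) = (LINT z|lborel. (LINT y|lborel. F (z - y) * G y) * cis (x * z)) / complex_of_real (sqrt (2 * pi))"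
    unfolding conv_def times_divide_eq_left by (rule integral_divide_zero)
  then show ?thesis unfolding ift_eq e by simp
qed

text \<open>The larger of \<open>a\<^sup>2\<close> and \<open>b\<^sup>2\<close> dominates, at the
  price of the factor 4 under the power \<open>r\<close>.\<close>

lemma wt_sum_le:
  assumes "r \<ge> 0" shows "wt r (a + b) \<le> 4 powr r * (wt r a + wt r b)"
proof -
  have *: "1 + (a + b)\<^sup>2 \<le> 2 * (1 + a\<^sup>2) + 2 * (1 + b\<^sup>2)"
    using sum_squares_bound[of a b] by (simp add: power2_sum)
  have wab: "(4 * (1 + c\<^sup>2)) powr r = 4 powr r * wt r c" for c
    unfolding wt_def by (rule powr_mult)
  have "(1 + (a + b)\<^sup>2) powr r \<le> (4 * (1 + a\<^sup>2)) powr r \<or> (1 + (a + b)\<^sup>2) powr r \<le> (4 * (1 + b\<^sup>2)) powr r"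
  proof (cases "a\<^sup>2 \<ge> b\<^sup>2")
    case True
    have "1 + (a + b)\<^sup>2 \<le> 4 * (1 + a\<^sup>2)" by (rule order_trans[OF *]) (use True in simp)
    then show ?thesis using assms by (intro disjI1 powr_mono2) auto
  next
    case False
    have "1 + (a + b)\<^sup>2 \<le> 4 * (1 + b\<^sup>2)" by (rule order_trans[OF *]) (use False in simp)
    then show ?thesis using assms by (intro disjI2 powr_mono2) auto
  qed
  then have "wt r (a + b) \<le> 4 powr r * wt r a \<or> wt r (a + b) \<le> 4 powr r * wt r b"
    unfolding wab by (simp add: wt_def)
  moreover have "0 \<le> 4 powr r * wt r a" "0 \<le> 4 powr r * wt r b" by simp_all
  ultimately show ?thesis unfolding distrib_left
    by (elim disjE) (simp_all add: add_increasing add_increasing2)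
qed

text \<open>\<open>4 powr r\<close> comes from \<open>wt_sum_le\<close>; the 2 counts the two
  negative weights left in \<open>Q_conv\<close>, each of which integrates to
  \<open>Kemb r\<close>.\<close>

definition Kalg :: "real \<Rightarrow> ennreal" where
  "Kalg r = ennreal (4 powr r) * (2 * Kemb r)"

lemma Kalg_finite: "r > 1/2 \<Longrightarrow> Kalg r < \<infinity>"
  using Kemb_finite[of r] by (simp add: Kalg_def ennreal_mult_less_top)

text \<open>Cauchy-Schwarz at each frequency \<open>z\<close> against the weight
  \<open>wt (-r) (z - y) * wt (-r) y\<close>. Multiplied by \<open>wt r z\<close>, this weight has
  an integral over \<open>y\<close> bounded independently of \<open>z\<close>, since after
  \<open>wt_sum_le\<close> one of its two factors cancels in each term. Fubini then separates the
  rest into \<open>Q r F\<close> and \<open>Q r G\<close>.\<close>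

lemma Q_conv:
  assumes [measurable]: "F \<in> borel_measurable borel" "G \<in> borel_measurable borel"
    and i: "integrable lborel F" "integrable lborel G" and r: "r \<ge> 0"
  shows "Q r (conv F G) \<le> Kalg r * (Q r F * Q r G)"
proof -
  have [measurable]: "conv F G \<in> borel_measurable borel" using conv_integrable[OF i] by auto
  define A where "A = (\<lambda>x. ennreal (wt r x) * ennreal ((cmod (F x))\<^sup>2))"
  define B where "B = (\<lambda>x. ennreal (wt r x) * ennreal ((cmod (G x))\<^sup>2))"
  have [measurable]: "A \<in> borel_measurable borel" "B \<in> borel_measurable borel" by (auto simp: A_def B_def)
  have pw: "ennreal (wt r z) * ennreal ((cmod (conv F G z))\<^sup>2) \<le> Kalg r * (\<integral>\<^sup>+y. A (z - y) * B y \<partial>lborel)" for z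
  proof -
    have s1: "1 \<le> sqrt (2 * pi)" using pi_ge_two by (intro real_le_rsqrt) auto
    have "cmod (conv F G z) \<le> cmod (LINT y|lborel. F (z - y) * G y)"
      using s1 by (auto simp: conv_def norm_divide divide_le_eq mult_le_cancel_left1 not_le[symmetric])
    then have "ennreal (cmod (conv F G z)) \<le> (\<integral>\<^sup>+y. ennreal (cmod (F (z - y) * G y)) \<partial>lborel)"
    proof (rule order_trans[OF ennreal_leI])
      show "ennreal (cmod (LINT y|lborel. F (z - y) * G y)) \<le> (\<integral>\<^sup>+y. ennreal (cmod (F (z - y) * G y)) \<partial>lborel)"
      \<comment> \<open>The convolution integral may diverge at some \<open>z\<close>; its default
        value there is 0 and the bound is trivial.\<close>
      proof (cases "integrable lborel (\<lambda>y. F (z - y) * G y)")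
        case True
        then show ?thesis by (rule integral_norm_bound_ennreal)
      qed (simp add: not_integrable_integral_eq)
    qed
    also have "\<dots> = (\<integral>\<^sup>+y. ennreal (wt (r/2) (z - y) * cmod (F (z - y)) * (wt (r/2) y * cmod (G y))) * ennreal (wt (-r/2) (z - y) * wt (-r/2) y) \<partial>lborel)"
    proof (intro nn_integral_cong)
      fix y
      have "wt (r/2) c * wt (-r/2) c = 1" for c using wt_add[of "r/2" "-r/2" c] by simp
      then have "cmod (F (z - y) * G y) = (wt (r/2) (z - y) * wt (-r/2) (z - y)) * cmod (F (z - y)) * ((wt (r/2) y * wt (-r/2) y) * cmod (G y))"
        by (simp add: norm_mult)
      also have "\<dots> = (wt (r/2) (z - y) * cmod (F (z - y)) * (wt (r/2) y * cmod (G y))) * (wt (-r/2) (z - y) * wt (-r/2) y)"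
        by (simp only: mult_ac)
      finally show "ennreal (cmod (F (z - y) * G y)) = ennreal (wt (r/2) (z - y) * cmod (F (z - y)) * (wt (r/2) y * cmod (G y))) * ennreal (wt (-r/2) (z - y) * wt (-r/2) y)"
        by (simp only:) (rule ennreal_mult; simp)
    qed
    finally have "(ennreal (cmod (conv F G z)))\<^sup>2 \<le> (\<integral>\<^sup>+y. ennreal (wt (r/2) (z - y) * cmod (F (z - y)) * (wt (r/2) y * cmod (G y))) * ennreal (wt (-r/2) (z - y) * wt (-r/2) y) \<partial>lborel)\<^sup>2"
      by (rule power_mono) simp
    also have "\<dots> \<le> (\<integral>\<^sup>+y. (ennreal (wt (r/2) (z - y) * cmod (F (z - y)) * (wt (r/2) y * cmod (G y))))\<^sup>2 \<partial>lborel)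
        * (\<integral>\<^sup>+y. (ennreal (wt (-r/2) (z - y) * wt (-r/2) y))\<^sup>2 \<partial>lborel)"
      by (rule Cauchy_Schwarz_nn_integral) auto
    also have "(\<integral>\<^sup>+y. (ennreal (wt (r/2) (z - y) * cmod (F (z - y)) * (wt (r/2) y * cmod (G y))))\<^sup>2 \<partial>lborel) = (\<integral>\<^sup>+y. A (z - y) * B y \<partial>lborel)"
    proof (intro nn_integral_cong)
      fix y
      have w: "(wt (r/2) c)\<^sup>2 = wt r c" for c using wt_add[of "r/2" "r/2" c] by (simp add: power2_eq_square)
      have "(ennreal (wt (r/2) (z - y) * cmod (F (z - y)) * (wt (r/2) y * cmod (G y))))\<^sup>2
         = ennreal ((wt (r/2) (z - y) * cmod (F (z - y)) * (wt (r/2) y * cmod (G y)))\<^sup>2)"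
        by (rule ennreal_power) simp
      also have "(wt (r/2) (z - y) * cmod (F (z - y)) * (wt (r/2) y * cmod (G y)))\<^sup>2 = wt r (z - y) * (cmod (F (z - y)))\<^sup>2 * (wt r y * (cmod (G y))\<^sup>2)"
        by (simp only: power_mult_distrib w)
      also have "ennreal \<dots> = A (z - y) * B y"
        by (simp add: A_def B_def ennreal_mult)
      finally show "(ennreal (wt (r/2) (z - y) * cmod (F (z - y)) * (wt (r/2) y * cmod (G y))))\<^sup>2 = A (z - y) * B y" .
    qed
    finally have cs: "ennreal ((cmod (conv F G z))\<^sup>2) \<le> (\<integral>\<^sup>+y. A (z - y) * B y \<partial>lborel)
        * (\<integral>\<^sup>+y. (ennreal (wt (-r/2) (z - y) * wt (-r/2) y))\<^sup>2 \<partial>lborel)"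
      by (simp add: ennreal_power)
    have "ennreal (wt r z) * (\<integral>\<^sup>+y. (ennreal (wt (-r/2) (z - y) * wt (-r/2) y))\<^sup>2 \<partial>lborel)
        = (\<integral>\<^sup>+y. ennreal (wt r z) * (ennreal (wt (-r/2) (z - y) * wt (-r/2) y))\<^sup>2 \<partial>lborel)"
      by (rule nn_integral_cmult[symmetric]) simp
    also have "\<dots> \<le> (\<integral>\<^sup>+y. ennreal (4 powr r) * (ennreal (wt (-r) y) + ennreal (wt (-r) (z - y))) \<partial>lborel)"
    proof (intro nn_integral_mono)
      fix y
      have w: "(wt (-r/2) c)\<^sup>2 = wt (-r) c" for c using wt_add[of "-r/2" "-r/2" c] by (simp add: power2_eq_square)
      have e: "(wt r a + wt r b) * (wt (-r) a * wt (-r) b) = wt (-r) b + wt (-r) a" for a b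
        by (simp add: wt_minus field_simps)
      have "wt r z * (wt (-r/2) (z - y) * wt (-r/2) y)\<^sup>2 = wt r ((z - y) + y) * (wt (-r) (z - y) * wt (-r) y)"
        unfolding power_mult_distrib w by simp
      also have "\<dots> \<le> (4 powr r * (wt r (z - y) + wt r y)) * (wt (-r) (z - y) * wt (-r) y)"
        by (intro mult_right_mono wt_sum_le r) simp
      also have "\<dots> = 4 powr r * (wt (-r) y + wt (-r) (z - y))"
        unfolding mult.assoc e ..
      finally have "ennreal (wt r z * (wt (-r/2) (z - y) * wt (-r/2) y)\<^sup>2) \<le> ennreal (4 powr r * (wt (-r) y + wt (-r) (z - y)))"
        by (rule ennreal_leI)
      moreover have "ennreal (wt r z * (wt (-r/2) (z - y) * wt (-r/2) y)\<^sup>2) = ennreal (wt r z) * (ennreal (wt (-r/2) (z - y) * wt (-r/2) y))\<^sup>2"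
        by (subst ennreal_mult) (auto simp: ennreal_power)
      moreover have "ennreal (4 powr r * (wt (-r) y + wt (-r) (z - y))) = ennreal (4 powr r) * (ennreal (wt (-r) y) + ennreal (wt (-r) (z - y)))"
        by (subst ennreal_mult) (auto simp: ennreal_plus)
      ultimately show "ennreal (wt r z) * (ennreal (wt (-r/2) (z - y) * wt (-r/2) y))\<^sup>2 \<le> ennreal (4 powr r) * (ennreal (wt (-r) y) + ennreal (wt (-r) (z - y)))"
        by simp
    qed
    also have "\<dots> = ennreal (4 powr r) * (Kemb r + (\<integral>\<^sup>+y. ennreal (wt (-r) (z - y)) \<partial>lborel))"
      unfolding Kemb_def by (simp add: nn_integral_cmult nn_integral_add)
    also have "(\<integral>\<^sup>+y. ennreal (wt (-r) (z - y)) \<partial>lborel) = Kemb r"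
      unfolding Kemb_def using nn_integral_real_affine[of "\<lambda>y. ennreal (wt (-r) y)" "-1" z] by simp
    finally have k: "ennreal (wt r z) * (\<integral>\<^sup>+y. (ennreal (wt (-r/2) (z - y) * wt (-r/2) y))\<^sup>2 \<partial>lborel) \<le> Kalg r"
      by (simp add: Kalg_def mult_2)
    have "ennreal (wt r z) * ennreal ((cmod (conv F G z))\<^sup>2) \<le> ennreal (wt r z) * ((\<integral>\<^sup>+y. A (z - y) * B y \<partial>lborel)
        * (\<integral>\<^sup>+y. (ennreal (wt (-r/2) (z - y) * wt (-r/2) y))\<^sup>2 \<partial>lborel))"
      by (rule mult_left_mono[OF cs]) simp
    also have "\<dots> = (ennreal (wt r z) * (\<integral>\<^sup>+y. (ennreal (wt (-r/2) (z - y) * wt (-r/2) y))\<^sup>2 \<partial>lborel)) * (\<integral>\<^sup>+y. A (z - y) * B y \<partial>lborel)"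
      by (simp only: mult_ac)
    also have "\<dots> \<le> Kalg r * (\<integral>\<^sup>+y. A (z - y) * B y \<partial>lborel)"
      by (rule mult_right_mono[OF k]) simp
    finally show ?thesis .
  qed
  have "Q r (conv F G) \<le> (\<integral>\<^sup>+z. Kalg r * (\<integral>\<^sup>+y. A (z - y) * B y \<partial>lborel) \<partial>lborel)"
    unfolding Q_def by (intro nn_integral_mono pw)
  also have "\<dots> = Kalg r * (\<integral>\<^sup>+z. (\<integral>\<^sup>+y. A (z - y) * B y \<partial>lborel) \<partial>lborel)"
    by (rule nn_integral_cmult) simp
  also have "(\<integral>\<^sup>+z. (\<integral>\<^sup>+y. A (z - y) * B y \<partial>lborel) \<partial>lborel) = (\<integral>\<^sup>+y. (\<integral>\<^sup>+z. A (z - y) * B y \<partial>lborel) \<partial>lborel)"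
    by (rule lborel_pair.Fubini') simp
  also have "\<dots> = (\<integral>\<^sup>+y. (\<integral>\<^sup>+z. A z \<partial>lborel) * B y \<partial>lborel)"
    by (intro nn_integral_cong) (simp add: nn_integral_multc nn_integral_shift[of A])
  also have "\<dots> = (\<integral>\<^sup>+z. A z \<partial>lborel) * (\<integral>\<^sup>+y. B y \<partial>lborel)"
    by (rule nn_integral_cmult) simp
  finally show ?thesis by (simp add: A_def B_def Q_def)
qed

text \<open>Above order 1/2 both transforms are integrable, so the product is the inverse transform
  of their convolution and \<open>Q_conv\<close> applies.\<close>

theorem Sq_mult:
  assumes f: "CL2 f" "Sq r f < \<infinity>" and g: "CL2 g" "Sq r g < \<infinity>" and r: "r > 1/2"
  shows "CL2 (\<lambda>x. f x * g x)" "Sq r (\<lambda>x. f x * g x) \<le> Kalg r * (Sq r f * Sq r g)"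
    "Sq r (\<lambda>x. f x * g x) < \<infinity>"
proof -
  note i = Sq_ift[OF f(1) r f(2)] and j = Sq_ift[OF g(1) r g(2)]
  have q: "Q r (conv (FT f) (FT g)) \<le> Kalg r * (Sq r f * Sq r g)"
    unfolding Sq_def by (rule Q_conv[OF FT_measurable[OF f(1)] FT_measurable[OF g(1)] i(1) j(1)]) (use r in simp)
  have fin: "Kalg r * (Sq r f * Sq r g) < \<infinity>" using Kalg_finite[OF r] f g by (simp add: ennreal_mult_less_top)
  have ci: "integrable lborel (conv (FT f) (FT g))" by (rule conv_integrable[OF i(1) j(1)])
  have cL: "L2 (conv (FT f) (FT g))"
    by (rule Q_L2[where r=r]) (use ci q fin r in \<open>auto intro: le_less_trans\<close>)
  have e: "cx (\<lambda>x. f x * g x) = ift (conv (FT f) (FT g))"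
  proof
    fix x
    show "cx (\<lambda>x. f x * g x) x = ift (conv (FT f) (FT g)) x"
      using fun_cong[OF i(2), of x] fun_cong[OF j(2), of x] by (simp add: ift_conv[OF i(1) j(1)])
  qed
  show "CL2 (\<lambda>x. f x * g x)" by (rule CL2_of_ift(1)[OF ci cL e])
  show 1: "Sq r (\<lambda>x. f x * g x) \<le> Kalg r * (Sq r f * Sq r g)"
    using Sq_eqI[OF CL2_of_ift[OF ci cL e], of r] q by simp
  show "Sq r (\<lambda>x. f x * g x) < \<infinity>" by (rule le_less_trans[OF 1 fin])
qed

section \<open>Interpolation between \<open>L\<^sup>2\<close> and \<open>H\<^sup>2\<close>\<close>

text \<open>The normalising constant of quadratic real interpolation: replacing x by t w turns the
  integral into \<open>w powr \<theta>\<close> times this number, so a fractional power of a weight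
  is an average of the functions t w / (1 + t w). Convergence at 0 requires \<theta> < 1, at
  infinity \<theta> > 0.\<close>

definition kint :: "real \<Rightarrow> ennreal" where
  "kint \<theta> = (\<integral>\<^sup>+x. ennreal (indicator {0<..} x * (x powr (- \<theta> - 1) * (x / (1 + x)))) \<partial>lborel)"

lemma kint_scale:
  assumes "w > 0"
  shows "(\<integral>\<^sup>+t. ennreal (indicator {0<..} t * (t powr (- \<theta> - 1) * (t * w / (1 + t * w)))) \<partial>lborel) = ennreal (w powr \<theta>) * kint \<theta>"
proof -
  let ?f = "\<lambda>t. ennreal (indicator {0<..} t * (t powr (- \<theta> - 1) * (t * w / (1 + t * w))))"
  have "(\<integral>\<^sup>+t. ?f t \<partial>lborel) = ennreal (1 / w) * (\<integral>\<^sup>+t. ?f (t / w) \<partial>lborel)"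
    using nn_integral_real_affine[of ?f "1 / w" 0] assms by simp
  also have "(\<integral>\<^sup>+t. ?f (t / w) \<partial>lborel) = (\<integral>\<^sup>+t. ennreal (w powr (\<theta> + 1)) * ennreal (indicator {0<..} t * (t powr (- \<theta> - 1) * (t / (1 + t)))) \<partial>lborel)"
  proof (intro nn_integral_cong)
    fix t :: real
    show "?f (t / w) = ennreal (w powr (\<theta> + 1)) * ennreal (indicator {0<..} t * (t powr (- \<theta> - 1) * (t / (1 + t))))"
    proof (cases "t > 0")
      case True
      have "(t / w) powr (- \<theta> - 1) = t powr (- \<theta> - 1) * w powr (\<theta> + 1)"
        using True assms by (simp add: powr_divide powr_minus_divide[of w "\<theta> + 1", simplified] field_simps)
      then have "indicator {0<..} (t / w) * ((t / w) powr (- \<theta> - 1) * (t / w * w / (1 + t / w * w)))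
          = w powr (\<theta> + 1) * (indicator {0<..} t * (t powr (- \<theta> - 1) * (t / (1 + t))))"
        using True assms by simp
      then show ?thesis by (simp only:) (rule ennreal_mult, use True in auto)
    next
      case False
      then have "indicator {0<..} (t / w) = (0::real)" using assms by (simp add: indicator_def zero_less_divide_iff)
      then show ?thesis using False by simp
    qed
  qed
  also have "\<dots> = ennreal (w powr (\<theta> + 1)) * kint \<theta>"
    unfolding kint_def by (rule nn_integral_cmult) simp
  also have "ennreal (1 / w) * (ennreal (w powr (\<theta> + 1)) * kint \<theta>) = ennreal (w powr \<theta>) * kint \<theta>"
    using assms by (simp add: powr_add mult.assoc[symmetric] flip: ennreal_mult)
  finally show ?thesis .
qed

lemma kint_bounds:
  assumes "0 < \<theta>" "\<theta> < 1"
  shows "kint \<theta> < \<infinity>" "kint \<theta> > 0"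
proof -
  have i1: "integrable lborel (\<lambda>x. indicator {0..1} x * x powr (- \<theta>))"
  proof -
    have "((\<lambda>x. x powr (- \<theta>)) has_integral (1 powr (- \<theta> + 1) / (- \<theta> + 1))) {0..1}"
      using assms by (intro has_integral_powr_from_0) auto
    then have "set_integrable lebesgue {0..1} (\<lambda>x. x powr (- \<theta>))"
      by (intro nonnegative_absolutely_integrable_1) (auto simp: integrable_on_def)
    then have "integrable lebesgue (\<lambda>x. indicator {0..1} x * x powr (- \<theta>))" by (simp add: set_integrable_def)
    then show ?thesis by (subst (asm) integrable_completion) auto
  qed
  have i2: "integrable lborel (\<lambda>x. indicator {1..} x * x powr (- \<theta> - 1))"
  proof -
    have "((\<lambda>x. x powr (- \<theta> - 1)) has_integral (-(1 powr (- \<theta> - 1 + 1)) / (- \<theta> - 1 + 1))) {1..}"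
      using assms by (intro has_integral_powr_to_inf) auto
    then have "set_integrable lebesgue {1..} (\<lambda>x. x powr (- \<theta> - 1))"
      by (intro nonnegative_absolutely_integrable_1) (auto simp: integrable_on_def)
    then have "integrable lebesgue (\<lambda>x. indicator {1..} x * x powr (- \<theta> - 1))" by (simp add: set_integrable_def)
    then show ?thesis by (subst (asm) integrable_completion) auto
  qed
  define k where "k = (\<lambda>x. indicator {0..1} x * x powr (- \<theta>) + indicator {1..} x * x powr (- \<theta> - 1))"
  have k: "integrable lborel k" unfolding k_def by (intro Bochner_Integration.integrable_add i1 i2)
  have "indicator {0<..} x * (x powr (- \<theta> - 1) * (x / (1 + x))) \<le> k x" for x
  proof (cases "x > 0")
    case True
    have e: "x powr (- \<theta>) = x powr (- \<theta> - 1) * x" using True powr_add[of x "- \<theta> - 1" 1] by simp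
    have "x powr (- \<theta> - 1) * (x / (1 + x)) \<le> x powr (- \<theta> - 1) * x" "x powr (- \<theta> - 1) * (x / (1 + x)) \<le> x powr (- \<theta> - 1) * 1"
      using True by (auto intro!: mult_left_mono simp: divide_le_eq)
    then show ?thesis using True e by (cases "x \<le> 1") (auto simp: k_def indicator_def)
  qed (simp add: k_def)
  then have "kint \<theta> \<le> (\<integral>\<^sup>+x. ennreal (norm (k x)) \<partial>lborel)"
    unfolding kint_def by (intro nn_integral_mono ennreal_leI) (simp add: order_trans[OF _ abs_ge_self])
  also have "\<dots> < \<infinity>" using k by (simp add: integrable_iff_bounded)
  finally show "kint \<theta> < \<infinity>" .
  have "0 < ennreal (2 powr (- \<theta> - 1) / 2)" by simp
  also have "\<dots> = (\<integral>\<^sup>+x. ennreal (2 powr (- \<theta> - 1) / 2) * indicator {1..2::real} x \<partial>lborel)"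
    by (subst nn_integral_cmult_indicator) (auto simp: emeasure_lborel_Icc)
  also have "\<dots> \<le> kint \<theta>"
    unfolding kint_def
  proof (rule nn_integral_mono)
    fix x :: real
    show "ennreal (2 powr (- \<theta> - 1) / 2) * indicator {1..2} x \<le> ennreal (indicator {0<..} x * (x powr (- \<theta> - 1) * (x / (1 + x))))"
    proof (cases "x \<in> {1..2}")
      case True
      have "2 powr (- \<theta> - 1) \<le> x powr (- \<theta> - 1)" using True assms by (intro powr_mono2') auto
      moreover have "1/2 \<le> x / (1 + x)" using True by (simp add: field_simps)
      ultimately have "2 powr (- \<theta> - 1) * (1/2) \<le> x powr (- \<theta> - 1) * (x / (1 + x))" by (intro mult_mono) auto
      then show ?thesis using True by (auto simp: indicator_def intro!: ennreal_leI)
    qed simp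
  qed
  finally show "kint \<theta> > 0" .
qed

text \<open>\<open>kint_scale\<close> at \<open>w = wt 2 x\<close>, followed by Fubini. The inner
  integral is the squared K-functional of the pair \<open>L\<^sup>2\<close>,
  \<open>H\<^sup>2\<close> at parameter \<open>t\<close>, computed on the transform side.\<close>

lemma Q_tau_average:
  assumes [measurable]: "F \<in> borel_measurable borel"
  shows "(\<integral>\<^sup>+t. ennreal (indicator {0<..} t * t powr (- \<theta> - 1)) *
      (\<integral>\<^sup>+x. ennreal (t * wt 2 x / (1 + t * wt 2 x)) * ennreal ((cmod (F x))\<^sup>2) \<partial>lborel) \<partial>lborel) = kint \<theta> * Q (2 * \<theta>) F"
proof -
  let ?a = "\<lambda>t. ennreal (indicator {0<..} t * t powr (- \<theta> - 1))"
  let ?k = "\<lambda>t x. ennreal (t * wt 2 x / (1 + t * wt 2 x))"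
  have "(\<integral>\<^sup>+t. ?a t * (\<integral>\<^sup>+x. ?k t x * ennreal ((cmod (F x))\<^sup>2) \<partial>lborel) \<partial>lborel)
     = (\<integral>\<^sup>+t. (\<integral>\<^sup>+x. ?a t * (?k t x * ennreal ((cmod (F x))\<^sup>2)) \<partial>lborel) \<partial>lborel)"
    by (intro nn_integral_cong) (simp add: nn_integral_cmult)
  also have "\<dots> = (\<integral>\<^sup>+x. (\<integral>\<^sup>+t. ?a t * (?k t x * ennreal ((cmod (F x))\<^sup>2)) \<partial>lborel) \<partial>lborel)"
    by (rule lborel_pair.Fubini') simp
  also have "\<dots> = (\<integral>\<^sup>+x. (kint \<theta> * (ennreal (wt (2 * \<theta>) x) * ennreal ((cmod (F x))\<^sup>2))) \<partial>lborel)"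
  proof (intro nn_integral_cong)
    fix x
    have "(\<integral>\<^sup>+t. ?a t * (?k t x * ennreal ((cmod (F x))\<^sup>2)) \<partial>lborel) = (\<integral>\<^sup>+t. ?a t * ?k t x \<partial>lborel) * ennreal ((cmod (F x))\<^sup>2)"
      by (subst nn_integral_multc[symmetric]) (auto simp: mult.assoc)
    also have "(\<integral>\<^sup>+t. ?a t * ?k t x \<partial>lborel) = (\<integral>\<^sup>+t. ennreal (indicator {0<..} t * (t powr (- \<theta> - 1) * (t * wt 2 x / (1 + t * wt 2 x)))) \<partial>lborel)"
      by (intro nn_integral_cong) (auto simp: indicator_def ennreal_mult' simp flip: ennreal_mult')
    also have "\<dots> = ennreal (wt 2 x powr \<theta>) * kint \<theta>" by (rule kint_scale) simp
    also have "wt 2 x powr \<theta> = wt (2 * \<theta>) x" by (simp only: wt_def powr_powr)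
    finally show "(\<integral>\<^sup>+t. ?a t * (?k t x * ennreal ((cmod (F x))\<^sup>2)) \<partial>lborel) = kint \<theta> * (ennreal (wt (2 * \<theta>) x) * ennreal ((cmod (F x))\<^sup>2))"
      by (simp only: mult_ac)
  qed
  also have "\<dots> = kint \<theta> * Q (2 * \<theta>) F"
    unfolding Q_def by (rule nn_integral_cmult) simp
  finally show ?thesis .
qed

text \<open>\<open>f1\<close> is the minimiser of \<open>\<parallel>f - f1\<parallel>\<^sup>2 + t \<parallel>f1\<parallel>\<^sup>2\<close>, where the second norm is that of \<open>H\<^sup>2\<close>.\<close>

lemma smooth_split:
  assumes f: "CL2 f" and t: "t > 0"
  obtains f1 f1' f1'' where "CL2 f1" "CL2 f1'" "CL2 f1''"
    "\<And>x. (f1 has_real_derivative f1' x) (at x)" "\<And>x. (f1' has_real_derivative f1'' x) (at x)"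
    "ft (cx f1) (\<lambda>x. of_real (1 / (1 + t * wt 2 x)) * FT f x)" "Sq 4 f1 < \<infinity>"
proof -
  note [measurable] = FT_measurable[OF f]
  define m where "m = (\<lambda>x. 1 / (1 + t * wt 2 x))"
  have [measurable]: "m \<in> borel_measurable borel" by (simp add: m_def)
  have pos: "1 + t * wt 2 x > 0" for x using t by (simp add: add_pos_pos)
  let ?F = "\<lambda>x. of_real (m x) * FT f x"
  have "Q 4 ?F \<le> (\<integral>\<^sup>+x. ennreal (1 / t\<^sup>2) * ennreal ((cmod (FT f x))\<^sup>2) \<partial>lborel)"
    unfolding Q_def
  proof (rule nn_integral_mono)
    fix x
    have "t * wt 2 x / (1 + t * wt 2 x) \<le> 1" using pos[of x] by (simp add: divide_le_eq)
    then have "wt 2 x * m x \<le> 1 / t" using t pos[of x] by (simp add: m_def field_simps)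
    then have "(wt 2 x * m x)\<^sup>2 \<le> (1 / t)\<^sup>2" using pos[of x] by (intro power_mono) (auto simp: m_def less_imp_le)
    then have "wt 4 x * (m x)\<^sup>2 \<le> 1 / t\<^sup>2" using wt_add[of 2 2 x] by (simp add: power2_eq_square mult_ac)
    then have "wt 4 x * (m x)\<^sup>2 * (cmod (FT f x))\<^sup>2 \<le> 1 / t\<^sup>2 * (cmod (FT f x))\<^sup>2" by (rule mult_right_mono) simp
    then have "ennreal (wt 4 x * (cmod (?F x))\<^sup>2) \<le> ennreal (1 / t\<^sup>2 * (cmod (FT f x))\<^sup>2)"
      by (intro ennreal_leI) (simp add: norm_mult power_mult_distrib mult.assoc)
    then show "ennreal (wt 4 x) * ennreal ((cmod (?F x))\<^sup>2) \<le> ennreal (1 / t\<^sup>2) * ennreal ((cmod (FT f x))\<^sup>2)"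
      by (subst (1 2) ennreal_mult[symmetric]) auto
  qed
  also have "\<dots> = ennreal (1 / t\<^sup>2) * sqn (FT f)" unfolding sqn_def by (rule nn_integral_cmult) simp
  also have "\<dots> < \<infinity>" using ft_L2(2)[OF ft_FT[OF f]] by (simp add: L2_def ennreal_mult_less_top)
  finally have q: "Q 4 ?F < \<infinity>" .
  have i: "integrable lborel ?F" by (rule Q_integrable[OF _ _ q]) auto
  have L: "L2 ?F" by (rule Q_L2[OF _ _ q]) auto
  define f1 where "f1 = (\<lambda>x. Re (ift ?F x))"
  have "cx f1 = ift ?F"
    unfolding f1_def by (rule ift_real_even[OF f _ _ i]) (auto simp: m_def wt_def)
  note f1 = CL2_of_ift[OF i L this]
  have s: "Sq 4 f1 < \<infinity>" using Sq_eqI[OF f1, of 4] q by simp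
  obtain f1' where f1': "\<And>x. (f1 has_real_derivative f1' x) (at x)" "CL2 f1'" "Sq (4 - 1) f1' < \<infinity>"
    by (rule Sq_C1[OF f1(1) _ s]) auto
  obtain f1'' where f1'': "\<And>x. (f1' has_real_derivative f1'' x) (at x)" "CL2 f1''"
    by (rule Sq_C1[OF f1'(2) _ f1'(3)]) auto
  show ?thesis by (rule that[OF f1(1) f1'(2) f1''(2) f1'(1) f1''(1)]) (use f1(2) s in \<open>auto simp: m_def\<close>)
qed

text \<open>Every splitting of \<open>f\<close> is sent by the additive \<open>T\<close> to a
  splitting of \<open>T f\<close>. So the K-functional of \<open>T f\<close> at \<open>t\<close> is
  at most \<open>A\<close> times the cost of the optimal splitting of \<open>f\<close>, which is the
  one of \<open>smooth_split\<close>; averaging over \<open>t\<close> gives order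
  \<open>r = 2 * \<theta>\<close>. The hypothesis in \<open>H\<^sup>2\<close> speaks of classically
  twice differentiable functions, hence the smoothness recorded for the minimiser.\<close>

theorem Sobolev_interpolation:
  fixes T :: "(real \<Rightarrow> real) \<Rightarrow> real \<Rightarrow> real"
  assumes TC: "\<And>f. CL2 f \<Longrightarrow> CL2 (T f)"
    and add: "\<And>f g. CL2 f \<Longrightarrow> CL2 g \<Longrightarrow> T (\<lambda>x. f x + g x) = (\<lambda>x. T f x + T g x)"
    and b0: "\<And>f. CL2 f \<Longrightarrow> Sq 0 (T f) \<le> A * Sq 0 f"
    and b2: "\<And>f f' f''. CL2 f \<Longrightarrow> CL2 f' \<Longrightarrow> CL2 f'' \<Longrightarrow> (\<And>x. (f has_real_derivative f' x) (at x)) \<Longrightarrow>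
      (\<And>x. (f' has_real_derivative f'' x) (at x)) \<Longrightarrow> Sq 2 (T f) \<le> A * Sq 2 f"
    and f: "CL2 f" and r: "0 < r" "r < 2"
  shows "Sq r (T f) \<le> A * Sq r f"
proof -
  note [measurable] = FT_measurable[OF f] FT_measurable[OF TC[OF f]]
  let ?k = "\<lambda>t x. ennreal (t * wt 2 x / (1 + t * wt 2 x))"
  have key: "(\<integral>\<^sup>+x. ?k t x * ennreal ((cmod (FT (T f) x))\<^sup>2) \<partial>lborel) \<le> A * (\<integral>\<^sup>+x. ?k t x * ennreal ((cmod (FT f x))\<^sup>2) \<partial>lborel)"
    if t: "t > 0" for t
  proof -
    obtain f1 f1' f1'' where f1: "CL2 f1" "CL2 f1'" "CL2 f1''"
      "\<And>x. (f1 has_real_derivative f1' x) (at x)" "\<And>x. (f1' has_real_derivative f1'' x) (at x)"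
      "ft (cx f1) (\<lambda>x. of_real (1 / (1 + t * wt 2 x)) * FT f x)" "Sq 4 f1 < \<infinity>"
      by (rule smooth_split[OF f t], rule that)
    let ?F1 = "\<lambda>x. of_real (1 / (1 + t * wt 2 x)) * FT f x"
    define f0 where "f0 = (\<lambda>x. f x - f1 x)"
    have f0: "CL2 f0" unfolding f0_def by (rule CL2_diff[OF f f1(1)])
    have ft0: "ft (cx f0) (\<lambda>x. FT f x - ?F1 x)"
      using ft_diff[OF ft_FT[OF f] f1(6)] by (simp add: f0_def)
    have Tf: "T f = (\<lambda>x. T f0 x + T f1 x)"
      using add[OF f0 f1(1)] by (simp add: f0_def)
    note T0 = TC[OF f0] and T1 = TC[OF f1(1)]
    note [measurable] = FT_measurable[OF T0] FT_measurable[OF T1]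
    have ae: "AE x in lborel. FT (T f) x = FT (T f0) x + FT (T f1) x"
      by (rule FT_eq[OF TC[OF f]]) (use ft_real_add[OF T0 T1] in \<open>simp add: Tf\<close>)
    have "(\<integral>\<^sup>+x. ?k t x * ennreal ((cmod (FT (T f) x))\<^sup>2) \<partial>lborel) \<le>
        (\<integral>\<^sup>+x. ennreal ((cmod (FT (T f0) x))\<^sup>2) + ennreal t * (ennreal (wt 2 x) * ennreal ((cmod (FT (T f1) x))\<^sup>2)) \<partial>lborel)"
    proof (rule nn_integral_mono_AE, use ae in eventually_elim)
      fix x assume e: "FT (T f) x = FT (T f0) x + FT (T f1) x"
      define a b \<kappa> where "a = cmod (FT (T f0) x)" "b = cmod (FT (T f1) x)" "\<kappa> = t * wt 2 x"
      have \<kappa>: "\<kappa> > 0" using t by (simp add: a_b_\<kappa>_def)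
      have "(cmod (FT (T f) x))\<^sup>2 \<le> (a + b)\<^sup>2" unfolding e a_b_\<kappa>_def by (intro power_mono norm_triangle_ineq) simp
      then have "\<kappa> / (1 + \<kappa>) * (cmod (FT (T f) x))\<^sup>2 \<le> \<kappa> / (1 + \<kappa>) * (a + b)\<^sup>2" using \<kappa> by (intro mult_left_mono) auto
      also have "\<dots> \<le> a\<^sup>2 + \<kappa> * b\<^sup>2"
      proof -
        \<comment> \<open>For a given sum \<open>a + b\<close> the least value of
          \<open>a\<^sup>2 + \<kappa> * b\<^sup>2\<close> is
          \<open>\<kappa> / (1 + \<kappa>) * (a + b)\<^sup>2\<close>, reached at
          \<open>a = \<kappa> * b\<close>.\<close>
        have "0 \<le> (a - \<kappa> * b)\<^sup>2" by simp
        then have "\<kappa> * (a + b)\<^sup>2 \<le> (a\<^sup>2 + \<kappa> * b\<^sup>2) * (1 + \<kappa>)" by (simp add: power2_eq_square algebra_simps)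
        then show ?thesis using \<kappa> by (simp add: pos_divide_le_eq)
      qed
      finally have "ennreal (\<kappa> / (1 + \<kappa>) * (cmod (FT (T f) x))\<^sup>2) \<le> ennreal (a\<^sup>2 + \<kappa> * b\<^sup>2)" by (rule ennreal_leI)
      moreover have "ennreal (\<kappa> / (1 + \<kappa>) * (cmod (FT (T f) x))\<^sup>2) = ennreal (\<kappa> / (1 + \<kappa>)) * ennreal ((cmod (FT (T f) x))\<^sup>2)"
        using \<kappa> by (intro ennreal_mult) auto
      moreover have "ennreal (a\<^sup>2 + \<kappa> * b\<^sup>2) = ennreal (a\<^sup>2) + ennreal (\<kappa> * b\<^sup>2)" using \<kappa> by (intro ennreal_plus) auto
      moreover have "ennreal (\<kappa> * b\<^sup>2) = ennreal t * (ennreal (wt 2 x) * ennreal (b\<^sup>2))"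
        using t by (simp add: a_b_\<kappa>_def ennreal_mult mult.assoc)
      ultimately show "?k t x * ennreal ((cmod (FT (T f) x))\<^sup>2) \<le> ennreal ((cmod (FT (T f0) x))\<^sup>2) + ennreal t * (ennreal (wt 2 x) * ennreal ((cmod (FT (T f1) x))\<^sup>2))"
        by (simp add: a_b_\<kappa>_def)
    qed
    also have "\<dots> = Sq 0 (T f0) + ennreal t * Sq 2 (T f1)"
      unfolding Sq_def Q_def by (subst nn_integral_add) (auto simp: nn_integral_cmult)
    also have "\<dots> \<le> A * Sq 0 f0 + ennreal t * (A * Sq 2 f1)"
      by (intro add_mono mult_left_mono b0 f0 b2[OF f1(1-5)]) auto
    also have "\<dots> = A * (Q 0 (\<lambda>x. FT f x - ?F1 x) + ennreal t * Q 2 ?F1)"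
      unfolding Sq_eqI[OF f0 ft0] Sq_eqI[OF f1(1,6)] by (simp only: distrib_left mult_ac)
    also have "Q 0 (\<lambda>x. FT f x - ?F1 x) + ennreal t * Q 2 ?F1 = (\<integral>\<^sup>+x. ?k t x * ennreal ((cmod (FT f x))\<^sup>2) \<partial>lborel)"
    proof -
      have "Q 0 (\<lambda>x. FT f x - ?F1 x) + ennreal t * Q 2 ?F1 = (\<integral>\<^sup>+x. ennreal ((cmod (FT f x - ?F1 x))\<^sup>2) + ennreal t * (ennreal (wt 2 x) * ennreal ((cmod (?F1 x))\<^sup>2)) \<partial>lborel)"
        unfolding Q_def by (subst nn_integral_add) (auto simp: nn_integral_cmult)
      also have "\<dots> = (\<integral>\<^sup>+x. ?k t x * ennreal ((cmod (FT f x))\<^sup>2) \<partial>lborel)"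
      proof (intro nn_integral_cong)
        fix x
        define \<kappa> where "\<kappa> = t * wt 2 x"
        have \<kappa>: "\<kappa> > 0" using t by (simp add: \<kappa>_def)
        have 1: "FT f x - ?F1 x = of_real (\<kappa> / (1 + \<kappa>)) * FT f x"
        proof -
          have "1 - 1 / (1 + \<kappa>) = \<kappa> / (1 + \<kappa>)" using \<kappa> by (simp add: field_simps)
          then have "of_real (\<kappa> / (1 + \<kappa>)) = (1 - of_real (1 / (1 + \<kappa>)) :: complex)" by (metis of_real_1 of_real_diff)
          then show ?thesis unfolding \<kappa>_def[symmetric] by (simp only: left_diff_distrib mult_1)
        qed
        have alg: "(\<kappa> / (1 + \<kappa>))\<^sup>2 + \<kappa> * (1 / (1 + \<kappa>))\<^sup>2 = \<kappa> / (1 + \<kappa>)"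
          using \<kappa> by (simp add: power2_eq_square divide_simps) (simp add: algebra_simps)
        define c where "c = (cmod (FT f x))\<^sup>2"
        have c0: "c \<ge> 0" by (simp add: c_def)
        have 2: "(cmod (FT f x - ?F1 x))\<^sup>2 = (\<kappa> / (1 + \<kappa>))\<^sup>2 * c"
          unfolding 1 c_def by (simp only: norm_mult power_mult_distrib norm_of_real power2_abs)
        have 3: "(cmod (?F1 x))\<^sup>2 = (1 / (1 + \<kappa>))\<^sup>2 * c"
          unfolding \<kappa>_def[symmetric] c_def by (simp only: norm_mult power_mult_distrib norm_of_real power2_abs)
        have "ennreal t * (ennreal (wt 2 x) * ennreal ((1 / (1 + \<kappa>))\<^sup>2 * c)) = ennreal (\<kappa> * (1 / (1 + \<kappa>))\<^sup>2 * c)"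
          using t c0 by (simp add: \<kappa>_def mult.assoc flip: ennreal_mult)
        then have "ennreal ((\<kappa> / (1 + \<kappa>))\<^sup>2 * c) + ennreal t * (ennreal (wt 2 x) * ennreal ((1 / (1 + \<kappa>))\<^sup>2 * c))
          = ennreal ((\<kappa> / (1 + \<kappa>))\<^sup>2 * c + \<kappa> * (1 / (1 + \<kappa>))\<^sup>2 * c)"
          using \<kappa> c0 by (simp add: ennreal_plus del: ennreal_plus_if)
        also have "(\<kappa> / (1 + \<kappa>))\<^sup>2 * c + \<kappa> * (1 / (1 + \<kappa>))\<^sup>2 * c = \<kappa> / (1 + \<kappa>) * c"
          unfolding distrib_right[symmetric] alg ..
        also have "ennreal (\<kappa> / (1 + \<kappa>) * c) = ennreal (\<kappa> / (1 + \<kappa>)) * ennreal c"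
          using \<kappa> c0 by (intro ennreal_mult) auto
        finally show "ennreal ((cmod (FT f x - ?F1 x))\<^sup>2) + ennreal t * (ennreal (wt 2 x) * ennreal ((cmod (?F1 x))\<^sup>2)) = ?k t x * ennreal ((cmod (FT f x))\<^sup>2)"
          unfolding 2 3 by (simp only: \<kappa>_def c_def)
      qed
      finally show ?thesis .
    qed
    finally show ?thesis .
  qed
  define \<theta> where "\<theta> = r / 2"
  have \<theta>: "0 < \<theta>" "\<theta> < 1" "2 * \<theta> = r" using r by (auto simp: \<theta>_def)
  let ?a = "\<lambda>t. ennreal (indicator {0<..} t * t powr (- \<theta> - 1))"
  have "(\<integral>\<^sup>+t. ?a t * (\<integral>\<^sup>+x. ?k t x * ennreal ((cmod (FT (T f) x))\<^sup>2) \<partial>lborel) \<partial>lborel)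
      \<le> (\<integral>\<^sup>+t. A * (?a t * (\<integral>\<^sup>+x. ?k t x * ennreal ((cmod (FT f x))\<^sup>2) \<partial>lborel)) \<partial>lborel)"
  proof (rule nn_integral_mono)
    fix t :: real
    show "?a t * (\<integral>\<^sup>+x. ?k t x * ennreal ((cmod (FT (T f) x))\<^sup>2) \<partial>lborel) \<le> A * (?a t * (\<integral>\<^sup>+x. ?k t x * ennreal ((cmod (FT f x))\<^sup>2) \<partial>lborel))"
    proof (cases "t > 0")
      case True
      from mult_left_mono[OF key[OF True], of "?a t"] show ?thesis by (simp add: mult.left_commute)
    qed simp
  qed
  also have "\<dots> = A * (\<integral>\<^sup>+t. ?a t * (\<integral>\<^sup>+x. ?k t x * ennreal ((cmod (FT f x))\<^sup>2) \<partial>lborel) \<partial>lborel)"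
    by (rule nn_integral_cmult) simp
  finally have le: "kint \<theta> * Sq r (T f) \<le> A * (kint \<theta> * Sq r f)"
    unfolding Q_tau_average[OF FT_measurable[OF f]] Q_tau_average[OF FT_measurable[OF TC[OF f]]] \<theta>(3) Sq_def .
  obtain c where c: "kint \<theta> = ennreal c" "c > 0"
    using kint_bounds[OF \<theta>(1,2)] by (cases "kint \<theta>") auto
  have "ennreal (1 / c) * (ennreal c * X) = X" for X using c by (simp add: mult.assoc[symmetric] flip: ennreal_mult)
  then show ?thesis
    using mult_left_mono[OF le, of "ennreal (1 / c)"] unfolding c(1) by (simp add: mult.left_commute)
qed

section \<open>Curves in Sobolev spaces\<close>

text \<open>Continuity of the curve \<open>\<phi>\<close> from \<open>I\<close> to \<open>H\<^sup>r\<close>.\<close>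

definition scont :: "real \<Rightarrow> real set \<Rightarrow> (real \<Rightarrow> real \<Rightarrow> real) \<Rightarrow> bool" where
  "scont r I \<phi> \<longleftrightarrow> (\<forall>t\<in>I. CL2 (\<phi> t) \<and> Sq r (\<phi> t) < \<infinity>) \<and>
     (\<forall>t\<in>I. ((\<lambda>\<tau>. Sq r (\<lambda>x. \<phi> \<tau> x - \<phi> t x)) \<longlongrightarrow> 0) (at t within I))"

lemma scontD:
  assumes "scont r I \<phi>" "t \<in> I"
  shows "CL2 (\<phi> t)" "Sq r (\<phi> t) < \<infinity>" "((\<lambda>\<tau>. Sq r (\<lambda>x. \<phi> \<tau> x - \<phi> t x)) \<longlongrightarrow> 0) (at t within I)"
  using assms by (auto simp: scont_def)

lemma ennreal_squeeze_0:
  fixes f g :: "'a \<Rightarrow> ennreal"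
  assumes "\<forall>\<^sub>F x in F. f x \<le> g x" "(g \<longlongrightarrow> 0) F"
  shows "(f \<longlongrightarrow> 0) F"
  by (rule tendsto_sandwich[OF _ assms(1) tendsto_const assms(2)]) simp

lemma ennreal_cmult_0:
  fixes f :: "'a \<Rightarrow> ennreal"
  assumes "(f \<longlongrightarrow> 0) F" "c < \<top>"
  shows "((\<lambda>x. c * f x) \<longlongrightarrow> 0) F" "((\<lambda>x. f x * c) \<longlongrightarrow> 0) F"
  using ennreal_tendsto_cmult[OF assms(2,1)] by (simp_all add: mult.commute)

lemma ennreal_add_0:
  fixes f g :: "'a \<Rightarrow> ennreal"
  assumes "(f \<longlongrightarrow> 0) F" "(g \<longlongrightarrow> 0) F"
  shows "((\<lambda>x. f x + g x) \<longlongrightarrow> 0) F"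
  using tendsto_add[OF assms] by simp

lemma eventually_within: "\<forall>\<^sub>F x in at t within I. x \<in> I"
  by (simp add: eventually_at_filter)

lemma scontI:
  assumes "\<And>t. t \<in> I \<Longrightarrow> CL2 (\<phi> t)" "\<And>t. t \<in> I \<Longrightarrow> Sq r (\<phi> t) < \<infinity>"
    and "\<And>t. t \<in> I \<Longrightarrow> ((\<lambda>\<tau>. Sq r (\<lambda>x. \<phi> \<tau> x - \<phi> t x)) \<longlongrightarrow> 0) (at t within I)"
  shows "scont r I \<phi>"
  using assms by (auto simp: scont_def)

lemma scont_mono:
  assumes "scont r I \<phi>" "r' \<le> r"
  shows "scont r' I \<phi>"
proof (rule scontI)
  fix t assume t: "t \<in> I"
  show "CL2 (\<phi> t)" using scontD[OF assms(1) t] by simp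
  show "Sq r' (\<phi> t) < \<infinity>" by (rule Sq_finite_mono[OF assms(2)]) (use scontD[OF assms(1) t] in simp)
  show "((\<lambda>\<tau>. Sq r' (\<lambda>x. \<phi> \<tau> x - \<phi> t x)) \<longlongrightarrow> 0) (at t within I)"
    by (rule ennreal_squeeze_0[OF always_eventually scontD(3)[OF assms(1) t]]) (intro allI Sq_mono assms)
qed

lemma scont_cong:
  assumes "scont r I \<phi>" "\<And>t x. t \<in> I \<Longrightarrow> \<psi> t x = \<phi> t x"
  shows "scont r I \<psi>"
proof (rule scontI)
  fix t assume t: "t \<in> I"
  have e: "\<psi> t = \<phi> t" if "t \<in> I" for t using assms(2)[OF that] by blast
  show "CL2 (\<psi> t)" "Sq r (\<psi> t) < \<infinity>" using scontD[OF assms(1) t] e[OF t] by simp_all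
  show "((\<lambda>\<tau>. Sq r (\<lambda>x. \<psi> \<tau> x - \<psi> t x)) \<longlongrightarrow> 0) (at t within I)"
    by (rule ennreal_squeeze_0[OF _ scontD(3)[OF assms(1) t]])
      (use eventually_within[of I t] in eventually_elim, simp add: e t)
qed

lemma scont_const: "CL2 f \<Longrightarrow> Sq r f < \<infinity> \<Longrightarrow> scont r I (\<lambda>t. f)"
  using Sq_cmult[OF CL2_zero, of r 0] by (intro scontI) simp_all

lemma scont_add:
  assumes a: "scont r I \<phi>" and b: "scont r I \<psi>"
  shows "scont r I (\<lambda>t x. \<phi> t x + \<psi> t x)"
proof (rule scontI)
  fix t assume t: "t \<in> I"
  note at = scontD[OF a t] and bt = scontD[OF b t]
  show "CL2 (\<lambda>x. \<phi> t x + \<psi> t x)" by (rule CL2_add[OF at(1) bt(1)])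
  show "Sq r (\<lambda>x. \<phi> t x + \<psi> t x) < \<infinity>" by (rule Sq_add_finite[OF at(1) bt(1) at(2) bt(2)])
  show "((\<lambda>\<tau>. Sq r (\<lambda>x. \<phi> \<tau> x + \<psi> \<tau> x - (\<phi> t x + \<psi> t x))) \<longlongrightarrow> 0) (at t within I)"
  proof (rule ennreal_squeeze_0)
    show "\<forall>\<^sub>F \<tau> in at t within I. Sq r (\<lambda>x. \<phi> \<tau> x + \<psi> \<tau> x - (\<phi> t x + \<psi> t x)) \<le>
        2 * Sq r (\<lambda>x. \<phi> \<tau> x - \<phi> t x) + 2 * Sq r (\<lambda>x. \<psi> \<tau> x - \<psi> t x)"
      using eventually_within[of I t]
    proof eventually_elim
      fix \<tau> assume "\<tau> \<in> I"
      then show "Sq r (\<lambda>x. \<phi> \<tau> x + \<psi> \<tau> x - (\<phi> t x + \<psi> t x)) \<le> 2 * Sq r (\<lambda>x. \<phi> \<tau> x - \<phi> t x) + 2 * Sq r (\<lambda>x. \<psi> \<tau> x - \<psi> t x)"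
        using Sq_add[of "\<lambda>x. \<phi> \<tau> x - \<phi> t x" "\<lambda>x. \<psi> \<tau> x - \<psi> t x" r] t scontD(1)[OF a] scontD(1)[OF b]
        by (simp add: CL2_diff add_diff_add)
    qed
    show "((\<lambda>\<tau>. 2 * Sq r (\<lambda>x. \<phi> \<tau> x - \<phi> t x) + 2 * Sq r (\<lambda>x. \<psi> \<tau> x - \<psi> t x)) \<longlongrightarrow> 0) (at t within I)"
      by (intro ennreal_add_0 ennreal_cmult_0 scontD(3)[OF a t] scontD(3)[OF b t]) simp_all
  qed
qed

text \<open>The increment of the product is expanded around the fixed time \<open>t\<close> as da db
  + da \<psi> + \<phi> db, so that only values at \<open>t\<close> occur as constant factors and the
  remaining factors tend to zero.\<close>

lemma scont_mult:
  assumes a: "scont r I \<phi>" and b: "scont r I \<psi>" and r: "r > 1/2"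
  shows "scont r I (\<lambda>t x. \<phi> t x * \<psi> t x)"
proof (rule scontI)
  fix t assume t: "t \<in> I"
  note at = scontD[OF a t] and bt = scontD[OF b t]
  show "CL2 (\<lambda>x. \<phi> t x * \<psi> t x)" "Sq r (\<lambda>x. \<phi> t x * \<psi> t x) < \<infinity>"
    by (rule Sq_mult[OF at(1,2) bt(1,2) r])+
  let ?da = "\<lambda>\<tau> x. \<phi> \<tau> x - \<phi> t x" and ?db = "\<lambda>\<tau> x. \<psi> \<tau> x - \<psi> t x"
  let ?K = "Kalg r"
  have K: "?K < \<top>" using Kalg_finite[OF r] by simp
  show "((\<lambda>\<tau>. Sq r (\<lambda>x. \<phi> \<tau> x * \<psi> \<tau> x - \<phi> t x * \<psi> t x)) \<longlongrightarrow> 0) (at t within I)"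
  proof (rule ennreal_squeeze_0)
    show "\<forall>\<^sub>F \<tau> in at t within I. Sq r (\<lambda>x. \<phi> \<tau> x * \<psi> \<tau> x - \<phi> t x * \<psi> t x) \<le>
        2 * (2 * (?K * (Sq r (?da \<tau>) * Sq r (?db \<tau>))) + 2 * (?K * (Sq r (?da \<tau>) * Sq r (\<psi> t)))) + 2 * (?K * (Sq r (\<phi> t) * Sq r (?db \<tau>)))"
      using eventually_within[of I t]
    proof eventually_elim
      fix \<tau> assume \<tau>: "\<tau> \<in> I"
      note a\<tau> = scontD[OF a \<tau>] and b\<tau> = scontD[OF b \<tau>]
      have da: "CL2 (?da \<tau>)" "Sq r (?da \<tau>) < \<infinity>" and db: "CL2 (?db \<tau>)" "Sq r (?db \<tau>) < \<infinity>"
        using at a\<tau> bt b\<tau> by (auto intro!: CL2_diff le_less_trans[OF Sq_diff] simp: ennreal_mult_less_top)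
      note m1 = Sq_mult[OF da db r] and m2 = Sq_mult[OF da bt(1,2) r] and m3 = Sq_mult[OF at(1,2) db r]
      have e: "(\<lambda>x. \<phi> \<tau> x * \<psi> \<tau> x - \<phi> t x * \<psi> t x) = (\<lambda>x. (?da \<tau> x * ?db \<tau> x + ?da \<tau> x * \<psi> t x) + \<phi> t x * ?db \<tau> x)"
        by (simp add: fun_eq_iff algebra_simps)
      have "Sq r (\<lambda>x. \<phi> \<tau> x * \<psi> \<tau> x - \<phi> t x * \<psi> t x) \<le> 2 * Sq r (\<lambda>x. ?da \<tau> x * ?db \<tau> x + ?da \<tau> x * \<psi> t x) + 2 * Sq r (\<lambda>x. \<phi> t x * ?db \<tau> x)"
        unfolding e by (rule Sq_add[OF CL2_add[OF m1(1) m2(1)] m3(1)])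
      also have "\<dots> \<le> 2 * (2 * Sq r (\<lambda>x. ?da \<tau> x * ?db \<tau> x) + 2 * Sq r (\<lambda>x. ?da \<tau> x * \<psi> t x)) + 2 * Sq r (\<lambda>x. \<phi> t x * ?db \<tau> x)"
        by (intro add_mono mult_left_mono Sq_add m1 m2) simp_all
      also have "\<dots> \<le> 2 * (2 * (?K * (Sq r (?da \<tau>) * Sq r (?db \<tau>))) + 2 * (?K * (Sq r (?da \<tau>) * Sq r (\<psi> t)))) + 2 * (?K * (Sq r (\<phi> t) * Sq r (?db \<tau>)))"
        by (intro add_mono mult_left_mono m1 m2 m3) simp_all
      finally show "Sq r (\<lambda>x. \<phi> \<tau> x * \<psi> \<tau> x - \<phi> t x * \<psi> t x) \<le> \<dots>" .
    qed
    have dd: "((\<lambda>\<tau>. Sq r (?da \<tau>) * Sq r (?db \<tau>)) \<longlongrightarrow> 0) (at t within I)"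
      using tendsto_mult_ennreal[OF at(3) bt(3)] by simp
    show "((\<lambda>\<tau>. 2 * (2 * (?K * (Sq r (?da \<tau>) * Sq r (?db \<tau>))) + 2 * (?K * (Sq r (?da \<tau>) * Sq r (\<psi> t)))) + 2 * (?K * (Sq r (\<phi> t) * Sq r (?db \<tau>)))) \<longlongrightarrow> 0) (at t within I)"
      using at bt K by (intro ennreal_add_0 ennreal_cmult_0 dd) simp_all
  qed
qed

lemma scont_scalar:
  assumes a: "scont r I \<phi>" and c: "continuous_on I c"
  shows "scont r I (\<lambda>t x. c t * \<phi> t x)"
proof (rule scontI)
  fix t assume t: "t \<in> I"
  note at = scontD[OF a t]
  show "CL2 (\<lambda>x. c t * \<phi> t x)" by (rule CL2_cmult[OF at(1)])
  show "Sq r (\<lambda>x. c t * \<phi> t x) < \<infinity>" using at by (simp add: Sq_cmult ennreal_mult_less_top)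
  have ct: "(c \<longlongrightarrow> c t) (at t within I)" using c t by (simp add: continuous_on_def)
  show "((\<lambda>\<tau>. Sq r (\<lambda>x. c \<tau> * \<phi> \<tau> x - c t * \<phi> t x)) \<longlongrightarrow> 0) (at t within I)"
  proof (rule ennreal_squeeze_0)
    show "\<forall>\<^sub>F \<tau> in at t within I. Sq r (\<lambda>x. c \<tau> * \<phi> \<tau> x - c t * \<phi> t x) \<le>
        2 * (ennreal ((c \<tau>)\<^sup>2) * Sq r (\<lambda>x. \<phi> \<tau> x - \<phi> t x)) + 2 * (ennreal ((c \<tau> - c t)\<^sup>2) * Sq r (\<phi> t))"
      using eventually_within[of I t]
    proof eventually_elim
      fix \<tau> assume \<tau>: "\<tau> \<in> I"
      have d: "CL2 (\<lambda>x. \<phi> \<tau> x - \<phi> t x)" by (rule CL2_diff[OF scontD(1)[OF a \<tau>] at(1)])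
      have e: "(\<lambda>x. c \<tau> * \<phi> \<tau> x - c t * \<phi> t x) = (\<lambda>x. c \<tau> * (\<phi> \<tau> x - \<phi> t x) + (c \<tau> - c t) * \<phi> t x)"
        by (simp add: fun_eq_iff algebra_simps)
      show "Sq r (\<lambda>x. c \<tau> * \<phi> \<tau> x - c t * \<phi> t x) \<le>
        2 * (ennreal ((c \<tau>)\<^sup>2) * Sq r (\<lambda>x. \<phi> \<tau> x - \<phi> t x)) + 2 * (ennreal ((c \<tau> - c t)\<^sup>2) * Sq r (\<phi> t))"
        unfolding e Sq_cmult[OF d, symmetric] Sq_cmult[OF at(1), symmetric]
        by (rule Sq_add[OF CL2_cmult[OF d] CL2_cmult[OF at(1)]])
    qed
    have 1: "((\<lambda>\<tau>. ennreal ((c \<tau>)\<^sup>2) * Sq r (\<lambda>x. \<phi> \<tau> x - \<phi> t x)) \<longlongrightarrow> ennreal ((c t)\<^sup>2) * 0) (at t within I)"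
      by (intro tendsto_mult_ennreal tendsto_ennrealI tendsto_intros ct at(3)) simp
    have "((\<lambda>\<tau>. (c \<tau> - c t)\<^sup>2) \<longlongrightarrow> (c t - c t)\<^sup>2) (at t within I)" by (intro tendsto_intros ct)
    then have "((\<lambda>\<tau>. ennreal ((c \<tau> - c t)\<^sup>2)) \<longlongrightarrow> ennreal 0) (at t within I)" by (intro tendsto_ennrealI) simp
    then have 2: "((\<lambda>\<tau>. ennreal ((c \<tau> - c t)\<^sup>2)) \<longlongrightarrow> 0) (at t within I)" by simp
    show "((\<lambda>\<tau>. 2 * (ennreal ((c \<tau>)\<^sup>2) * Sq r (\<lambda>x. \<phi> \<tau> x - \<phi> t x)) + 2 * (ennreal ((c \<tau> - c t)\<^sup>2) * Sq r (\<phi> t))) \<longlongrightarrow> 0) (at t within I)"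
      using 1 at by (intro ennreal_add_0 ennreal_cmult_0 2) simp_all
  qed
qed

lemma scont_cmult: "scont r I \<phi> \<Longrightarrow> scont r I (\<lambda>t x. c * \<phi> t x)"
  by (rule scont_scalar[OF _ continuous_on_const])

text \<open>Together with its converse \<open>scont_deriv\<close> this trades one order of
  regularity for one classical derivative; the inductions on the order below all step through
  it.\<close>

lemma scont_Suc:
  assumes a: "scont r I \<phi>" and b: "scont r I \<phi>'"
    and d: "\<And>t x. t \<in> I \<Longrightarrow> (\<phi> t has_real_derivative \<phi>' t x) (at x)"
  shows "scont (r + 1) I \<phi>"
proof (rule scontI)
  fix t assume t: "t \<in> I"
  note at = scontD[OF a t] and bt = scontD[OF b t]
  show "CL2 (\<phi> t)" by fact
  show "Sq (r + 1) (\<phi> t) < \<infinity>" using at bt by (simp add: Sq_Suc[OF at(1) bt(1) d[OF t]])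
  show "((\<lambda>\<tau>. Sq (r + 1) (\<lambda>x. \<phi> \<tau> x - \<phi> t x)) \<longlongrightarrow> 0) (at t within I)"
  proof (rule ennreal_squeeze_0[OF _ ennreal_add_0[OF at(3) bt(3)]], use eventually_within[of I t] in eventually_elim)
    fix \<tau> assume \<tau>: "\<tau> \<in> I"
    show "Sq (r + 1) (\<lambda>x. \<phi> \<tau> x - \<phi> t x) \<le> Sq r (\<lambda>x. \<phi> \<tau> x - \<phi> t x) + Sq r (\<lambda>x. \<phi>' \<tau> x - \<phi>' t x)"
      by (rule eq_refl, rule Sq_Suc[OF CL2_diff[OF scontD(1)[OF a \<tau>] at(1)] CL2_diff[OF scontD(1)[OF b \<tau>] bt(1)]])
        (intro DERIV_diff d t \<tau>)
  qed
qed

lemma scont_deriv: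
  assumes a: "scont (r + 1) I \<phi>" and c: "\<And>t. t \<in> I \<Longrightarrow> CL2 (\<phi>' t)"
    and d: "\<And>t x. t \<in> I \<Longrightarrow> (\<phi> t has_real_derivative \<phi>' t x) (at x)"
  shows "scont r I \<phi>'"
proof (rule scontI)
  fix t assume t: "t \<in> I"
  note at = scontD[OF a t]
  show "CL2 (\<phi>' t)" by (rule c[OF t])
  have "Sq r (\<phi>' t) \<le> Sq (r + 1) (\<phi> t)" by (simp add: Sq_Suc[OF at(1) c[OF t] d[OF t]])
  then show "Sq r (\<phi>' t) < \<infinity>" using at(2) by (rule le_less_trans)
  show "((\<lambda>\<tau>. Sq r (\<lambda>x. \<phi>' \<tau> x - \<phi>' t x)) \<longlongrightarrow> 0) (at t within I)"
  proof (rule ennreal_squeeze_0[OF _ at(3)], use eventually_within[of I t] in eventually_elim)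
    fix \<tau> assume \<tau>: "\<tau> \<in> I"
    have "Sq (r + 1) (\<lambda>x. \<phi> \<tau> x - \<phi> t x) = Sq r (\<lambda>x. \<phi> \<tau> x - \<phi> t x) + Sq r (\<lambda>x. \<phi>' \<tau> x - \<phi>' t x)"
      by (rule Sq_Suc[OF CL2_diff[OF scontD(1)[OF a \<tau>] at(1)] CL2_diff[OF c[OF \<tau>] c[OF t]]])
        (intro DERIV_diff d t \<tau>)
    then show "Sq r (\<lambda>x. \<phi>' \<tau> x - \<phi>' t x) \<le> Sq (r + 1) (\<lambda>x. \<phi> \<tau> x - \<phi> t x)" by simp
  qed
qed

text \<open>The binomial expansion of \<open>wt 2\<close>, read as a statement about derivatives: it
  reduces bounds in \<open>H\<^sup>2\<close> to bounds in \<open>L\<^sup>2\<close>.\<close>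

lemma Sq_2:
  assumes f: "CL2 f" "CL2 f'" "CL2 f''" "\<And>x. (f has_real_derivative f' x) (at x)" "\<And>x. (f' has_real_derivative f'' x) (at x)"
  shows "Sq 2 f = Sq 0 f + 2 * Sq 0 f' + Sq 0 f''"
  using Sq_Suc[OF f(1,2,4), of 0] Sq_Suc[OF f(1,2,4), of 1] Sq_Suc[OF f(2,3,5), of 0] by (simp add: mult_2 add_ac)

lemma Sq_0_mult_bounded:
  assumes a: "continuous_on UNIV a" "\<And>x. \<bar>a x\<bar> \<le> K" and f: "CL2 f"
  shows "CL2 (\<lambda>x. a x * f x)" "Sq 0 (\<lambda>x. a x * f x) \<le> ennreal (K\<^sup>2) * Sq 0 f"
proof -
  show c: "CL2 (\<lambda>x. a x * f x)" by (rule CL2_mult_bounded[OF a f])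
  note [measurable] = CL2_measurable[OF f]
  show "Sq 0 (\<lambda>x. a x * f x) \<le> ennreal (K\<^sup>2) * Sq 0 f"
    unfolding Sq_0[OF c] Sq_0[OF f] sqn_def
  proof (subst nn_integral_cmult[symmetric], simp, intro nn_integral_mono)
    fix x
    have "\<bar>a x\<bar>\<^sup>2 \<le> K\<^sup>2" by (intro power_mono a) simp
    then have "(a x)\<^sup>2 * (f x)\<^sup>2 \<le> K\<^sup>2 * (f x)\<^sup>2" by (intro mult_right_mono) auto
    then show "ennreal ((cmod (cx (\<lambda>x. a x * f x) x))\<^sup>2) \<le> ennreal (K\<^sup>2) * ennreal ((cmod (cx f x))\<^sup>2)"
      by (simp add: norm_mult power_mult_distrib flip: ennreal_mult)
  qed
qed

section \<open>Composition with the inverse of a flow\<close>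

lemma Lipschitz_inverse:
  fixes q :: "real \<Rightarrow> real"
  assumes d: "\<And>y. (q has_real_derivative qx y) (at y)" and 1: "\<And>y. 1 \<le> qx y" and qp: "\<And>x. q (p x) = x"
  shows "\<bar>p x - p y\<bar> \<le> \<bar>x - y\<bar>" "continuous_on UNIV p" "x \<le> y \<Longrightarrow> q x \<le> q y"
    "a \<le> b \<Longrightarrow> b - a \<le> q b - q a"
proof -
  have *: "b - a \<le> q b - q a" if ab: "a \<le> b" for a b
  proof (cases "a = b")
    case False
    then obtain z where "q b - q a = (b - a) * qx z" using MVT2[of a b q qx] d ab by auto
    moreover have "(b - a) * 1 \<le> (b - a) * qx z" using ab 1 by (intro mult_left_mono) auto
    ultimately show ?thesis by simp
  qed simp
  show "a \<le> b \<Longrightarrow> b - a \<le> q b - q a" by (rule *)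
  show "x \<le> y \<Longrightarrow> q x \<le> q y" using *[of x y] by simp
  show l: "\<bar>p x - p y\<bar> \<le> \<bar>x - y\<bar>" for x y
    using *[of "p x" "p y"] *[of "p y" "p x"] by (cases "p x \<le> p y") (auto simp: qp)
  show "continuous_on UNIV p"
    unfolding continuous_on_iff dist_real_def
  proof (intro ballI allI impI)
    fix x e :: real assume "e > 0"
    then show "\<exists>d>0. \<forall>x'\<in>UNIV. \<bar>x' - x\<bar> < d \<longrightarrow> \<bar>p x' - p x\<bar> < e"
      using l by (intro exI[of _ e]) (auto intro: le_less_trans)
  qed
qed

text \<open>Substitution on compact intervals and monotone convergence; the image intervals exhaust
  the line because \<open>q\<close> is increasing and onto.\<close>

lemma nn_integral_subst_UNIV:
  fixes q :: "real \<Rightarrow> real" and F :: "real \<Rightarrow> ennreal"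
  assumes d: "\<And>y. (q has_real_derivative qx y) (at y)" and c: "continuous_on UNIV qx" and 1: "\<And>y. 1 \<le> qx y"
    and qp: "\<And>x. q (p x) = x" and pq: "\<And>y. p (q y) = y" and [measurable]: "F \<in> borel_measurable borel"
  shows "(\<integral>\<^sup>+x. F (p x) \<partial>lborel) = (\<integral>\<^sup>+y. F y * ennreal (qx y) \<partial>lborel)"
proof -
  note L = Lipschitz_inverse[OF d 1 qp]
  have [measurable]: "p \<in> borel_measurable borel" "qx \<in> borel_measurable borel"
    using L(2) c by (auto intro: borel_measurable_continuous_onI)
  have eq: "(\<integral>\<^sup>+x. F (p x) * indicator {q (- real (Suc n))..q (real (Suc n))} x \<partial>lborel)
      = (\<integral>\<^sup>+y. F y * ennreal (qx y) * indicator {- real (Suc n)..real (Suc n)} y \<partial>lborel)" for n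
    using nn_integral_substitution_aux[of "\<lambda>x. F (p x)" "- real (Suc n)" "real (Suc n)" q qx] d c 1 order_trans[OF zero_le_one 1]
    by (simp add: pq continuous_on_subset)
  have "(\<lambda>n. \<integral>\<^sup>+x. F (p x) * indicator {q (- real (Suc n))..q (real (Suc n))} x \<partial>lborel) \<longlonglongrightarrow> (\<integral>\<^sup>+x. F (p x) \<partial>lborel)"
  proof (rule nn_integral_LIMSEQ)
    have "q (- real (Suc (Suc n))) \<le> q (- real (Suc n))" "q (real (Suc n)) \<le> q (real (Suc (Suc n)))" for n
      by (rule L(3), simp)+
    then show "incseq (\<lambda>n x. F (p x) * indicator {q (- real (Suc n))..q (real (Suc n))} x)"
      by (intro incseq_SucI le_funI mult_left_mono) (auto simp: indicator_def intro: order_trans simp del: of_nat_Suc)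
    fix x
    obtain k where k: "\<bar>p x\<bar> \<le> real k" using real_arch_simple by blast
    show "(\<lambda>n. F (p x) * indicator {q (- real (Suc n))..q (real (Suc n))} x) \<longlonglongrightarrow> F (p x)"
    proof (rule tendsto_eventually, rule eventually_sequentiallyI[of k])
      fix n assume "k \<le> n"
      then have "- real (Suc n) \<le> p x" "p x \<le> real (Suc n)" using k by auto
      then have "q (- real (Suc n)) \<le> q (p x)" "q (p x) \<le> q (real (Suc n))" by (blast intro: L(3))+
      then show "F (p x) * indicator {q (- real (Suc n))..q (real (Suc n))} x = F (p x)" by (simp add: qp)
    qed
  qed simp
  moreover have "(\<lambda>n. \<integral>\<^sup>+y. F y * ennreal (qx y) * indicator {- real (Suc n)..real (Suc n)} y \<partial>lborel) \<longlonglongrightarrow> (\<integral>\<^sup>+y. F y * ennreal (qx y) \<partial>lborel)"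
  proof (rule nn_integral_LIMSEQ)
    show "incseq (\<lambda>n y. F y * ennreal (qx y) * indicator {- real (Suc n)..real (Suc n)} y)"
      by (intro incseq_SucI le_funI mult_left_mono) (auto simp: indicator_def)
    fix x
    obtain k where k: "\<bar>x\<bar> \<le> real k" using real_arch_simple by blast
    show "(\<lambda>n. F x * ennreal (qx x) * indicator {- real (Suc n)..real (Suc n)} x) \<longlonglongrightarrow> F x * ennreal (qx x)"
    proof (rule tendsto_eventually, rule eventually_sequentiallyI[of k])
      fix n assume "k \<le> n"
      then have "x \<in> {- real (Suc n)..real (Suc n)}" using k by auto
      then show "F x * ennreal (qx x) * indicator {- real (Suc n)..real (Suc n)} x = F x * ennreal (qx x)" by simp
    qed
  qed simp
  ultimately show ?thesis unfolding eq by (rule LIMSEQ_unique)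
qed

text \<open>The window on the right is centred at \<open>b\<close> and depends on \<open>a\<close>
  only through \<delta>, so that in \<open>comp_diff_small\<close> the bound can be integrated over
  the position with the order of integration exchanged.\<close>

lemma FTC_Cauchy_Schwarz:
  fixes f :: "real \<Rightarrow> real"
  assumes d: "\<And>x. (f has_real_derivative f' x) (at x)" and c: "continuous_on UNIV f'" and ab: "\<bar>a - b\<bar> \<le> \<delta>"
  shows "ennreal ((f a - f b)\<^sup>2) \<le> ennreal \<delta> * (\<integral>\<^sup>+y. ennreal ((f' y)\<^sup>2) * indicator {b - \<delta>..b + \<delta>} y \<partial>lborel)"
proof -
  define l u where "l = min a b" "u = max a b"
  have lu: "l \<le> u" "u - l \<le> \<delta>" "{l..u} \<subseteq> {b - \<delta>..b + \<delta>}" using ab by (auto simp: l_u_def)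
  have [measurable]: "f' \<in> borel_measurable borel" using c by (rule borel_measurable_continuous_onI)
  have "(LINT y|lborel. indicator {l..u} y *\<^sub>R f' y) = f u - f l"
    by (rule integral_FTC_atLeastAtMost[OF lu(1)])
      (use d c in \<open>auto simp: has_real_derivative_iff_has_vector_derivative intro: has_vector_derivative_at_within continuous_on_subset\<close>)
  moreover have "integrable lborel (\<lambda>y. indicator {l..u} y *\<^sub>R f' y)"
    using borel_integrable_atLeastAtMost'[of l u f'] c by (simp add: set_integrable_def continuous_on_subset)
  ultimately have "ennreal \<bar>f u - f l\<bar> \<le> (\<integral>\<^sup>+y. ennreal (norm (indicator {l..u} y *\<^sub>R f' y)) \<partial>lborel)"
    using integral_norm_bound_ennreal[of lborel "\<lambda>y. indicator {l..u} y *\<^sub>R f' y"] by simp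
  also have "\<dots> = (\<integral>\<^sup>+y. indicator {l..u} y * (ennreal \<bar>f' y\<bar> * indicator {l..u} y) \<partial>lborel)"
    by (intro nn_integral_cong) (auto simp: indicator_def)
  finally have "(ennreal \<bar>f u - f l\<bar>)\<^sup>2 \<le> (\<integral>\<^sup>+y. indicator {l..u} y * (ennreal \<bar>f' y\<bar> * indicator {l..u} y) \<partial>lborel)\<^sup>2"
    by (rule power_mono) simp
  also have "\<dots> \<le> (\<integral>\<^sup>+y. (indicator {l..u} y)\<^sup>2 \<partial>lborel) * (\<integral>\<^sup>+y. (ennreal \<bar>f' y\<bar> * indicator {l..u} y)\<^sup>2 \<partial>lborel)"
    by (rule Cauchy_Schwarz_nn_integral) auto
  also have "(\<integral>\<^sup>+y. (indicator {l..u} y)\<^sup>2 \<partial>lborel) = (\<integral>\<^sup>+y. indicator {l..u} y \<partial>lborel)"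
    by (intro nn_integral_cong) (auto simp: indicator_def)
  also have "\<dots> = ennreal (u - l)" using lu by (simp add: emeasure_lborel_Icc)
  also have "ennreal (u - l) * (\<integral>\<^sup>+y. (ennreal \<bar>f' y\<bar> * indicator {l..u} y)\<^sup>2 \<partial>lborel)
     \<le> ennreal \<delta> * (\<integral>\<^sup>+y. ennreal ((f' y)\<^sup>2) * indicator {b - \<delta>..b + \<delta>} y \<partial>lborel)"
    using lu by (intro mult_mono ennreal_leI nn_integral_mono) (auto simp: indicator_def ennreal_power)
  also have "(ennreal \<bar>f u - f l\<bar>)\<^sup>2 = ennreal ((f a - f b)\<^sup>2)"
    by (auto simp: l_u_def ennreal_power min_def max_def power2_commute)
  finally show ?thesis .
qed

text \<open>The smooth parts from \<open>smooth_split\<close> with \<open>t\<close> tending to zero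
  are dense: their multipliers increase to 1, and dominated convergence on the transform side serves
  every order \<open>r\<close> at once.\<close>

lemma smooth_approx:
  assumes f: "CL2 f" and fin: "Sq r f < \<infinity>" and e: "e > 0"
  obtains f1 f1' f1'' where "CL2 f1" "CL2 f1'" "CL2 f1''"
    "\<And>x. (f1 has_real_derivative f1' x) (at x)" "\<And>x. (f1' has_real_derivative f1'' x) (at x)"
    "Sq 4 f1 < \<infinity>" "Sq r (\<lambda>x. f x - f1 x) \<le> ennreal e"
proof -
  note [measurable] = FT_measurable[OF f]
  define t where "t = (\<lambda>n. inverse (real (Suc n)))"
  have t0: "t n > 0" for n by (simp add: t_def)
  have tl: "t \<longlonglongrightarrow> 0" unfolding t_def by (rule LIMSEQ_inverse_real_of_nat)
  let ?R = "\<lambda>n x. FT f x - of_real (1 / (1 + t n * wt 2 x)) * FT f x"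
  have "(\<lambda>n. Q r (?R n)) \<longlonglongrightarrow> (\<integral>\<^sup>+x. 0 \<partial>(lborel::real measure))"
    unfolding Q_def
  proof (rule nn_integral_dominated_convergence[where w="\<lambda>x. ennreal (wt r x) * ennreal ((cmod (FT f x))\<^sup>2)"])
    have c: "?R n x = of_real (t n * wt 2 x / (1 + t n * wt 2 x)) * FT f x" for n x
    proof -
      have "1 + t n * wt 2 x > 0" using t0[of n] by (simp add: add_pos_pos)
      then have "t n * wt 2 x / (1 + t n * wt 2 x) = 1 - 1 / (1 + t n * wt 2 x)" by (simp add: field_simps)
      then show ?thesis by (simp add: left_diff_distrib)
    qed
    show "AE x in lborel. ennreal (wt r x) * ennreal ((cmod (?R n x))\<^sup>2) \<le> ennreal (wt r x) * ennreal ((cmod (FT f x))\<^sup>2)" for n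
    proof (intro AE_I2 mult_left_mono ennreal_leI power_mono)
      fix x
      have "\<bar>t n * wt 2 x / (1 + t n * wt 2 x)\<bar> \<le> 1" using t0[of n] by (simp add: add_pos_pos)
      from mult_right_mono[OF this, of "cmod (FT f x)"] show "cmod (?R n x) \<le> cmod (FT f x)"
        unfolding c norm_mult norm_of_real by simp
    qed simp_all
    show "AE x in lborel. (\<lambda>n. ennreal (wt r x) * ennreal ((cmod (?R n x))\<^sup>2)) \<longlonglongrightarrow> 0"
    proof (rule AE_I2)
      fix x
      have "(\<lambda>n. (cmod (?R n x))\<^sup>2) \<longlonglongrightarrow> (cmod (FT f x - of_real (1 / (1 + 0 * wt 2 x)) * FT f x))\<^sup>2"
        by (intro tendsto_intros tl) simp
      then have "(\<lambda>n. ennreal ((cmod (?R n x))\<^sup>2)) \<longlonglongrightarrow> ennreal 0" by (intro tendsto_ennrealI) simp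
      then show "(\<lambda>n. ennreal (wt r x) * ennreal ((cmod (?R n x))\<^sup>2)) \<longlonglongrightarrow> 0"
        by (intro ennreal_cmult_0) simp_all
    qed
    show "(\<integral>\<^sup>+x. ennreal (wt r x) * ennreal ((cmod (FT f x))\<^sup>2) \<partial>lborel) < \<infinity>"
      using fin by (simp add: Sq_def Q_def)
  qed simp_all
  then have "\<forall>\<^sub>F n in sequentially. Q r (?R n) < ennreal e" using e by (intro order_tendstoD) auto
  then obtain n where n: "Q r (?R n) < ennreal e" by (auto simp: eventually_sequentially)
  obtain f1 f1' f1'' where f1: "CL2 f1" "CL2 f1'" "CL2 f1''"
      "\<And>x. (f1 has_real_derivative f1' x) (at x)" "\<And>x. (f1' has_real_derivative f1'' x) (at x)"
      "ft (cx f1) (\<lambda>x. of_real (1 / (1 + t n * wt 2 x)) * FT f x)" "Sq 4 f1 < \<infinity>"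
      by (rule smooth_split[OF f t0[of n]], rule that)
  have "ft (cx (\<lambda>x. f x - f1 x)) (?R n)" using ft_diff[OF ft_FT[OF f] f1(6)] by simp
  then have "Sq r (\<lambda>x. f x - f1 x) = Q r (?R n)" by (rule Sq_eqI[OF CL2_diff[OF f f1(1)]])
  then have "Sq r (\<lambda>x. f x - f1 x) \<le> ennreal e" using n by simp
  then show ?thesis by (rule that[OF f1(1-5,7)])
qed

lemma wt_interpolate:
  assumes r: "0 < r" "r < 2" and d: "d > 0"
  shows "\<exists>C>0. \<forall>x. wt r x \<le> d * wt 2 x + C"
proof -
  \<comment> \<open>Chosen so that \<open>R powr (r - 2) = d\<close>. Where
    \<open>1 + x\<^sup>2\<close> is at least \<open>R\<close>, the lower weight is absorbed by
    \<open>d * wt 2 x\<close>; elsewhere it is at most \<open>R powr r\<close>.\<close>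
  define R where "R = d powr (- 1 / (2 - r))"
  have "wt r x \<le> d * wt 2 x + R powr r" for x
  proof (cases "1 + x\<^sup>2 \<ge> R")
    case True
    have p: "0 < 1 + x\<^sup>2" by (rule one_plus_sq_pos)
    have "(1 + x\<^sup>2) powr (r - 2) \<le> R powr (r - 2)"
      using True r d by (intro powr_mono2') (auto simp: R_def)
    also have "R powr (r - 2) = d"
    proof -
      have "- 1 / (2 - r) * (r - 2) = 1" using r by (simp add: field_simps)
      then show ?thesis using d unfolding R_def powr_powr by simp
    qed
    finally have "(1 + x\<^sup>2) powr (r - 2) * (1 + x\<^sup>2) powr 2 \<le> d * (1 + x\<^sup>2) powr 2" by (rule mult_right_mono) simp
    then have "wt r x \<le> d * wt 2 x" unfolding wt_def powr_add[symmetric] by simp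
    then show ?thesis by (simp add: add_increasing2)
  next
    case False
    then have "wt r x \<le> R powr r" unfolding wt_def using r one_plus_sq_pos[of x] by (intro powr_mono2) auto
    moreover have "0 \<le> d * wt 2 x" using d by simp
    ultimately show ?thesis by linarith
  qed
  moreover have "R powr r > 0" using d by (simp add: R_def)
  ultimately show ?thesis by blast
qed

lemma Sq_interpolate:
  assumes r: "0 < r" "r < 2" and d: "d > 0"
  obtains C where "C > 0" "\<And>f. CL2 f \<Longrightarrow> Sq r f \<le> ennreal d * Sq 2 f + ennreal C * Sq 0 f"
proof -
  obtain C where C: "C > 0" "\<And>x. wt r x \<le> d * wt 2 x + C" using wt_interpolate[OF assms] by blast
  have "Sq r f \<le> ennreal d * Sq 2 f + ennreal C * Sq 0 f" if f: "CL2 f" for f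
  proof -
    note [measurable] = FT_measurable[OF f]
    have "Sq r f \<le> (\<integral>\<^sup>+x. ennreal d * (ennreal (wt 2 x) * ennreal ((cmod (FT f x))\<^sup>2)) + ennreal C * (ennreal (wt 0 x) * ennreal ((cmod (FT f x))\<^sup>2)) \<partial>lborel)"
      unfolding Sq_def Q_def
    proof (rule nn_integral_mono)
      fix x
      have "ennreal (wt r x) \<le> ennreal (d * wt 2 x + C)" by (rule ennreal_leI[OF C(2)])
      also have "\<dots> = ennreal d * ennreal (wt 2 x) + ennreal C" using d C by (simp add: ennreal_plus ennreal_mult del: ennreal_plus_if)
      finally have "ennreal (wt r x) * ennreal ((cmod (FT f x))\<^sup>2) \<le> (ennreal d * ennreal (wt 2 x) + ennreal C) * ennreal ((cmod (FT f x))\<^sup>2)"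
        by (rule mult_right_mono) simp
      then show "ennreal (wt r x) * ennreal ((cmod (FT f x))\<^sup>2) \<le> ennreal d * (ennreal (wt 2 x) * ennreal ((cmod (FT f x))\<^sup>2)) + ennreal C * (ennreal (wt 0 x) * ennreal ((cmod (FT f x))\<^sup>2))"
        by (simp add: distrib_right mult.assoc)
    qed
    also have "\<dots> = ennreal d * Sq 2 f + ennreal C * Sq 0 f"
      unfolding Sq_def Q_def by (subst nn_integral_add) (auto simp: nn_integral_cmult)
    finally show ?thesis .
  qed
  with C(1) show ?thesis by (rule that)
qed

text \<open>The lower bound on \<open>qx\<close> makes every \<open>p t\<close> nonexpansive, and
  \<open>M\<close> and \<open>N\<close> bound the Jacobian and its derivative uniformly in time.
  Continuity in time enters as uniform convergence of the inverse maps, \<open>pu\<close>; this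
  keeps the analysis independent of the formula for the flow.\<close>

locale flow =
  fixes I :: "real set" and q qx qxx p :: "real \<Rightarrow> real \<Rightarrow> real" and M N :: real
  assumes qd: "\<And>t y. t \<in> I \<Longrightarrow> (q t has_real_derivative qx t y) (at y)"
    and qxd: "\<And>t y. t \<in> I \<Longrightarrow> (qx t has_real_derivative qxx t y) (at y)"
    and qxxc: "\<And>t. t \<in> I \<Longrightarrow> continuous_on UNIV (qxx t)"
    and qx1: "\<And>t y. t \<in> I \<Longrightarrow> 1 \<le> qx t y" and qxM: "\<And>t y. t \<in> I \<Longrightarrow> qx t y \<le> M"
    and qxxN: "\<And>t y. t \<in> I \<Longrightarrow> \<bar>qxx t y\<bar> \<le> N"
    and pq: "\<And>t y. t \<in> I \<Longrightarrow> p t (q t y) = y" and qp: "\<And>t x. t \<in> I \<Longrightarrow> q t (p t x) = x"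
    and pu: "\<And>t e. t \<in> I \<Longrightarrow> e > 0 \<Longrightarrow> \<forall>\<^sub>F \<tau> in at t within I. \<forall>x. \<bar>p \<tau> x - p t x\<bar> \<le> e"
begin

lemma qxc: "t \<in> I \<Longrightarrow> continuous_on UNIV (qx t)"
  using qxd by (intro continuous_at_imp_continuous_on ballI DERIV_isCont) blast

lemma pc: "t \<in> I \<Longrightarrow> continuous_on UNIV (p t)"
  by (rule Lipschitz_inverse(2)[of "q t" "qx t"]) (simp_all add: qd qx1 qp)

lemma pd:
  assumes t: "t \<in> I" shows "(p t has_real_derivative 1 / qx t (p t x)) (at x)"
proof -
  have "(p t has_real_derivative inverse (qx t (p t x))) (at x)"
    by (rule DERIV_inverse_function[OF qd[OF t], of _ _ "x - 1" "x + 1"])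
      (use qx1[OF t, of "p t x"] qp[OF t] pc[OF t] in \<open>auto simp: continuous_on_eq_continuous_at\<close>)
  then show ?thesis by (simp add: inverse_eq_divide)
qed

lemma M1: "t \<in> I \<Longrightarrow> 1 \<le> M" using qx1 qxM order_trans by blast

lemma comp_0:
  assumes t: "t \<in> I" and f: "CL2 f"
  shows "CL2 (\<lambda>x. f (p t x))" "Sq 0 (\<lambda>x. f (p t x)) \<le> ennreal M * Sq 0 f"
proof -
  note [measurable] = CL2_measurable[OF f]
  have c: "continuous_on UNIV (\<lambda>x. f (p t x))"
    by (rule continuous_on_compose2[OF CL2_continuous(1)[OF f] pc[OF t]]) simp
  have "sqn (cx (\<lambda>x. f (p t x))) = (\<integral>\<^sup>+y. ennreal ((cmod (cx f y))\<^sup>2) * ennreal (qx t y) \<partial>lborel)"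
    unfolding sqn_def
    by (rule nn_integral_subst_UNIV[OF qd[OF t] qxc[OF t] qx1[OF t] qp[OF t] pq[OF t]]) simp
  also have "\<dots> \<le> (\<integral>\<^sup>+y. ennreal M * ennreal ((cmod (cx f y))\<^sup>2) \<partial>lborel)"
    by (intro nn_integral_mono) (auto simp: mult.commute[of "ennreal M"] intro!: mult_left_mono ennreal_leI qxM t)
  also have "\<dots> = ennreal M * sqn (cx f)" unfolding sqn_def by (rule nn_integral_cmult) simp
  finally have le: "sqn (cx (\<lambda>x. f (p t x))) \<le> ennreal M * sqn (cx f)" .
  also have "\<dots> < \<infinity>" using CL2_L2[OF f] by (simp add: L2_def ennreal_mult_less_top)
  finally show "CL2 (\<lambda>x. f (p t x))"
    using c unfolding CL2_def L2_def by (auto intro!: borel_measurable_continuous_onI continuous_on_of_real)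
  from le show "Sq 0 (\<lambda>x. f (p t x)) \<le> ennreal M * Sq 0 f"
    unfolding Sq_0[OF f] Sq_0[OF \<open>CL2 (\<lambda>x. f (p t x))\<close>] .
qed

lemma inv_bounds: "t \<in> I \<Longrightarrow> \<bar>1 / qx t y\<bar> \<le> 1" "t \<in> I \<Longrightarrow> \<bar>- qxx t y / (qx t y)\<^sup>2 * (1 / qx t y)\<bar> \<le> N"
proof -
  assume t: "t \<in> I"
  have 1: "1 \<le> qx t y" by (rule qx1[OF t])
  then show "\<bar>1 / qx t y\<bar> \<le> 1" by simp
  have "1 ^ 3 \<le> (qx t y) ^ 3" by (rule power_mono[OF 1]) simp
  then have "1 \<le> (qx t y)\<^sup>2 * qx t y" by (simp add: power2_eq_square power3_eq_cube)
  then have "\<bar>qxx t y\<bar> / ((qx t y)\<^sup>2 * qx t y) \<le> \<bar>qxx t y\<bar> / 1" by (intro divide_left_mono) auto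
  with qxxN[OF t, of y] 1 show "\<bar>- qxx t y / (qx t y)\<^sup>2 * (1 / qx t y)\<bar> \<le> N"
    by (simp add: abs_mult)
qed

text \<open>One constant for both ends of the interpolation: \<open>M\<close> is the price of the
  change of variables, the remaining factor that of the second derivative of a composition.\<close>

definition A :: ennreal where "A = ennreal (2 * M * (1 + N\<^sup>2))"

text \<open>With b the derivative of \<open>p t\<close>, the composition has derivatives b f'(p) and
  b^2 f''(p) + b' f'(p), where b is at most 1 and b' at most \<open>N\<close> in absolute
  value.\<close>

lemma comp_2:
  assumes t: "t \<in> I" and f: "CL2 f" "CL2 f'" "CL2 f''"
    and d: "\<And>x. (f has_real_derivative f' x) (at x)" "\<And>x. (f' has_real_derivative f'' x) (at x)"
  shows "Sq 2 (\<lambda>x. f (p t x)) \<le> A * Sq 2 f"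
proof -
  let ?b = "\<lambda>x. 1 / qx t (p t x)" and ?b' = "\<lambda>x. - qxx t (p t x) / (qx t (p t x))\<^sup>2 * (1 / qx t (p t x))"
  have q0: "qx t y \<noteq> 0" for y using qx1[OF t, of y] by linarith
  have bc: "continuous_on UNIV ?b" and b'c: "continuous_on UNIV ?b'"
    by (auto intro!: continuous_intros continuous_on_compose2[OF qxc[OF t] pc[OF t]] continuous_on_compose2[OF qxxc[OF t] pc[OF t]] simp: q0)
  have bd: "(?b has_real_derivative ?b' x) (at x)" for x
    by (auto intro!: derivative_eq_intros DERIV_chain2[OF qxd[OF t] pd[OF t]] simp: q0 power2_eq_square)
  note c0 = comp_0[OF t f(1)] and c1 = comp_0[OF t f(2)] and c2 = comp_0[OF t f(3)]
  let ?g' = "\<lambda>x. ?b x * f' (p t x)" and ?g'' = "\<lambda>x. ?b x * (?b x * f'' (p t x)) + ?b' x * f' (p t x)"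
  have g1: "CL2 ?g'" "Sq 0 ?g' \<le> ennreal (1\<^sup>2) * Sq 0 (\<lambda>x. f' (p t x))"
    by (rule Sq_0_mult_bounded[OF bc _ c1(1)], rule inv_bounds(1)[OF t])+
  have g2: "CL2 (\<lambda>x. ?b x * f'' (p t x))" "Sq 0 (\<lambda>x. ?b x * f'' (p t x)) \<le> ennreal (1\<^sup>2) * Sq 0 (\<lambda>x. f'' (p t x))"
    by (rule Sq_0_mult_bounded[OF bc _ c2(1)], rule inv_bounds(1)[OF t])+
  have g3: "CL2 (\<lambda>x. ?b x * (?b x * f'' (p t x)))" "Sq 0 (\<lambda>x. ?b x * (?b x * f'' (p t x))) \<le> ennreal (1\<^sup>2) * Sq 0 (\<lambda>x. ?b x * f'' (p t x))"
    by (rule Sq_0_mult_bounded[OF bc _ g2(1)], rule inv_bounds(1)[OF t])+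
  have g4: "CL2 (\<lambda>x. ?b' x * f' (p t x))" "Sq 0 (\<lambda>x. ?b' x * f' (p t x)) \<le> ennreal (N\<^sup>2) * Sq 0 (\<lambda>x. f' (p t x))"
    by (rule Sq_0_mult_bounded[OF b'c _ c1(1)], rule inv_bounds(2)[OF t])+
  have g'': "CL2 ?g''" by (rule CL2_add[OF g3(1) g4(1)])
  have d1: "((\<lambda>x. f (p t x)) has_real_derivative ?g' x) (at x)" for x
    using DERIV_chain2[OF d(1) pd[OF t]] by (simp add: mult.commute)
  have d2: "(?g' has_real_derivative ?g'' x) (at x)" for x
    using DERIV_mult[OF bd DERIV_chain2[OF d(2) pd[OF t]], of x] by (simp add: algebra_simps)
  obtain S0 S1 S2 where S: "Sq 0 f = ennreal S0" "S0 \<ge> 0" "Sq 0 f' = ennreal S1" "S1 \<ge> 0" "Sq 0 f'' = ennreal S2" "S2 \<ge> 0"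
  proof -
    have "Sq 0 f < \<top>" "Sq 0 f' < \<top>" "Sq 0 f'' < \<top>" using f by (auto simp: Sq_0 CL2_def L2_def)
    then show ?thesis using that by (cases "Sq 0 f"; cases "Sq 0 f'"; cases "Sq 0 f''") auto
  qed
  have M: "1 \<le> M" by (rule M1[OF t])
  have "Sq 2 (\<lambda>x. f (p t x)) = Sq 0 (\<lambda>x. f (p t x)) + 2 * Sq 0 ?g' + Sq 0 ?g''"
    by (rule Sq_2[OF c0(1) g1(1) g'' d1 d2])
  also have "\<dots> \<le> ennreal M * Sq 0 f + 2 * (ennreal M * Sq 0 f') + (2 * (ennreal M * Sq 0 f'') + 2 * (ennreal (N\<^sup>2) * (ennreal M * Sq 0 f')))"
  proof (intro add_mono mult_left_mono)
    show "Sq 0 ?g' \<le> ennreal M * Sq 0 f'" using order_trans[OF g1(2)] c1(2) by simp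
    have "Sq 0 ?g'' \<le> 2 * Sq 0 (\<lambda>x. ?b x * (?b x * f'' (p t x))) + 2 * Sq 0 (\<lambda>x. ?b' x * f' (p t x))"
      by (rule Sq_add[OF g3(1) g4(1)])
    also have "\<dots> \<le> 2 * (ennreal M * Sq 0 f'') + 2 * (ennreal (N\<^sup>2) * (ennreal M * Sq 0 f'))"
    proof (intro add_mono mult_left_mono)
      show "Sq 0 (\<lambda>x. ?b x * (?b x * f'' (p t x))) \<le> ennreal M * Sq 0 f''"
        using order_trans[OF order_trans[OF g3(2)], of "Sq 0 (\<lambda>x. f'' (p t x))" "ennreal M * Sq 0 f''"] g2(2) c2(2) by simp
      show "Sq 0 (\<lambda>x. ?b' x * f' (p t x)) \<le> ennreal (N\<^sup>2) * (ennreal M * Sq 0 f')"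
        by (rule order_trans[OF g4(2) mult_left_mono[OF c1(2)]]) simp
    qed simp_all
    finally show "Sq 0 ?g'' \<le> 2 * (ennreal M * Sq 0 f'') + 2 * (ennreal (N\<^sup>2) * (ennreal M * Sq 0 f'))" .
  qed (simp_all add: c0(2))
  also have "\<dots> = ennreal (M * S0 + 2 * (M * S1) + (2 * (M * S2) + 2 * (N\<^sup>2 * (M * S1))))"
    unfolding S using M S by (simp add: ennreal_plus ennreal_mult ennreal_mult'' del: ennreal_plus_if)
  also have "\<dots> \<le> ennreal (2 * M * (1 + N\<^sup>2) * (S0 + 2 * S1 + S2))"
  proof (rule ennreal_leI)
    have "0 \<le> M * S0" "0 \<le> M * S1" "0 \<le> M * S2" "0 \<le> N\<^sup>2 * (M * S0)" "0 \<le> N\<^sup>2 * (M * S1)" "0 \<le> N\<^sup>2 * (M * S2)"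
      using M S by (auto intro!: mult_nonneg_nonneg)
    then show "M * S0 + 2 * (M * S1) + (2 * (M * S2) + 2 * (N\<^sup>2 * (M * S1))) \<le> 2 * M * (1 + N\<^sup>2) * (S0 + 2 * S1 + S2)"
      by (simp add: algebra_simps)
  qed
  also have "\<dots> = A * Sq 2 f"
    unfolding Sq_2[OF f d] S A_def using M S by (simp add: ennreal_plus ennreal_mult ennreal_mult'' del: ennreal_plus_if)
  finally show ?thesis .
qed

lemma comp_interpolated:
  assumes t: "t \<in> I" and f: "CL2 f" and r: "0 < r" "r < 2"
  shows "Sq r (\<lambda>x. f (p t x)) \<le> A * Sq r f"
proof (rule Sobolev_interpolation[where T="\<lambda>f x. f (p t x)", OF _ _ _ _ f r])
  fix f assume f: "CL2 f"
  show "Sq 0 (\<lambda>x. f (p t x)) \<le> A * Sq 0 f"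
  proof (rule order_trans[OF comp_0(2)[OF t f] mult_right_mono])
    have "M * 1 \<le> (2 * M) * (1 + N\<^sup>2)" using M1[OF t] by (intro mult_mono) auto
    then show "ennreal M \<le> A" unfolding A_def by (intro ennreal_leI) simp
  qed simp
qed (simp_all add: comp_0 comp_2 t)

lemma A_finite: "A < \<top>" by (simp add: A_def)

text \<open>The window estimate is integrated over \<open>x\<close> and the integrals are exchanged.
  For fixed \<open>y\<close>, the positions whose label lies within \<delta> of \<open>y\<close>
  form a set of measure at most \<open>2 * M * \<delta>\<close>, because \<open>q t\<close>
  stretches lengths by at most \<open>M\<close>.\<close>

lemma comp_diff_small:
  assumes t: "t \<in> I" and \<tau>: "\<tau> \<in> I" and f: "CL2 f" "CL2 f'" and d: "\<And>x. (f has_real_derivative f' x) (at x)"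
    and \<delta>: "\<delta> > 0" "\<And>x. \<bar>p \<tau> x - p t x\<bar> \<le> \<delta>"
  shows "Sq 0 (\<lambda>x. f (p \<tau> x) - f (p t x)) \<le> ennreal (2 * M * \<delta>\<^sup>2) * Sq 0 f'"
proof -
  note [measurable] = CL2_measurable[OF f(1)] CL2_measurable[OF f(2)] borel_measurable_continuous_onI[OF pc[OF t]]
  have c: "CL2 (\<lambda>x. f (p \<tau> x) - f (p t x))" by (rule CL2_diff[OF comp_0(1)[OF \<tau> f(1)] comp_0(1)[OF t f(1)]])
  let ?i = "\<lambda>x y. indicator {p t x - \<delta>..p t x + \<delta>} y :: ennreal"
  have "?i = (\<lambda>x y. if p t x - \<delta> \<le> y \<and> y \<le> p t x + \<delta> then 1 else 0)" by (auto simp: fun_eq_iff indicator_def)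
  then have [measurable]: "case_prod ?i \<in> borel_measurable (borel \<Otimes>\<^sub>M borel)"
    "\<And>x. ?i x \<in> borel_measurable borel"
    by simp_all
  have mp: "(\<lambda>(x, y). ennreal ((f' y)\<^sup>2) * ?i x y) \<in> borel_measurable (lborel \<Otimes>\<^sub>M lborel)"
  proof -
    have "(\<lambda>p'. ennreal ((f' (snd p'))\<^sup>2) * case_prod ?i p') \<in> borel_measurable (borel \<Otimes>\<^sub>M borel)" by measurable
    then show ?thesis by (simp add: case_prod_beta')
  qed
  have "Sq 0 (\<lambda>x. f (p \<tau> x) - f (p t x)) = (\<integral>\<^sup>+x. ennreal ((f (p \<tau> x) - f (p t x))\<^sup>2) \<partial>lborel)"
    unfolding Sq_0[OF c] sqn_def by (simp flip: of_real_diff)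
  also have "\<dots> \<le> (\<integral>\<^sup>+x. ennreal \<delta> * (\<integral>\<^sup>+y. ennreal ((f' y)\<^sup>2) * ?i x y \<partial>lborel) \<partial>lborel)"
    by (intro nn_integral_mono FTC_Cauchy_Schwarz[OF d CL2_continuous(1)[OF f(2)] \<delta>(2)])
  also have "\<dots> = ennreal \<delta> * (\<integral>\<^sup>+x. (\<integral>\<^sup>+y. ennreal ((f' y)\<^sup>2) * ?i x y \<partial>lborel) \<partial>lborel)"
    using mp by (intro nn_integral_cmult lborel.borel_measurable_nn_integral) simp
  finally have 1: "Sq 0 (\<lambda>x. f (p \<tau> x) - f (p t x)) \<le> ennreal \<delta> * (\<integral>\<^sup>+x. (\<integral>\<^sup>+y. ennreal ((f' y)\<^sup>2) * ?i x y \<partial>lborel) \<partial>lborel)" .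
  have "(\<integral>\<^sup>+x. (\<integral>\<^sup>+y. ennreal ((f' y)\<^sup>2) * ?i x y \<partial>lborel) \<partial>lborel) = (\<integral>\<^sup>+y. (\<integral>\<^sup>+x. ennreal ((f' y)\<^sup>2) * ?i x y \<partial>lborel) \<partial>lborel)"
    by (rule lborel_pair.Fubini'[OF mp, symmetric])
  also have "\<dots> \<le> (\<integral>\<^sup>+y. ennreal (2 * M * \<delta>) * ennreal ((f' y)\<^sup>2) \<partial>lborel)"
  proof (rule nn_integral_mono)
    fix y
    have "(\<integral>\<^sup>+x. ?i x y \<partial>lborel) = (\<integral>\<^sup>+x. indicator {y - \<delta>..y + \<delta>} (p t x) \<partial>lborel)"
      by (intro nn_integral_cong) (auto simp: indicator_def)
    also have "\<dots> = (\<integral>\<^sup>+z. indicator {y - \<delta>..y + \<delta>} z * ennreal (qx t z) \<partial>lborel)"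
      by (rule nn_integral_subst_UNIV[OF qd[OF t] qxc[OF t] qx1[OF t] qp[OF t] pq[OF t]]) simp
    also have "\<dots> \<le> (\<integral>\<^sup>+z. ennreal M * indicator {y - \<delta>..y + \<delta>} z \<partial>lborel)"
      by (intro nn_integral_mono) (auto simp: indicator_def intro!: ennreal_leI qxM t)
    also have "\<dots> = ennreal M * ennreal (2 * \<delta>)"
      using \<delta> by (subst nn_integral_cmult_indicator) (auto simp: emeasure_lborel_Icc)
    also have "\<dots> = ennreal (2 * M * \<delta>)" using M1[OF t] \<delta>(1) ennreal_mult[of M "2 * \<delta>"] by (simp add: mult.left_commute mult.assoc)
    finally have "(\<integral>\<^sup>+x. ?i x y \<partial>lborel) \<le> ennreal (2 * M * \<delta>)" .
    then have "ennreal ((f' y)\<^sup>2) * (\<integral>\<^sup>+x. ?i x y \<partial>lborel) \<le> ennreal ((f' y)\<^sup>2) * ennreal (2 * M * \<delta>)" by (rule mult_left_mono) simp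
    moreover have "(\<integral>\<^sup>+x. ennreal ((f' y)\<^sup>2) * ?i x y \<partial>lborel) = ennreal ((f' y)\<^sup>2) * (\<integral>\<^sup>+x. ?i x y \<partial>lborel)"
      by (rule nn_integral_cmult) (simp add: indicator_def[abs_def])
    ultimately show "(\<integral>\<^sup>+x. ennreal ((f' y)\<^sup>2) * ?i x y \<partial>lborel) \<le> ennreal (2 * M * \<delta>) * ennreal ((f' y)\<^sup>2)"
      by (simp add: mult.commute)
  qed
  also have "\<dots> = ennreal (2 * M * \<delta>) * Sq 0 f'"
    unfolding Sq_0[OF f(2)] sqn_def by (subst nn_integral_cmult) auto
  finally have 2: "(\<integral>\<^sup>+x. (\<integral>\<^sup>+y. ennreal ((f' y)\<^sup>2) * ?i x y \<partial>lborel) \<partial>lborel) \<le> ennreal (2 * M * \<delta>) * Sq 0 f'" .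
  have "Sq 0 (\<lambda>x. f (p \<tau> x) - f (p t x)) \<le> ennreal \<delta> * (ennreal (2 * M * \<delta>) * Sq 0 f')"
    by (rule order_trans[OF 1 mult_left_mono[OF 2]]) simp
  also have "\<dots> = ennreal (\<delta> * (2 * M * \<delta>)) * Sq 0 f'"
    using M1[OF t] \<delta>(1) by (simp add: ennreal_mult mult.assoc)
  also have "\<delta> * (2 * M * \<delta>) = 2 * M * \<delta>\<^sup>2" by (simp add: power2_eq_square)
  finally show ?thesis .
qed

end

text \<open>The epsilon argument in a reusable form: an error proportional to \<open>d\<close>, plus
  a term that tends to zero but may depend on \<open>d\<close>.\<close>

lemma ennreal_0_by_approx:
  fixes f :: "'a \<Rightarrow> ennreal"
  assumes K: "K < \<top>" and *: "\<And>d. d > 0 \<Longrightarrow> \<exists>g. (g \<longlongrightarrow> 0) F \<and> (\<forall>\<^sub>F x in F. f x \<le> ennreal d * K + g x)"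
  shows "(f \<longlongrightarrow> 0) F"
proof (rule ennreal_tendsto_0I)
  fix e :: real assume e: "e > 0"
  obtain k where k: "K = ennreal k" "k \<ge> 0" using K by (cases K) auto
  define d where "d = e / (2 * (k + 1))"
  have d: "d > 0" "d * k \<le> e / 2" using e k by (auto simp: d_def field_simps)
  obtain g where g: "(g \<longlongrightarrow> 0) F" "\<forall>\<^sub>F x in F. f x \<le> ennreal d * K + g x" using *[OF d(1)] by blast
  have "\<forall>\<^sub>F x in F. g x < ennreal (e / 2)" using g(1) e by (intro order_tendstoD) auto
  then show "\<forall>\<^sub>F x in F. f x \<le> ennreal e"
    using g(2)
  proof eventually_elim
    fix x assume 1: "g x < ennreal (e / 2)" and 2: "f x \<le> ennreal d * K + g x"
    have "ennreal d * K \<le> ennreal (e / 2)" unfolding k(1) using d k by (simp add: ennreal_leI flip: ennreal_mult)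
    then have "f x \<le> ennreal (e / 2) + ennreal (e / 2)"
      using 1 by (intro order_trans[OF 2] add_mono) auto
    also have "\<dots> = ennreal e" using e by (subst ennreal_plus[symmetric]) auto
    finally show "f x \<le> ennreal e" .
  qed
qed

lemma scont_C1:
  assumes a: "scont r I \<phi>" and r: "r > 3/2"
  obtains \<phi>' where "\<And>t x. t \<in> I \<Longrightarrow> (\<phi> t has_real_derivative \<phi>' t x) (at x)" "scont (r - 1) I \<phi>'"
proof -
  have "\<exists>f'. (\<forall>x. (\<phi> t has_real_derivative f' x) (at x)) \<and> CL2 f'" if t: "t \<in> I" for t
    by (rule Sq_C1[OF scontD(1)[OF a t] r scontD(2)[OF a t]]) blast
  then obtain \<phi>' where *: "\<And>t x. t \<in> I \<Longrightarrow> (\<phi> t has_real_derivative \<phi>' t x) (at x)" "\<And>t. t \<in> I \<Longrightarrow> CL2 (\<phi>' t)"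
    by metis
  have "scont (r - 1) I \<phi>'" by (rule scont_deriv[where \<phi>=\<phi>]) (use a * in simp_all)
  with *(1) show ?thesis by (rule that)
qed

context flow
begin

lemma comp_diff_0:
  assumes t: "t \<in> I" and f: "CL2 f" "CL2 f'" and d: "\<And>x. (f has_real_derivative f' x) (at x)"
  shows "((\<lambda>\<tau>. Sq 0 (\<lambda>x. f (p \<tau> x) - f (p t x))) \<longlongrightarrow> 0) (at t within I)"
proof (rule ennreal_0_by_approx)
  show "ennreal (2 * M) * Sq 0 f' < \<top>" using CL2_L2[OF f(2)] by (simp add: Sq_0[OF f(2)] L2_def ennreal_mult_less_top)
  fix e :: real assume e: "e > 0"
  have ev: "\<forall>\<^sub>F \<tau> in at t within I. \<forall>x. \<bar>p \<tau> x - p t x\<bar> \<le> sqrt e" by (rule pu[OF t]) (use e in simp)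
  have "\<forall>\<^sub>F \<tau> in at t within I. Sq 0 (\<lambda>x. f (p \<tau> x) - f (p t x)) \<le> ennreal e * (ennreal (2 * M) * Sq 0 f')"
    using ev eventually_within[of I t]
  proof eventually_elim
    fix \<tau> assume \<tau>: "\<tau> \<in> I" and c: "\<forall>x. \<bar>p \<tau> x - p t x\<bar> \<le> sqrt e"
    have "Sq 0 (\<lambda>x. f (p \<tau> x) - f (p t x)) \<le> ennreal (2 * M * (sqrt e)\<^sup>2) * Sq 0 f'"
      by (rule comp_diff_small[OF t \<tau> f d]) (use c e in auto)
    also have "2 * M * (sqrt e)\<^sup>2 = e * (2 * M)" using e by simp
    also have "ennreal (e * (2 * M)) = ennreal e * ennreal (2 * M)" using e M1[OF t] by (intro ennreal_mult) auto
    finally show "Sq 0 (\<lambda>x. f (p \<tau> x) - f (p t x)) \<le> ennreal e * (ennreal (2 * M) * Sq 0 f')" by (simp only: mult.assoc)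
  qed
  then show "\<exists>g. (g \<longlongrightarrow> 0) (at t within I) \<and> (\<forall>\<^sub>F x in at t within I. Sq 0 (\<lambda>xa. f (p x xa) - f (p t xa)) \<le> ennreal e * (ennreal (2 * M) * Sq 0 f') + g x)"
    by (intro exI[of _ "\<lambda>_. 0"]) simp
qed

text \<open>An Ehrling-type argument: by \<open>Sq_interpolate\<close> the norm of order
  \<open>r\<close> is a small multiple of the \<open>H\<^sup>2\<close> norm, which is bounded in
  time, plus a large multiple of the \<open>L\<^sup>2\<close> norm, which tends to zero.\<close>

lemma comp_strong_smooth:
  assumes t: "t \<in> I" and f: "CL2 f" "CL2 f'" and d: "\<And>x. (f has_real_derivative f' x) (at x)"
    and b: "\<And>\<tau>. \<tau> \<in> I \<Longrightarrow> Sq 2 (\<lambda>x. f (p \<tau> x)) \<le> K" "K < \<top>" and r: "0 < r" "r < 2"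
  shows "((\<lambda>\<tau>. Sq r (\<lambda>x. f (p \<tau> x) - f (p t x))) \<longlongrightarrow> 0) (at t within I)"
proof (rule ennreal_0_by_approx)
  show "2 * K + 2 * K < \<top>" using b(2) by (simp add: ennreal_mult_less_top)
  fix e :: real assume e: "e > 0"
  obtain C where C: "C > 0" "\<And>f. CL2 f \<Longrightarrow> Sq r f \<le> ennreal e * Sq 2 f + ennreal C * Sq 0 f"
    by (rule Sq_interpolate[OF r e], rule that)
  have "\<forall>\<^sub>F \<tau> in at t within I. Sq r (\<lambda>x. f (p \<tau> x) - f (p t x)) \<le> ennreal e * (2 * K + 2 * K) + ennreal C * Sq 0 (\<lambda>x. f (p \<tau> x) - f (p t x))"
    using eventually_within[of I t]
  proof eventually_elim
    fix \<tau> assume \<tau>: "\<tau> \<in> I"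
    note c = comp_0(1)[OF \<tau> f(1)] comp_0(1)[OF t f(1)]
    have "Sq 2 (\<lambda>x. f (p \<tau> x) - f (p t x)) \<le> 2 * Sq 2 (\<lambda>x. f (p \<tau> x)) + 2 * Sq 2 (\<lambda>x. f (p t x))" by (rule Sq_diff[OF c])
    also have "\<dots> \<le> 2 * K + 2 * K" by (intro add_mono mult_left_mono b \<tau> t) auto
    finally have "Sq 2 (\<lambda>x. f (p \<tau> x) - f (p t x)) \<le> 2 * K + 2 * K" .
    then show "Sq r (\<lambda>x. f (p \<tau> x) - f (p t x)) \<le> ennreal e * (2 * K + 2 * K) + ennreal C * Sq 0 (\<lambda>x. f (p \<tau> x) - f (p t x))"
      by (intro order_trans[OF C(2)[OF CL2_diff[OF c]]] add_mono mult_left_mono) auto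
  qed
  moreover have "((\<lambda>\<tau>. ennreal C * Sq 0 (\<lambda>x. f (p \<tau> x) - f (p t x))) \<longlongrightarrow> 0) (at t within I)"
    by (rule ennreal_cmult_0(1)[OF comp_diff_0[OF t f d]]) simp
  ultimately show "\<exists>g. (g \<longlongrightarrow> 0) (at t within I) \<and> (\<forall>\<^sub>F \<tau> in at t within I. Sq r (\<lambda>x. f (p \<tau> x) - f (p t x)) \<le> ennreal e * (2 * K + 2 * K) + g \<tau>)"
    by blast
qed

text \<open>Convergence on smooth functions extends by density, with \<open>A\<close> bounding the
  error of the approximation uniformly in time.\<close>

lemma comp_strong:
  assumes t: "t \<in> I" and f: "CL2 f" "Sq r f < \<infinity>" and r: "0 < r" "r < 2"
  shows "((\<lambda>\<tau>. Sq r (\<lambda>x. f (p \<tau> x) - f (p t x))) \<longlongrightarrow> 0) (at t within I)"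
proof (rule ennreal_0_by_approx)
  show "8 * A < \<top>" using A_finite by (simp add: ennreal_mult_less_top)
  fix e :: real assume e: "e > 0"
  obtain f1 f1' f1'' where f1: "CL2 f1" "CL2 f1'" "CL2 f1''"
    "\<And>x. (f1 has_real_derivative f1' x) (at x)" "\<And>x. (f1' has_real_derivative f1'' x) (at x)"
    "Sq 4 f1 < \<infinity>" "Sq r (\<lambda>x. f x - f1 x) \<le> ennreal e"
    by (rule smooth_approx[OF f e], rule that)
  have f12: "Sq 2 f1 < \<infinity>" by (rule Sq_finite_mono[OF _ f1(6)]) simp
  have g: "((\<lambda>\<tau>. Sq r (\<lambda>x. f1 (p \<tau> x) - f1 (p t x))) \<longlongrightarrow> 0) (at t within I)"
    by (rule comp_strong_smooth[OF t f1(1,2,4), of "A * Sq 2 f1"])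
      (use comp_2[OF _ f1(1-5)] A_finite f12 r in \<open>auto simp: ennreal_mult_less_top\<close>)
  let ?f0 = "\<lambda>x. f x - f1 x"
  have f0: "CL2 ?f0" by (rule CL2_diff[OF f(1) f1(1)])
  have "\<forall>\<^sub>F \<tau> in at t within I. Sq r (\<lambda>x. f (p \<tau> x) - f (p t x)) \<le> ennreal e * (8 * A) + 2 * Sq r (\<lambda>x. f1 (p \<tau> x) - f1 (p t x))"
    using eventually_within[of I t]
  proof eventually_elim
    fix \<tau> assume \<tau>: "\<tau> \<in> I"
    have b: "Sq r (\<lambda>x. ?f0 (p s x)) \<le> A * ennreal e" if "s \<in> I" for s
      by (rule order_trans[OF comp_interpolated[OF that f0 r] mult_left_mono[OF f1(7)]]) simp
    note c0 = comp_0(1)[OF \<tau> f0] comp_0(1)[OF t f0] and c1 = comp_0(1)[OF \<tau> f1(1)] comp_0(1)[OF t f1(1)]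
    have "Sq r (\<lambda>x. f (p \<tau> x) - f (p t x)) = Sq r (\<lambda>x. (?f0 (p \<tau> x) - ?f0 (p t x)) + (f1 (p \<tau> x) - f1 (p t x)))"
      by simp
    also have "\<dots> \<le> 2 * Sq r (\<lambda>x. ?f0 (p \<tau> x) - ?f0 (p t x)) + 2 * Sq r (\<lambda>x. f1 (p \<tau> x) - f1 (p t x))"
      by (rule Sq_add[OF CL2_diff[OF c0] CL2_diff[OF c1]])
    also have "\<dots> \<le> 2 * (2 * (A * ennreal e) + 2 * (A * ennreal e)) + 2 * Sq r (\<lambda>x. f1 (p \<tau> x) - f1 (p t x))"
      by (intro add_mono mult_left_mono order_trans[OF Sq_diff[OF c0]] b \<tau> t) auto
    also have "2 * (2 * (A * ennreal e) + 2 * (A * ennreal e)) = ennreal e * (8 * A)"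
    proof -
      have 8: "2 * (2 * X + 2 * X) = 8 * X" for X :: ennreal by (simp add: distrib_left flip: mult.assoc distrib_right)
      show ?thesis unfolding 8 by (simp only: mult_ac)
    qed
    finally show "Sq r (\<lambda>x. f (p \<tau> x) - f (p t x)) \<le> ennreal e * (8 * A) + 2 * Sq r (\<lambda>x. f1 (p \<tau> x) - f1 (p t x))" .
  qed
  moreover have "((\<lambda>\<tau>. 2 * Sq r (\<lambda>x. f1 (p \<tau> x) - f1 (p t x))) \<longlongrightarrow> 0) (at t within I)"
    by (rule ennreal_cmult_0(1)[OF g]) simp
  ultimately show "\<exists>g. (g \<longlongrightarrow> 0) (at t within I) \<and> (\<forall>\<^sub>F \<tau> in at t within I. Sq r (\<lambda>x. f (p \<tau> x) - f (p t x)) \<le> ennreal e * (8 * A) + g \<tau>)"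
    by blast
qed

text \<open>The increment first changes the function under the new flow, where the uniform bound
  suffices, and then the flow for the fixed function \<open>\<phi> t\<close>, where strong
  continuity suffices. In the opposite order strong continuity would be wanted for a moving
  function.\<close>

lemma scont_comp_base:
  assumes a: "scont r I \<phi>" and r: "0 < r" "r < 2"
  shows "scont r I (\<lambda>t x. \<phi> t (p t x))"
proof (rule scontI)
  fix t assume t: "t \<in> I"
  note at = scontD[OF a t]
  show c: "CL2 (\<lambda>x. \<phi> t (p t x))" by (rule comp_0(1)[OF t at(1)])
  show "Sq r (\<lambda>x. \<phi> t (p t x)) < \<infinity>"
    by (rule le_less_trans[OF comp_interpolated[OF t at(1) r]]) (use at A_finite in \<open>simp add: ennreal_mult_less_top\<close>)
  show "((\<lambda>\<tau>. Sq r (\<lambda>x. \<phi> \<tau> (p \<tau> x) - \<phi> t (p t x))) \<longlongrightarrow> 0) (at t within I)"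
  proof (rule ennreal_squeeze_0)
    show "\<forall>\<^sub>F \<tau> in at t within I. Sq r (\<lambda>x. \<phi> \<tau> (p \<tau> x) - \<phi> t (p t x)) \<le>
       2 * (A * Sq r (\<lambda>x. \<phi> \<tau> x - \<phi> t x)) + 2 * Sq r (\<lambda>x. \<phi> t (p \<tau> x) - \<phi> t (p t x))"
      using eventually_within[of I t]
    proof eventually_elim
      fix \<tau> assume \<tau>: "\<tau> \<in> I"
      have d: "CL2 (\<lambda>x. \<phi> \<tau> x - \<phi> t x)" by (rule CL2_diff[OF scontD(1)[OF a \<tau>] at(1)])
      have d': "CL2 (\<lambda>x. \<phi> t (p \<tau> x) - \<phi> t (p t x))" by (rule CL2_diff[OF comp_0(1)[OF \<tau> at(1)] c])
      have "Sq r (\<lambda>x. \<phi> \<tau> (p \<tau> x) - \<phi> t (p t x)) = Sq r (\<lambda>x. (\<phi> \<tau> (p \<tau> x) - \<phi> t (p \<tau> x)) + (\<phi> t (p \<tau> x) - \<phi> t (p t x)))"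
        by simp
      also have "\<dots> \<le> 2 * Sq r (\<lambda>x. \<phi> \<tau> (p \<tau> x) - \<phi> t (p \<tau> x)) + 2 * Sq r (\<lambda>x. \<phi> t (p \<tau> x) - \<phi> t (p t x))"
        by (rule Sq_add[OF comp_0(1)[OF \<tau> d] d'])
      also have "\<dots> \<le> 2 * (A * Sq r (\<lambda>x. \<phi> \<tau> x - \<phi> t x)) + 2 * Sq r (\<lambda>x. \<phi> t (p \<tau> x) - \<phi> t (p t x))"
        by (intro add_mono mult_left_mono comp_interpolated[OF \<tau> d r]) auto
      finally show "Sq r (\<lambda>x. \<phi> \<tau> (p \<tau> x) - \<phi> t (p t x)) \<le> \<dots>" .
    qed
    show "((\<lambda>\<tau>. 2 * (A * Sq r (\<lambda>x. \<phi> \<tau> x - \<phi> t x)) + 2 * Sq r (\<lambda>x. \<phi> t (p \<tau> x) - \<phi> t (p t x))) \<longlongrightarrow> 0) (at t within I)"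
      by (intro ennreal_add_0 ennreal_cmult_0 at comp_strong[OF t at(1,2) r] A_finite) simp_all
  qed
qed

text \<open>Interpolation covers the orders between 1/2 and 2. From order 2 on, the derivative
  \<phi>'(p) / qx(p) of the composition is a product of curves of order \<open>r - 1\<close>,
  available by induction. The Jacobian factor tends to be near 1 far out, so hypothesis
  \<open>b\<close> concerns it after subtraction of 1.\<close>

theorem scont_comp:
  assumes b: "scont R I (\<lambda>t y. 1 / qx t y - 1)"
  shows "scont r I \<phi> \<Longrightarrow> 1/2 < r \<Longrightarrow> r \<le> R \<Longrightarrow> scont r I (\<lambda>t x. \<phi> t (p t x))"
proof -
  have "\<forall>r \<phi>. scont r I \<phi> \<longrightarrow> 1/2 < r \<longrightarrow> r \<le> R \<longrightarrow> r < 2 + real n \<longrightarrow> scont r I (\<lambda>t x. \<phi> t (p t x))" for n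
  proof (induction n)
    case 0
    then show ?case by (auto intro: scont_comp_base)
  next
    case (Suc n)
    show ?case
    proof (intro allI impI)
      fix r \<phi> assume a: "scont r I \<phi>" and r: "1/2 < r" "r \<le> R" "r < 2 + real (Suc n)"
      show "scont r I (\<lambda>t x. \<phi> t (p t x))"
      proof (cases "r < 2")
        case True
        with a r show ?thesis by (intro scont_comp_base) auto
      next
        case False
        obtain \<phi>' where \<phi>': "\<And>t x. t \<in> I \<Longrightarrow> (\<phi> t has_real_derivative \<phi>' t x) (at x)" "scont (r - 1) I \<phi>'"
          by (rule scont_C1[OF a]) (use False in auto)
        have r1: "1/2 < r - 1" "r - 1 \<le> R" "r - 1 < 2 + real n" using r False by auto
        have 1: "scont (r - 1) I (\<lambda>t x. \<phi> t (p t x))" using Suc scont_mono[OF a, of "r - 1"] r1 by simp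
        have 2: "scont (r - 1) I (\<lambda>t x. \<phi>' t (p t x))" using Suc \<phi>'(2) r1 by simp
        have 3: "scont (r - 1) I (\<lambda>t x. 1 / qx t (p t x) - 1)" using Suc scont_mono[OF b r1(2)] r1 by fastforce
        have "scont (r - 1) I (\<lambda>t x. \<phi>' t (p t x) * (1 / qx t (p t x) - 1) + \<phi>' t (p t x))"
          by (intro scont_add scont_mult 2 3 r1)
        then have 4: "scont (r - 1) I (\<lambda>t x. \<phi>' t (p t x) * (1 / qx t (p t x)))"
          by (rule scont_cong) (simp add: algebra_simps)
        have "scont (r - 1 + 1) I (\<lambda>t x. \<phi> t (p t x))"
          by (rule scont_Suc[OF 1 4]) (intro DERIV_chain2 \<phi>' pd)
        then show ?thesis by simp
      qed
    qed
  qed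
  moreover obtain n where "r < 2 + real n" using reals_Archimedean2[of "r - 2"] by (auto simp: algebra_simps)
  ultimately show "scont r I \<phi> \<Longrightarrow> 1/2 < r \<Longrightarrow> r \<le> R \<Longrightarrow> scont r I (\<lambda>t x. \<phi> t (p t x))" by blast
qed

end

section \<open>Multiplication by smooth functions\<close>

text \<open>The product rule produces the coefficients 9, 12 and 4 in front of the three squared
  norms, to be compared with 1, 2 and 1 in \<open>Sq_2\<close>; the constant 20 leaves room.\<close>

lemma mult_2_bound:
  assumes a: "\<And>x. (a has_real_derivative a' x) (at x)" "\<And>x. (a' has_real_derivative a'' x) (at x)" "continuous_on UNIV a''"
    and K: "\<And>x. \<bar>a x\<bar> \<le> K" "\<And>x. \<bar>a' x\<bar> \<le> K" "\<And>x. \<bar>a'' x\<bar> \<le> K"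
    and f: "CL2 f" "CL2 f'" "CL2 f''"
    and d: "\<And>x. (f has_real_derivative f' x) (at x)" "\<And>x. (f' has_real_derivative f'' x) (at x)"
  shows "Sq 2 (\<lambda>x. a x * f x) \<le> ennreal (20 * K\<^sup>2) * Sq 2 f"
proof -
  have ac: "continuous_on UNIV a" "continuous_on UNIV a'"
    using a by (auto intro!: continuous_at_imp_continuous_on DERIV_isCont)
  note m00 = Sq_0_mult_bounded[OF ac(1) K(1) f(1)] and m01 = Sq_0_mult_bounded[OF ac(1) K(1) f(2)]
    and m02 = Sq_0_mult_bounded[OF ac(1) K(1) f(3)] and m10 = Sq_0_mult_bounded[OF ac(2) K(2) f(1)]
    and m11 = Sq_0_mult_bounded[OF ac(2) K(2) f(2)] and m20 = Sq_0_mult_bounded[OF a(3) K(3) f(1)]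
  let ?g' = "\<lambda>x. a' x * f x + a x * f' x" and ?g'' = "\<lambda>x. (a'' x * f x + a' x * f' x) + (a' x * f' x + a x * f'' x)"
  have g': "CL2 ?g'" by (intro CL2_add m00 m10 m01)
  have g'': "CL2 ?g''" by (intro CL2_add m20 m11 m02)
  have d1: "((\<lambda>x. a x * f x) has_real_derivative ?g' x) (at x)" for x
    using DERIV_mult[OF a(1) d(1), of x] by (simp add: algebra_simps)
  have d2: "(?g' has_real_derivative ?g'' x) (at x)" for x
    using DERIV_add[OF DERIV_mult[OF a(2) d(1)] DERIV_mult[OF a(1) d(2)], of x] by (simp add: algebra_simps)
  obtain S0 S1 S2 where S: "Sq 0 f = ennreal S0" "S0 \<ge> 0" "Sq 0 f' = ennreal S1" "S1 \<ge> 0" "Sq 0 f'' = ennreal S2" "S2 \<ge> 0"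
  proof -
    have "Sq 0 f < \<top>" "Sq 0 f' < \<top>" "Sq 0 f'' < \<top>" using f by (auto simp: Sq_0 CL2_def L2_def)
    then show ?thesis using that by (cases "Sq 0 f"; cases "Sq 0 f'"; cases "Sq 0 f''") auto
  qed
  have "Sq 2 (\<lambda>x. a x * f x) = Sq 0 (\<lambda>x. a x * f x) + 2 * Sq 0 ?g' + Sq 0 ?g''"
    by (rule Sq_2[OF m00(1) g' g'' d1 d2])
  also have "\<dots> \<le> ennreal (K\<^sup>2) * Sq 0 f + 2 * (2 * (ennreal (K\<^sup>2) * Sq 0 f) + 2 * (ennreal (K\<^sup>2) * Sq 0 f'))
     + (2 * (2 * (ennreal (K\<^sup>2) * Sq 0 f) + 2 * (ennreal (K\<^sup>2) * Sq 0 f')) + 2 * (2 * (ennreal (K\<^sup>2) * Sq 0 f') + 2 * (ennreal (K\<^sup>2) * Sq 0 f'')))"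
  proof (intro add_mono mult_left_mono)
    show "Sq 0 ?g' \<le> 2 * (ennreal (K\<^sup>2) * Sq 0 f) + 2 * (ennreal (K\<^sup>2) * Sq 0 f')"
      by (rule order_trans[OF Sq_add[OF m10(1) m01(1)]]) (intro add_mono mult_left_mono m10 m01, simp_all)
    have "Sq 0 ?g'' \<le> 2 * Sq 0 (\<lambda>x. a'' x * f x + a' x * f' x) + 2 * Sq 0 (\<lambda>x. a' x * f' x + a x * f'' x)"
      by (intro Sq_add CL2_add m20 m11 m02)
    also have "\<dots> \<le> 2 * (2 * (ennreal (K\<^sup>2) * Sq 0 f) + 2 * (ennreal (K\<^sup>2) * Sq 0 f')) + 2 * (2 * (ennreal (K\<^sup>2) * Sq 0 f') + 2 * (ennreal (K\<^sup>2) * Sq 0 f''))"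
    proof (intro add_mono mult_left_mono)
      show "Sq 0 (\<lambda>x. a'' x * f x + a' x * f' x) \<le> 2 * (ennreal (K\<^sup>2) * Sq 0 f) + 2 * (ennreal (K\<^sup>2) * Sq 0 f')"
        by (rule order_trans[OF Sq_add[OF m20(1) m11(1)]]) (intro add_mono mult_left_mono m20 m11, simp_all)
      show "Sq 0 (\<lambda>x. a' x * f' x + a x * f'' x) \<le> 2 * (ennreal (K\<^sup>2) * Sq 0 f') + 2 * (ennreal (K\<^sup>2) * Sq 0 f'')"
        by (rule order_trans[OF Sq_add[OF m11(1) m02(1)]]) (intro add_mono mult_left_mono m11 m02, simp_all)
    qed simp_all
    finally show "Sq 0 ?g'' \<le> 2 * (2 * (ennreal (K\<^sup>2) * Sq 0 f) + 2 * (ennreal (K\<^sup>2) * Sq 0 f')) + 2 * (2 * (ennreal (K\<^sup>2) * Sq 0 f') + 2 * (ennreal (K\<^sup>2) * Sq 0 f''))" .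
  qed (simp_all add: m00(2))
  also have "\<dots> = ennreal (K\<^sup>2 * S0 + 2 * (2 * (K\<^sup>2 * S0) + 2 * (K\<^sup>2 * S1)) + (2 * (2 * (K\<^sup>2 * S0) + 2 * (K\<^sup>2 * S1)) + 2 * (2 * (K\<^sup>2 * S1) + 2 * (K\<^sup>2 * S2))))"
  proof -
    have 2: "(2 :: ennreal) = ennreal 2" by simp
    show ?thesis unfolding S(1,3,5) 2
      by (simp only: ennreal_mult[symmetric] ennreal_plus[symmetric] mult_nonneg_nonneg add_nonneg_nonneg zero_le_power2 S(2,4,6) zero_le_numeral)
  qed
  also have "\<dots> \<le> ennreal (20 * K\<^sup>2 * (S0 + 2 * S1 + S2))"
  proof (rule ennreal_leI)
    have "0 \<le> S0 * K\<^sup>2" "0 \<le> S1 * K\<^sup>2" "0 \<le> S2 * K\<^sup>2" using S by auto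
    then show "K\<^sup>2 * S0 + 2 * (2 * (K\<^sup>2 * S0) + 2 * (K\<^sup>2 * S1)) + (2 * (2 * (K\<^sup>2 * S0) + 2 * (K\<^sup>2 * S1)) + 2 * (2 * (K\<^sup>2 * S1) + 2 * (K\<^sup>2 * S2))) \<le> 20 * K\<^sup>2 * (S0 + 2 * S1 + S2)"
      by (simp add: algebra_simps)
  qed
  also have "\<dots> = ennreal (20 * K\<^sup>2) * Sq 2 f"
    unfolding Sq_2[OF f d] S using S by (simp add: ennreal_plus ennreal_mult ennreal_mult'' del: ennreal_plus_if)
  finally show ?thesis .
qed

lemma scont_mult_smooth_base:
  assumes \<phi>: "scont r I \<phi>" and r: "0 < r" "r < 2"
    and a: "\<And>x. (a has_real_derivative a' x) (at x)" "\<And>x. (a' has_real_derivative a'' x) (at x)" "continuous_on UNIV a''"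
    and K: "\<And>x. \<bar>a x\<bar> \<le> K" "\<And>x. \<bar>a' x\<bar> \<le> K" "\<And>x. \<bar>a'' x\<bar> \<le> K"
  shows "scont r I (\<lambda>t x. a x * \<phi> t x)"
proof -
  have ac: "continuous_on UNIV a" using a by (auto intro!: continuous_at_imp_continuous_on DERIV_isCont)
  have C: "CL2 (\<lambda>x. a x * f x)" if "CL2 f" for f by (rule CL2_mult_bounded[OF ac K(1) that])
  have b: "Sq r (\<lambda>x. a x * f x) \<le> ennreal (20 * K\<^sup>2) * Sq r f" if f: "CL2 f" for f
  proof (rule Sobolev_interpolation[where T="\<lambda>f x. a x * f x", OF C _ _ _ f r])
    fix f assume f: "CL2 f"
    show "Sq 0 (\<lambda>x. a x * f x) \<le> ennreal (20 * K\<^sup>2) * Sq 0 f"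
      by (rule order_trans[OF Sq_0_mult_bounded(2)[OF ac K(1) f] mult_right_mono]) (auto intro!: ennreal_leI)
  qed (auto simp: distrib_left intro: mult_2_bound[OF a K])
  show ?thesis
  proof (rule scontI)
    fix t assume t: "t \<in> I"
    note at = scontD[OF \<phi> t]
    show "CL2 (\<lambda>x. a x * \<phi> t x)" by (rule C[OF at(1)])
    show "Sq r (\<lambda>x. a x * \<phi> t x) < \<infinity>"
      by (rule le_less_trans[OF b[OF at(1)]]) (use at in \<open>simp add: ennreal_mult_less_top\<close>)
    show "((\<lambda>\<tau>. Sq r (\<lambda>x. a x * \<phi> \<tau> x - a x * \<phi> t x)) \<longlongrightarrow> 0) (at t within I)"
    proof (rule ennreal_squeeze_0[OF _ ennreal_cmult_0(1)[OF at(3), of "ennreal (20 * K\<^sup>2)"]], use eventually_within[of I t] in eventually_elim)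
      fix \<tau> assume \<tau>: "\<tau> \<in> I"
      show "Sq r (\<lambda>x. a x * \<phi> \<tau> x - a x * \<phi> t x) \<le> ennreal (20 * K\<^sup>2) * Sq r (\<lambda>x. \<phi> \<tau> x - \<phi> t x)"
        using b[OF CL2_diff[OF scontD(1)[OF \<phi> \<tau>] at(1)]] by (simp add: right_diff_distrib)
    qed simp
  qed
qed

text \<open>Made for the factors \<open>u0\<close> and \<open>h\<close>, which are bounded but may
  lie outside every Sobolev space, so that \<open>scont_mult\<close> cannot be applied to them.
  Their derivatives do lie in one: in the product rule a' \<phi> falls under the algebra property
  and a \<phi>' under the induction. Orders below 2 are again interpolated.\<close>

theorem scont_mult_smooth:
  assumes a: "\<And>x. (a has_real_derivative a' x) (at x)" and K: "\<And>x. \<bar>a x\<bar> \<le> K" and a': "CL2 a'" "Sq R a' < \<infinity>" and R: "R > 3/2"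
  shows "scont r I \<phi> \<Longrightarrow> 1/2 < r \<Longrightarrow> r \<le> R \<Longrightarrow> scont r I (\<lambda>t x. a x * \<phi> t x)"
proof -
  obtain a'' where a'': "\<And>x. (a' has_real_derivative a'' x) (at x)" "CL2 a''" "Sq (R - 1) a'' < \<infinity>"
    by (rule Sq_C1[OF a'(1) R a'(2)], rule that)
  obtain K1 where K1: "\<And>x. \<bar>a' x\<bar> \<le> K1" by (rule Sq_bounded[OF a'(1) _ a'(2)]) (use R in auto)
  obtain K2 where K2: "\<And>x. \<bar>a'' x\<bar> \<le> K2" by (rule Sq_bounded[OF a''(2) _ a''(3)]) (use R in auto)
  define L where "L = max K (max K1 K2)"
  have L: "\<bar>a x\<bar> \<le> L" "\<bar>a' x\<bar> \<le> L" "\<bar>a'' x\<bar> \<le> L" for x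
    using K[of x] K1[of x] K2[of x] by (auto simp: L_def)
  have base: "scont r I (\<lambda>t x. a x * \<phi> t x)" if "scont r I \<phi>" "1/2 < r" "r < 2" for r \<phi>
    by (rule scont_mult_smooth_base[OF that(1) _ that(3) a a''(1) CL2_continuous(1)[OF a''(2)] L]) (use that in simp)
  have "\<forall>r \<phi>. scont r I \<phi> \<longrightarrow> 1/2 < r \<longrightarrow> r \<le> R \<longrightarrow> r < 2 + real n \<longrightarrow> scont r I (\<lambda>t x. a x * \<phi> t x)" for n
  proof (induction n)
    case 0
    then show ?case by (auto intro: base)
  next
    case (Suc n)
    show ?case
    proof (intro allI impI)
      fix r \<phi> assume \<phi>: "scont r I \<phi>" and r: "1/2 < r" "r \<le> R" "r < 2 + real (Suc n)"
      show "scont r I (\<lambda>t x. a x * \<phi> t x)"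
      proof (cases "r < 2")
        case True
        with \<phi> r show ?thesis by (intro base) auto
      next
        case False
        obtain \<phi>' where \<phi>': "\<And>t x. t \<in> I \<Longrightarrow> (\<phi> t has_real_derivative \<phi>' t x) (at x)" "scont (r - 1) I \<phi>'"
          by (rule scont_C1[OF \<phi>]) (use False in auto)
        have r1: "1/2 < r - 1" "r - 1 \<le> R" "r - 1 < 2 + real n" using r False by auto
        have \<phi>1: "scont (r - 1) I \<phi>" by (rule scont_mono[OF \<phi>]) simp
        have 1: "scont (r - 1) I (\<lambda>t x. a x * \<phi> t x)" using Suc \<phi>1 r1 by simp
        have 2: "scont (r - 1) I (\<lambda>t x. a x * \<phi>' t x)" using Suc \<phi>'(2) r1 by simp
        have 3: "scont (r - 1) I (\<lambda>t. a')" by (rule scont_const[OF a'(1) Sq_finite_mono[OF r1(2) a'(2)]])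
        have "scont (r - 1 + 1) I (\<lambda>t x. a x * \<phi> t x)"
        proof (rule scont_Suc[OF 1 scont_add[OF scont_mult[OF 3 \<phi>1 r1(1)] 2]])
          fix t x assume "t \<in> I"
          from DERIV_mult[OF a \<phi>'(1)[OF this], of x]
          show "((\<lambda>x. a x * \<phi> t x) has_real_derivative a' x * \<phi> t x + a x * \<phi>' t x) (at x)" by (simp add: algebra_simps)
        qed
        then show ?thesis by simp
      qed
    qed
  qed
  moreover obtain n where "r < 2 + real n" using reals_Archimedean2[of "r - 2"] by (auto simp: algebra_simps)
  ultimately show "scont r I \<phi> \<Longrightarrow> 1/2 < r \<Longrightarrow> r \<le> R \<Longrightarrow> scont r I (\<lambda>t x. a x * \<phi> t x)" by blast
qed

section \<open>Difference quotients in time\<close>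

lemma ennreal_power2_le_imp_le:
  fixes X :: ennreal
  assumes le: "X\<^sup>2 \<le> (ennreal c)\<^sup>2" and c: "c \<ge> 0"
  shows "X \<le> ennreal c"
proof -
  have "X\<^sup>2 < \<top>" by (rule le_less_trans[OF le]) (simp add: ennreal_power[OF c])
  then have "X < \<top>" by (simp add: power_less_top_ennreal)
  then obtain x where x: "X = ennreal x" "x \<ge> 0" by (cases X) auto
  have "ennreal (x\<^sup>2) \<le> ennreal (c\<^sup>2)" using le unfolding x(1) ennreal_power[OF x(2)] ennreal_power[OF c] .
  then have "x\<^sup>2 \<le> c\<^sup>2" by (subst (asm) ennreal_le_iff) simp_all
  then have "x \<le> c" using c by (rule power2_le_imp_le)
  then show ?thesis unfolding x(1) by (rule ennreal_leI)
qed

text \<open>The norm as a supremum of scalar pairings, a substitute for integration of curves with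
  values in \<open>H\<^sup>r\<close>. The extremal test is \<open>wt r\<close> times the conjugate
  of \<open>FT f\<close>, restricted to \<open>E n\<close> so that it is integrable and bounded. The
  resulting \<alpha>^2 \<le> B \<alpha> is divided by \<alpha>, and monotone convergence removes the
  restriction.\<close>

lemma Sq_dual:
  assumes f: "CL2 f" and B: "B \<ge> 0"
    and *: "\<And>\<psi>. integrable lborel \<psi> \<Longrightarrow> L2 \<psi> \<Longrightarrow> Q (- r) \<psi> < \<infinity> \<Longrightarrow>
      ennreal ((cmod (LINT x|lborel. cx f x * fhat \<psi> x))\<^sup>2) \<le> ennreal B * Q (- r) \<psi>"
  shows "Sq r f \<le> ennreal B"
proof -
  note [measurable] = FT_measurable[OF f]
  define E where "E n = {x. \<bar>x\<bar> \<le> real n \<and> cmod (FT f x) \<le> real n}" for n :: nat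
  have [measurable]: "E n \<in> sets borel" for n unfolding E_def by measurable
  let ?a = "\<lambda>n x. wt r x * (cmod (FT f x))\<^sup>2 * indicator (E n) x"
  have bound: "(\<integral>\<^sup>+x. ennreal (?a n x) \<partial>lborel) \<le> ennreal B" for n
  proof -
    define \<psi> where "\<psi> = (\<lambda>x. of_real (wt r x * indicator (E n) x) * cnj (FT f x))"
    have [measurable]: "\<psi> \<in> borel_measurable borel" by (simp add: \<psi>_def)
    have "compact (wt r ` {- real n..real n})" by (intro compact_continuous_image continuous_wt) auto
    then obtain W where W: "\<And>x. x \<in> {- real n..real n} \<Longrightarrow> \<bar>wt r x\<bar> \<le> W"
      by (metis (no_types, lifting) bounded_iff compact_imp_bounded image_eqI real_norm_def)
    have bd: "cmod (\<psi> x) \<le> (W * real n) * indicator {- real n..real n} x" for x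
    proof (cases "x \<in> E n")
      case True
      then have "x \<in> {- real n..real n}" "cmod (FT f x) \<le> real n" by (auto simp: E_def)
      then show ?thesis using W[of x] True order_trans[OF abs_ge_zero W[of x]] by (auto simp: \<psi>_def norm_mult intro!: mult_mono)
    next
      case False
      have "0 \<le> W" using order_trans[OF abs_ge_zero W[of 0]] by simp
      then show ?thesis using False by (simp add: \<psi>_def)
    qed
    have ii: "integrable lborel (\<lambda>x. (W * real n) * indicator {- real n..real n} x)"
      by (intro integrable_mult_right integrable_real_indicator) (simp_all add: emeasure_lborel_Icc_eq)
    have i: "integrable lborel \<psi>"
      by (rule Bochner_Integration.integrable_bound[OF ii]) (use bd in \<open>auto intro!: order_trans[OF _ abs_ge_self]\<close>)
    have "cmod (\<psi> x) \<le> W * real n" for x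
    proof -
      have "0 \<le> W" using order_trans[OF abs_ge_zero W[of 0]] by simp
      then have "0 \<le> W * real n" by simp
      then show ?thesis using bd[of x] by (cases "x \<in> {- real n..real n}") auto
    qed
    then have L: "L2 \<psi>" using L2_of_bounded_integrable[OF i] by blast
    have e1: "FT f x * \<psi> x = of_real (?a n x)" for x
      unfolding \<psi>_def by (simp add: complex_norm_square[symmetric] mult_ac flip: of_real_power)
    have int: "integrable lborel (\<lambda>x. FT f x * \<psi> x)" by (rule L2_C_S(1)[OF ft_L2(2)[OF ft_FT[OF f]] L])
    have ra: "integrable lborel (?a n)" using integrable_Re[OF int] unfolding e1 by simp
    have an: "0 \<le> ?a n x" for x by simp
    define \<alpha> where "\<alpha> = (LINT x|lborel. ?a n x)"
    have \<alpha>0: "\<alpha> \<ge> 0" unfolding \<alpha>_def by (intro integral_nonneg_AE) simp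
    have \<alpha>: "(\<integral>\<^sup>+x. ennreal (?a n x) \<partial>lborel) = ennreal \<alpha>"
      unfolding \<alpha>_def by (rule nn_integral_eq_integral[OF ra]) simp
    have Q: "Q (- r) \<psi> = ennreal \<alpha>"
      unfolding Q_def \<alpha>[symmetric]
    proof (intro nn_integral_cong)
      fix x
      have "wt (- r) x * (cmod (\<psi> x))\<^sup>2 = ?a n x"
        unfolding \<psi>_def by (simp add: norm_mult power_mult_distrib wt_minus power2_eq_square indicator_def)
      then show "ennreal (wt (- r) x) * ennreal ((cmod (\<psi> x))\<^sup>2) = ennreal (?a n x)"
        by (subst ennreal_mult[symmetric]) auto
    qed
    have "(LINT x|lborel. cx f x * fhat \<psi> x) = (LINT x|lborel. FT f x * \<psi> x)"
      using ft_FT[OF f] i L by (simp add: ft_def)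
    also have "\<dots> = of_real \<alpha>" unfolding e1 \<alpha>_def by (rule integral_complex_of_real)
    finally have "ennreal (\<alpha>\<^sup>2) \<le> ennreal B * ennreal \<alpha>"
      using *[OF i L] by (simp add: Q)
    then have "\<alpha> * \<alpha> \<le> B * \<alpha>" using \<alpha>0 B by (simp add: power2_eq_square flip: ennreal_mult)
    then have "\<alpha> \<le> B" using \<alpha>0 B by (cases "\<alpha> = 0") auto
    then show ?thesis unfolding \<alpha> by (rule ennreal_leI)
  qed
  have "(\<lambda>n. \<integral>\<^sup>+x. ennreal (?a n x) \<partial>lborel) \<longlonglongrightarrow> Sq r f"
    unfolding Sq_def Q_def
  proof (rule nn_integral_LIMSEQ)
    show "incseq (\<lambda>n x. ennreal (?a n x))"
      by (intro incseq_SucI le_funI ennreal_leI mult_left_mono) (auto simp: E_def indicator_def)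
    fix x
    obtain k where k: "max \<bar>x\<bar> (cmod (FT f x)) \<le> real k" using real_arch_simple by blast
    show "(\<lambda>n. ennreal (?a n x)) \<longlonglongrightarrow> ennreal (wt r x) * ennreal ((cmod (FT f x))\<^sup>2)"
    proof (rule tendsto_eventually, rule eventually_sequentiallyI[of k])
      fix n assume "k \<le> n"
      then have "real k \<le> real n" by simp
      then have "x \<in> E n" using k by (simp add: E_def)
      then show "ennreal (?a n x) = ennreal (wt r x) * ennreal ((cmod (FT f x))\<^sup>2)" by (simp add: ennreal_mult)
    qed
  qed simp
  then show ?thesis by (rule LIMSEQ_le_const2) (use bound in blast)
qed

lemma Sq_pairing:
  assumes f: "CL2 f" and \<psi>: "integrable lborel \<psi>" "L2 \<psi>"
  shows "ennreal ((cmod (LINT x|lborel. cx f x * fhat \<psi> x))\<^sup>2) \<le> Sq r f * Q (- r) \<psi>"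
proof -
  note [measurable] = FT_measurable[OF f] L2_measurable[OF \<psi>(2)]
  have p1: "(LINT x|lborel. cx f x * fhat \<psi> x) = (LINT x|lborel. FT f x * \<psi> x)"
    using ft_FT[OF f] \<psi> by (simp add: ft_def)
  have p2: "ennreal (cmod (LINT x|lborel. FT f x * \<psi> x)) \<le> (\<integral>\<^sup>+x. ennreal (cmod (FT f x * \<psi> x)) \<partial>lborel)"
    by (rule integral_norm_bound_ennreal[OF L2_C_S(1)[OF ft_L2(2)[OF ft_FT[OF f]] \<psi>(2)]])
  have p3: "(\<integral>\<^sup>+x. ennreal (cmod (FT f x * \<psi> x)) \<partial>lborel) = (\<integral>\<^sup>+x. ennreal (wt (r/2) x * cmod (FT f x)) * ennreal (wt (-(r/2)) x * cmod (\<psi> x)) \<partial>lborel)"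
  proof (intro nn_integral_cong)
    fix x
    have w: "wt (r/2) x * wt (-(r/2)) x = 1" by (simp add: wt_minus)
    have "cmod (FT f x * \<psi> x) = (wt (r/2) x * wt (-(r/2)) x) * (cmod (FT f x) * cmod (\<psi> x))" by (simp only: w norm_mult mult_1)
    also have "\<dots> = (wt (r/2) x * cmod (FT f x)) * (wt (-(r/2)) x * cmod (\<psi> x))" by (simp only: mult_ac)
    finally have e: "cmod (FT f x * \<psi> x) = (wt (r/2) x * cmod (FT f x)) * (wt (-(r/2)) x * cmod (\<psi> x))" .
    show "ennreal (cmod (FT f x * \<psi> x)) = ennreal (wt (r/2) x * cmod (FT f x)) * ennreal (wt (-(r/2)) x * cmod (\<psi> x))"
      unfolding e by (rule ennreal_mult) auto
  qed
  have p4: "(\<integral>\<^sup>+x. ennreal (wt (r/2) x * cmod (FT f x)) * ennreal (wt (-(r/2)) x * cmod (\<psi> x)) \<partial>lborel)\<^sup>2 \<le>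
      (\<integral>\<^sup>+x. (ennreal (wt (r/2) x * cmod (FT f x)))\<^sup>2 \<partial>lborel) * (\<integral>\<^sup>+x. (ennreal (wt (-(r/2)) x * cmod (\<psi> x)))\<^sup>2 \<partial>lborel)"
    by (rule Cauchy_Schwarz_nn_integral) auto
  have sq: "(\<integral>\<^sup>+x. (ennreal (wt (r/2) x * cmod (G x)))\<^sup>2 \<partial>lborel) = Q r G" for r G
    unfolding Q_def
  proof (intro nn_integral_cong)
    fix x
    have "(wt (r / 2) x * cmod (G x))\<^sup>2 = wt r x * (cmod (G x))\<^sup>2"
      using wt_add[of "r/2" "r/2" x] by (simp add: power_mult_distrib power2_eq_square)
    moreover have "(ennreal (wt (r / 2) x * cmod (G x)))\<^sup>2 = ennreal ((wt (r / 2) x * cmod (G x))\<^sup>2)"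
      by (rule ennreal_power) simp
    ultimately show "(ennreal (wt (r / 2) x * cmod (G x)))\<^sup>2 = ennreal (wt r x) * ennreal ((cmod (G x))\<^sup>2)"
      using ennreal_mult'[of "wt r x" "(cmod (G x))\<^sup>2"] by simp
  qed
  have "(ennreal (cmod (LINT x|lborel. cx f x * fhat \<psi> x)))\<^sup>2 \<le> (\<integral>\<^sup>+x. ennreal (wt (r/2) x * cmod (FT f x)) * ennreal (wt (-(r/2)) x * cmod (\<psi> x)) \<partial>lborel)\<^sup>2"
    unfolding p1 by (rule power_mono[OF p2[unfolded p3]]) simp
  also have "\<dots> \<le> Q r (FT f) * Q (- r) \<psi>"
    using p4 sq[of r "FT f"] sq[of "-r" \<psi>] by simp
  finally have "(ennreal (cmod (LINT x|lborel. cx f x * fhat \<psi> x)))\<^sup>2 \<le> Q r (FT f) * Q (- r) \<psi>" .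
  then show ?thesis by (simp add: Sq_def ennreal_power)
qed

text \<open>Minkowski's inequality for the time integral of a curve in \<open>H\<^sup>r\<close>.
  After pairing with a test, Fubini leaves a scalar integral over time, and
  \<open>Sq_pairing\<close> bounds its integrand at each time.\<close>

lemma Sq_integral_bound:
  fixes \<phi> :: "real \<Rightarrow> real \<Rightarrow> real"
  assumes ab: "a \<le> b" and \<phi>: "\<And>s. s \<in> {a..b} \<Longrightarrow> CL2 (\<phi> s)" "\<And>s. s \<in> {a..b} \<Longrightarrow> Sq r (\<phi> s) \<le> ennreal B"
    and B: "B \<ge> 0" and r: "r \<ge> 0"
    and m: "(\<lambda>(s, x). indicator {a..b} s * \<phi> s x) \<in> borel_measurable (borel \<Otimes>\<^sub>M borel)"
    and D: "CL2 D" "\<And>x. D x = (LINT s|lborel. indicator {a..b} s * \<phi> s x)"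
  shows "Sq r D \<le> ennreal ((b - a)\<^sup>2 * B)"
proof (rule Sq_dual[OF D(1)])
  show "0 \<le> (b - a)\<^sup>2 * B" using B by simp
  fix \<psi> assume \<psi>: "integrable lborel \<psi>" "L2 \<psi>" and fin: "Q (- r) \<psi> < \<infinity>"
  note Lh = L2_fhat[OF \<psi>]
  have [measurable]: "fhat \<psi> \<in> borel_measurable borel" using \<psi> by simp
  define f where "f = (\<lambda>s x. cx (\<lambda>x. indicator {a..b} s * \<phi> s x) x * fhat \<psi> x)"
  have m1: "(\<lambda>p. indicator {a..b} (fst p) * \<phi> (fst p) (snd p)) \<in> borel_measurable (borel \<Otimes>\<^sub>M borel)"
    using m by (simp add: case_prod_beta')
  have mf: "case_prod f \<in> borel_measurable (borel \<Otimes>\<^sub>M borel)"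
    unfolding f_def case_prod_beta' using m1 by measurable
  have mf': "case_prod f \<in> borel_measurable (lborel \<Otimes>\<^sub>M lborel)" using mf by simp
  obtain K where K: "sqn (fhat \<psi>) = ennreal K" "K \<ge> 0" using Lh by (cases "sqn (fhat \<psi>)") (auto simp: L2_def)
  \<comment> \<open>This \<open>L\<^sup>2\<close> bound serves the integrability required by Fubini;
    the sharp bound of order \<open>r\<close> comes afterwards in \<open>pt\<close>.\<close>
  have nn: "(\<integral>\<^sup>+x. ennreal (norm (f s x)) \<partial>lborel) \<le> ennreal (sqrt (B * K)) * indicator {a..b} s" for s
  proof (cases "s \<in> {a..b}")
    case True
    note [measurable] = CL2_measurable[OF \<phi>(1)[OF True]]
    have "(\<integral>\<^sup>+x. ennreal (norm (f s x)) \<partial>lborel) = (\<integral>\<^sup>+x. ennreal (cmod (cx (\<phi> s) x)) * ennreal (cmod (fhat \<psi> x)) \<partial>lborel)"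
      using True by (intro nn_integral_cong) (simp add: f_def norm_mult ennreal_mult)
    then have "(\<integral>\<^sup>+x. ennreal (norm (f s x)) \<partial>lborel)\<^sup>2 \<le> (\<integral>\<^sup>+x. (ennreal (cmod (cx (\<phi> s) x)))\<^sup>2 \<partial>lborel) * (\<integral>\<^sup>+x. (ennreal (cmod (fhat \<psi> x)))\<^sup>2 \<partial>lborel)"
      by (simp only:) (rule Cauchy_Schwarz_nn_integral, auto)
    also have "\<dots> = Sq 0 (\<phi> s) * sqn (fhat \<psi>)"
      unfolding Sq_0[OF \<phi>(1)[OF True]] sqn_def by (simp add: ennreal_power)
    also have "\<dots> \<le> ennreal B * ennreal K"
      unfolding K(1) by (intro mult_right_mono order_trans[OF Sq_mono[OF r] \<phi>(2)[OF True]]) simp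
    also have "\<dots> = (ennreal (sqrt (B * K)))\<^sup>2" using B K by (simp add: ennreal_power ennreal_mult)
    finally have "(\<integral>\<^sup>+x. ennreal (norm (f s x)) \<partial>lborel) \<le> ennreal (sqrt (B * K))"
      by (rule ennreal_power2_le_imp_le) (use B K in simp)
    then show ?thesis using True by simp
  qed (simp add: f_def)
  have i: "integrable (lborel \<Otimes>\<^sub>M lborel) (case_prod f)"
  proof (rule integrableI_bounded[OF mf'])
    have "(\<integral>\<^sup>+p. ennreal (norm (case_prod f p)) \<partial>(lborel \<Otimes>\<^sub>M lborel)) = (\<integral>\<^sup>+s. \<integral>\<^sup>+x. ennreal (norm (f s x)) \<partial>lborel \<partial>lborel)"
      using lborel.nn_integral_fst[of "\<lambda>p. ennreal (norm (case_prod f p))" lborel] mf' by simp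
    also have "\<dots> \<le> (\<integral>\<^sup>+s. ennreal (sqrt (B * K)) * indicator {a..b} s \<partial>lborel)" by (intro nn_integral_mono nn)
    also have "\<dots> < \<infinity>" by (subst nn_integral_cmult_indicator) (auto simp: emeasure_lborel_Icc_eq ennreal_mult_less_top)
    finally show "(\<integral>\<^sup>+p. ennreal (norm (case_prod f p)) \<partial>(lborel \<Otimes>\<^sub>M lborel)) < \<infinity>" .
  qed
  have "(LINT x|lborel. LINT s|lborel. f s x) = (LINT s|lborel. LINT x|lborel. f s x)"
    by (rule lborel_pair.Fubini_integral[OF i])
  moreover have "(LINT s|lborel. f s x) = cx D x * fhat \<psi> x" for x
    unfolding f_def D(2) integral_mult_left_zero integral_complex_of_real ..
  ultimately have e: "(LINT x|lborel. cx D x * fhat \<psi> x) = (LINT s|lborel. LINT x|lborel. f s x)" by simp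
  obtain W where W: "Q (- r) \<psi> = ennreal W" "W \<ge> 0" using fin by (cases "Q (- r) \<psi>") auto
  have pt: "cmod (LINT x|lborel. f s x) \<le> sqrt (B * W) * indicator {a..b} s" for s
  proof (cases "s \<in> {a..b}")
    case True
    have "(LINT x|lborel. f s x) = (LINT x|lborel. cx (\<phi> s) x * fhat \<psi> x)" using True by (simp add: f_def)
    then have "ennreal ((cmod (LINT x|lborel. f s x))\<^sup>2) \<le> Sq r (\<phi> s) * Q (- r) \<psi>"
      using Sq_pairing[OF \<phi>(1)[OF True] \<psi>] by simp
    also have "\<dots> \<le> ennreal B * ennreal W" unfolding W(1) by (intro mult_right_mono \<phi>(2) True) simp
    finally have "(cmod (LINT x|lborel. f s x))\<^sup>2 \<le> B * W" using B W by (simp flip: ennreal_mult)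
    then have "sqrt ((cmod (LINT x|lborel. f s x))\<^sup>2) \<le> sqrt (B * W)" by (rule real_sqrt_le_mono)
    then show ?thesis using True by simp
  qed (simp add: f_def)
  have "cmod (LINT s|lborel. LINT x|lborel. f s x) \<le> (LINT s|lborel. sqrt (B * W) * indicator {a..b} s)"
    by (rule order_trans[OF integral_norm_bound], rule integral_mono')
      (use pt B W in \<open>auto intro!: integrable_real_indicator mult_nonneg_nonneg simp: emeasure_lborel_Icc_eq\<close>)
  also have "\<dots> = sqrt (B * W) * (b - a)" using ab by simp
  finally have "(cmod (LINT x|lborel. cx D x * fhat \<psi> x))\<^sup>2 \<le> (sqrt (B * W) * (b - a))\<^sup>2"
    unfolding e by (intro power_mono) auto
  also have "\<dots> = (b - a)\<^sup>2 * B * W" using B W by (simp add: power_mult_distrib)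
  finally show "ennreal ((cmod (LINT x|lborel. cx D x * fhat \<psi> x))\<^sup>2) \<le> ennreal ((b - a)\<^sup>2 * B) * Q (- r) \<psi>"
    unfolding W(1) using B W by (simp add: ennreal_leI flip: ennreal_mult)
qed

text \<open>Upgrades a pointwise time derivative to one in the norm of \<open>H\<^sup>r\<close>: the
  defect of the difference quotient is the mean of \<open>\<phi> s - \<phi> t\<close> over the times
  between, which is small since \<phi> is continuous into the space. Joint continuity of \<phi>
  supplies the measurability for Fubini.\<close>

theorem scont_difference_quotient:
  fixes \<phi> \<psi> :: "real \<Rightarrow> real \<Rightarrow> real"
  assumes \<phi>: "scont r {0..T} \<phi>" and r: "r \<ge> 0" and \<psi>: "\<And>t. t \<in> {0..T} \<Longrightarrow> CL2 (\<psi> t)"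
    and d: "\<And>t x. t \<in> {0..T} \<Longrightarrow> ((\<lambda>s. \<psi> s x) has_real_derivative \<phi> t x) (at t within {0..T})"
    and c: "continuous_on ({0..T} \<times> UNIV) (\<lambda>(s, x). \<phi> s x)" and t: "t \<in> {0..T}"
  shows "((\<lambda>\<tau>. Sq r (\<lambda>x. (\<psi> \<tau> x - \<psi> t x) / (\<tau> - t) - \<phi> t x)) \<longlongrightarrow> 0) (at t within {0..T})"
proof (rule ennreal_tendsto_0I)
  fix e :: real assume e: "e > 0"
  note st = scontD[OF \<phi> t]
  have "\<forall>\<^sub>F \<tau> in at t within {0..T}. Sq r (\<lambda>x. \<phi> \<tau> x - \<phi> t x) < ennreal e"
    using e by (intro order_tendstoD(2)[OF st(3)]) simp
  then obtain \<delta> where \<delta>: "\<delta> > 0" "\<And>\<tau>. \<tau> \<in> {0..T} \<Longrightarrow> \<tau> \<noteq> t \<Longrightarrow> \<bar>\<tau> - t\<bar> < \<delta> \<Longrightarrow> Sq r (\<lambda>x. \<phi> \<tau> x - \<phi> t x) < ennreal e"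
    unfolding eventually_at by (auto simp: dist_real_def)
  have z: "Sq r (\<lambda>x. \<phi> t x - \<phi> t x) = 0" using Sq_cmult[OF st(1), of r 0] by simp
  have "Sq r (\<lambda>x. (\<psi> \<tau> x - \<psi> t x) / (\<tau> - t) - \<phi> t x) \<le> ennreal e" if \<tau>: "\<tau> \<in> {0..T}" "\<tau> \<noteq> t" "\<bar>\<tau> - t\<bar> < \<delta>" for \<tau>
  proof -
    define a b where "a = min t \<tau>" "b = max t \<tau>"
    have ab: "a < b" "{a..b} \<subseteq> {0..T}" "b - a = \<bar>\<tau> - t\<bar>" using t \<tau> by (auto simp: a_b_def)
    define D where "D = (\<lambda>x. \<psi> b x - \<psi> a x - (b - a) * \<phi> t x)"
    have abI: "a \<in> {0..T}" "b \<in> {0..T}" using t \<tau> by (auto simp: a_b_def min_def max_def)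
    have CD: "CL2 D" unfolding D_def by (intro CL2_diff CL2_cmult \<psi> abI st)
    have "Sq r D \<le> ennreal ((b - a)\<^sup>2 * e)"
    proof (rule Sq_integral_bound[OF _ _ _ _ r _ CD, where \<phi>="\<lambda>s x. \<phi> s x - \<phi> t x"])
      show "a \<le> b" using ab by simp
      show "e \<ge> 0" using e by simp
      fix s assume s: "s \<in> {a..b}"
      then have sI: "s \<in> {0..T}" using ab by blast
      show "CL2 (\<lambda>x. \<phi> s x - \<phi> t x)" by (rule CL2_diff[OF scontD(1)[OF \<phi> sI] st(1)])
      have "\<bar>s - t\<bar> < \<delta>" using s ab \<tau> by (auto simp: a_b_def min_def max_def split: if_splits)
      then show "Sq r (\<lambda>x. \<phi> s x - \<phi> t x) \<le> ennreal e"
        using \<delta>(2)[OF sI] z by (cases "s = t") auto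
    next
      have c1: "continuous_on ({a..b} \<times> UNIV) (\<lambda>p. \<phi> (fst p) (snd p) - \<phi> t (snd p))"
      proof (intro continuous_intros)
        have c': "continuous_on ({0..T} \<times> UNIV) (\<lambda>p. \<phi> (fst p) (snd p))" using c by (simp add: case_prod_beta')
        show "continuous_on ({a..b} \<times> UNIV) (\<lambda>p. \<phi> (fst p) (snd p))" by (rule continuous_on_subset[OF c']) (use ab in auto)
        show "continuous_on ({a..b} \<times> UNIV) (\<lambda>p. \<phi> t (snd p))"
          by (rule continuous_on_compose2[OF CL2_continuous(1)[OF st(1)]]) (auto intro: continuous_intros)
      qed
      have "(\<lambda>p. indicator ({a..b} \<times> UNIV) p *\<^sub>R (\<phi> (fst p) (snd p) - \<phi> t (snd p))) \<in> borel_measurable borel"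
        by (rule borel_measurable_continuous_on_indicator[OF _ c1]) (intro borel_closed closed_Times closed_UNIV closed_atLeastAtMost)
      then show "(\<lambda>(s, x). indicator {a..b} s * (\<phi> s x - \<phi> t x)) \<in> borel_measurable (borel \<Otimes>\<^sub>M borel)"
        unfolding borel_prod by (simp add: case_prod_beta' indicator_times)
    next
      fix x
      have cx: "continuous_on {a..b} (\<lambda>s. \<phi> s x - \<phi> t x)"
      proof (intro continuous_intros)
        show "continuous_on {a..b} (\<lambda>s. \<phi> s x)"
        proof -
          have "continuous_on {a..b} (\<lambda>s. (\<lambda>(s, x). \<phi> s x) (s, x))"
            by (rule continuous_on_compose2[OF c]) (use ab in \<open>auto intro!: continuous_intros\<close>)
          then show ?thesis by simp
        qed
      qed
      have "(LINT s|lborel. indicator {a..b} s *\<^sub>R (\<phi> s x - \<phi> t x)) = (\<psi> b x - b * \<phi> t x) - (\<psi> a x - a * \<phi> t x)"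
      proof (rule integral_FTC_atLeastAtMost[OF less_imp_le[OF ab(1)] _ cx])
        fix s assume "a \<le> s" "s \<le> b"
        then have s: "s \<in> {0..T}" using ab by auto
        have "((\<lambda>s. \<psi> s x - s * \<phi> t x) has_real_derivative \<phi> s x - \<phi> t x) (at s within {a..b})"
          by (rule DERIV_subset[OF _ ab(2)]) (auto intro!: derivative_eq_intros d[OF s])
        then show "((\<lambda>s. \<psi> s x - s * \<phi> t x) has_vector_derivative \<phi> s x - \<phi> t x) (at s within {a..b})"
          by (simp add: has_real_derivative_iff_has_vector_derivative)
      qed
      then show "D x = (LINT s|lborel. indicator {a..b} s * (\<phi> s x - \<phi> t x))"
        by (simp add: D_def algebra_simps)
    qed
    moreover have "(\<lambda>x. (\<psi> \<tau> x - \<psi> t x) / (\<tau> - t) - \<phi> t x) = (\<lambda>x. (1 / (b - a)) * D x)"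
    proof
      fix x
      show "(\<psi> \<tau> x - \<psi> t x) / (\<tau> - t) - \<phi> t x = (1 / (b - a)) * D x"
        using \<tau>(2) by (cases "t < \<tau>") (auto simp: D_def a_b_def min_def max_def field_simps)
    qed
    ultimately have "Sq r (\<lambda>x. (\<psi> \<tau> x - \<psi> t x) / (\<tau> - t) - \<phi> t x) \<le> ennreal ((1 / (b - a))\<^sup>2) * ennreal ((b - a)\<^sup>2 * e)"
      by (simp only: Sq_cmult[OF CD] mult_left_mono zero_le)
    also have "\<dots> = ennreal ((1 / (b - a))\<^sup>2 * ((b - a)\<^sup>2 * e))" using e by (subst ennreal_mult) auto
    also have "(1 / (b - a))\<^sup>2 * ((b - a)\<^sup>2 * e) = e" using ab by (simp add: power2_eq_square)
    finally show ?thesis .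
  qed
  then show "\<forall>\<^sub>F \<tau> in at t within {0..T}. Sq r (\<lambda>x. (\<psi> \<tau> x - \<psi> t x) / (\<tau> - t) - \<phi> t x) \<le> ennreal e"
    unfolding eventually_at using \<delta>(1) by (auto simp: dist_real_def)
qed

section \<open>The explicit solution\<close>

lemma scont_0_Lipschitz:
  assumes c: "\<And>t. t \<in> I \<Longrightarrow> continuous_on UNIV (\<phi> t)" and f: "CL2 f"
    and b: "\<And>t x. t \<in> I \<Longrightarrow> \<bar>\<phi> t x\<bar> \<le> C * \<bar>f x\<bar>"
    and l: "\<And>t \<tau> x. t \<in> I \<Longrightarrow> \<tau> \<in> I \<Longrightarrow> \<bar>\<phi> \<tau> x - \<phi> t x\<bar> \<le> C * \<bar>\<tau> - t\<bar> * \<bar>f x\<bar>"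
  shows "scont 0 I \<phi>"
proof -
  note [measurable] = CL2_measurable[OF f]
  have s: "CL2 k" "Sq 0 k \<le> ennreal (D\<^sup>2) * Sq 0 f"
    if k: "continuous_on UNIV k" "\<And>x. \<bar>k x\<bar> \<le> D * \<bar>f x\<bar>" for k D
  proof -
    have "L2 (\<lambda>x. of_real D * cx f x)" using L2_cmult[OF CL2_L2[OF f]] by simp
    then have "L2 (cx k)"
    proof (rule L2_bound)
      show "cx k \<in> borel_measurable borel" by (intro borel_measurable_continuous_onI continuous_on_of_real k(1))
      fix x
      show "cmod (cx k x) \<le> cmod (of_real D * cx f x)"
        using k(2)[of x] mult_right_mono[OF abs_ge_self[of D] abs_ge_zero[of "f x"]] by (simp add: norm_mult)
    qed
    then show C: "CL2 k" using k(1) by (simp add: CL2_def)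
    show "Sq 0 k \<le> ennreal (D\<^sup>2) * Sq 0 f"
      unfolding Sq_0[OF C] Sq_0[OF f] sqn_def
    proof (subst nn_integral_cmult[symmetric], simp, intro nn_integral_mono)
      fix x
      have "\<bar>k x\<bar>\<^sup>2 \<le> (D * \<bar>f x\<bar>)\<^sup>2" by (intro power_mono k) simp
      then have "(k x)\<^sup>2 \<le> D\<^sup>2 * (f x)\<^sup>2" by (simp add: power_mult_distrib)
      then show "ennreal ((cmod (cx k x))\<^sup>2) \<le> ennreal (D\<^sup>2) * ennreal ((cmod (cx f x))\<^sup>2)"
        by (simp add: ennreal_leI flip: ennreal_mult)
    qed
  qed
  have fin: "Sq 0 f < \<top>" using CL2_L2[OF f] by (simp add: Sq_0[OF f] L2_def)
  show ?thesis
  proof (rule scontI)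
    fix t assume t: "t \<in> I"
    show "CL2 (\<phi> t)" by (rule s(1)[OF c[OF t] b[OF t]])
    show "Sq 0 (\<phi> t) < \<infinity>" by (rule le_less_trans[OF s(2)[OF c[OF t] b[OF t]]]) (use fin in \<open>simp add: ennreal_mult_less_top\<close>)
    have "((\<lambda>\<tau>. (C * \<bar>\<tau> - t\<bar>)\<^sup>2) \<longlongrightarrow> (C * \<bar>t - t\<bar>)\<^sup>2) (at t within I)" by (intro tendsto_intros)
    then have "((\<lambda>\<tau>. ennreal ((C * \<bar>\<tau> - t\<bar>)\<^sup>2)) \<longlongrightarrow> ennreal 0) (at t within I)" by (intro tendsto_ennrealI) simp
    then have lim: "((\<lambda>\<tau>. ennreal ((C * \<bar>\<tau> - t\<bar>)\<^sup>2)) \<longlongrightarrow> 0) (at t within I)" by simp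
    show "((\<lambda>\<tau>. Sq 0 (\<lambda>x. \<phi> \<tau> x - \<phi> t x)) \<longlongrightarrow> 0) (at t within I)"
    proof (rule ennreal_squeeze_0[OF _ ennreal_cmult_0(2)[OF lim fin]], use eventually_within[of I t] in eventually_elim)
      fix \<tau> assume \<tau>: "\<tau> \<in> I"
      show "Sq 0 (\<lambda>x. \<phi> \<tau> x - \<phi> t x) \<le> ennreal ((C * \<bar>\<tau> - t\<bar>)\<^sup>2) * Sq 0 f"
        by (rule s(2)) (intro continuous_intros c t \<tau>, rule l[OF t \<tau>])
    qed
  qed
qed

text \<open>\<open>r\<close> stands for \<open>s - 1\<close>, the order of the initial slope
  \<open>v0\<close>, and \<open>T\<close> is an arbitrary horizon: the construction is made on each
  \<open>{0..T}\<close> separately, where all bounds are uniform. Unimodality has been used up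
  before this point, in \<open>v0_nonneg\<close>.\<close>

locale hunter_saxton =
  fixes u0 v0 v0' g :: "real \<Rightarrow> real" and r T K0 K1 K2 :: real
  assumes u0d: "\<And>x. (u0 has_real_derivative v0 x) (at x)" and u0b: "\<And>x. \<bar>u0 x\<bar> \<le> K0"
    and v0d: "\<And>x. (v0 has_real_derivative v0' x) (at x)" and v0: "CL2 v0" "Sq r v0 < \<infinity>"
    and v0': "CL2 v0'" "Sq (r - 1) v0' < \<infinity>" and r: "r > 3/2"
    and v0_nonneg: "\<And>x. 0 \<le> v0 x" and v0_le: "\<And>x. v0 x \<le> K1" and v0'_le: "\<And>x. \<bar>v0' x\<bar> \<le> K2"
    and g: "continuous_on {0..} g" and T: "T > 0"
begin

abbreviation I :: "real set" where "I \<equiv> {0..T}"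

text \<open>The reciprocal square root of the Jacobian \<open>qx\<close>. In label variables the
  slope of the solution is \<open>v0 * bb\<close> and the derivative of the inverse flow is
  \<open>bb\<^sup>2\<close>, so the regularity of the whole construction rests on this one
  factor.\<close>

definition bb :: "real \<Rightarrow> real \<Rightarrow> real" where "bb t y = 1 / (1 + t * v0 y / 2)"

lemma den_ge: "t \<in> I \<Longrightarrow> 1 \<le> 1 + t * v0 y / 2"
  using v0_nonneg[of y] by simp

lemma den_pos: "t \<in> I \<Longrightarrow> 0 < 1 + t * v0 y / 2"
  using den_ge[of t y] by linarith

lemma bb_bounds: "t \<in> I \<Longrightarrow> 0 < bb t y" "t \<in> I \<Longrightarrow> bb t y \<le> 1"
  using den_ge[of t y] by (auto simp: bb_def)

lemma v0c: "continuous_on UNIV v0" "continuous_on UNIV v0'" "continuous_on UNIV u0"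
  using CL2_continuous(1)[OF v0(1)] CL2_continuous(1)[OF v0'(1)] u0d
  by (auto intro!: continuous_at_imp_continuous_on DERIV_isCont)

lemma bb_deriv: "t \<in> I \<Longrightarrow> (bb t has_real_derivative - (t / 2) * v0' y * (bb t y)\<^sup>2) (at y)"
  unfolding bb_def using den_pos[of t y]
  by (auto intro!: derivative_eq_intros v0d simp: power2_eq_square field_simps)

lemma bbc: "t \<in> I \<Longrightarrow> continuous_on UNIV (bb t)"
  using bb_deriv by (intro continuous_at_imp_continuous_on ballI DERIV_isCont) blast

lemma bb_minus_1: "t \<in> I \<Longrightarrow> bb t y - 1 = - (t / 2) * v0 y * bb t y"
  unfolding bb_def using den_pos[of t y] by (simp add: field_simps)

lemma bb_diff: "t \<in> I \<Longrightarrow> \<tau> \<in> I \<Longrightarrow> bb \<tau> y - bb t y = - ((\<tau> - t) / 2) * v0 y * (bb \<tau> y * bb t y)"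
proof -
  assume t: "t \<in> I" and \<tau>: "\<tau> \<in> I"
  have *: "1 / a - 1 / b = (b - a) * (1 / a * (1 / b))" if "a > 0" "b > 0" for a b :: real
    using that by (simp add: field_simps)
  have "(1 + t * v0 y / 2) - (1 + \<tau> * v0 y / 2) = - ((\<tau> - t) / 2) * v0 y" by (simp add: field_simps)
  then show "bb \<tau> y - bb t y = - ((\<tau> - t) / 2) * v0 y * (bb \<tau> y * bb t y)"
    unfolding bb_def using *[OF den_pos[OF \<tau>, of y] den_pos[OF t, of y]] by simp
qed

lemma bb_prod_bounds:
  assumes "t \<in> I" "\<tau> \<in> I" shows "0 \<le> bb \<tau> y * bb t y" "bb \<tau> y * bb t y \<le> 1"
  using bb_bounds[OF assms(1), of y] bb_bounds[OF assms(2), of y] by (auto intro: mult_le_one)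

lemma K1_nonneg: "0 \<le> K1" using v0_nonneg[of 0] v0_le[of 0] by linarith

lemma scont_bb_1: "scont 1 I (\<lambda>t y. bb t y - 1)"
proof -
  \<comment> \<open>Large enough for the Lipschitz constants of \<open>bb\<close> and of
    \<open>t * (bb t y)\<^sup>2\<close> in time, and for \<open>T / 2\<close>.\<close>
  define C where "C = 1 + T * (1 + K1)"
  have C: "1 \<le> C" "T \<le> C" using T K1_nonneg by (auto simp: C_def algebra_simps)
  have C2: "1/2 \<le> C" "T/2 \<le> C" using C T by auto
  have bl: "\<bar>bb \<tau> y - bb t y\<bar> \<le> \<bar>\<tau> - t\<bar> / 2 * v0 y" if "t \<in> I" "\<tau> \<in> I" for t \<tau> y
  proof -
    have "\<bar>bb \<tau> y - bb t y\<bar> = \<bar>\<tau> - t\<bar> / 2 * v0 y * (bb \<tau> y * bb t y)"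
      using bb_diff[OF that] v0_nonneg[of y] bb_prod_bounds(1)[OF that] bb_bounds[of t y] bb_bounds[of \<tau> y] that by (simp add: abs_mult)
    also have "\<dots> \<le> \<bar>\<tau> - t\<bar> / 2 * v0 y * 1"
      using v0_nonneg[of y] by (intro mult_left_mono bb_prod_bounds that) auto
    finally show ?thesis by simp
  qed
  have 1: "scont 0 I (\<lambda>t y. bb t y - 1)"
  proof (rule scont_0_Lipschitz[OF _ v0(1)])
    fix t y assume t: "t \<in> I"
    show "continuous_on UNIV (\<lambda>y. bb t y - 1)" by (intro continuous_intros bbc t)
    have "\<bar>bb t y - 1\<bar> = t / 2 * v0 y * bb t y"
      using bb_minus_1[OF t] v0_nonneg[of y] bb_bounds[OF t, of y] t by (simp add: abs_mult)
    also have "\<dots> \<le> T / 2 * v0 y * 1"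
      using v0_nonneg[of y] bb_bounds[OF t, of y] t by (intro mult_mono) auto
    also have "\<dots> \<le> C * v0 y" using mult_right_mono[OF C2(2) v0_nonneg[of y]] by simp
    finally show "\<bar>bb t y - 1\<bar> \<le> C * \<bar>v0 y\<bar>" using v0_nonneg[of y] by simp
  next
    fix t \<tau> y assume t: "t \<in> I" and \<tau>: "\<tau> \<in> I"
    have "\<bar>bb \<tau> y - 1 - (bb t y - 1)\<bar> \<le> \<bar>\<tau> - t\<bar> / 2 * v0 y" using bl[OF t \<tau>] by simp
    also have "\<dots> = 1/2 * (\<bar>\<tau> - t\<bar> * v0 y)" by simp
    also have "\<dots> \<le> C * (\<bar>\<tau> - t\<bar> * v0 y)" using C2 v0_nonneg[of y] by (intro mult_right_mono) auto
    finally show "\<bar>bb \<tau> y - 1 - (bb t y - 1)\<bar> \<le> C * \<bar>\<tau> - t\<bar> * \<bar>v0 y\<bar>" using v0_nonneg[of y] by simp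
  qed
  have 2: "scont 0 I (\<lambda>t y. - (t / 2) * v0' y * (bb t y)\<^sup>2)"
  proof (rule scont_0_Lipschitz[OF _ v0'(1)])
    fix t y assume t: "t \<in> I"
    show "continuous_on UNIV (\<lambda>y. - (t / 2) * v0' y * (bb t y)\<^sup>2)" by (intro continuous_intros bbc t v0c)
    have "(bb t y)\<^sup>2 \<le> 1" using bb_prod_bounds[OF t t, of y] by (simp add: power2_eq_square)
    then have "t / 2 * \<bar>v0' y\<bar> * (bb t y)\<^sup>2 \<le> T / 2 * \<bar>v0' y\<bar> * 1" using t by (intro mult_mono) auto
    also have "\<dots> \<le> C * \<bar>v0' y\<bar>" using mult_right_mono[OF C2(2) abs_ge_zero[of "v0' y"]] by simp
    finally show "\<bar>- (t / 2) * v0' y * (bb t y)\<^sup>2\<bar> \<le> C * \<bar>v0' y\<bar>" using t by (simp add: abs_mult)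
  next
    fix t \<tau> y assume t: "t \<in> I" and \<tau>: "\<tau> \<in> I"
    have s: "(bb \<tau> y)\<^sup>2 \<le> 1" using bb_prod_bounds[OF \<tau> \<tau>, of y] by (simp add: power2_eq_square)
    have "\<bar>(bb \<tau> y)\<^sup>2 - (bb t y)\<^sup>2\<bar> = \<bar>bb \<tau> y - bb t y\<bar> * (bb \<tau> y + bb t y)"
      using bb_bounds[OF t, of y] bb_bounds[OF \<tau>, of y] by (simp add: power2_eq_square square_diff_square_factored abs_mult mult.commute)
    also have "\<dots> \<le> (\<bar>\<tau> - t\<bar> / 2 * K1) * 2"
      using bb_bounds[OF t, of y] bb_bounds[OF \<tau>, of y] K1_nonneg
      by (intro mult_mono order_trans[OF bl[OF t \<tau>]] mult_left_mono v0_le) auto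
    finally have q: "\<bar>(bb \<tau> y)\<^sup>2 - (bb t y)\<^sup>2\<bar> \<le> \<bar>\<tau> - t\<bar> * K1" by simp
    have "\<bar>\<tau> * (bb \<tau> y)\<^sup>2 - t * (bb t y)\<^sup>2\<bar> = \<bar>(\<tau> - t) * (bb \<tau> y)\<^sup>2 + t * ((bb \<tau> y)\<^sup>2 - (bb t y)\<^sup>2)\<bar>"
      by (simp add: algebra_simps)
    also have "\<dots> \<le> \<bar>\<tau> - t\<bar> * (bb \<tau> y)\<^sup>2 + t * \<bar>(bb \<tau> y)\<^sup>2 - (bb t y)\<^sup>2\<bar>"
      using t by (intro order_trans[OF abs_triangle_ineq]) (simp add: abs_mult)
    also have "\<dots> \<le> \<bar>\<tau> - t\<bar> * 1 + T * (\<bar>\<tau> - t\<bar> * K1)"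
      using t s q by (intro add_mono mult_mono) auto
    also have "\<dots> \<le> C * \<bar>\<tau> - t\<bar>" using T by (simp add: C_def algebra_simps)
    finally have e: "\<bar>\<tau> * (bb \<tau> y)\<^sup>2 - t * (bb t y)\<^sup>2\<bar> \<le> C * \<bar>\<tau> - t\<bar>" .
    have "- (\<tau> / 2) * v0' y * (bb \<tau> y)\<^sup>2 - - (t / 2) * v0' y * (bb t y)\<^sup>2 = - (v0' y / 2) * (\<tau> * (bb \<tau> y)\<^sup>2 - t * (bb t y)\<^sup>2)"
      by (simp add: field_simps)
    then have "\<bar>- (\<tau> / 2) * v0' y * (bb \<tau> y)\<^sup>2 - - (t / 2) * v0' y * (bb t y)\<^sup>2\<bar> = \<bar>v0' y\<bar> / 2 * \<bar>\<tau> * (bb \<tau> y)\<^sup>2 - t * (bb t y)\<^sup>2\<bar>"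
      by (simp add: abs_mult)
    also have "\<dots> \<le> \<bar>v0' y\<bar> * (C * \<bar>\<tau> - t\<bar>)" using e by (intro mult_mono) auto
    finally show "\<bar>- (\<tau> / 2) * v0' y * (bb \<tau> y)\<^sup>2 - - (t / 2) * v0' y * (bb t y)\<^sup>2\<bar> \<le> C * \<bar>\<tau> - t\<bar> * \<bar>v0' y\<bar>"
      by (simp add: mult_ac)
  qed
  have "scont (0 + 1) I (\<lambda>t y. bb t y - 1)"
  proof (rule scont_Suc[OF 1 2])
    fix t y assume t: "t \<in> I"
    show "((\<lambda>y. bb t y - 1) has_real_derivative - (t / 2) * v0' y * (bb t y)\<^sup>2) (at y)"
      using DERIV_diff[OF bb_deriv[OF t] DERIV_const] by simp
  qed
  then show ?thesis by simp
qed

lemma scont_mult_bb_aux: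
  assumes b: "scont \<rho> I (\<lambda>t y. bb t y - 1)" and \<psi>: "scont \<rho> I \<psi>" and \<rho>: "\<rho> > 1/2"
  shows "scont \<rho> I (\<lambda>t y. \<psi> t y * bb t y)"
  by (rule scont_cong[OF scont_add[OF scont_mult[OF \<psi> b \<rho>] \<psi>]]) (simp add: algebra_simps)

text \<open>Bootstrapping: the derivative of \<open>bb\<close> is \<open>v0'\<close> times
  \<open>bb\<^sup>2\<close> up to a factor depending on \<open>t\<close>, so order \<rho> of
  \<open>bb - 1\<close> and order \<open>r - 1\<close> of \<open>v0'\<close> give order \<rho> + 1.
  The start at order 1 is made by hand in \<open>scont_bb_1\<close>, because the algebra property
  used in the step requires an order above 1/2.\<close>

lemma scont_bb: "scont r I (\<lambda>t y. bb t y - 1)"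
proof -
  have "scont (min (1 + real n) r) I (\<lambda>t y. bb t y - 1)" for n
  proof (induction n)
    case 0
    then show ?case by (intro scont_mono[OF scont_bb_1]) simp
  next
    case (Suc n)
    define \<rho> where "\<rho> = min (1 + real n) (r - 1)"
    have \<rho>: "\<rho> > 1/2" "\<rho> \<le> r - 1" "\<rho> \<le> min (1 + real n) r" using r by (auto simp: \<rho>_def)
    have b: "scont \<rho> I (\<lambda>t y. bb t y - 1)" by (rule scont_mono[OF Suc \<rho>(3)])
    have v: "scont \<rho> I (\<lambda>t. v0')" by (rule scont_const[OF v0'(1) Sq_finite_mono[OF \<rho>(2) v0'(2)]])
    have "scont \<rho> I (\<lambda>t y. (- t / 2) * (v0' y * bb t y * bb t y))"
      by (intro scont_scalar scont_mult_bb_aux b v \<rho>) (intro continuous_intros, simp)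
    then have "scont \<rho> I (\<lambda>t y. - (t / 2) * v0' y * (bb t y)\<^sup>2)"
      by (rule scont_cong) (simp add: power2_eq_square)
    then have "scont (\<rho> + 1) I (\<lambda>t y. bb t y - 1)"
    proof (rule scont_Suc[OF b])
      fix t y assume t: "t \<in> I"
      show "((\<lambda>y. bb t y - 1) has_real_derivative - (t / 2) * v0' y * (bb t y)\<^sup>2) (at y)"
        using DERIV_diff[OF bb_deriv[OF t] DERIV_const] by simp
    qed
    then show ?case by (rule scont_mono) (simp add: \<rho>_def)
  qed
  moreover obtain n where "r \<le> 1 + real n" using real_arch_simple[of "r - 1"] by (auto simp: algebra_simps)
  then have "min (1 + real n) r = r" by simp
  ultimately show ?thesis by metis
qed

lemma scont_mult_bb: "scont \<rho> I \<psi> \<Longrightarrow> 1/2 < \<rho> \<Longrightarrow> \<rho> \<le> r \<Longrightarrow> scont \<rho> I (\<lambda>t y. \<psi> t y * bb t y)"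
  by (rule scont_mult_bb_aux[OF scont_mono[OF scont_bb]])

end

section \<open>The Lagrangian flow: energy, labels and the inverse map\<close>

lemma half_line_integral_deriv:
  fixes k :: "real \<Rightarrow> real"
  assumes c: "continuous_on UNIV k" and i: "integrable lborel k"
  shows "((\<lambda>x. LINT z|lborel. indicator {..x} z * k z) has_real_derivative k y) (at y)"
proof -
  let ?h = "\<lambda>x. LINT z|lborel. indicator {..x} z * k z"
  have [measurable]: "k \<in> borel_measurable borel" using i by auto
  have ii: "integrable lborel (\<lambda>z. indicator A z * k z)" if [measurable]: "A \<in> sets borel" for A
    by (rule Bochner_Integration.integrable_bound[OF i]) (auto simp: indicator_def)
  have e: "?h x = ?h (y - 1) + integral {y - 1..x} k" if "x \<in> {y - 1<..<y + 1}" for x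
  proof -
    have ic: "set_integrable lborel {y - 1..x} k"
      using c by (intro borel_integrable_atLeastAtMost') (auto intro: continuous_on_subset)
    have "?h x = (LINT z|lborel. indicator {..y - 1} z * k z + indicator {y - 1<..x} z * k z)"
      using that by (intro Bochner_Integration.integral_cong) (auto simp: indicator_def)
    also have "\<dots> = ?h (y - 1) + (LINT z|lborel. indicator {y - 1<..x} z * k z)"
      by (rule Bochner_Integration.integral_add[OF ii ii]) auto
    also have "(LINT z|lborel. indicator {y - 1<..x} z * k z) = (LINT z|lborel. indicator {y - 1..x} z * k z)"
    proof (rule integral_cong_AE)
      have "AE z in lborel. z \<noteq> y - 1" by (rule AE_lborel_singleton)
      then show "AE z in lborel. indicator {y - 1<..x} z * k z = indicator {y - 1..x} z * k z"
        by eventually_elim (auto simp: indicator_def)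
    qed auto
    also have "\<dots> = integral {y - 1..x} k"
      using set_borel_integral_eq_integral(2)[OF ic] by (simp add: set_lebesgue_integral_def)
    finally show ?thesis .
  qed
  have "((\<lambda>x. integral {y - 1..x} k) has_real_derivative k y) (at y within {y - 1..y + 1})"
    using c by (intro integral_has_real_derivative) (auto intro: continuous_on_subset)
  then have "((\<lambda>x. integral {y - 1..x} k) has_real_derivative k y) (at y)"
    by (simp add: at_within_Icc_at)
  from DERIV_add[OF DERIV_const[of "?h (y - 1)"] this]
  have "((\<lambda>x. ?h (y - 1) + integral {y - 1..x} k) has_real_derivative k y) (at y)" by simp
  then show ?thesis
    by (rule has_field_derivative_transform_within_open[where S="{y - 1<..<y + 1}"]) (simp_all add: e)
qed

lemma CL2_integrable_sq:
  assumes "CL2 f" shows "integrable lborel (\<lambda>x. (f x)\<^sup>2)"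
proof -
  have "integrable lborel (\<lambda>x. cx f x * cx f x)" by (rule L2_C_S(1)[OF CL2_L2 CL2_L2]) (rule assms)+
  then have "integrable lborel (\<lambda>x. Re (cx f x * cx f x))" by (rule integrable_Re)
  then show ?thesis by (simp add: power2_eq_square)
qed

context hunter_saxton
begin

text \<open>\<open>h y\<close> is the conserved energy to the left of the characteristic from \<open>y\<close>. The velocity \<open>U\<close> along it
  grows at the rate \<open>h y / 2 + g\<close>, and \<open>q\<close> is the time integral of \<open>U\<close>.\<close>

definition h :: "real \<Rightarrow> real" where "h y = (LINT z|lborel. indicator {..y} z * (v0 z)\<^sup>2)"
definition H0 :: real where "H0 = (LINT z|lborel. (v0 z)\<^sup>2)"
definition G :: "real \<Rightarrow> real" where "G t = integral {0..t} g"
definition C1 :: "real \<Rightarrow> real" where "C1 t = integral {0..t} (\<lambda>s. s * g s)"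
text \<open>The time integral of \<open>G\<close>, integrated by parts so that only single integrals
  of continuous functions occur; \<open>C1\<close> returns by itself in the label function
  \<open>A\<close>.\<close>

definition \<Gamma> :: "real \<Rightarrow> real" where "\<Gamma> t = t * G t - C1 t"
definition q :: "real \<Rightarrow> real \<Rightarrow> real" where "q t y = y + t * u0 y + t\<^sup>2 / 4 * h y + \<Gamma> t"
definition qx :: "real \<Rightarrow> real \<Rightarrow> real" where "qx t y = (1 + t * v0 y / 2)\<^sup>2"
definition qxx :: "real \<Rightarrow> real \<Rightarrow> real" where "qxx t y = (1 + t * v0 y / 2) * t * v0' y"
definition p :: "real \<Rightarrow> real \<Rightarrow> real" where "p t x = inv (q t) x"
definition U :: "real \<Rightarrow> real \<Rightarrow> real" where "U t y = u0 y + t / 2 * h y + G t"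

lemma gI: "continuous_on I g" by (rule continuous_on_subset[OF g]) auto

lemma G_deriv: "t \<in> I \<Longrightarrow> (G has_real_derivative g t) (at t within I)"
  unfolding G_def by (rule integral_has_real_derivative[OF gI])

lemma C1_deriv: "t \<in> I \<Longrightarrow> (C1 has_real_derivative t * g t) (at t within I)"
  unfolding C1_def by (rule integral_has_real_derivative) (intro continuous_intros gI)

lemma \<Gamma>_deriv: "t \<in> I \<Longrightarrow> (\<Gamma> has_real_derivative G t) (at t within I)"
  unfolding \<Gamma>_def by (auto intro!: derivative_eq_intros G_deriv C1_deriv)

lemma h_deriv: "(h has_real_derivative (v0 y)\<^sup>2) (at y)"
  unfolding h_def using v0c by (intro half_line_integral_deriv CL2_integrable_sq v0) (intro continuous_intros)

lemma hc: "continuous_on UNIV h"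
  using h_deriv by (intro continuous_at_imp_continuous_on ballI DERIV_isCont) blast

lemma h_bounds: "0 \<le> h y" "h y \<le> H0" "\<bar>h y\<bar> \<le> H0"
proof -
  have [measurable]: "v0 \<in> borel_measurable borel" using v0(1) by (rule CL2_measurable)
  have i: "integrable lborel (\<lambda>z. (v0 z)\<^sup>2)" by (rule CL2_integrable_sq[OF v0(1)])
  show "0 \<le> h y" unfolding h_def by (intro integral_nonneg_AE) auto
  moreover show "h y \<le> H0" unfolding h_def H0_def
    by (rule integral_mono'[OF i]) (auto simp: indicator_def)
  ultimately show "\<bar>h y\<bar> \<le> H0" by simp
qed

lemma q_deriv: "(q t has_real_derivative qx t y) (at y)"
  unfolding q_def qx_def
  by (auto intro!: derivative_eq_intros u0d h_deriv simp: power2_eq_square field_simps)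

lemma qx_deriv: "(qx t has_real_derivative qxx t y) (at y)"
  unfolding qx_def qxx_def by (auto intro!: derivative_eq_intros v0d)

lemma qx_ge_1: "t \<in> I \<Longrightarrow> 1 \<le> qx t y"
  unfolding qx_def using den_ge[of t y] by (rule one_le_power)

lemma q_expand: "t \<in> I \<Longrightarrow> a \<le> b \<Longrightarrow> b - a \<le> q t b - q t a"
proof -
  assume t: "t \<in> I" and ab: "a \<le> b"
  show "b - a \<le> q t b - q t a"
  proof (cases "a = b")
    case False
    then obtain z where "q t b - q t a = (b - a) * qx t z" using MVT2[of a b "q t" "qx t"] q_deriv ab by auto
    moreover have "(b - a) * 1 \<le> (b - a) * qx t z" using ab qx_ge_1[OF t] by (intro mult_left_mono) auto
    ultimately show ?thesis by simp
  qed simp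
qed

lemma q_surj: assumes t: "t \<in> I" shows "\<exists>y. q t y = x"
proof -
  define d where "d = \<bar>x - q t 0\<bar>"
  have d: "d \<ge> 0" by (simp add: d_def)
  have "q t (- d) \<le> x" "x \<le> q t d"
    using q_expand[OF t, of "- d" 0] q_expand[OF t, of 0 d] d by (auto simp: d_def)
  moreover have "continuous_on {- d..d} (q t)"
    using q_deriv by (intro continuous_at_imp_continuous_on ballI DERIV_isCont) blast
  ultimately obtain y where "q t y = x" using IVT'[of "q t" "- d" x d] d by auto
  then show ?thesis by blast
qed

lemma qp: "t \<in> I \<Longrightarrow> q t (p t x) = x"
  unfolding p_def using q_surj[of t x] by (metis f_inv_into_f rangeI)

lemma pq: assumes t: "t \<in> I" shows "p t (q t y) = y"
  using q_expand[OF t, of "p t (q t y)" y] q_expand[OF t, of y "p t (q t y)"] qp[OF t, of "q t y"]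
  by (cases "y \<le> p t (q t y)") auto

lemma \<Gamma>_tendsto: "t \<in> I \<Longrightarrow> (\<Gamma> \<longlongrightarrow> \<Gamma> t) (at t within I)"
  using \<Gamma>_deriv DERIV_continuous_on[of I \<Gamma> G] by (simp add: continuous_on_def)

lemma G_tendsto: "t \<in> I \<Longrightarrow> (G \<longlongrightarrow> G t) (at t within I)"
  using G_deriv DERIV_continuous_on[of I G g] by (simp add: continuous_on_def)

text \<open>Since \<open>q \<tau>\<close> expands distances, the two labels are no further apart
  than their images under \<open>q \<tau>\<close>. One image is \<open>x\<close>, which is also
  \<open>q t (p t x)\<close>, the other is \<open>q \<tau> (p t x)\<close>: what remains is the
  explicit time dependence of \<open>q\<close> at a single label.\<close>

lemma p_uniform:
  assumes t: "t \<in> I" and e: "e > 0"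
  shows "\<forall>\<^sub>F \<tau> in at t within I. \<forall>x. \<bar>p \<tau> x - p t x\<bar> \<le> e"
proof -
  have "((\<lambda>\<tau>. \<bar>\<tau> - t\<bar> * K0 + \<bar>\<tau>\<^sup>2 - t\<^sup>2\<bar> / 4 * H0 + \<bar>\<Gamma> \<tau> - \<Gamma> t\<bar>) \<longlongrightarrow> \<bar>t - t\<bar> * K0 + \<bar>t\<^sup>2 - t\<^sup>2\<bar> / 4 * H0 + \<bar>\<Gamma> t - \<Gamma> t\<bar>) (at t within I)"
    by (intro tendsto_intros \<Gamma>_tendsto t) auto
  then have "\<forall>\<^sub>F \<tau> in at t within I. \<bar>\<tau> - t\<bar> * K0 + \<bar>\<tau>\<^sup>2 - t\<^sup>2\<bar> / 4 * H0 + \<bar>\<Gamma> \<tau> - \<Gamma> t\<bar> < e"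
    using e by (intro order_tendstoD(2)) auto
  then show ?thesis using eventually_within[of I t]
  proof eventually_elim
    fix \<tau> assume l: "\<bar>\<tau> - t\<bar> * K0 + \<bar>\<tau>\<^sup>2 - t\<^sup>2\<bar> / 4 * H0 + \<bar>\<Gamma> \<tau> - \<Gamma> t\<bar> < e" and \<tau>: "\<tau> \<in> I"
    show "\<forall>x. \<bar>p \<tau> x - p t x\<bar> \<le> e"
    proof
      fix x
      have "\<bar>p \<tau> x - p t x\<bar> \<le> \<bar>q \<tau> (p \<tau> x) - q \<tau> (p t x)\<bar>"
        using q_expand[OF \<tau>, of "p \<tau> x" "p t x"] q_expand[OF \<tau>, of "p t x" "p \<tau> x"] by (cases "p t x \<le> p \<tau> x") auto
      also have "\<dots> = \<bar>q t (p t x) - q \<tau> (p t x)\<bar>" unfolding qp[OF t] qp[OF \<tau>] ..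
      also have "q t (p t x) - q \<tau> (p t x) = - ((\<tau> - t) * u0 (p t x) + (\<tau>\<^sup>2 - t\<^sup>2) / 4 * h (p t x) + (\<Gamma> \<tau> - \<Gamma> t))"
        by (simp add: q_def field_simps)
      also have "\<bar>\<dots>\<bar> \<le> \<bar>\<tau> - t\<bar> * \<bar>u0 (p t x)\<bar> + \<bar>\<tau>\<^sup>2 - t\<^sup>2\<bar> / 4 * \<bar>h (p t x)\<bar> + \<bar>\<Gamma> \<tau> - \<Gamma> t\<bar>"
        unfolding abs_minus_cancel
        by (intro order_trans[OF abs_triangle_ineq] add_mono) (auto simp: abs_mult)
      also have "\<dots> \<le> \<bar>\<tau> - t\<bar> * K0 + \<bar>\<tau>\<^sup>2 - t\<^sup>2\<bar> / 4 * H0 + \<bar>\<Gamma> \<tau> - \<Gamma> t\<bar>"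
        by (intro add_mono mult_left_mono u0b h_bounds) auto
      finally show "\<bar>p \<tau> x - p t x\<bar> \<le> e" using l by linarith
    qed
  qed
qed

end

sublocale hunter_saxton \<subseteq> fl: flow I q qx qxx p "(1 + T * K1 / 2)\<^sup>2" "(1 + T * K1 / 2) * T * K2"
proof
  fix t y :: real assume t: "t \<in> I"
  show "(q t has_real_derivative qx t y) (at y)" by (rule q_deriv)
  show "(qx t has_real_derivative qxx t y) (at y)" by (rule qx_deriv)
  show "1 \<le> qx t y" by (rule qx_ge_1[OF t])
  have le: "t * v0 y / 2 \<le> T * K1 / 2" using t v0_nonneg[of y] v0_le[of y] by (simp add: mult_mono)
  have pos: "0 \<le> 1 + t * v0 y / 2" using den_pos[OF t, of y] by simp
  show "qx t y \<le> (1 + T * K1 / 2)\<^sup>2" unfolding qx_def using le pos by (intro power_mono) auto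
  have "\<bar>qxx t y\<bar> = (1 + t * v0 y / 2) * t * \<bar>v0' y\<bar>" unfolding qxx_def using t pos by (simp add: abs_mult)
  also have "\<dots> \<le> (1 + T * K1 / 2) * T * K2"
    using t T le pos K1_nonneg v0'_le[of y] by (intro mult_mono) auto
  finally show "\<bar>qxx t y\<bar> \<le> (1 + T * K1 / 2) * T * K2" .
  show "p t (q t y) = y" "q t (p t y) = y" by (rule pq[OF t] qp[OF t])+
next
  fix t :: real assume t: "t \<in> I"
  show "continuous_on UNIV (qxx t)" unfolding qxx_def by (intro continuous_intros v0c) simp
next
  fix t e :: real assume "t \<in> I" "0 < e"
  then show "\<forall>\<^sub>F \<tau> in at t within I. \<forall>x. \<bar>p \<tau> x - p t x\<bar> \<le> e" by (rule p_uniform)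
qed

text \<open>Bounded uniformly and continuous in time for the sup norm. This is the
  \<open>L\<^sup>\<infinity>\<close> half of the norms in the statement, kept apart from the Sobolev
  half because \<open>u\<close> itself may fail to be square integrable.\<close>

definition ucb :: "real set \<Rightarrow> (real \<Rightarrow> real \<Rightarrow> real) \<Rightarrow> bool" where
  "ucb I \<psi> \<longleftrightarrow> (\<exists>M. \<forall>t\<in>I. \<forall>x. \<bar>\<psi> t x\<bar> \<le> M) \<and>
     (\<forall>t\<in>I. \<forall>e>0. \<forall>\<^sub>F \<tau> in at t within I. \<forall>x. \<bar>\<psi> \<tau> x - \<psi> t x\<bar> \<le> e)"

lemma ucbD: "ucb I \<psi> \<Longrightarrow> t \<in> I \<Longrightarrow> e > 0 \<Longrightarrow> \<forall>\<^sub>F \<tau> in at t within I. \<forall>x. \<bar>\<psi> \<tau> x - \<psi> t x\<bar> \<le> e"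
  by (auto simp: ucb_def)

lemma ucb_bounded:
  assumes "ucb I \<psi>" obtains M where "M > 0" "\<And>t x. t \<in> I \<Longrightarrow> \<bar>\<psi> t x\<bar> \<le> M"
proof -
  obtain M where M: "\<And>t x. t \<in> I \<Longrightarrow> \<bar>\<psi> t x\<bar> \<le> M" using assms unfolding ucb_def by blast
  have "\<bar>\<psi> t x\<bar> \<le> max M 1" if "t \<in> I" for t x using M[OF that, of x] by simp
  moreover have "max M 1 > 0" by simp
  ultimately show ?thesis using that by blast
qed

lemma ucb_add:
  assumes a: "ucb I \<phi>" and b: "ucb I \<psi>" shows "ucb I (\<lambda>t x. \<phi> t x + \<psi> t x)"
  unfolding ucb_def
proof (intro conjI ballI allI impI)
  obtain M N where M: "\<And>t x. t \<in> I \<Longrightarrow> \<bar>\<phi> t x\<bar> \<le> M" and N: "\<And>t x. t \<in> I \<Longrightarrow> \<bar>\<psi> t x\<bar> \<le> N"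
    using ucb_bounded[OF a] ucb_bounded[OF b] by metis
  have "\<bar>\<phi> t x + \<psi> t x\<bar> \<le> M + N" if "t \<in> I" for t x
    using M[OF that, of x] N[OF that, of x] by linarith
  then show "\<exists>M. \<forall>t\<in>I. \<forall>x. \<bar>\<phi> t x + \<psi> t x\<bar> \<le> M" by blast
  fix t e :: real assume t: "t \<in> I" and e: "e > 0"
  then have e2: "e / 2 > 0" by simp
  show "\<forall>\<^sub>F \<tau> in at t within I. \<forall>x. \<bar>\<phi> \<tau> x + \<psi> \<tau> x - (\<phi> t x + \<psi> t x)\<bar> \<le> e"
    using ucbD[OF a t e2] ucbD[OF b t e2]
  proof eventually_elim
    fix \<tau> assume 1: "\<forall>x. \<bar>\<phi> \<tau> x - \<phi> t x\<bar> \<le> e / 2" and 2: "\<forall>x. \<bar>\<psi> \<tau> x - \<psi> t x\<bar> \<le> e / 2"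
    show "\<forall>x. \<bar>\<phi> \<tau> x + \<psi> \<tau> x - (\<phi> t x + \<psi> t x)\<bar> \<le> e"
    proof
      fix x show "\<bar>\<phi> \<tau> x + \<psi> \<tau> x - (\<phi> t x + \<psi> t x)\<bar> \<le> e"
        using 1[THEN spec, of x] 2[THEN spec, of x] by linarith
    qed
  qed
qed

lemma ucb_mult:
  assumes a: "ucb I \<phi>" and b: "ucb I \<psi>" shows "ucb I (\<lambda>t x. \<phi> t x * \<psi> t x)"
  unfolding ucb_def
proof (intro conjI ballI allI impI)
  obtain M where M: "M > 0" "\<And>t x. t \<in> I \<Longrightarrow> \<bar>\<phi> t x\<bar> \<le> M" by (rule ucb_bounded[OF a], rule that)
  obtain N where N: "N > 0" "\<And>t x. t \<in> I \<Longrightarrow> \<bar>\<psi> t x\<bar> \<le> N" by (rule ucb_bounded[OF b], rule that)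
  have "\<bar>\<phi> t x * \<psi> t x\<bar> \<le> M * N" if "t \<in> I" for t x
    unfolding abs_mult using M N that by (intro mult_mono) auto
  then show "\<exists>M. \<forall>t\<in>I. \<forall>x. \<bar>\<phi> t x * \<psi> t x\<bar> \<le> M" by blast
  fix t e :: real assume t: "t \<in> I" and e: "e > 0"
  have e2: "e / (2 * N) > 0" "e / (2 * M) > 0" using e M N by auto
  show "\<forall>\<^sub>F \<tau> in at t within I. \<forall>x. \<bar>\<phi> \<tau> x * \<psi> \<tau> x - \<phi> t x * \<psi> t x\<bar> \<le> e"
    using ucbD[OF a t e2(1)] ucbD[OF b t e2(2)] eventually_within[of I t]
  proof eventually_elim
    fix \<tau> assume 1: "\<forall>x. \<bar>\<phi> \<tau> x - \<phi> t x\<bar> \<le> e / (2 * N)" and 2: "\<forall>x. \<bar>\<psi> \<tau> x - \<psi> t x\<bar> \<le> e / (2 * M)" and \<tau>: "\<tau> \<in> I"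
    show "\<forall>x. \<bar>\<phi> \<tau> x * \<psi> \<tau> x - \<phi> t x * \<psi> t x\<bar> \<le> e"
    proof
      fix x
      have "\<phi> \<tau> x * \<psi> \<tau> x - \<phi> t x * \<psi> t x = (\<phi> \<tau> x - \<phi> t x) * \<psi> \<tau> x + \<phi> t x * (\<psi> \<tau> x - \<psi> t x)" by (simp add: algebra_simps)
      then have "\<bar>\<phi> \<tau> x * \<psi> \<tau> x - \<phi> t x * \<psi> t x\<bar> \<le> \<bar>\<phi> \<tau> x - \<phi> t x\<bar> * \<bar>\<psi> \<tau> x\<bar> + \<bar>\<phi> t x\<bar> * \<bar>\<psi> \<tau> x - \<psi> t x\<bar>"
        by (metis abs_mult abs_triangle_ineq)
      also have "\<dots> \<le> e / (2 * N) * N + M * (e / (2 * M))"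
        using 1 2 M N t \<tau> e2 by (intro add_mono mult_mono) auto
      also have "\<dots> = e" using M N by simp
      finally show "\<bar>\<phi> \<tau> x * \<psi> \<tau> x - \<phi> t x * \<psi> t x\<bar> \<le> e" .
    qed
  qed
qed

lemma ucb_time:
  assumes c: "continuous_on I c" and I: "compact I" shows "ucb I (\<lambda>t x. c t)"
  unfolding ucb_def
proof (intro conjI ballI allI impI)
  have "bounded (c ` I)" by (intro compact_imp_bounded compact_continuous_image c I)
  then show "\<exists>M. \<forall>t\<in>I. \<forall>x::real. \<bar>c t\<bar> \<le> M" by (auto simp: bounded_iff)
  fix t e :: real assume t: "t \<in> I" and e: "e > 0"
  have "\<forall>\<^sub>F \<tau> in at t within I. dist (c \<tau>) (c t) < e" using c t e by (intro tendstoD) (auto simp: continuous_on_def)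
  then show "\<forall>\<^sub>F \<tau> in at t within I. \<forall>x::real. \<bar>c \<tau> - c t\<bar> \<le> e" by eventually_elim (simp add: dist_real_def)
qed

lemma ucb_inverse:
  assumes a: "ucb I \<phi>" and 1: "\<And>t x. t \<in> I \<Longrightarrow> 1 \<le> \<phi> t x" shows "ucb I (\<lambda>t x. 1 / \<phi> t x)"
  unfolding ucb_def
proof (intro conjI ballI allI impI)
  have "\<bar>1 / \<phi> t x\<bar> \<le> 1" if "t \<in> I" for t x using 1[OF that, of x] by simp
  then show "\<exists>M. \<forall>t\<in>I. \<forall>x. \<bar>1 / \<phi> t x\<bar> \<le> M" by blast
  fix t e :: real assume t: "t \<in> I" and e: "e > 0"
  show "\<forall>\<^sub>F \<tau> in at t within I. \<forall>x. \<bar>1 / \<phi> \<tau> x - 1 / \<phi> t x\<bar> \<le> e"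
    using ucbD[OF a t e] eventually_within[of I t]
  proof eventually_elim
    fix \<tau> assume l: "\<forall>x. \<bar>\<phi> \<tau> x - \<phi> t x\<bar> \<le> e" and \<tau>: "\<tau> \<in> I"
    show "\<forall>x. \<bar>1 / \<phi> \<tau> x - 1 / \<phi> t x\<bar> \<le> e"
    proof
      fix x
      have o: "1 \<le> \<phi> \<tau> x" "1 \<le> \<phi> t x" using 1 t \<tau> by auto
      then have m: "1 \<le> \<phi> \<tau> x * \<phi> t x" using mult_mono[of 1 "\<phi> \<tau> x" 1 "\<phi> t x"] by simp
      have "1 / \<phi> \<tau> x - 1 / \<phi> t x = - (\<phi> \<tau> x - \<phi> t x) / (\<phi> \<tau> x * \<phi> t x)" using o by (simp add: field_simps)
      then have "\<bar>1 / \<phi> \<tau> x - 1 / \<phi> t x\<bar> = \<bar>\<phi> \<tau> x - \<phi> t x\<bar> / (\<phi> \<tau> x * \<phi> t x)" using m by (simp add: abs_minus_commute)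
      also have "\<dots> \<le> \<bar>\<phi> \<tau> x - \<phi> t x\<bar> / 1" using m by (intro divide_left_mono) auto
      finally have "\<bar>1 / \<phi> \<tau> x - 1 / \<phi> t x\<bar> \<le> \<bar>\<phi> \<tau> x - \<phi> t x\<bar>" by simp
      with l[THEN spec, of x] show "\<bar>1 / \<phi> \<tau> x - 1 / \<phi> t x\<bar> \<le> e" by linarith
    qed
  qed
qed

lemma Lipschitz_of_deriv:
  fixes f :: "real \<Rightarrow> real"
  assumes "\<And>x. (f has_real_derivative f' x) (at x)" "\<And>x. \<bar>f' x\<bar> \<le> L"
  shows "\<bar>f x - f y\<bar> \<le> L * \<bar>x - y\<bar>"
  using field_differentiable_bound[of UNIV f f' L x y] assms by simp

lemma (in flow) ucb_comp:
  assumes f: "\<And>x. (f has_real_derivative f' x) (at x)" and L: "\<And>x. \<bar>f' x\<bar> \<le> L" and b: "\<And>x. \<bar>f x\<bar> \<le> K"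
  shows "ucb I (\<lambda>t x. f (p t x))"
  unfolding ucb_def
proof (intro conjI ballI allI impI)
  show "\<exists>M. \<forall>t\<in>I. \<forall>x. \<bar>f (p t x)\<bar> \<le> M" using b by blast
  fix t e :: real assume t: "t \<in> I" and e: "e > 0"
  have L0: "0 \<le> L" using L[of 0] by linarith
  then have "e / (L + 1) > 0" using e by simp
  from pu[OF t this] show "\<forall>\<^sub>F \<tau> in at t within I. \<forall>x. \<bar>f (p \<tau> x) - f (p t x)\<bar> \<le> e"
  proof eventually_elim
    fix \<tau> assume l: "\<forall>x. \<bar>p \<tau> x - p t x\<bar> \<le> e / (L + 1)"
    show "\<forall>x. \<bar>f (p \<tau> x) - f (p t x)\<bar> \<le> e"
    proof
      fix x
      have "\<bar>f (p \<tau> x) - f (p t x)\<bar> \<le> L * \<bar>p \<tau> x - p t x\<bar>" by (rule Lipschitz_of_deriv[OF f L])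
      also have "\<dots> \<le> (L + 1) * (e / (L + 1))" using l L0 by (intro mult_mono) auto
      also have "\<dots> = e" using L0 by simp
      finally show "\<bar>f (p \<tau> x) - f (p t x)\<bar> \<le> e" .
    qed
  qed
qed

lemma (in flow) p_jointly_continuous: "continuous_on (I \<times> UNIV) (\<lambda>z. p (fst z) (snd z))"
  unfolding continuous_on_def
proof safe
  fix t x :: real assume t: "t \<in> I"
  show "((\<lambda>z. p (fst z) (snd z)) \<longlongrightarrow> p (fst (t, x)) (snd (t, x))) (at (t, x) within I \<times> UNIV)"
  proof (rule tendstoI)
    fix e :: real assume e: "e > 0"
    then have e2: "e / 2 > 0" by simp
    obtain d where d: "d > 0" "\<And>\<tau>. \<tau> \<in> I \<Longrightarrow> \<tau> \<noteq> t \<Longrightarrow> dist \<tau> t < d \<Longrightarrow> \<forall>x. \<bar>p \<tau> x - p t x\<bar> \<le> e / 2"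
      using pu[OF t e2] unfolding eventually_at by blast
    have close: "\<bar>p \<tau> y - p t x\<bar> < e" if "\<tau> \<in> I" "dist \<tau> t < d" "dist y x < e / 2" for \<tau> y
    proof -
      have "\<bar>p \<tau> y - p t y\<bar> \<le> e / 2" using d(2)[OF that(1) _ that(2)] e by (cases "\<tau> = t") auto
      moreover have "\<bar>p t y - p t x\<bar> \<le> \<bar>y - x\<bar>"
        by (rule Lipschitz_inverse(1)[OF qd[OF t] qx1[OF t] qp[OF t]])
      ultimately show ?thesis using that(3) unfolding dist_real_def by linarith
    qed
    show "\<forall>\<^sub>F z in at (t, x) within I \<times> UNIV. dist (p (fst z) (snd z)) (p (fst (t, x)) (snd (t, x))) < e"
      unfolding eventually_at
    proof (intro exI[of _ "min d (e / 2)"] conjI ballI impI)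
      fix z assume z: "z \<in> I \<times> UNIV" "z \<noteq> (t, x) \<and> dist z (t, x) < min d (e / 2)"
      have "dist (fst z) t < d" "dist (snd z) x < e / 2"
        using z(2) dist_fst_le[of z "(t, x)"] dist_snd_le[of z "(t, x)"] by auto
      then show "dist (p (fst z) (snd z)) (p (fst (t, x)) (snd (t, x))) < e"
        using close[of "fst z" "snd z"] z(1) by (auto simp: dist_real_def)
    qed (use d e in auto)
  qed
qed

context hunter_saxton
begin

section \<open>The explicit solution in Eulerian variables\<close>

definition u :: "real \<Rightarrow> real \<Rightarrow> real" where "u t x = U t (p t x)"
definition v :: "real \<Rightarrow> real \<Rightarrow> real" where "v t x = v0 (p t x) * bb t (p t x)"
text \<open>The space derivative of \<open>v\<close>: two powers of \<open>bb\<close> come from the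
  label derivative of \<open>v0 * bb\<close>, two more from the derivative of
  \<open>p\<close>.\<close>

definition w :: "real \<Rightarrow> real \<Rightarrow> real" where "w t x = v0' (p t x) * bb t (p t x) ^ 4"
definition ut :: "real \<Rightarrow> real \<Rightarrow> real" where "ut t x = - (u t x * v t x) + h (p t x) / 2 + g t"
text \<open>The mixed derivative of \<open>u\<close>, reached both as the space derivative of
  \<open>ut\<close> and as the time derivative of \<open>v\<close>.\<close>

definition vt :: "real \<Rightarrow> real \<Rightarrow> real" where "vt t x = - (u t x * w t x) - (v t x)\<^sup>2 / 2"

lemma bb_qx: "1 / qx t y = (bb t y)\<^sup>2"
  by (simp add: qx_def bb_def power_divide)

lemma den_bb: "t \<in> I \<Longrightarrow> (1 + t * v0 y / 2) * bb t y = 1"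
  unfolding bb_def using den_pos[of t y] by simp

lemma p_deriv: "t \<in> I \<Longrightarrow> (p t has_real_derivative (bb t (p t x))\<^sup>2) (at x)"
  using fl.pd[of t x] by (simp only: bb_qx)

lemma u_deriv: assumes t: "t \<in> I" shows "(u t has_real_derivative v t x) (at x)"
proof -
  let ?y = "p t x"
  have "(U t has_real_derivative v0 ?y + t / 2 * (v0 ?y)\<^sup>2) (at ?y)"
    unfolding U_def by (auto intro!: derivative_eq_intros u0d h_deriv)
  from DERIV_chain2[OF this p_deriv[OF t]]
  have "(u t has_real_derivative (v0 ?y + t / 2 * (v0 ?y)\<^sup>2) * (bb t ?y)\<^sup>2) (at x)" by (simp add: u_def[abs_def])
  moreover have "(v0 ?y + t / 2 * (v0 ?y)\<^sup>2) * (bb t ?y)\<^sup>2 = v0 ?y * bb t ?y * ((1 + t * v0 ?y / 2) * bb t ?y)"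
    by (simp add: power2_eq_square algebra_simps)
  ultimately show ?thesis unfolding den_bb[OF t] by (simp add: v_def)
qed

lemma v0bb_deriv: assumes t: "t \<in> I" shows "((\<lambda>y. v0 y * bb t y) has_real_derivative v0' y * (bb t y)\<^sup>2) (at y)"
proof -
  have "((\<lambda>y. v0 y * bb t y) has_real_derivative v0' y * bb t y + (- (t / 2) * v0' y * (bb t y)\<^sup>2) * v0 y) (at y)"
    using DERIV_mult[OF v0d bb_deriv[OF t], of y] by simp
  moreover have "v0' y * bb t y + (- (t / 2) * v0' y * (bb t y)\<^sup>2) * v0 y = v0' y * bb t y * (1 - t / 2 * v0 y * bb t y)"
    by (simp add: power2_eq_square algebra_simps)
  moreover have "1 - t / 2 * v0 y * bb t y = bb t y" using bb_minus_1[OF t, of y] by simp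
  ultimately show ?thesis by (simp add: power2_eq_square mult.assoc)
qed

lemma v_deriv: assumes t: "t \<in> I" shows "(v t has_real_derivative w t x) (at x)"
  using DERIV_chain2[OF v0bb_deriv[OF t] p_deriv[OF t, of x]]
  by (simp add: v_def[abs_def] w_def power_numeral_reduce mult_ac)

lemma ut_deriv: assumes t: "t \<in> I" shows "(ut t has_real_derivative vt t x) (at x)"
proof -
  have "(ut t has_real_derivative - (v t x * v t x + w t x * u t x) + (v0 (p t x))\<^sup>2 * (bb t (p t x))\<^sup>2 / 2) (at x)"
    unfolding ut_def[abs_def]
    by (auto intro!: derivative_eq_intros u_deriv v_deriv t DERIV_chain2[OF h_deriv p_deriv[OF t]])
  moreover have "- (v t x * v t x + w t x * u t x) + (v0 (p t x))\<^sup>2 * (bb t (p t x))\<^sup>2 / 2 = vt t x"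
    by (simp add: vt_def v_def power2_eq_square field_simps)
  ultimately show ?thesis by simp
qed

lemma scont_qx: "scont r I (\<lambda>t y. 1 / qx t y - 1)"
proof (rule scont_cong[OF scont_add[OF scont_mult[OF scont_bb scont_bb] scont_cmult[OF scont_bb, of 2]]])
  show "1 / qx t y - 1 = (bb t y - 1) * (bb t y - 1) + 2 * (bb t y - 1)" for t y
    unfolding bb_qx by (simp add: power2_eq_square algebra_simps)
qed (use r in simp)

lemma scont_v: "scont r I v"
proof -
  have "scont r I (\<lambda>t y. v0 y * bb t y)"
    by (rule scont_mult_bb[OF scont_const[OF v0]]) (use r in auto)
  from fl.scont_comp[OF scont_qx this] show ?thesis using r by (simp add: v_def[abs_def])
qed

lemma scont_F: "scont (r - 1) I (\<lambda>t y. v0' y * bb t y ^ 4)"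
proof -
  have r1: "1/2 < r - 1" "r - 1 \<le> r" using r by auto
  have "scont (r - 1) I (\<lambda>t y. v0' y * bb t y * bb t y * bb t y * bb t y)"
    by (intro scont_mult_bb r1 scont_const v0')
  then show ?thesis by (rule scont_cong) (simp add: power_numeral_reduce)
qed

lemma v0_sq: "CL2 (\<lambda>x. (v0 x)\<^sup>2)" "Sq r (\<lambda>x. (v0 x)\<^sup>2) < \<infinity>"
  using Sq_mult[OF v0 v0] r by (simp_all add: power2_eq_square)

lemma G_cont: "continuous_on I G"
  using G_tendsto by (simp add: continuous_on_def)

text \<open>The order drops by one because \<open>w\<close> contains \<open>v0'\<close>. The factors
  \<open>u0\<close> and \<open>h\<close> are multiplied in label variables, where they do not depend
  on time and \<open>scont_mult_smooth\<close> applies; composition with the inverse flow comes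
  after.\<close>

lemma scont_vt: "scont (r - 1) I vt"
proof -
  have r1: "1/2 < r - 1" "r - 1 \<le> r" using r by auto
  let ?F = "\<lambda>t y. v0' y * bb t y ^ 4"
  have 1: "scont (r - 1) I (\<lambda>t y. u0 y * ?F t y)"
    by (rule scont_mult_smooth[OF u0d u0b v0 r scont_F r1])
  have 2: "scont (r - 1) I (\<lambda>t y. h y * ?F t y)"
    by (rule scont_mult_smooth[OF h_deriv h_bounds(3) v0_sq r scont_F r1])
  have "scont (r - 1) I (\<lambda>t y. (u0 y * ?F t y + t / 2 * (h y * ?F t y)) + G t * ?F t y)"
    by (intro scont_add scont_scalar 1 2 scont_F G_cont) (intro continuous_intros, simp)
  then have "scont (r - 1) I (\<lambda>t y. U t y * ?F t y)" by (rule scont_cong) (simp add: U_def algebra_simps)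
  from fl.scont_comp[OF scont_qx this r1] have uw: "scont (r - 1) I (\<lambda>t x. u t x * w t x)" by (simp add: u_def w_def)
  have vv: "scont (r - 1) I (\<lambda>t x. v t x * v t x)"
    by (intro scont_mult scont_mono[OF scont_v] r1)
  show ?thesis
    by (rule scont_cong[OF scont_add[OF scont_cmult[OF uw, of "-1"] scont_cmult[OF vv, of "-1/2"]]]) (simp add: vt_def power2_eq_square)
qed

lemma ucb_v: "ucb I v"
proof -
  have v0p: "ucb I (\<lambda>t x. v0 (p t x))"
    by (rule fl.ucb_comp[OF v0d v0'_le]) (use v0_nonneg v0_le in auto)
  have "ucb I (\<lambda>t x. 1 + t / 2 * v0 (p t x))"
    by (intro ucb_add ucb_mult ucb_time v0p) (auto intro!: continuous_intros)
  then have "ucb I (\<lambda>t x. 1 / (1 + t / 2 * v0 (p t x)))"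
    by (rule ucb_inverse) (use v0_nonneg in auto)
  from ucb_mult[OF v0p this] show ?thesis by (simp add: v_def[abs_def] bb_def)
qed

lemma ucb_hp: "ucb I (\<lambda>t x. h (p t x))"
proof (rule fl.ucb_comp[OF h_deriv _ h_bounds(3)])
  show "\<bar>(v0 x)\<^sup>2\<bar> \<le> K1\<^sup>2" for x using power_mono[OF v0_le v0_nonneg, of x 2] by simp
qed

lemma ucb_u: "ucb I u"
proof -
  have u0p: "ucb I (\<lambda>t x. u0 (p t x))"
    by (rule fl.ucb_comp[OF u0d _ u0b, of K1]) (use v0_nonneg v0_le in auto)
  have "ucb I (\<lambda>t x. (u0 (p t x) + t / 2 * h (p t x)) + G t)"
    by (intro ucb_add ucb_mult ucb_time u0p ucb_hp G_cont) (auto intro!: continuous_intros)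
  then show ?thesis by (simp add: u_def[abs_def] U_def)
qed

lemma ucb_ut: "ucb I ut"
proof -
  have "ucb I (\<lambda>t x. ((- 1) * (u t x * v t x) + (1/2) * h (p t x)) + g t)"
    by (intro ucb_add ucb_mult ucb_time ucb_u ucb_v ucb_hp gI) (auto intro!: continuous_intros)
  then show ?thesis by (simp add: ut_def[abs_def])
qed

lemma q_time_deriv: "t \<in> I \<Longrightarrow> ((\<lambda>s. q s y) has_real_derivative U t y) (at t within I)"
  unfolding q_def U_def by (auto intro!: derivative_eq_intros \<Gamma>_deriv)

lemma p_time_tendsto: assumes t: "t \<in> I" shows "((\<lambda>s. p s x) \<longlongrightarrow> p t x) (at t within I)"
proof (rule tendstoI)
  fix e :: real assume e: "e > 0"
  then have "e / 2 > 0" by simp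
  from p_uniform[OF t this] show "\<forall>\<^sub>F s in at t within I. dist (p s x) (p t x) < e"
  proof eventually_elim
    fix s assume "\<forall>x. \<bar>p s x - p t x\<bar> \<le> e / 2"
    then have "\<bar>p s x - p t x\<bar> \<le> e / 2" by simp
    then show "dist (p s x) (p t x) < e" using e by (simp add: dist_real_def)
  qed
qed

text \<open>Caratheodory slopes \<sigma> and \<eta> of \<open>u0\<close> and \<open>h\<close> at the
  label \<open>y\<close> make \<open>p s x - y\<close> an exact factor in
  \<open>q s (p s x) - q s y\<close>. The cofactor \<open>D\<close> tends to \<open>qx t y\<close>
  by mere continuity of the inverse flow in time, and the quotient of the time increment of
  \<open>q\<close> by \<open>D\<close> converges.\<close>

lemma p_time_deriv:
  assumes t: "t \<in> I"
  shows "((\<lambda>s. p s x) has_real_derivative - (U t (p t x) * (bb t (p t x))\<^sup>2)) (at t within I)"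
proof -
  define y where "y = p t x"
  obtain \<sigma> where \<sigma>: "\<And>z. u0 z - u0 y = \<sigma> z * (z - y)" "isCont \<sigma> y" "\<sigma> y = v0 y"
    using u0d[of y] unfolding CARAT_DERIV by blast
  obtain \<eta> where \<eta>: "\<And>z. h z - h y = \<eta> z * (z - y)" "isCont \<eta> y" "\<eta> y = (v0 y)\<^sup>2"
    using h_deriv[of y] unfolding CARAT_DERIV by blast
  define D where "D = (\<lambda>s. 1 + s * \<sigma> (p s x) + s\<^sup>2 / 4 * \<eta> (p s x))"
  have pl: "((\<lambda>s. p s x) \<longlongrightarrow> y) (at t within I)" unfolding y_def by (rule p_time_tendsto[OF t])
  have "(D \<longlongrightarrow> 1 + t * \<sigma> y + t\<^sup>2 / 4 * \<eta> y) (at t within I)"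
    unfolding D_def by (intro tendsto_intros isCont_tendsto_compose[OF \<sigma>(2) pl] isCont_tendsto_compose[OF \<eta>(2) pl]) simp
  moreover have "1 + t * \<sigma> y + t\<^sup>2 / 4 * \<eta> y = qx t y"
    by (simp add: \<sigma> \<eta> qx_def power2_eq_square field_simps)
  ultimately have Dl: "(D \<longlongrightarrow> qx t y) (at t within I)" by simp
  have q1: "1 \<le> qx t y" by (rule qx_ge_1[OF t])
  have "\<forall>\<^sub>F s in at t within I. 0 < D s" using q1 by (intro order_tendstoD(1)[OF Dl]) simp
  then have ev: "\<forall>\<^sub>F s in at t within I. - ((q s y - q t y) / (s - t)) / D s = (p s x - y) / (s - t)"
    using eventually_within[of I t]
  proof eventually_elim
    fix s assume D: "0 < D s" and s: "s \<in> I"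
    have "0 = q s (p s x) - q t y" using qp[OF s, of x] qp[OF t, of x] by (simp add: y_def)
    also have "\<dots> = (q s (p s x) - q s y) + (q s y - q t y)" by simp
    also have "q s (p s x) - q s y = (p s x - y) + s * (u0 (p s x) - u0 y) + s\<^sup>2 / 4 * (h (p s x) - h y)"
      by (simp add: q_def algebra_simps)
    also have "\<dots> = (p s x - y) * D s"
    proof -
      have *: "a + s * (m * a) + k * (n * a) = a * (1 + s * m + k * n)" for a k m n by (simp add: algebra_simps)
      show ?thesis unfolding \<sigma>(1) \<eta>(1) D_def by (rule *)
    qed
    finally have "p s x - y = - (q s y - q t y) / D s" using D by (simp add: field_simps)
    then have **: "(p s x - y) / (s - t) = - (q s y - q t y) / D s / (s - t)" by (rule arg_cong)
    show "- ((q s y - q t y) / (s - t)) / D s = (p s x - y) / (s - t)" unfolding ** by (simp add: mult.commute minus_divide_left)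
  qed
  have "((\<lambda>s. (q s y - q t y) / (s - t)) \<longlongrightarrow> U t y) (at t within I)"
    using q_time_deriv[OF t, of y] by (simp add: has_field_derivative_iff)
  then have "((\<lambda>s. - ((q s y - q t y) / (s - t)) / D s) \<longlongrightarrow> - U t y / qx t y) (at t within I)"
    by (intro tendsto_divide tendsto_minus Dl) (use q1 in auto)
  then have "((\<lambda>s. (p s x - y) / (s - t)) \<longlongrightarrow> - U t y / qx t y) (at t within I)"
    by (rule Lim_transform_eventually[OF _ ev])
  moreover have "- U t y / qx t y = - (U t y * (bb t y)\<^sup>2)" using bb_qx[of t y] by (metis minus_divide_left mult.right_neutral times_divide_eq_right)
  ultimately show ?thesis by (simp add: has_field_derivative_iff y_def)
qed

lemma v_time_deriv:
  assumes t: "t \<in> I" shows "((\<lambda>s. v s x) has_real_derivative vt t x) (at t within I)"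
proof -
  let ?y = "p t x"
  define a where "a = - (U t ?y * (bb t ?y)\<^sup>2)"
  have v0p: "((\<lambda>s. v0 (p s x)) has_real_derivative v0' ?y * a) (at t within I)"
    unfolding a_def by (rule DERIV_chain2[OF v0d p_time_deriv[OF t]])
  have d: "1 + t * v0 ?y / 2 \<noteq> 0" using den_pos[OF t, of ?y] by simp
  have "((\<lambda>s. v0 (p s x) / (1 + s * v0 (p s x) / 2)) has_real_derivative
     (v0' ?y * a * (1 + t * v0 ?y / 2) - v0 ?y * (v0 ?y / 2 + t * (v0' ?y * a) / 2)) / (1 + t * v0 ?y / 2)\<^sup>2) (at t within I)"
    by (rule derivative_eq_intros v0p d refl | simp add: power2_eq_square add.commute)+
  moreover have "(v0' ?y * a * (1 + t * v0 ?y / 2) - v0 ?y * (v0 ?y / 2 + t * (v0' ?y * a) / 2)) / (1 + t * v0 ?y / 2)\<^sup>2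
     = (v0' ?y * a - (v0 ?y)\<^sup>2 / 2) * (bb t ?y)\<^sup>2"
  proof -
    have *: "v0' ?y * a * (1 + t * v0 ?y / 2) - v0 ?y * (v0 ?y / 2 + t * (v0' ?y * a) / 2) = v0' ?y * a - (v0 ?y)\<^sup>2 / 2"
      by (simp add: power2_eq_square field_simps)
    show ?thesis unfolding * by (simp add: bb_def power_divide)
  qed
  moreover have "(v0' ?y * a - (v0 ?y)\<^sup>2 / 2) * (bb t ?y)\<^sup>2 = vt t x"
    by (simp add: vt_def u_def v_def w_def a_def power_numeral_reduce field_simps)
  ultimately show ?thesis by (simp add: v_def bb_def)
qed

lemma u_time_deriv:
  assumes t: "t \<in> I" shows "((\<lambda>s. u s x) has_real_derivative ut t x) (at t within I)"
proof -
  let ?y = "p t x"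
  define a where "a = - (U t ?y * (bb t ?y)\<^sup>2)"
  have u0p: "((\<lambda>s. u0 (p s x)) has_real_derivative v0 ?y * a) (at t within I)"
    unfolding a_def by (rule DERIV_chain2[OF u0d p_time_deriv[OF t]])
  have hp: "((\<lambda>s. h (p s x)) has_real_derivative (v0 ?y)\<^sup>2 * a) (at t within I)"
    unfolding a_def by (rule DERIV_chain2[OF h_deriv p_time_deriv[OF t]])
  have "((\<lambda>s. u0 (p s x) + s / 2 * h (p s x) + G s) has_real_derivative
     v0 ?y * a + (h ?y / 2 + t / 2 * ((v0 ?y)\<^sup>2 * a)) + g t) (at t within I)"
    by (rule derivative_eq_intros u0p hp G_deriv[OF t] refl | simp)+
  moreover have "v0 ?y * a + (h ?y / 2 + t / 2 * ((v0 ?y)\<^sup>2 * a)) + g t = ut t x"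
  proof -
    have "v0 ?y * a + t / 2 * ((v0 ?y)\<^sup>2 * a) = - (U t ?y * v0 ?y * bb t ?y * ((1 + t * v0 ?y / 2) * bb t ?y))"
      by (simp add: a_def power2_eq_square algebra_simps)
    then have "v0 ?y * a + t / 2 * ((v0 ?y)\<^sup>2 * a) = - (u t x * v t x)" unfolding den_bb[OF t] by (simp add: u_def v_def mult.assoc)
    then show ?thesis by (simp add: ut_def)
  qed
  ultimately show ?thesis by (simp add: u_def U_def)
qed

lemma vt_jointly_continuous: "continuous_on (I \<times> UNIV) (\<lambda>(s, x). vt s x)"
proof -
  let ?P = "\<lambda>z. p (fst z) (snd z)"
  have P: "continuous_on (I \<times> UNIV) ?P" by (rule fl.p_jointly_continuous)
  have fst: "continuous_on (I \<times> UNIV) fst" by (intro continuous_intros)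
  have c: "continuous_on (I \<times> UNIV) (\<lambda>z. u0 (?P z))" "continuous_on (I \<times> UNIV) (\<lambda>z. h (?P z))"
    "continuous_on (I \<times> UNIV) (\<lambda>z. v0 (?P z))" "continuous_on (I \<times> UNIV) (\<lambda>z. v0' (?P z))"
    "continuous_on (I \<times> (UNIV :: real set)) (\<lambda>z. G (fst z))"
    by (rule continuous_on_compose2[OF v0c(3) P] continuous_on_compose2[OF hc P] continuous_on_compose2[OF v0c(1) P]
        continuous_on_compose2[OF v0c(2) P] continuous_on_compose2[OF G_cont fst]; auto)+
  have d: "1 + fst z * v0 (?P z) / 2 \<noteq> 0" if "z \<in> I \<times> UNIV" for z
    using den_pos[of "fst z" "?P z"] that by auto
  have "continuous_on (I \<times> UNIV) (\<lambda>z. vt (fst z) (snd z))"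
    unfolding vt_def u_def v_def w_def U_def bb_def by (intro continuous_intros c ballI d) simp_all
  then show ?thesis by (simp add: case_prod_beta')
qed

text \<open>Conservation of the energy to the left of a particle: in label variables
  \<open>v\<^sup>2\<close> carries the factor \<open>bb\<^sup>2\<close>, which cancels the Jacobian
  \<open>qx\<close>, and monotonicity of the flow maps half-lines to half-lines.\<close>

lemma half_line_energy:
  assumes t: "t \<in> I" shows "(LBINT z:{..x}. 1/2 * (v t z)\<^sup>2) = h (p t x) / 2"
proof -
  have [measurable]: "v0 \<in> borel_measurable borel" "bb t \<in> borel_measurable borel" "p t \<in> borel_measurable borel"
    using v0c bbc[OF t] fl.pc[OF t] by (auto intro: borel_measurable_continuous_onI)
  have [measurable]: "v t \<in> borel_measurable borel" unfolding v_def[abs_def] by measurable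
  let ?F = "\<lambda>y. ennreal (indicator {..p t x} y * (v0 y * bb t y)\<^sup>2)"
  have mono: "p t z \<le> p t x \<longleftrightarrow> z \<le> x" for z
    using q_expand[OF t, of "p t z" "p t x"] q_expand[OF t, of "p t x" "p t z"] qp[OF t, of x] qp[OF t, of z]
    by (cases "p t z \<le> p t x") auto
  have "(\<integral>\<^sup>+z. ennreal (indicator {..x} z * (v t z)\<^sup>2) \<partial>lborel) = (\<integral>\<^sup>+z. ?F (p t z) \<partial>lborel)"
    by (intro nn_integral_cong) (auto simp: v_def indicator_def mono)
  also have "\<dots> = (\<integral>\<^sup>+y. ?F y * ennreal (qx t y) \<partial>lborel)"
    by (rule nn_integral_subst_UNIV[OF q_deriv fl.qxc[OF t] qx_ge_1[OF t] qp[OF t] pq[OF t]]) simp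
  also have "\<dots> = (\<integral>\<^sup>+y. ennreal (indicator {..p t x} y * (v0 y)\<^sup>2) \<partial>lborel)"
  proof (intro nn_integral_cong)
    fix y
    have "(bb t y)\<^sup>2 * qx t y = 1" using bb_qx[of t y] qx_ge_1[OF t, of y] by (simp add: field_simps)
    then have e: "indicator {..p t x} y * (v0 y * bb t y)\<^sup>2 * qx t y = indicator {..p t x} y * (v0 y)\<^sup>2"
      by (simp add: power_mult_distrib mult.assoc)
    have "?F y * ennreal (qx t y) = ennreal (indicator {..p t x} y * (v0 y * bb t y)\<^sup>2 * qx t y)"
      using qx_ge_1[OF t, of y] by (intro ennreal_mult[symmetric]) auto
    then show "?F y * ennreal (qx t y) = ennreal (indicator {..p t x} y * (v0 y)\<^sup>2)" unfolding e .
  qed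
  finally have n: "(\<integral>\<^sup>+z. ennreal (indicator {..x} z * (v t z)\<^sup>2) \<partial>lborel) = (\<integral>\<^sup>+y. ennreal (indicator {..p t x} y * (v0 y)\<^sup>2) \<partial>lborel)" .
  have "(LINT z|lborel. indicator {..x} z * (v t z)\<^sup>2) = h (p t x)"
    unfolding h_def by (subst (1 2) integral_eq_nn_integral) (auto simp: n)
  moreover have "(LBINT z:{..x}. 1/2 * (v t z)\<^sup>2) = 1/2 * (LINT z|lborel. indicator {..x} z * (v t z)\<^sup>2)"
    unfolding set_lebesgue_integral_def integral_mult_right_zero[symmetric] by (intro Bochner_Integration.integral_cong) auto
  ultimately show ?thesis by simp
qed

lemma solution_equation:
  assumes t: "t \<in> I" shows "ut t x + u t x * v t x = (LBINT z:{..x}. 1/2 * (v t z)\<^sup>2) + g t"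
  unfolding half_line_energy[OF t] by (simp add: ut_def)

lemma p_0: "p 0 x = x"
proof -
  have z: "0 \<in> I" using T by simp
  have "\<Gamma> 0 = 0" by (simp add: \<Gamma>_def C1_def)
  then have "q 0 x = x" by (simp add: q_def)
  then show ?thesis using pq[OF z, of x] by simp
qed

lemma u_0: "u 0 = u0"
  by (auto simp: u_def p_0 U_def G_def)

end

section \<open>The function spaces of the statement\<close>

lemma has_fourier_on_FT: assumes f: "CL2 f" shows "has_fourier_on UNIV f (FT f)"
  unfolding has_fourier_on_def
proof (intro conjI allI impI)
  show m: "FT f \<in> borel_measurable borel" by (rule FT_measurable[OF f])
  show "set_integrable lborel K (FT f)" if K: "compact K \<and> K \<subseteq> UNIV" for K
  proof -
    obtain B where B: "\<And>x. x \<in> K \<Longrightarrow> \<bar>x\<bar> \<le> B" using K compact_imp_bounded[of K] by (auto simp: bounded_iff)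
    have "K \<subseteq> {- B..B}" using B by (auto simp: abs_le_iff) (metis minus_le_iff)
    moreover have "K \<in> sets lborel" using K by (simp add: borel_compact)
    ultimately show ?thesis by (intro set_integrable_subset[OF L2_interval_integrable[OF ft_L2(2)[OF ft_FT[OF f]], of "-B" B]])
  qed
  show "(LINT x|lborel. complex_of_real (f x) * fourier_L1 \<phi> x) = (LINT \<xi>|lborel. FT f \<xi> * complex_of_real (\<phi> \<xi>))"
    if "test_function \<phi> \<and> closure {x. \<phi> x \<noteq> 0} \<subseteq> UNIV" for \<phi>
    unfolding fourier_L1_eq by (rule ft_test[OF ft_FT[OF f]]) (use that in simp)
qed

lemma has_fourier_on_UNIV_unique:
  assumes f: "CL2 f" and F: "has_fourier_on UNIV f F" shows "AE x in lborel. FT f x = F x"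
proof (rule ft_unique_test[OF ft_FT[OF f]])
  show "set_integrable lborel {c..d} F" for c d using F by (simp add: has_fourier_on_def)
  show "(LINT x|lborel. cx f x * fhat (\<lambda>x. of_real (\<phi> x)) x) = (LINT y|lborel. F y * of_real (\<phi> y))"
    if "test_function \<phi>" for \<phi> using F that by (simp add: has_fourier_on_def fourier_L1_eq)
qed

lemma Q_integrable_iff:
  assumes [measurable]: "F \<in> borel_measurable borel"
  shows "integrable lborel (\<lambda>\<xi>. (1 + \<xi>\<^sup>2) powr r * (cmod (F \<xi>))\<^sup>2) \<longleftrightarrow> Q r F < \<infinity>"
    "(LINT \<xi>|lborel. (1 + \<xi>\<^sup>2) powr r * (cmod (F \<xi>))\<^sup>2) = enn2real (Q r F)"
proof -
  have e: "ennreal ((1 + \<xi>\<^sup>2) powr r * (cmod (F \<xi>))\<^sup>2) = ennreal (wt r \<xi>) * ennreal ((cmod (F \<xi>))\<^sup>2)" for \<xi>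
    unfolding wt_def by (rule ennreal_mult) auto
  show "integrable lborel (\<lambda>\<xi>. (1 + \<xi>\<^sup>2) powr r * (cmod (F \<xi>))\<^sup>2) \<longleftrightarrow> Q r F < \<infinity>"
    unfolding integrable_iff_bounded Q_def by (simp add: abs_mult e)
  show "(LINT \<xi>|lborel. (1 + \<xi>\<^sup>2) powr r * (cmod (F \<xi>))\<^sup>2) = enn2real (Q r F)"
    unfolding Q_def by (subst integral_eq_nn_integral) (auto simp: e)
qed

lemma sobolev_CL2:
  assumes c: "continuous_on UNIV f" and s: "f \<in> sobolev r" shows "CL2 f" "Sq r f < \<infinity>"
proof -
  have i: "integrable lborel (\<lambda>x. (f x)\<^sup>2)" using s by (simp add: sobolev_def)
  have "sqn (cx f) = (\<integral>\<^sup>+x. ennreal (norm ((f x)\<^sup>2)) \<partial>lborel)" by (simp add: sqn_def)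
  also have "\<dots> < \<infinity>" using i unfolding integrable_iff_bounded by simp
  finally show f: "CL2 f" using c by (auto simp: CL2_def L2_def intro!: borel_measurable_continuous_onI continuous_on_of_real)
  obtain F where F: "has_fourier_on UNIV f F" "integrable lborel (\<lambda>\<xi>. (1 + \<xi>\<^sup>2) powr r * (cmod (F \<xi>))\<^sup>2)"
    using s unfolding sobolev_def by blast
  have "Sq r f = Q r F" unfolding Sq_def by (rule Q_cong_AE[OF has_fourier_on_UNIV_unique[OF f F(1)]])
  then show "Sq r f < \<infinity>" using F Q_integrable_iff(1)[of F r] by (simp add: has_fourier_on_def)
qed

lemma sobolevI: assumes f: "CL2 f" and fin: "Sq r f < \<infinity>" shows "f \<in> sobolev r"
  unfolding sobolev_def
proof (intro CollectI conjI exI)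
  show "f \<in> borel_measurable borel" by (rule CL2_measurable[OF f])
  show "integrable lborel (\<lambda>x. (f x)\<^sup>2)" by (rule CL2_integrable_sq[OF f])
  show "has_fourier_on UNIV f (FT f)" by (rule has_fourier_on_FT[OF f])
  show "integrable lborel (\<lambda>\<xi>. (1 + \<xi>\<^sup>2) powr r * (cmod (FT f \<xi>))\<^sup>2)"
    using fin Q_integrable_iff(1)[OF FT_measurable[OF f], of r] by (simp add: Sq_def)
qed

text \<open>The transform chosen inside \<open>sobolev_norm\<close> agrees with \<open>FT f\<close>
  almost everywhere, so the choice is immaterial to the integral.\<close>

lemma sobolev_norm_eq: assumes f: "CL2 f" shows "sobolev_norm r f = sqrt (enn2real (Sq r f))"
proof -
  have h: "has_fourier_on UNIV f (fourier_on UNIV f)"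
    unfolding fourier_on_def by (rule someI[of "has_fourier_on UNIV f"]) (rule has_fourier_on_FT[OF f])
  then have "Q r (FT f) = Q r (fourier_on UNIV f)" by (intro Q_cong_AE has_fourier_on_UNIV_unique[OF f])
  moreover have "fourier_on UNIV f \<in> borel_measurable borel" using h by (simp add: has_fourier_on_def)
  ultimately show ?thesis by (simp add: sobolev_norm_def Q_integrable_iff(2) Sq_def)
qed

lemma sqrt_enn2real_tendsto_0:
  assumes "(f \<longlongrightarrow> 0) F" shows "((\<lambda>x. sqrt (enn2real (f x))) \<longlongrightarrow> 0) F"
proof -
  have "((\<lambda>x. enn2real (f x)) \<longlongrightarrow> enn2real 0) F" using tendsto_enn2real[of f 0 F] assms by simp
  then show ?thesis using tendsto_real_sqrt by fastforce
qed

lemma sup_norm_le: assumes "\<And>x. \<bar>f x\<bar> \<le> e" shows "sup_norm f \<le> e"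
  unfolding sup_norm_def by (rule cSUP_least) (use assms in auto)

lemma sup_norm_nonneg: assumes "\<And>x. \<bar>f x\<bar> \<le> M" shows "0 \<le> sup_norm f"
  unfolding sup_norm_def by (rule order_trans[OF abs_ge_zero cSUP_upper[of 0]]) (use assms in \<open>auto intro!: bdd_aboveI\<close>)

lemma sup_norm_upper: assumes "\<And>x. \<bar>f x\<bar> \<le> M" shows "\<bar>f x\<bar> \<le> sup_norm f"
  unfolding sup_norm_def by (rule cSUP_upper) (use assms in \<open>auto intro!: bdd_aboveI\<close>)

lemma sup_norm_tendsto_0:
  assumes "\<And>e. e > 0 \<Longrightarrow> \<forall>\<^sub>F \<tau> in F. \<forall>x. \<bar>f \<tau> x\<bar> \<le> e"
  shows "((\<lambda>\<tau>. sup_norm (f \<tau>)) \<longlongrightarrow> 0) F"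
proof (rule tendstoI)
  fix e :: real assume e: "e > 0"
  then have "e / 2 > 0" by simp
  from assms[OF this] show "\<forall>\<^sub>F \<tau> in F. dist (sup_norm (f \<tau>)) 0 < e"
  proof eventually_elim
    fix \<tau> assume *: "\<forall>x. \<bar>f \<tau> x\<bar> \<le> e / 2"
    have "sup_norm (f \<tau>) \<le> e / 2" by (rule sup_norm_le) (use * in blast)
    moreover have "0 \<le> sup_norm (f \<tau>)" by (rule sup_norm_nonneg) (use * in blast)
    ultimately show "dist (sup_norm (f \<tau>)) 0 < e" using e by (simp add: dist_real_def)
  qed
qed

text \<open>A bounded \<open>u\<close> has a transform only as a distribution, which may be singular
  at the origin, as for constants. A test \<phi> vanishing near 0 equals the variable times
  \<open>k\<close>, and this variable is moved onto \<open>u\<close> as a derivative by parts, where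
  the square integrable transform of u' takes over.\<close>

lemma has_fourier_off_zero:
  assumes d: "\<And>x. (u has_real_derivative u' x) (at x)" and b: "\<And>x. \<bar>u x\<bar> \<le> M" and u': "CL2 u'"
  shows "has_fourier_on (- {0}) u (\<lambda>\<xi>. FT u' \<xi> / (\<i> * of_real \<xi>))"
  unfolding has_fourier_on_def
proof (intro conjI allI impI)
  note [measurable] = FT_measurable[OF u']
  let ?F = "\<lambda>\<xi>. FT u' \<xi> / (\<i> * of_real \<xi>)"
  show m: "?F \<in> borel_measurable borel" by measurable
  show "set_integrable lborel K ?F" if K: "compact K \<and> K \<subseteq> - {0}" for K
  proof -
    have o: "open (- K)" "0 \<in> - K" using K by (auto simp: compact_imp_closed open_Compl)
    then obtain e where e: "e > 0" "ball 0 e \<subseteq> - K" unfolding open_contains_ball by blast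
    have ke: "e \<le> \<bar>x\<bar>" if "x \<in> K" for x using e(2) that by (auto simp: subset_iff dist_real_def not_less[symmetric])
    have "set_integrable lborel K (FT u')" using has_fourier_on_FT[OF u'] K by (simp add: has_fourier_on_def)
    then have i: "integrable lborel (\<lambda>x. indicator K x *\<^sub>R FT u' x)" by (simp add: set_integrable_def)
    have [measurable]: "K \<in> sets borel" using K by (simp add: borel_compact)
    have "integrable lborel (\<lambda>x. indicator K x *\<^sub>R ?F x)"
    proof (rule Bochner_Integration.integrable_bound[OF integrable_mult_right[OF i, of "of_real (1/e)"]])
      show "AE x in lborel. norm (indicator K x *\<^sub>R ?F x) \<le> norm (of_real (1/e) * (indicator K x *\<^sub>R FT u' x))"
      proof (rule AE_I2)
        fix x
        show "norm (indicator K x *\<^sub>R ?F x) \<le> norm (of_real (1/e) * (indicator K x *\<^sub>R FT u' x))"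
        proof (cases "x \<in> K")
          case True
          have "cmod (FT u' x) / \<bar>x\<bar> \<le> cmod (FT u' x) / e" using ke[OF True] e(1) by (intro divide_left_mono) auto
          then show ?thesis using True e(1) by (simp add: norm_divide norm_mult)
        qed simp
      qed
    qed measurable
    then show ?thesis by (simp add: set_integrable_def)
  qed
  show "(LINT x|lborel. complex_of_real (u x) * fourier_L1 \<phi> x) = (LINT \<xi>|lborel. ?F \<xi> * complex_of_real (\<phi> \<xi>))"
    if \<phi>: "test_function \<phi> \<and> closure {x. \<phi> x \<noteq> 0} \<subseteq> - {0}" for \<phi>
  proof -
    note pr = test_function_props[of \<phi>]
    have tf: "test_function \<phi>" using \<phi> by simp
    obtain R where R: "\<And>x. \<bar>x\<bar> \<ge> R \<Longrightarrow> \<phi> x = 0" "\<And>x. \<bar>x\<bar> \<ge> R \<Longrightarrow> deriv \<phi> x = 0"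
      using test_function_props(4)[OF tf] by blast
    have o: "open (- closure {x. \<phi> x \<noteq> 0})" "0 \<in> - closure {x. \<phi> x \<noteq> 0}" using \<phi> by auto
    then obtain e where e: "e > 0" "ball 0 e \<subseteq> - closure {x. \<phi> x \<noteq> 0}" unfolding open_contains_ball by blast
    have z: "\<phi> x = 0" if "\<bar>x\<bar> < e" for x
    proof (rule ccontr)
      assume "\<phi> x \<noteq> 0"
      then have "x \<in> closure {x. \<phi> x \<noteq> 0}" by (intro subsetD[OF closure_subset]) simp
      moreover have "x \<in> ball 0 e" using that by (simp add: dist_real_def)
      ultimately show False using e(2) by blast
    qed
    \<comment> \<open>At the origin \<open>k\<close> takes the default value 0 of a division by
      zero, which is the right one as \<phi> vanishes on \<open>ball 0 e\<close>.\<close>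
    define k where "k = (\<lambda>x. \<phi> x / x)"
    define k' where "k' = (\<lambda>x. if x = 0 then 0 else deriv \<phi> x / x - \<phi> x / x\<^sup>2)"
    have kd: "(k has_real_derivative k' x) (at x)" for x
    proof (cases "x = 0")
      case True
      have "(k has_real_derivative 0) (at 0)"
        by (rule has_field_derivative_transform_within_open[of "\<lambda>_. 0" _ _ "ball 0 e"])
          (use e z in \<open>auto simp: k_def dist_real_def\<close>)
      then show ?thesis using True by (simp add: k'_def)
    next
      case False
      have "(k has_real_derivative (deriv \<phi> x * x - \<phi> x * 1) / (x * x)) (at x)"
        unfolding k_def by (rule DERIV_divide[OF test_function_props(1)[OF tf] DERIV_ident False])
      moreover have "(deriv \<phi> x * x - \<phi> x * 1) / (x * x) = k' x" using False by (simp add: k'_def power2_eq_square field_simps)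
      ultimately show ?thesis by simp
    qed
    have dz: "deriv \<phi> x = 0" if "\<bar>x\<bar> < e" for x
    proof -
      have "(\<phi> has_real_derivative 0) (at x)"
        by (rule has_field_derivative_transform_within_open[of "\<lambda>_. 0" _ _ "ball 0 e"])
          (use that z in \<open>auto simp: dist_real_def\<close>)
      then show ?thesis by (rule DERIV_imp_deriv)
    qed
    have k'c: "continuous_on UNIV k'"
    proof (rule continuous_at_imp_continuous_on, rule ballI)
      fix x :: real
      show "isCont k' x"
      proof (cases "x = 0")
        case True
        have "continuous_on (ball 0 e) k' \<longleftrightarrow> continuous_on (ball (0::real) e) (\<lambda>_. 0 :: real)"
          by (rule continuous_on_cong) (auto simp: k'_def z dz dist_real_def)
        then have "continuous_on (ball 0 e) k'" by simp
        then show ?thesis using True e(1) by (simp add: continuous_on_eq_continuous_at)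
      next
        case False
        have "continuous_on (- {0}) k' \<longleftrightarrow> continuous_on (- {0}) (\<lambda>x. deriv \<phi> x / x - \<phi> x / x\<^sup>2)"
          by (rule continuous_on_cong) (auto simp: k'_def)
        moreover have "continuous_on (- {0}) (\<lambda>x. deriv \<phi> x / x - \<phi> x / x\<^sup>2)"
          by (intro continuous_intros continuous_on_subset[OF test_function_props(2)[OF tf]] continuous_on_subset[OF test_function_props(3)[OF tf]]) auto
        ultimately have "continuous_on (- {0}) k'" by simp
        then show ?thesis using False by (simp add: continuous_on_eq_continuous_at open_Compl)
      qed
    qed
    have kz: "\<bar>x\<bar> \<ge> R \<Longrightarrow> k x = 0" "\<bar>x\<bar> \<ge> R \<Longrightarrow> k' x = 0" for x by (simp_all add: k_def k'_def R)
    note kf = fhat_deriv_compact[OF kd k'c kz]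
    have xk: "of_real x * cx k x = cx \<phi> x" for x using z[of 0] e by (simp add: k_def)
    have ik: "integrable lborel (\<lambda>x. of_real x * cx k x)" unfolding xk by (rule test_function_transform(1)[OF tf])
    have fd: "(fhat (cx k) has_vector_derivative fhat (\<lambda>y. - \<i> * of_real y * cx k y) x) (at x)" for x
      by (rule fhat_has_vector_derivative[OF kf(1) ik])
    have fk: "fhat (\<lambda>y. - \<i> * of_real y * cx k y) x = - \<i> * fhat (cx \<phi>) x" for x
      using fhat_cmult[of "-\<i>" "cx \<phi>" x] xk by (simp add: mult.assoc)
    have ud: "(cx u has_vector_derivative cx u' x) (at x)" for x by (rule has_vector_derivative_of_real[OF d])
    have cu: "continuous_on UNIV u" using d by (intro continuous_at_imp_continuous_on ballI DERIV_isCont)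
    have [measurable]: "u \<in> borel_measurable borel" using cu by (rule borel_measurable_continuous_onI)
    have ub: "integrable lborel (\<lambda>x. cx u x * F x)" if F: "integrable lborel F" for F
    proof (rule Bochner_Integration.integrable_bound[OF integrable_mult_right[OF F, of "of_real M"]])
      have "\<bar>u x\<bar> \<le> \<bar>M\<bar>" for x using b[of x] by linarith
      then show "AE x in lborel. norm (cx u x * F x) \<le> norm (of_real M * F x)"
        by (auto simp: norm_mult intro!: mult_right_mono)
    qed (use F in auto)
    have ibp: "(LINT x|lborel. cx u' x * fhat (cx k) x) = - (LINT x|lborel. cx u x * fhat (\<lambda>y. - \<i> * of_real y * cx k y) x)"
    proof (rule integral_by_parts_L1[OF ud CL2_continuous(2)[OF u'] fd])
      have i': "integrable lborel (\<lambda>y. - \<i> * of_real y * cx k y)" using integrable_mult_right[OF ik, of "-\<i>"] by (simp add: mult.assoc)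
      then show "continuous_on UNIV (fhat (\<lambda>y. - \<i> * of_real y * cx k y))" by (rule continuous_fhat)
      show "integrable lborel (\<lambda>x. cx u x * fhat (cx k) x)" by (rule ub[OF kf(3)])
      show "integrable lborel (\<lambda>x. cx u' x * fhat (cx k) x)" by (rule L2_C_S(1)[OF CL2_L2[OF u'] L2_fhat[OF kf(1,2)]])
      show "integrable lborel (\<lambda>x. cx u x * fhat (\<lambda>y. - \<i> * of_real y * cx k y) x)"
        unfolding fk by (intro ub integrable_mult_right test_function_transform(3)[OF tf])
    qed
    have "(LINT x|lborel. cx u x * fhat (cx \<phi>) x) = (1/\<i>) * (LINT x|lborel. \<i> * (cx u x * fhat (cx \<phi>) x))"
      by (simp add: integral_mult_right_zero)
    also have "(LINT x|lborel. \<i> * (cx u x * fhat (cx \<phi>) x)) = (LINT x|lborel. cx u' x * fhat (cx k) x)"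
      unfolding ibp fk by (subst Bochner_Integration.integral_minus[symmetric]) (simp add: mult_ac)
    also have "\<dots> = (LINT y|lborel. FT u' y * cx k y)" using ft_FT[OF u'] kf(1,2) by (simp add: ft_def)
    also have "(1/\<i>) * \<dots> = (LINT y|lborel. (1/\<i>) * (FT u' y * cx k y))" by (rule integral_mult_right_zero[symmetric])
    also have "\<dots> = (LINT \<xi>|lborel. ?F \<xi> * cx \<phi> \<xi>)"
    proof (intro Bochner_Integration.integral_cong refl)
      show "(1/\<i>) * (FT u' \<xi> * cx k \<xi>) = ?F \<xi> * cx \<phi> \<xi>" for \<xi>
        by (cases "\<xi> = 0") (simp_all add: k_def field_simps)
    qed
    finally show ?thesis by (simp add: fourier_L1_eq)
  qed
qed

lemma fourier_off_zero_unique: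
  assumes "has_fourier_on (- {0}) u F" "has_fourier_on (- {0}) u F'"
  shows "AE x in lborel. F x = F' x"
proof (rule AE_unique_off_zero)
  fix c d :: real assume "0 \<notin> {c..d}"
  then show "set_integrable lborel {c..d} F" "set_integrable lborel {c..d} F'" using assms by (auto simp: has_fourier_on_def)
next
  fix \<phi> assume "test_function \<phi>" "closure {x. \<phi> x \<noteq> 0} \<subseteq> - {0}"
  then have "(LINT x|lborel. complex_of_real (u x) * fourier_L1 \<phi> x) = (LINT x|lborel. F x * of_real (\<phi> x))"
    "(LINT x|lborel. complex_of_real (u x) * fourier_L1 \<phi> x) = (LINT x|lborel. F' x * of_real (\<phi> x))"
    using assms by (simp_all add: has_fourier_on_def)
  then show "(LINT x|lborel. F x * of_real (\<phi> x)) = (LINT x|lborel. F' x * of_real (\<phi> x))" by (rule trans[OF sym])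
qed

lemma frac_deriv_norm_nonneg: "0 \<le> frac_deriv_norm \<sigma> u"
  unfolding frac_deriv_norm_def by (simp add: integral_nonneg_AE)

text \<open>The homogeneous weight is dominated by the inhomogeneous one. The one-sided bound
  suffices, since for the explicit solution the companion space enters through membership and
  convergence to zero.\<close>

lemma frac_deriv:
  assumes d: "\<And>x. (u has_real_derivative u' x) (at x)" and b: "\<And>x. \<bar>u x\<bar> \<le> M" and u': "CL2 u'"
    and s: "\<sigma> \<ge> 0" and fin: "Sq \<sigma> u' < \<infinity>"
  shows "frac_deriv_L2 \<sigma> u" "frac_deriv_norm \<sigma> u \<le> sqrt (enn2real (Sq \<sigma> u'))"
proof -
  note [measurable] = FT_measurable[OF u']
  let ?F = "\<lambda>\<xi>. FT u' \<xi> / (\<i> * of_real \<xi>)"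
  let ?w = "\<lambda>F \<xi>. (cmod (of_real (\<bar>\<xi>\<bar> powr \<sigma>) * (\<i> * of_real \<xi> * F \<xi>)))\<^sup>2"
  note hF = has_fourier_off_zero[OF d b u']
  have le: "?w ?F \<xi> \<le> wt \<sigma> \<xi> * (cmod (FT u' \<xi>))\<^sup>2" for \<xi>
  proof (cases "\<xi> = 0")
    case False
    have "(\<bar>\<xi>\<bar> powr \<sigma>)\<^sup>2 = (\<bar>\<xi>\<bar>\<^sup>2) powr \<sigma>" by (metis abs_ge_zero power2_eq_square powr_mult)
    also have "\<dots> \<le> wt \<sigma> \<xi>" unfolding wt_def using s by (intro powr_mono2) auto
    finally have "(\<bar>\<xi>\<bar> powr \<sigma>)\<^sup>2 * (cmod (FT u' \<xi>))\<^sup>2 \<le> wt \<sigma> \<xi> * (cmod (FT u' \<xi>))\<^sup>2" by (rule mult_right_mono) simp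
    then show ?thesis using False by (simp add: norm_mult norm_divide power_mult_distrib)
  qed simp
  have iw: "integrable lborel (\<lambda>\<xi>. wt \<sigma> \<xi> * (cmod (FT u' \<xi>))\<^sup>2)"
    using Q_integrable_iff(1)[of "FT u'" \<sigma>] fin by (simp add: Sq_def wt_def)
  have iF: "integrable lborel (?w ?F)"
    by (rule Bochner_Integration.integrable_bound[OF iw]) (use le in \<open>auto intro!: order_trans[OF _ abs_ge_self]\<close>)
  then show "frac_deriv_L2 \<sigma> u" unfolding frac_deriv_L2_def using hF by blast
  have h: "has_fourier_on (- {0}) u (fourier_on (- {0}) u)"
    unfolding fourier_on_def by (rule someI[of "has_fourier_on (- {0}) u"]) (rule hF)
  have [measurable]: "fourier_on (- {0}) u \<in> borel_measurable borel" using h by (simp add: has_fourier_on_def)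
  have "(LINT \<xi>|lborel. ?w (fourier_on (- {0}) u) \<xi>) = (LINT \<xi>|lborel. ?w ?F \<xi>)"
    by (rule integral_cong_AE) (use fourier_off_zero_unique[OF h hF] in \<open>auto elim!: eventually_mono\<close>)
  also have "\<dots> \<le> (LINT \<xi>|lborel. wt \<sigma> \<xi> * (cmod (FT u' \<xi>))\<^sup>2)"
    by (rule integral_mono[OF iF iw]) (rule le)
  also have "\<dots> = enn2real (Sq \<sigma> u')" using Q_integrable_iff(2)[of "FT u'" \<sigma>] by (simp add: Sq_def wt_def)
  finally show "frac_deriv_norm \<sigma> u \<le> sqrt (enn2real (Sq \<sigma> u'))" unfolding frac_deriv_norm_def by (rule real_sqrt_le_mono)
qed

lemma E_spaceI:
  assumes d: "\<And>x. (f has_real_derivative f' x) (at x)" and b: "\<And>x. \<bar>f x\<bar> \<le> M"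
    and f': "CL2 f'" "Sq (s - 1) f' < \<infinity>"
  shows "f \<in> E_space s"
proof -
  have "deriv f = f'" using d by (auto intro: DERIV_imp_deriv)
  moreover have "bounded (range f)" using b by (auto simp: bounded_iff)
  moreover have "f C1_differentiable_on UNIV"
    unfolding C1_differentiable_on_def using d CL2_continuous(1)[OF f'(1)]
    by (auto simp: has_real_derivative_iff_has_vector_derivative)
  ultimately show ?thesis using sobolevI[OF f'] by (simp add: E_space_def)
qed

lemma E_norm_eq:
  assumes d: "\<And>x. (f has_real_derivative f' x) (at x)" and f': "CL2 f'"
  shows "E_norm s f = sup_norm f + sqrt (enn2real (Sq (s - 1) f'))"
proof -
  have "deriv f = f'" using d by (auto intro: DERIV_imp_deriv)
  then show ?thesis using sobolev_norm_eq[OF f'] by (simp add: E_norm_def)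
qed

lemma Ebar_spaceI:
  assumes d: "\<And>x. (f has_real_derivative f' x) (at x)" and b: "\<And>x. \<bar>f x\<bar> \<le> M"
    and s: "s \<ge> 2" and f': "CL2 f'" "Sq (s - 2) f' < \<infinity>"
  shows "f \<in> Ebar_space s"
proof -
  have "bounded (range f)" using b by (auto simp: bounded_iff)
  moreover have "continuous_on UNIV f" using d by (intro continuous_at_imp_continuous_on ballI DERIV_isCont)
  ultimately show ?thesis using frac_deriv(1)[OF d b f'(1) _ f'(2)] s by (simp add: Ebar_space_def)
qed

lemma Ebar_norm_tendsto_0:
  assumes d: "\<And>\<tau> x. \<tau> \<in> I \<Longrightarrow> (f \<tau> has_real_derivative f' \<tau> x) (at x)"
    and c: "\<And>\<tau>. \<tau> \<in> I \<Longrightarrow> CL2 (f' \<tau>)" and s: "s \<ge> 2"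
    and lim: "((\<lambda>\<tau>. Sq (s - 2) (f' \<tau>)) \<longlongrightarrow> 0) (at t within I)"
    and sup: "\<And>e. e > 0 \<Longrightarrow> \<forall>\<^sub>F \<tau> in at t within I. \<forall>x. \<bar>f \<tau> x\<bar> \<le> e"
  shows "((\<lambda>\<tau>. Ebar_norm s (f \<tau>)) \<longlongrightarrow> 0) (at t within I)"
proof -
  have fin: "\<forall>\<^sub>F \<tau> in at t within I. Sq (s - 2) (f' \<tau>) < 1" by (rule order_tendstoD(2)[OF lim]) simp
  have ev: "\<forall>\<^sub>F \<tau> in at t within I. 0 \<le> frac_deriv_norm (s - 2) (f \<tau>) \<and>
      frac_deriv_norm (s - 2) (f \<tau>) \<le> sqrt (enn2real (Sq (s - 2) (f' \<tau>)))"
    using fin sup[OF zero_less_one] eventually_within[of I t]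
  proof eventually_elim
    fix \<tau> assume 1: "Sq (s - 2) (f' \<tau>) < 1" and 2: "\<forall>x. \<bar>f \<tau> x\<bar> \<le> 1" and 3: "\<tau> \<in> I"
    have f: "Sq (s - 2) (f' \<tau>) < \<infinity>" using 1 by (rule less_trans) simp
    have b: "\<bar>f \<tau> x\<bar> \<le> 1" for x using 2 by blast
    show "0 \<le> frac_deriv_norm (s - 2) (f \<tau>) \<and> frac_deriv_norm (s - 2) (f \<tau>) \<le> sqrt (enn2real (Sq (s - 2) (f' \<tau>)))"
      using frac_deriv(2)[OF d[OF 3] b c[OF 3] _ f] s by (simp add: frac_deriv_norm_nonneg)
  qed
  have "((\<lambda>\<tau>. frac_deriv_norm (s - 2) (f \<tau>)) \<longlongrightarrow> 0) (at t within I)"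
    by (rule tendsto_sandwich[OF _ _ tendsto_const sqrt_enn2real_tendsto_0[OF lim]]; rule eventually_mono[OF ev]) auto
  from tendsto_add[OF sup_norm_tendsto_0[OF sup] this] show ?thesis by (simp add: Ebar_norm_def[abs_def])
qed

context hunter_saxton
begin

text \<open>All norms split into a sup part and a Sobolev part. For the difference quotient in time,
  the Sobolev part is \<open>scont_difference_quotient\<close> at order \<open>r - 1\<close>; the
  sup part is a mean value estimate for \<open>u s x - s * ut t x\<close>, whose time derivative is
  small near \<open>t\<close> uniformly in \<open>x\<close>.\<close>

lemma explicit_is_solution: "is_solution g (r + 1) u0 T u"
  unfolding is_solution_def
proof (intro conjI exI ballI allI)
  obtain M M' where M: "\<And>t x. t \<in> I \<Longrightarrow> \<bar>u t x\<bar> \<le> M" "\<And>t x. t \<in> I \<Longrightarrow> \<bar>ut t x\<bar> \<le> M'"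
    using ucb_u ucb_ut unfolding ucb_def by blast
  have r1: "r - 1 \<ge> 0" "r - 1 \<le> r" "r + 1 \<ge> 2" "r + 1 - 2 = r - 1" "r + 1 - 1 = r" using r by simp_all
  note v = scontD[OF scont_v] and v1 = scontD[OF scont_mono[OF scont_v r1(2)]] and vt = scontD[OF scont_vt]
  have du: "((\<lambda>x. u \<tau> x - u t x) has_real_derivative v \<tau> x - v t x) (at x)" if "\<tau> \<in> I" "t \<in> I" for \<tau> t x
    by (intro DERIV_diff u_deriv that)
  have supu: "\<forall>\<^sub>F \<tau> in at t within I. \<forall>x. \<bar>u \<tau> x - u t x\<bar> \<le> e" if "t \<in> I" "e > 0" for t e
    by (rule ucbD[OF ucb_u that])
  show "C0_into I (E_space (r + 1)) (E_norm (r + 1)) u"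
    unfolding C0_into_def
  proof (intro conjI ballI)
    fix t assume t: "t \<in> I"
    show "u t \<in> E_space (r + 1)"
      by (rule E_spaceI[OF u_deriv[OF t] M(1)[OF t] v(1)[OF t]]) (use v(2)[OF t] r1 in simp)
    have "((\<lambda>\<tau>. sup_norm (\<lambda>x. u \<tau> x - u t x) + sqrt (enn2real (Sq r (\<lambda>x. v \<tau> x - v t x)))) \<longlongrightarrow> 0 + 0) (at t within I)"
      by (intro tendsto_add sup_norm_tendsto_0 sqrt_enn2real_tendsto_0 v(3)[OF t] supu[OF t])
    then have "((\<lambda>\<tau>. sup_norm (\<lambda>x. u \<tau> x - u t x) + sqrt (enn2real (Sq r (\<lambda>x. v \<tau> x - v t x)))) \<longlongrightarrow> 0) (at t within I)" by simp
    then show "((\<lambda>\<tau>. E_norm (r + 1) (\<lambda>x. u \<tau> x - u t x)) \<longlongrightarrow> 0) (at t within I)"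
    proof (rule Lim_transform_eventually, use eventually_within[of I t] in eventually_elim)
      fix \<tau> assume \<tau>: "\<tau> \<in> I"
      show "sup_norm (\<lambda>x. u \<tau> x - u t x) + sqrt (enn2real (Sq r (\<lambda>x. v \<tau> x - v t x))) = E_norm (r + 1) (\<lambda>x. u \<tau> x - u t x)"
        using E_norm_eq[OF du[OF \<tau> t] CL2_diff[OF v(1)[OF \<tau>] v(1)[OF t]], of "r + 1"] r1 by simp
    qed
  qed
  show "C1_into I (Ebar_space (r + 1)) (Ebar_norm (r + 1)) u ut"
    unfolding C1_into_def C0_into_def
  proof (intro conjI ballI)
    fix t assume t: "t \<in> I"
    show "u t \<in> Ebar_space (r + 1)"
      by (rule Ebar_spaceI[OF u_deriv[OF t] M(1)[OF t] r1(3) v(1)[OF t]]) (use v1(2)[OF t] r1 in simp)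
    show "ut t \<in> Ebar_space (r + 1)"
      by (rule Ebar_spaceI[OF ut_deriv[OF t] M(2)[OF t] r1(3) vt(1)[OF t]]) (use vt(2)[OF t] r1 in simp)
    show "((\<lambda>\<tau>. Ebar_norm (r + 1) (\<lambda>x. u \<tau> x - u t x)) \<longlongrightarrow> 0) (at t within I)"
      by (rule Ebar_norm_tendsto_0[OF du CL2_diff _ _ supu[OF t]]) (use t r1 v1[OF _] in simp_all)
    show "((\<lambda>\<tau>. Ebar_norm (r + 1) (\<lambda>x. ut \<tau> x - ut t x)) \<longlongrightarrow> 0) (at t within I)"
      by (rule Ebar_norm_tendsto_0[OF DERIV_diff[OF ut_deriv ut_deriv] CL2_diff _ _ ucbD[OF ucb_ut t]]) (use t r1 vt[OF _] in simp_all)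
    show "((\<lambda>\<tau>. Ebar_norm (r + 1) (\<lambda>x. (u \<tau> x - u t x) / (\<tau> - t) - ut t x)) \<longlongrightarrow> 0) (at t within I)"
    proof (rule Ebar_norm_tendsto_0)
      fix \<tau> x assume \<tau>: "\<tau> \<in> I"
      show "((\<lambda>x. (u \<tau> x - u t x) / (\<tau> - t) - ut t x) has_real_derivative (v \<tau> x - v t x) / (\<tau> - t) - vt t x) (at x)"
        by (intro DERIV_diff DERIV_cdivide u_deriv ut_deriv t \<tau>)
      have "CL2 (\<lambda>x. 1 / (\<tau> - t) * (v \<tau> x - v t x) - vt t x)" by (intro CL2_diff CL2_cmult v(1) vt(1) t \<tau>)
      then show "CL2 (\<lambda>x. (v \<tau> x - v t x) / (\<tau> - t) - vt t x)" by simp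
    next
      show "((\<lambda>\<tau>. Sq (r + 1 - 2) (\<lambda>x. (v \<tau> x - v t x) / (\<tau> - t) - vt t x)) \<longlongrightarrow> 0) (at t within I)"
        unfolding r1(4) by (rule scont_difference_quotient[OF scont_vt r1(1) v(1) v_time_deriv vt_jointly_continuous t])
    next
      fix e :: real assume e: "e > 0"
      obtain \<delta> where \<delta>: "\<delta> > 0" "\<And>\<sigma> x. \<sigma> \<in> I \<Longrightarrow> \<sigma> \<noteq> t \<Longrightarrow> \<bar>\<sigma> - t\<bar> < \<delta> \<Longrightarrow> \<bar>ut \<sigma> x - ut t x\<bar> \<le> e"
        using ucbD[OF ucb_ut t e] unfolding eventually_at by (auto simp: dist_real_def)
      have "\<bar>(u \<tau> x - u t x) / (\<tau> - t) - ut t x\<bar> \<le> e" if \<tau>: "\<tau> \<in> I" "\<tau> \<noteq> t" "\<bar>\<tau> - t\<bar> < \<delta>" for \<tau> x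
      proof -
        have "norm ((u \<tau> x - \<tau> * ut t x) - (u t x - t * ut t x)) \<le> e * norm (\<tau> - t)"
        proof (rule field_differentiable_bound[where S = "I \<inter> ball t \<delta>" and f' = "\<lambda>\<sigma>. ut \<sigma> x - ut t x"])
          show "convex (I \<inter> ball t \<delta>)" by (intro convex_Int) auto
          fix \<sigma> assume \<sigma>: "\<sigma> \<in> I \<inter> ball t \<delta>"
          have "((\<lambda>s. u s x - s * ut t x) has_real_derivative ut \<sigma> x - 1 * ut t x) (at \<sigma> within I)"
            by (intro DERIV_diff u_time_deriv DERIV_cmult_right DERIV_ident) (use \<sigma> in simp)
          from DERIV_subset[OF this Int_lower1]
          show "((\<lambda>s. u s x - s * ut t x) has_real_derivative ut \<sigma> x - ut t x) (at \<sigma> within I \<inter> ball t \<delta>)" by simp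
          show "norm (ut \<sigma> x - ut t x) \<le> e"
            using \<delta>(2)[of \<sigma> x] \<sigma> e by (cases "\<sigma> = t") (auto simp: dist_real_def abs_minus_commute)
        qed (use \<tau> t \<delta>(1) in \<open>auto simp: dist_real_def abs_minus_commute\<close>)
        moreover have "(u \<tau> x - \<tau> * ut t x) - (u t x - t * ut t x) = (u \<tau> x - u t x) - (\<tau> - t) * ut t x" by (simp add: algebra_simps)
        ultimately have *: "\<bar>(u \<tau> x - u t x) - (\<tau> - t) * ut t x\<bar> \<le> e * \<bar>\<tau> - t\<bar>" by (simp only: real_norm_def)
        have "(u \<tau> x - u t x) / (\<tau> - t) - ut t x = ((u \<tau> x - u t x) - (\<tau> - t) * ut t x) / (\<tau> - t)"
          using \<tau>(2) by (simp add: field_simps)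
        moreover have "0 < \<bar>\<tau> - t\<bar>" using \<tau>(2) by simp
        ultimately show ?thesis using * by (simp only: abs_divide pos_divide_le_eq)
      qed
      then show "\<forall>\<^sub>F \<tau> in at t within I. \<forall>x. \<bar>(u \<tau> x - u t x) / (\<tau> - t) - ut t x\<bar> \<le> e"
        unfolding eventually_at using \<delta>(1) by (auto simp: dist_real_def)
    qed (use r1 in simp)
  qed
  fix t x assume t: "t \<in> I"
  have "deriv (u t) = v t" using u_deriv[OF t] by (auto intro: DERIV_imp_deriv)
  then show "ut t x + u t x * deriv (u t) x = (LBINT z:{..x}. 1/2 * (deriv (u t) z)\<^sup>2) + g t"
    using solution_equation[OF t] by simp
qed (rule u_0)

end

section \<open>A maximum principle for transport\<close>

text \<open>Around each time the bound there, increased by 1, still holds; finitely many such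
  neighbourhoods cover the compact \<open>I\<close>.\<close>

lemma ucbI:
  assumes K: "compact I" and b: "\<And>t. t \<in> I \<Longrightarrow> \<exists>M. \<forall>x. \<bar>\<psi> t x\<bar> \<le> M"
    and c: "\<And>t e. t \<in> I \<Longrightarrow> e > 0 \<Longrightarrow> \<forall>\<^sub>F \<tau> in at t within I. \<forall>x. \<bar>\<psi> \<tau> x - \<psi> t x\<bar> \<le> e"
  shows "ucb I \<psi>"
proof -
  have "\<exists>d M. d > 0 \<and> (\<forall>\<sigma>\<in>I. \<bar>\<sigma> - t\<bar> < d \<longrightarrow> (\<forall>x. \<bar>\<psi> \<sigma> x\<bar> \<le> M))" if t: "t \<in> I" for t
  proof -
    obtain M where M: "\<And>x. \<bar>\<psi> t x\<bar> \<le> M" using b[OF t] by blast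
    obtain d where d: "d > 0" "\<And>\<sigma> x. \<sigma> \<in> I \<Longrightarrow> \<sigma> \<noteq> t \<Longrightarrow> \<bar>\<sigma> - t\<bar> < d \<Longrightarrow> \<bar>\<psi> \<sigma> x - \<psi> t x\<bar> \<le> 1"
      using c[OF t zero_less_one] unfolding eventually_at by (auto simp: dist_real_def)
    have "\<bar>\<psi> \<sigma> x\<bar> \<le> M + 1" if "\<sigma> \<in> I" "\<bar>\<sigma> - t\<bar> < d" for \<sigma> x
      using d(2)[OF that(1) _ that(2), of x] M[of x] by (cases "\<sigma> = t") auto
    then show ?thesis using d(1) by blast
  qed
  then obtain d M where dM: "\<And>t. t \<in> I \<Longrightarrow> d t > 0" "\<And>t \<sigma> x. t \<in> I \<Longrightarrow> \<sigma> \<in> I \<Longrightarrow> \<bar>\<sigma> - t\<bar> < d t \<Longrightarrow> \<bar>\<psi> \<sigma> x\<bar> \<le> M t"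
    by metis
  obtain C where C: "C \<subseteq> I" "finite C" "I \<subseteq> (\<Union>t\<in>C. ball t (d t))"
    using compactE_image[OF K, of I "\<lambda>t. ball t (d t)"] dM(1) by (metis (no_types, lifting) UN_I centre_in_ball open_ball subsetI)
  have "\<bar>\<psi> \<sigma> x\<bar> \<le> (\<Sum>t\<in>C. \<bar>M t\<bar>)" if \<sigma>: "\<sigma> \<in> I" for \<sigma> x
  proof -
    obtain t where t: "t \<in> C" "\<sigma> \<in> ball t (d t)" using C(3) \<sigma> by blast
    have "\<bar>\<psi> \<sigma> x\<bar> \<le> \<bar>M t\<bar>" using dM(2)[OF _ \<sigma>, of t x] t C(1) by (auto simp: dist_real_def abs_minus_commute)
    also have "\<dots> \<le> (\<Sum>t\<in>C. \<bar>M t\<bar>)" by (rule member_le_sum) (use t C in auto)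
    finally show ?thesis .
  qed
  then show ?thesis unfolding ucb_def using c by blast
qed

lemma scont_ucb:
  assumes s: "scont r I \<phi>" and r: "r > 1/2" and K: "compact I"
  shows "ucb I \<phi>"
proof (rule ucbI[OF K])
  fix t assume t: "t \<in> I"
  show "\<exists>M. \<forall>x. \<bar>\<phi> t x\<bar> \<le> M"
    by (rule Sq_bounded[OF scontD(1)[OF s t] r scontD(2)[OF s t]]) blast
  fix e :: real assume e: "e > 0"
  have lim: "((\<lambda>\<tau>. Kemb r * Sq r (\<lambda>x. \<phi> \<tau> x - \<phi> t x)) \<longlongrightarrow> 0) (at t within I)"
    by (rule ennreal_cmult_0(1)[OF scontD(3)[OF s t]]) (use Kemb_finite[OF r] in simp)
  have "\<forall>\<^sub>F \<tau> in at t within I. Kemb r * Sq r (\<lambda>x. \<phi> \<tau> x - \<phi> t x) < ennreal (e\<^sup>2)"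
    using e by (intro order_tendstoD(2)[OF lim]) simp
  moreover have "\<forall>\<^sub>F \<tau> in at t within I. Sq r (\<lambda>x. \<phi> \<tau> x - \<phi> t x) < 1"
    by (rule order_tendstoD(2)[OF scontD(3)[OF s t]]) simp
  ultimately show "\<forall>\<^sub>F \<tau> in at t within I. \<forall>x. \<bar>\<phi> \<tau> x - \<phi> t x\<bar> \<le> e"
    using eventually_within[of I t]
  proof (eventually_elim, intro allI)
    fix \<tau> x assume 1: "Kemb r * Sq r (\<lambda>x. \<phi> \<tau> x - \<phi> t x) < ennreal (e\<^sup>2)"
      and 2: "Sq r (\<lambda>x. \<phi> \<tau> x - \<phi> t x) < 1" and \<tau>: "\<tau> \<in> I"
    have "Sq r (\<lambda>x. \<phi> \<tau> x - \<phi> t x) < \<infinity>" using 2 by (rule less_trans) simp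
    from le_less_trans[OF Sq_sup[OF CL2_diff[OF scontD(1)[OF s \<tau>] scontD(1)[OF s t]] r this, of x] 1]
    have "(\<phi> \<tau> x - \<phi> t x)\<^sup>2 < e\<^sup>2" by (simp add: ennreal_less_iff)
    then show "\<bar>\<phi> \<tau> x - \<phi> t x\<bar> \<le> e" using e abs_le_square_iff[of "\<phi> \<tau> x - \<phi> t x" e] by simp
  qed
qed

lemma ucb_jointly_continuous:
  assumes u: "ucb I \<psi>" and c: "\<And>t. t \<in> I \<Longrightarrow> continuous_on UNIV (\<psi> t)"
  shows "continuous_on (I \<times> UNIV) (\<lambda>(s, x). \<psi> s x)"
  unfolding continuous_on_iff
proof (intro ballI allI impI)
  fix z :: "real \<times> real" and e :: real assume z: "z \<in> I \<times> UNIV" and e: "0 < e"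
  obtain t x where tx: "z = (t, x)" "t \<in> I" using z by auto
  have e4: "e / 4 > 0" using e by simp
  obtain d where d: "d > 0" "\<And>\<sigma> y. \<sigma> \<in> I \<Longrightarrow> \<sigma> \<noteq> t \<Longrightarrow> \<bar>\<sigma> - t\<bar> < d \<Longrightarrow> \<bar>\<psi> \<sigma> y - \<psi> t y\<bar> \<le> e / 4"
    using ucbD[OF u tx(2) e4] unfolding eventually_at by (auto simp: dist_real_def)
  obtain d' where d': "d' > 0" "\<And>y. \<bar>y - x\<bar> < d' \<Longrightarrow> \<bar>\<psi> t y - \<psi> t x\<bar> < e / 4"
    using c[OF tx(2), unfolded continuous_on_iff, THEN bspec, OF UNIV_I, THEN spec, THEN mp, OF e4] by (simp only: dist_real_def) blast
  show "\<exists>d>0. \<forall>z'\<in>I \<times> UNIV. dist z' z < d \<longrightarrow> dist (case z' of (s, x) \<Rightarrow> \<psi> s x) (case z of (s, x) \<Rightarrow> \<psi> s x) < e"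
  proof (intro exI[of _ "min d d'"] conjI ballI impI)
    fix z' :: "real \<times> real" assume z': "z' \<in> I \<times> UNIV" "dist z' z < min d d'"
    obtain \<sigma> y where sy: "z' = (\<sigma>, y)" "\<sigma> \<in> I" using z' by auto
    have 1: "\<bar>\<sigma> - t\<bar> < d" "\<bar>y - x\<bar> < d'"
      using z'(2) dist_fst_le[of z' z] dist_snd_le[of z' z] by (auto simp: sy tx dist_real_def)
    have "\<bar>\<psi> \<sigma> y - \<psi> t y\<bar> \<le> e / 4" using d(2)[OF sy(2) _ 1(1), of y] e by (cases "\<sigma> = t") auto
    then have "\<bar>\<psi> \<sigma> y - \<psi> t x\<bar> < e" using d'(2)[OF 1(2)] e by linarith
    then show "dist (case z' of (s, x) \<Rightarrow> \<psi> s x) (case z of (s, x) \<Rightarrow> \<psi> s x) < e"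
      by (simp add: sy tx dist_real_def)
  qed (use d d' in simp)
qed

text \<open>The weight \<open>sqrt (1 + x\<^sup>2)\<close> makes the penalised function attain its maximum, so only
  the partial derivatives at that one point are needed.\<close>

lemma transport_nonpos:
  fixes F Ft Fx W :: "real \<Rightarrow> real \<Rightarrow> real"
  assumes c: "continuous_on ({0..T} \<times> UNIV) (\<lambda>(s, x). F s x)"
    and B: "\<And>t x. t \<in> {0..T} \<Longrightarrow> F t x \<le> B" and F0: "\<And>x. F 0 x \<le> 0"
    and Ft: "\<And>t x. t \<in> {0..T} \<Longrightarrow> ((\<lambda>s. F s x) has_real_derivative Ft t x) (at t within {0..T})"
    and Fx: "\<And>t x. t \<in> {0..T} \<Longrightarrow> (F t has_real_derivative Fx t x) (at x)"
    and eq: "\<And>t x. t \<in> {0..T} \<Longrightarrow> Ft t x + W t x * Fx t x = 0"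
    and W: "\<And>t x. t \<in> {0..T} \<Longrightarrow> \<bar>W t x\<bar> \<le> M" and M: "M > 0" and t: "t \<in> {0..T}"
  shows "F t x \<le> 0"
proof (rule ccontr)
  assume "\<not> F t x \<le> 0"
  then have pos: "F t x > 0" by simp
  \<comment> \<open>This is the penalty at the point \<open>(t, x)\<close>. Its slope in space is at
    most 1, so transport with speed at most \<open>M\<close> can change it at rate at most
    \<open>M\<close>; the growth rate \<open>2 * M\<close> in time makes the contradiction at the
    maximum strict. \<open>e\<close> is chosen to keep the penalised value at \<open>(t, x)\<close>
    positive.\<close>
  define m where "m = 2 * M * t + sqrt (1 + x\<^sup>2)"
  have m: "m > 0" using M t by (simp add: m_def add_nonneg_pos add_pos_nonneg)
  define e where "e = F t x / (2 * m)"
  have e: "e > 0" "e * m < F t x" using m pos by (simp_all add: e_def)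
  define \<Phi> where "\<Phi> = (\<lambda>s y. F s y - e * (2 * M * s + sqrt (1 + y\<^sup>2)))"
  have \<Phi>pos: "\<Phi> t x > 0" using e by (simp add: \<Phi>_def m_def)
  \<comment> \<open>Beyond this radius the penalty outweighs the upper bound \<open>B\<close>, so a
    maximum over the compact strip with positive value lies in its interior in space.\<close>
  define R where "R = \<bar>B\<bar> / e + \<bar>x\<bar> + 1"
  have R: "R > 0" "\<bar>x\<bar> < R" "\<bar>B\<bar> < e * R" using e by (simp_all add: R_def field_simps add_nonneg_pos add_pos_nonneg)
  have small: "\<Phi> s y < 0" if "s \<in> {0..T}" "R \<le> \<bar>y\<bar>" for s y
  proof -
    have "\<bar>y\<bar> \<le> sqrt (1 + y\<^sup>2)" by (intro real_le_rsqrt) simp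
    then have "e * R \<le> e * (2 * M * s + sqrt (1 + y\<^sup>2))" using that e M by (intro mult_left_mono) (auto intro!: add_increasing)
    then show ?thesis using B[OF that(1), of y] R(3) by (simp add: \<Phi>_def)
  qed
  have ne: "{0..T} \<times> {-R..R} \<noteq> {}" "(t, x) \<in> {0..T} \<times> {-R..R}" using t R by auto
  have "continuous_on ({0..T} \<times> {-R..R}) (\<lambda>z. (case z of (s, x) \<Rightarrow> F s x) - e * (2 * M * fst z + sqrt (1 + (snd z)\<^sup>2)))"
    by (intro continuous_intros continuous_on_subset[OF c]) auto
  then have "continuous_on ({0..T} \<times> {-R..R}) (\<lambda>z. \<Phi> (fst z) (snd z))" by (simp add: \<Phi>_def case_prod_beta')
  from continuous_attains_sup[OF _ ne(1) this] obtain z where z: "z \<in> {0..T} \<times> {-R..R}"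
    "\<And>z'. z' \<in> {0..T} \<times> {-R..R} \<Longrightarrow> \<Phi> (fst z') (snd z') \<le> \<Phi> (fst z) (snd z)"
    by (auto simp: compact_Times)
  obtain t' x' where z': "z = (t', x')" by (cases z)
  have t': "t' \<in> {0..T}" using z(1) z' by simp
  have mx: "\<Phi> s y \<le> \<Phi> t' x'" if "s \<in> {0..T}" "\<bar>y\<bar> \<le> R" for s y
    using z(2)[of "(s, y)"] that z' by (auto simp: abs_le_iff)
  have pos': "\<Phi> t' x' > 0" using mx[OF t, of x] R(2) \<Phi>pos by simp
  have x': "\<bar>x'\<bar> < R" using small[OF t', of x'] pos' by linarith
  have "\<Phi> 0 x' \<le> 0"
  proof -
    have "0 \<le> e * (2 * M * 0 + sqrt (1 + x'\<^sup>2))" using e by simp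
    then show ?thesis using F0[of x'] by (simp add: \<Phi>_def)
  qed
  then have t'0: "t' > 0" using t' pos' by (cases "t' = 0") auto
  have s1: "1 + x'\<^sup>2 > 0" by (simp add: add_pos_nonneg)
  have "(\<Phi> t' has_real_derivative Fx t' x' - e * (x' / sqrt (1 + x'\<^sup>2))) (at x')"
    unfolding \<Phi>_def by (rule derivative_eq_intros Fx[OF t'] refl s1 | use s1 in \<open>simp add: divide_simps\<close>)+
  then have "Fx t' x' - e * (x' / sqrt (1 + x'\<^sup>2)) = 0"
  proof (rule DERIV_local_max[of _ _ _ "R - \<bar>x'\<bar>"])
    show "\<forall>y. \<bar>x' - y\<bar> < R - \<bar>x'\<bar> \<longrightarrow> \<Phi> t' y \<le> \<Phi> t' x'"
    proof (intro allI impI mx[OF t'])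
      show "\<bar>y\<bar> \<le> R" if "\<bar>x' - y\<bar> < R - \<bar>x'\<bar>" for y using that by linarith
    qed
  qed (use x' in simp)
  then have "\<bar>Fx t' x'\<bar> = e * (\<bar>x'\<bar> / sqrt (1 + x'\<^sup>2))" using e s1 by (simp add: abs_mult)
  also have "\<dots> \<le> e * 1"
  proof -
    have "\<bar>x'\<bar> \<le> sqrt (1 + x'\<^sup>2)" by (intro real_le_rsqrt) simp
    then show ?thesis using e s1 by (intro mult_left_mono) (auto simp: divide_le_eq_1)
  qed
  finally have "\<bar>W t' x' * Fx t' x'\<bar> \<le> M * e" unfolding abs_mult using W[OF t', of x'] M by (intro mult_mono) auto
  then have "Ft t' x' \<le> M * e" using eq[OF t', of x'] by linarith
  moreover have "M * e > 0" using M e by simp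
  ultimately have neg: "Ft t' x' - e * (2 * M) < 0" by (simp add: mult_ac)
  have "((\<lambda>s. \<Phi> s x') has_real_derivative Ft t' x' - e * (2 * M)) (at t' within {0..T})"
    unfolding \<Phi>_def by (rule derivative_eq_intros Ft[OF t'] refl | simp)+
  \<comment> \<open>The maximum may sit at the final time \<open>T\<close>, so it is compared with
    earlier times, which exist because \<open>t' > 0\<close>.\<close>
  from has_real_derivative_neg_dec_left[OF this neg] obtain d where d: "d > 0"
    "\<And>h. h > 0 \<Longrightarrow> t' - h \<in> {0..T} \<Longrightarrow> h < d \<Longrightarrow> \<Phi> t' x' < \<Phi> (t' - h) x'" by blast
  have "\<Phi> t' x' < \<Phi> (t' - min (d / 2) t') x'" by (rule d(2)) (use d(1) t' t'0 in auto)
  moreover have "\<Phi> (t' - min (d / 2) t') x' \<le> \<Phi> t' x'" by (rule mx) (use d(1) t' t'0 x' in auto)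
  ultimately show False by simp
qed

lemma half_line_tail:
  fixes k :: "real \<Rightarrow> real"
  assumes i: "integrable lborel k"
  shows "(\<lambda>n. LINT z|lborel. indicator {..c - real n} z * k z) \<longlonglongrightarrow> 0"
proof -
  have [measurable]: "k \<in> borel_measurable borel" using i by auto
  have "(\<lambda>n. LINT z|lborel. indicator {..c - real n} z * k z) \<longlonglongrightarrow> integral\<^sup>L lborel (\<lambda>z :: real. 0 :: real)"
  proof (rule integral_dominated_convergence[where w = "\<lambda>z. \<bar>k z\<bar>"])
    show "AE z in lborel. (\<lambda>n. indicator {..c - real n} z * k z) \<longlonglongrightarrow> 0"
    proof (rule AE_I2)
      fix z
      obtain N :: nat where N: "c - z < real N" using reals_Archimedean2 by blast
      have "\<forall>\<^sub>F n in sequentially. 0 = indicator {..c - real n} z * k z"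
        using eventually_ge_at_top[of N] by eventually_elim (use N in auto)
      then show "(\<lambda>n. indicator {..c - real n} z * k z) \<longlonglongrightarrow> 0" by (rule Lim_transform_eventually[OF tendsto_const])
    qed
  qed (use i in \<open>auto simp: indicator_def\<close>)
  then show ?thesis by simp
qed

text \<open>\<open>f\<^sup>2\<close> is Lipschitz with constant \<open>L\<close>, so on a window of
  length \<delta> = \<open>e / L\<close> it loses at most \<open>e / 2\<close> on average. The mass
  of the window is bounded by the tail of the integral, which vanishes far to the left and accounts
  for the other half of \<open>e\<close>.\<close>

lemma square_integrable_vanish:
  fixes f :: "real \<Rightarrow> real"
  assumes d: "\<And>x. (f has_real_derivative f' x) (at x)" and b: "\<And>x. \<bar>f x\<bar> \<le> A" "\<And>x. \<bar>f' x\<bar> \<le> A'"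
    and i: "integrable lborel (\<lambda>x. (f x)\<^sup>2)"
  shows "(\<lambda>n. (f (- real n))\<^sup>2) \<longlonglongrightarrow> 0"
proof (rule tendstoI)
  fix e :: real assume e: "e > 0"
  define L where "L = 2 * A * A' + 1"
  have A: "A \<ge> 0" "A' \<ge> 0" using b[of 0] by linarith+
  have L: "L > 0" using A by (simp add: L_def add_nonneg_pos)
  define K where "K = (\<lambda>x. LINT z|lborel. indicator {..x} z * (f z)\<^sup>2)"
  have fc: "continuous_on UNIV f" using d by (intro continuous_at_imp_continuous_on ballI DERIV_isCont)
  have K': "(K has_real_derivative (f y)\<^sup>2) (at y)" for y
    unfolding K_def by (rule half_line_integral_deriv[OF _ i]) (intro continuous_intros fc)
  have K0: "K y \<ge> 0" for y unfolding K_def by (intro integral_nonneg_AE) simp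
  have sq: "((\<lambda>x. (f x)\<^sup>2) has_real_derivative 2 * f x * f' x) (at x)" for x
    by (rule derivative_eq_intros d refl | simp)+
  have lip: "(f a)\<^sup>2 - L * y \<le> (f (a + y))\<^sup>2" if "y \<ge> 0" for a y
  proof -
    have "norm ((f (a + y))\<^sup>2 - (f a)\<^sup>2) \<le> L * norm (a + y - a)"
    proof (rule field_differentiable_bound[of UNIV])
      show "norm (2 * f z * f' z) \<le> L" for z
      proof -
        have "\<bar>f z\<bar> * \<bar>f' z\<bar> \<le> A * A'" using b[of z] A by (intro mult_mono) auto
        then show ?thesis by (simp add: L_def abs_mult)
      qed
    qed (use sq in auto)
    then show ?thesis using that by simp
  qed
  define \<delta> where "\<delta> = e / L"
  have \<delta>: "\<delta> > 0" using e L by (simp add: \<delta>_def)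
  have bound: "\<delta> * (f a)\<^sup>2 \<le> K (a + \<delta>) + L * \<delta>\<^sup>2 / 2" for a
  proof -
    have "K (a + 0) - 0 * (f a)\<^sup>2 + L * 0\<^sup>2 / 2 \<le> K (a + \<delta>) - \<delta> * (f a)\<^sup>2 + L * \<delta>\<^sup>2 / 2"
    proof (rule DERIV_nonneg_imp_nondecreasing[of 0 \<delta> "\<lambda>y. K (a + y) - y * (f a)\<^sup>2 + L * y\<^sup>2 / 2"])
      fix y assume y: "0 \<le> y" "y \<le> \<delta>"
      have "((\<lambda>y. K (a + y)) has_real_derivative (f (a + y))\<^sup>2 * 1) (at y)"
        by (rule DERIV_chain2[OF K']) (rule derivative_eq_intros refl | simp)+
      then have "((\<lambda>y. K (a + y) - y * (f a)\<^sup>2 + L * y\<^sup>2 / 2) has_real_derivative (f (a + y))\<^sup>2 - (f a)\<^sup>2 + L * y) (at y)"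
        by (auto intro!: derivative_eq_intros)
      then show "\<exists>D. ((\<lambda>y. K (a + y) - y * (f a)\<^sup>2 + L * y\<^sup>2 / 2) has_real_derivative D) (at y) \<and> 0 \<le> D"
        using lip[OF y(1), of a] by (intro exI conjI) auto
    qed (use \<delta> in simp)
    then show ?thesis using K0[of a] by simp
  qed
  have "(\<lambda>n. K (\<delta> - real n)) \<longlonglongrightarrow> 0" unfolding K_def by (rule half_line_tail[OF i])
  then have "\<forall>\<^sub>F n in sequentially. K (\<delta> - real n) < \<delta> * e / 2"
    by (rule order_tendstoD(2)) (use mult_pos_pos[OF \<delta> e] in linarith)
  then show "\<forall>\<^sub>F n in sequentially. dist ((f (- real n))\<^sup>2) 0 < e"
  proof eventually_elim
    fix n :: nat assume n: "K (\<delta> - real n) < \<delta> * e / 2"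
    have "L * \<delta>\<^sup>2 / 2 = \<delta> * e / 2" using L by (simp add: \<delta>_def power2_eq_square)
    then have "\<delta> * (f (- real n))\<^sup>2 < \<delta> * e" using bound[of "- real n"] n by (simp add: algebra_simps)
    then show "dist ((f (- real n))\<^sup>2) 0 < e" using \<delta> by (simp add: dist_real_def)
  qed
qed

section \<open>Uniqueness\<close>

lemma transport_zero:
  fixes F Ft Fx W :: "real \<Rightarrow> real \<Rightarrow> real"
  assumes c: "continuous_on ({0..T} \<times> UNIV) (\<lambda>(s, x). F s x)"
    and B: "\<And>t x. t \<in> {0..T} \<Longrightarrow> \<bar>F t x\<bar> \<le> B" and F0: "\<And>x. F 0 x = 0"
    and Ft: "\<And>t x. t \<in> {0..T} \<Longrightarrow> ((\<lambda>s. F s x) has_real_derivative Ft t x) (at t within {0..T})"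
    and Fx: "\<And>t x. t \<in> {0..T} \<Longrightarrow> (F t has_real_derivative Fx t x) (at x)"
    and eq: "\<And>t x. t \<in> {0..T} \<Longrightarrow> Ft t x + W t x * Fx t x = 0"
    and W: "\<And>t x. t \<in> {0..T} \<Longrightarrow> \<bar>W t x\<bar> \<le> M" and M: "M > 0" and t: "t \<in> {0..T}"
  shows "F t x = 0"
proof -
  have "F t x \<le> 0"
    by (rule transport_nonpos[OF c _ _ Ft Fx eq W M t, of B]) (use B F0 in \<open>auto simp: abs_le_iff\<close>)
  moreover have "- F t x \<le> 0"
  proof (rule transport_nonpos[where F = "\<lambda>s x. - F s x" and Ft = "\<lambda>s x. - Ft s x" and Fx = "\<lambda>s x. - Fx s x" and W = W and B = B and T = T])
    show "continuous_on ({0..T} \<times> UNIV) (\<lambda>(s, x). - F s x)"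
      using continuous_on_minus[OF c] by (simp add: case_prod_beta')
    show "- F s y \<le> B" if "s \<in> {0..T}" for s y using B[OF that, of y] by (simp add: abs_le_iff)
    show "- Ft s y + W s y * - Fx s y = 0" if "s \<in> {0..T}" for s y using eq[OF that, of y] by simp
  qed (use F0 W M t in \<open>auto intro!: DERIV_minus Ft Fx\<close>)
  ultimately show ?thesis by simp
qed

lemma bounded_diff: "\<exists>M. \<forall>x. \<bar>a x\<bar> \<le> M \<Longrightarrow> \<exists>M. \<forall>x. \<bar>b x\<bar> \<le> M \<Longrightarrow> \<exists>M. \<forall>x. \<bar>a x - b x :: real\<bar> \<le> M"
  by (metis (no_types, opaque_lifting) abs_triangle_ineq4 add_mono order_trans)

text \<open>The supremum of an unbounded set of reals has no meaningful value, so boundedness has to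
  accompany the convergence of \<open>sup_norm\<close>.\<close>

lemma sup_norm_eventually:
  assumes lim: "((\<lambda>\<tau>. sup_norm (f \<tau>)) \<longlongrightarrow> 0) F" and b: "\<forall>\<^sub>F \<tau> in F. \<exists>M. \<forall>x. \<bar>f \<tau> x\<bar> \<le> M" and e: "e > 0"
  shows "\<forall>\<^sub>F \<tau> in F. \<forall>x. \<bar>f \<tau> x\<bar> \<le> e"
  using order_tendstoD(2)[OF lim e] b
proof eventually_elim
  fix \<tau> assume 1: "sup_norm (f \<tau>) < e" and "\<exists>M. \<forall>x. \<bar>f \<tau> x\<bar> \<le> M"
  then obtain M where M: "\<And>x. \<bar>f \<tau> x\<bar> \<le> M" by blast
  show "\<forall>x. \<bar>f \<tau> x\<bar> \<le> e" using sup_norm_upper[of "f \<tau>", OF M] 1 by (meson less_imp_le order_trans)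
qed

text \<open>Finiteness is assumed because \<open>enn2real\<close> sends infinity to 0, so that a
  vanishing real norm alone would say nothing.\<close>

lemma sqrt_enn2real_tendsto_0D:
  assumes lim: "((\<lambda>x. sqrt (enn2real (f x))) \<longlongrightarrow> 0) F" and fin: "\<forall>\<^sub>F x in F. f x < \<infinity>"
  shows "(f \<longlongrightarrow> 0) F"
proof -
  have "((\<lambda>x. ennreal ((sqrt (enn2real (f x)))\<^sup>2)) \<longlongrightarrow> ennreal (0\<^sup>2)) F"
    by (intro tendsto_ennrealI tendsto_power lim)
  then have "((\<lambda>x. ennreal ((sqrt (enn2real (f x)))\<^sup>2)) \<longlongrightarrow> 0) F" by simp
  then show ?thesis
    by (rule Lim_transform_eventually) (use fin in \<open>auto elim!: eventually_mono\<close>)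
qed

lemma tendsto_0_summands:
  fixes f g :: "'a \<Rightarrow> real"
  assumes lim: "((\<lambda>x. f x + g x) \<longlongrightarrow> 0) F" and nn: "\<forall>\<^sub>F x in F. 0 \<le> f x \<and> 0 \<le> g x"
  shows "(f \<longlongrightarrow> 0) F" "(g \<longlongrightarrow> 0) F"
  by (rule tendsto_sandwich[OF _ _ tendsto_const lim]; rule eventually_mono[OF nn]; simp)+

lemma section_continuous:
  assumes "continuous_on (I \<times> UNIV) (\<lambda>(s, x). \<psi> s x)" shows "continuous_on I (\<lambda>s. \<psi> s x)"
proof -
  have "continuous_on I (\<lambda>s. (\<lambda>(s, x). \<psi> s x) (s, x))"
    by (rule continuous_on_compose2[OF assms]) (auto intro!: continuous_intros)
  then show ?thesis by simp
qed

section \<open>Regularity and evolution equations of an arbitrary solution\<close>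

locale hunter_saxton_solution = hunter_saxton +
  fixes W :: "real \<Rightarrow> real \<Rightarrow> real"
  assumes sol: "is_solution g (r + 1) u0 T W"
begin

definition V :: "real \<Rightarrow> real \<Rightarrow> real" where "V t = deriv (W t)"
definition Y :: "real \<Rightarrow> real \<Rightarrow> real" where "Y t = deriv (V t)"
definition H :: "real \<Rightarrow> real \<Rightarrow> real" where "H t x = (LINT z|lborel. indicator {..x} z * (V t z)\<^sup>2)"
definition Wt :: "real \<Rightarrow> real \<Rightarrow> real" where "Wt t x = H t x / 2 + g t - W t x * V t x"

lemma W_0: "W 0 = u0" using sol by (simp add: is_solution_def)

lemma W_space:
  assumes t: "t \<in> I"
  shows "(W t has_real_derivative V t x) (at x)" "CL2 (V t)" "Sq r (V t) < \<infinity>" "\<exists>M. \<forall>x. \<bar>W t x\<bar> \<le> M"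
proof -
  have E: "W t \<in> E_space (r + 1)" using sol t by (simp add: is_solution_def C0_into_def)
  then obtain D where D: "\<And>x. (W t has_real_derivative D x) (at x)" "continuous_on UNIV D"
    unfolding E_space_def C1_differentiable_on_def by (auto simp: has_real_derivative_iff_has_vector_derivative)
  have VD: "V t = D" unfolding V_def using D(1) by (auto intro: DERIV_imp_deriv)
  show "(W t has_real_derivative V t x) (at x)" unfolding VD by (rule D)
  have "V t \<in> sobolev r" using E by (simp add: E_space_def V_def)
  from sobolev_CL2[OF _ this] show "CL2 (V t)" "Sq r (V t) < \<infinity>" using D(2) VD by simp_all
  show "\<exists>M. \<forall>x. \<bar>W t x\<bar> \<le> M" using E by (auto simp: E_space_def bounded_iff)
qed

lemma V_deriv: assumes t: "t \<in> I" shows "(V t has_real_derivative Y t x) (at x)" "CL2 (Y t)"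
proof -
  obtain f' where f': "\<And>x. (V t has_real_derivative f' x) (at x)" "CL2 f'"
    by (rule Sq_C1[OF W_space(2)[OF t] r W_space(3)[OF t]], rule that)
  have "Y t = f'" unfolding Y_def using f'(1) by (auto intro: DERIV_imp_deriv)
  then show "(V t has_real_derivative Y t x) (at x)" "CL2 (Y t)" using f' by simp_all
qed

lemma W_diff: "t \<in> I \<Longrightarrow> \<tau> \<in> I \<Longrightarrow> \<exists>M. \<forall>x. \<bar>W \<tau> x - W t x\<bar> \<le> M"
  by (rule bounded_diff[OF W_space(4) W_space(4)])

lemma W_continuous:
  assumes t: "t \<in> I"
  shows "((\<lambda>\<tau>. sup_norm (\<lambda>x. W \<tau> x - W t x)) \<longlongrightarrow> 0) (at t within I)"
    "((\<lambda>\<tau>. Sq r (\<lambda>x. V \<tau> x - V t x)) \<longlongrightarrow> 0) (at t within I)"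
proof -
  let ?s = "\<lambda>\<tau>. sup_norm (\<lambda>x. W \<tau> x - W t x)" and ?q = "\<lambda>\<tau>. Sq r (\<lambda>x. V \<tau> x - V t x)"
  have "((\<lambda>\<tau>. E_norm (r + 1) (\<lambda>x. W \<tau> x - W t x)) \<longlongrightarrow> 0) (at t within I)"
    using sol t by (simp add: is_solution_def C0_into_def)
  then have "((\<lambda>\<tau>. ?s \<tau> + sqrt (enn2real (?q \<tau>))) \<longlongrightarrow> 0) (at t within I)"
  proof (rule Lim_transform_eventually, use eventually_within[of I t] in eventually_elim)
    fix \<tau> assume \<tau>: "\<tau> \<in> I"
    show "E_norm (r + 1) (\<lambda>x. W \<tau> x - W t x) = ?s \<tau> + sqrt (enn2real (?q \<tau>))"
      using E_norm_eq[OF DERIV_diff[OF W_space(1)[OF \<tau>] W_space(1)[OF t]] CL2_diff[OF W_space(2)[OF \<tau>] W_space(2)[OF t]], of "r + 1"] by simp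
  qed
  note * = tendsto_0_summands[OF this]
  have nn: "\<forall>\<^sub>F \<tau> in at t within I. 0 \<le> ?s \<tau> \<and> 0 \<le> sqrt (enn2real (?q \<tau>))"
    using eventually_within[of I t]
  proof eventually_elim
    fix \<tau> assume "\<tau> \<in> I"
    then obtain M where "\<And>x. \<bar>W \<tau> x - W t x\<bar> \<le> M" using W_diff[OF t] by blast
    then show "0 \<le> ?s \<tau> \<and> 0 \<le> sqrt (enn2real (?q \<tau>))" by (intro conjI sup_norm_nonneg) simp_all
  qed
  show "(?s \<longlongrightarrow> 0) (at t within I)" by (rule *(1)[OF nn])
  show "(?q \<longlongrightarrow> 0) (at t within I)"
  proof (rule sqrt_enn2real_tendsto_0D[OF *(2)[OF nn]], use eventually_within[of I t] in eventually_elim)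
    fix \<tau> assume \<tau>: "\<tau> \<in> I"
    show "?q \<tau> < \<infinity>"
      by (rule le_less_trans[OF Sq_diff[OF W_space(2)[OF \<tau>] W_space(2)[OF t]]])
        (use W_space(3)[OF \<tau>] W_space(3)[OF t] in \<open>simp add: ennreal_mult_less_top\<close>)
  qed
qed

lemma scont_V: "scont r I V"
  by (rule scontI[OF W_space(2,3) W_continuous(2)])

lemma ucb_V: "ucb I V"
  by (rule scont_ucb[OF scont_V]) (use r in auto)

lemma ucb_Y: "ucb I Y"
proof (rule scont_ucb)
  show "scont (r - 1) I Y"
    by (rule scont_deriv[OF _ V_deriv(2) V_deriv(1)]) (use scont_V in simp_all)
qed (use r in auto)

lemma ucb_W: "ucb I W"
proof (rule ucbI[OF compact_Icc W_space(4)])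
  fix t e :: real assume t: "t \<in> I" and e: "e > 0"
  show "\<forall>\<^sub>F \<tau> in at t within I. \<forall>x. \<bar>W \<tau> x - W t x\<bar> \<le> e"
    by (rule sup_norm_eventually[OF W_continuous(1)[OF t] _ e], rule eventually_mono[OF eventually_within], rule W_diff[OF t])
qed

lemma V_sq: "t \<in> I \<Longrightarrow> integrable lborel (\<lambda>x. (V t x)\<^sup>2)"
  by (rule CL2_integrable_sq[OF W_space(2)])

lemma Vc: "t \<in> I \<Longrightarrow> continuous_on UNIV (V t)"
  by (rule CL2_continuous(1)[OF W_space(2)])

lemma H_deriv: assumes t: "t \<in> I" shows "(H t has_real_derivative (V t x)\<^sup>2) (at x)"
  unfolding H_def[abs_def] by (rule half_line_integral_deriv[OF _ V_sq[OF t]]) (intro continuous_intros Vc t)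

lemma Wt_eq:
  fixes zt :: "real \<Rightarrow> real \<Rightarrow> real"
  assumes zt: "\<And>t x. t \<in> I \<Longrightarrow> zt t x + W t x * deriv (W t) x = (LBINT z:{..x}. 1/2 * (deriv (W t) z)\<^sup>2) + g t"
    and t: "t \<in> I"
  shows "zt t = Wt t"
proof
  fix x
  have "(LBINT z:{..x}. 1/2 * (deriv (W t) z)\<^sup>2) = 1/2 * H t x"
    unfolding set_lebesgue_integral_def H_def integral_mult_right_zero[symmetric] V_def by (intro Bochner_Integration.integral_cong) auto
  then show "zt t x = Wt t x" using zt[OF t, of x] by (simp add: Wt_def V_def)
qed

lemma Wt_C1: "C1_into I (Ebar_space (r + 1)) (Ebar_norm (r + 1)) W Wt"
proof -
  obtain zt where zt: "C1_into I (Ebar_space (r + 1)) (Ebar_norm (r + 1)) W zt"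
    "\<And>t x. t \<in> I \<Longrightarrow> zt t x + W t x * deriv (W t) x = (LBINT z:{..x}. 1/2 * (deriv (W t) z)\<^sup>2) + g t"
    using sol unfolding is_solution_def by blast
  note e = Wt_eq[OF zt(2)]
  have 1: "((\<lambda>\<tau>. Ebar_norm (r + 1) (\<lambda>x. Wt \<tau> x - Wt t x)) \<longlongrightarrow> 0) (at t within I)" if t: "t \<in> I" for t
  proof (rule Lim_transform_eventually)
    show "((\<lambda>\<tau>. Ebar_norm (r + 1) (\<lambda>x. zt \<tau> x - zt t x)) \<longlongrightarrow> 0) (at t within I)"
      using zt(1) t by (simp add: C1_into_def C0_into_def)
    show "\<forall>\<^sub>F \<tau> in at t within I. Ebar_norm (r + 1) (\<lambda>x. zt \<tau> x - zt t x) = Ebar_norm (r + 1) (\<lambda>x. Wt \<tau> x - Wt t x)"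
      using eventually_within[of I t] by eventually_elim (use e t in simp)
  qed
  have "\<forall>t\<in>I. Wt t \<in> Ebar_space (r + 1)" using zt(1) e by (simp add: C1_into_def C0_into_def)
  moreover have "\<forall>t\<in>I. ((\<lambda>\<tau>. Ebar_norm (r + 1) (\<lambda>x. (W \<tau> x - W t x) / (\<tau> - t) - Wt t x)) \<longlongrightarrow> 0) (at t within I)"
    using zt(1) e by (simp add: C1_into_def)
  ultimately show ?thesis using zt(1) 1 by (simp add: C1_into_def C0_into_def)
qed

lemma Ebar_eventually:
  assumes "((\<lambda>\<tau>. Ebar_norm (r + 1) (f \<tau>)) \<longlongrightarrow> 0) (at t within I)" and b: "\<And>\<tau>. \<tau> \<in> I \<Longrightarrow> \<exists>M. \<forall>x. \<bar>f \<tau> x\<bar> \<le> M" and e: "e > 0"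
  shows "\<forall>\<^sub>F \<tau> in at t within I. \<forall>x. \<bar>f \<tau> x\<bar> \<le> e"
proof (rule sup_norm_eventually[OF _ _ e])
  show ev: "\<forall>\<^sub>F \<tau> in at t within I. \<exists>M. \<forall>x. \<bar>f \<tau> x\<bar> \<le> M"
    by (rule eventually_mono[OF eventually_within]) (rule b)
  show "((\<lambda>\<tau>. sup_norm (f \<tau>)) \<longlongrightarrow> 0) (at t within I)"
  proof (rule tendsto_0_summands(1)[OF assms(1)[unfolded Ebar_norm_def]], use ev in eventually_elim)
    fix \<tau> assume "\<exists>M. \<forall>x. \<bar>f \<tau> x\<bar> \<le> M"
    then show "0 \<le> sup_norm (f \<tau>) \<and> 0 \<le> frac_deriv_norm (r + 1 - 2) (f \<tau>)"
      using sup_norm_nonneg[of "f \<tau>"] frac_deriv_norm_nonneg by blast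
  qed
qed

lemma Wt_bounded: "t \<in> I \<Longrightarrow> \<exists>M. \<forall>x. \<bar>Wt t x\<bar> \<le> M"
  using Wt_C1 by (auto simp: C1_into_def C0_into_def Ebar_space_def bounded_iff)

lemma ucb_Wt: "ucb I Wt"
proof (rule ucbI[OF compact_Icc Wt_bounded])
  fix t e :: real assume t: "t \<in> I" and e: "e > 0"
  show "\<forall>\<^sub>F \<tau> in at t within I. \<forall>x. \<bar>Wt \<tau> x - Wt t x\<bar> \<le> e"
    by (rule Ebar_eventually[OF _ bounded_diff[OF Wt_bounded Wt_bounded[OF t]] e]) (use Wt_C1 t in \<open>auto simp: C1_into_def C0_into_def\<close>)
qed

lemma W_time_deriv:
  assumes t: "t \<in> I" shows "((\<lambda>s. W s x) has_real_derivative Wt t x) (at t within I)"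
  unfolding has_field_derivative_iff
proof (rule LIM_zero_cancel, rule tendstoI)
  fix e :: real assume e: "e > 0"
  have b: "\<exists>M. \<forall>x. \<bar>(W \<tau> x - W t x) / (\<tau> - t) - Wt t x\<bar> \<le> M" if \<tau>: "\<tau> \<in> I" for \<tau>
  proof (rule bounded_diff[OF _ Wt_bounded[OF t]])
    obtain M where M: "\<And>x. \<bar>W \<tau> x - W t x\<bar> \<le> M" using W_diff[OF t \<tau>] by blast
    then have "\<bar>(W \<tau> x - W t x) / (\<tau> - t)\<bar> \<le> M / \<bar>\<tau> - t\<bar>" for x unfolding abs_divide by (intro divide_right_mono) auto
    then show "\<exists>M. \<forall>x. \<bar>(W \<tau> x - W t x) / (\<tau> - t)\<bar> \<le> M" by blast
  qed
  have lim: "((\<lambda>\<tau>. Ebar_norm (r + 1) (\<lambda>x. (W \<tau> x - W t x) / (\<tau> - t) - Wt t x)) \<longlongrightarrow> 0) (at t within I)"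
    using Wt_C1 t by (simp add: C1_into_def)
  have e2: "e / 2 > 0" using e by simp
  have "\<forall>\<^sub>F \<tau> in at t within I. \<forall>x. \<bar>(W \<tau> x - W t x) / (\<tau> - t) - Wt t x\<bar> \<le> e / 2"
    by (rule Ebar_eventually[OF lim b e2])
  then show "\<forall>\<^sub>F \<tau> in at t within I. dist ((W \<tau> x - W t x) / (\<tau> - t) - Wt t x) 0 < e"
  proof eventually_elim
    fix \<tau> assume *: "\<forall>x. \<bar>(W \<tau> x - W t x) / (\<tau> - t) - Wt t x\<bar> \<le> e / 2"
    have "\<bar>(W \<tau> x - W t x) / (\<tau> - t) - Wt t x\<bar> < e" using *[THEN spec, of x] e by linarith
    then show "dist ((W \<tau> x - W t x) / (\<tau> - t) - Wt t x) 0 < e" by (simp add: dist_real_def)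
  qed
qed

text \<open>Uniform continuity of the energy in time is read off the equation, whose other terms are
  already controlled, instead of from the defining integral.\<close>

lemma ucb_H: "ucb I H"
proof -
  have "ucb I (\<lambda>t x. 2 * (Wt t x + (W t x * V t x + (-1) * g t)))"
    by (intro ucb_mult ucb_add ucb_time ucb_Wt ucb_W ucb_V gI compact_Icc continuous_intros)
  then show ?thesis by (simp add: Wt_def)
qed

lemma Wc: "t \<in> I \<Longrightarrow> continuous_on UNIV (W t)" "t \<in> I \<Longrightarrow> continuous_on UNIV (H t)"
  by (intro continuous_at_imp_continuous_on ballI, rule DERIV_isCont, erule W_space(1) H_deriv)+

lemma joint:
  shows "continuous_on (I \<times> UNIV) (\<lambda>z. W (fst z) (snd z))" "continuous_on (I \<times> UNIV) (\<lambda>z. V (fst z) (snd z))"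
    "continuous_on (I \<times> UNIV) (\<lambda>z. Y (fst z) (snd z))" "continuous_on (I \<times> UNIV) (\<lambda>z. H (fst z) (snd z))"
  using ucb_jointly_continuous[OF ucb_W Wc(1)] ucb_jointly_continuous[OF ucb_V Vc]
    ucb_jointly_continuous[OF ucb_Y CL2_continuous(1)[OF V_deriv(2)]] ucb_jointly_continuous[OF ucb_H Wc(2)]
  by (simp_all add: case_prod_beta')

definition Vt :: "real \<Rightarrow> real \<Rightarrow> real" where "Vt t x = - ((V t x)\<^sup>2 / 2) - W t x * Y t x"

lemma Wt_deriv: assumes t: "t \<in> I" shows "(Wt t has_real_derivative Vt t x) (at x)"
proof -
  have "((\<lambda>x. H t x / 2 + g t - W t x * V t x) has_real_derivative (V t x)\<^sup>2 / 2 - (V t x * V t x + Y t x * W t x)) (at x)"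
    by (rule derivative_eq_intros H_deriv[OF t] W_space(1)[OF t] V_deriv(1)[OF t] refl | simp)+
  moreover have "(V t x)\<^sup>2 / 2 - (V t x * V t x + Y t x * W t x) = Vt t x" by (simp add: Vt_def power2_eq_square)
  ultimately show ?thesis by (simp add: Wt_def[abs_def])
qed

lemma Vt_joint: "continuous_on (I \<times> UNIV) (\<lambda>z. Vt (fst z) (snd z))"
  unfolding Vt_def by (intro continuous_intros joint) auto

lemma time_FTC:
  fixes f f' :: "real \<Rightarrow> real"
  assumes d: "\<And>s. s \<in> I \<Longrightarrow> (f has_real_derivative f' s) (at s within I)" and t: "t \<in> I"
  shows "(f' has_integral f t - f 0) {0..t}"
proof (rule fundamental_theorem_of_calculus)
  fix s assume s: "s \<in> {0..t}"
  have "(f has_real_derivative f' s) (at s within {0..t})" by (rule DERIV_subset[OF d]) (use s t in auto)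
  then show "(f has_vector_derivative f' s) (at s within {0..t})" by (simp add: has_real_derivative_iff_has_vector_derivative)
qed (use t in simp)

lemma time_FTC_deriv:
  fixes f f' :: "real \<Rightarrow> real"
  assumes c: "continuous_on I f'" and e: "\<And>s. s \<in> I \<Longrightarrow> f s = c + integral {0..s} f'" and t: "t \<in> I"
  shows "(f has_real_derivative f' t) (at t within I)"
proof -
  have "((\<lambda>s. c + integral {0..s} f') has_real_derivative 0 + f' t) (at t within I)"
    by (intro DERIV_add DERIV_const integral_has_real_derivative c t)
  then have "((\<lambda>s. c + integral {0..s} f') has_real_derivative f' t) (at t within I)" by simp
  then show ?thesis by (rule has_field_derivative_transform_within[OF _ zero_less_one t]) (simp add: e)
qed

text \<open>The solution concept provides a time derivative of \<open>W\<close> only. Integrating it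
  in time, differentiating under the integral in space and comparing with the space derivative of
  \<open>W \<tau> - W 0\<close> shows that the mixed derivatives agree.\<close>

lemma V_time_deriv:
  assumes t: "t \<in> I" shows "((\<lambda>s. V s x) has_real_derivative Vt t x) (at t within I)"
proof (rule time_FTC_deriv[OF _ _ t])
  have c: "continuous_on (I \<times> UNIV) (\<lambda>(s, x). Vt s x)" using Vt_joint by (simp add: case_prod_beta')
  show "continuous_on I (\<lambda>s. Vt s x)" by (rule section_continuous[OF c])
  fix \<tau> assume \<tau>: "\<tau> \<in> I"
  have i: "((\<lambda>s. Wt s y) has_integral W \<tau> y - W 0 y) {0..\<tau>}" for y
    by (rule time_FTC[OF W_time_deriv \<tau>])
  have "((\<lambda>y. integral (cbox 0 \<tau>) (\<lambda>s. Wt s y)) has_real_derivative integral (cbox 0 \<tau>) (\<lambda>s. Vt s x)) (at x within UNIV)"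
  proof (rule leibniz_rule_field_derivative)
    show "((\<lambda>y. Wt s y) has_real_derivative Vt s y) (at y within UNIV)" if "s \<in> cbox 0 \<tau>" for s y
      using Wt_deriv[of s y] that \<tau> by simp
    show "(\<lambda>s. Wt s y) integrable_on cbox 0 \<tau>" for y using i[of y] by auto
    have "continuous_on (UNIV \<times> cbox 0 \<tau>) (\<lambda>z. (\<lambda>z. Vt (fst z) (snd z)) (snd z, fst z))"
      by (rule continuous_on_compose2[OF Vt_joint]) (use \<tau> in \<open>auto intro!: continuous_intros\<close>)
    then show "continuous_on (UNIV \<times> cbox 0 \<tau>) (\<lambda>(y, s). Vt s y)" by (simp add: case_prod_beta')
  qed auto
  moreover have "(\<lambda>y. integral (cbox 0 \<tau>) (\<lambda>s. Wt s y)) = (\<lambda>y. W \<tau> y - W 0 y)"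
    using integral_unique[OF i] by auto
  ultimately have "((\<lambda>y. W \<tau> y - W 0 y) has_real_derivative integral {0..\<tau>} (\<lambda>s. Vt s x)) (at x)" by simp
  moreover have "((\<lambda>y. W \<tau> y - W 0 y) has_real_derivative V \<tau> x - V 0 x) (at x)"
    by (intro DERIV_diff W_space \<tau>) (use T in simp)
  ultimately show "V \<tau> x = V 0 x + integral {0..\<tau>} (\<lambda>s. Vt s x)" using DERIV_unique by fastforce
qed

text \<open>The balance law (V^2)_t + (W V^2)_x = 0, integrated over \<open>{a..x}\<close>, leaves
  the flux at both ends. It is integrated in time before \<open>a\<close> is sent to minus infinity:
  the flux at \<open>a\<close> vanishes at each single time by
  \<open>square_integrable_vanish\<close>, and dominated convergence carries this through the time
  integral.\<close>

lemma H_time_deriv: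
  assumes t: "t \<in> I" shows "((\<lambda>s. H s x) has_real_derivative - (W t x * (V t x)\<^sup>2)) (at t within I)"
proof (rule time_FTC_deriv[OF _ _ t, where f' = "\<lambda>s. - (W s x * (V s x)\<^sup>2)"])
  let ?P = "\<lambda>s y. W s y * (V s y)\<^sup>2"
  have sec: "continuous_on I (\<lambda>s. W s y)" "continuous_on I (\<lambda>s. V s y)" for y
    by (rule section_continuous, use joint in \<open>simp add: case_prod_beta'\<close>)+
  show "continuous_on I (\<lambda>s. - ?P s x)" by (intro continuous_intros sec)
  have E: "integral {a..x} (\<lambda>z. (V s z)\<^sup>2) = H s x - H s a" if "s \<in> I" "a \<le> x" for s a
    by (intro integral_unique fundamental_theorem_of_calculus that(2))
      (auto simp flip: has_real_derivative_iff_has_vector_derivative intro!: has_field_derivative_at_within H_deriv that(1))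
  have dE: "((\<lambda>s. H s x - H s a) has_real_derivative ?P s a - ?P s x) (at s within I)" if s: "s \<in> I" and a: "a \<le> x" for s a
  proof -
    have "((\<lambda>s. integral (cbox a x) (\<lambda>z. (V s z)\<^sup>2)) has_real_derivative integral (cbox a x) (\<lambda>z. 2 * V s z * Vt s z)) (at s within I)"
    proof (rule leibniz_rule_field_derivative[OF _ _ _ s])
      show "((\<lambda>s. (V s z)\<^sup>2) has_real_derivative 2 * V \<tau> z * Vt \<tau> z) (at \<tau> within I)" if "\<tau> \<in> I" for \<tau> z
        by (rule derivative_eq_intros V_time_deriv[OF that] refl | simp)+
      show "(\<lambda>z. (V \<tau> z)\<^sup>2) integrable_on cbox a x" if "\<tau> \<in> I" for \<tau>
        by (rule integrable_continuous) (intro continuous_intros continuous_on_subset[OF Vc[OF that]] subset_UNIV)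
      have "continuous_on (I \<times> cbox a x) (\<lambda>z. 2 * V (fst z) (snd z) * Vt (fst z) (snd z))"
        by (intro continuous_intros continuous_on_subset[OF joint(2)] continuous_on_subset[OF Vt_joint]) auto
      then show "continuous_on (I \<times> cbox a x) (\<lambda>(\<tau>, z). 2 * V \<tau> z * Vt \<tau> z)" by (simp add: case_prod_beta')
    qed auto
    moreover have "integral (cbox a x) (\<lambda>z. 2 * V s z * Vt s z) = - ?P s x - - ?P s a"
      unfolding cbox_interval
    proof (intro integral_unique fundamental_theorem_of_calculus a)
      fix z
      have "((\<lambda>z. - ?P s z) has_real_derivative - (V s z * (V s z)\<^sup>2 + 2 * V s z * Y s z * W s z)) (at z)"
        by (rule derivative_eq_intros W_space(1)[OF s] V_deriv(1)[OF s] refl | simp)+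
      moreover have "- (V s z * (V s z)\<^sup>2 + 2 * V s z * Y s z * W s z) = 2 * V s z * Vt s z"
        by (simp add: Vt_def power2_eq_square algebra_simps)
      ultimately show "((\<lambda>z. - ?P s z) has_vector_derivative 2 * V s z * Vt s z) (at z within {a..x})"
        by (auto simp flip: has_real_derivative_iff_has_vector_derivative intro: has_field_derivative_at_within)
    qed
    ultimately have "((\<lambda>s. integral {a..x} (\<lambda>z. (V s z)\<^sup>2)) has_real_derivative ?P s a - ?P s x) (at s within I)" by simp
    then show ?thesis by (rule has_field_derivative_transform_within[OF _ zero_less_one s]) (simp add: E a)
  qed
  fix \<tau> assume \<tau>: "\<tau> \<in> I"
  \<comment> \<open>Shifts the sequence of left endpoints so that all of them lie at or below
    \<open>x\<close>.\<close>
  define N where "N = nat \<lceil>\<bar>x\<bar>\<rceil>"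
  have N: "- real (n + N) \<le> x" for n unfolding N_def by linarith
  define a where "a = (\<lambda>n. - real (n + N))"
  have hi: "((\<lambda>s. ?P s (a n) - ?P s x) has_integral (H \<tau> x - H \<tau> (a n)) - (H 0 x - H 0 (a n))) {0..\<tau>}" for n
    by (rule time_FTC[OF dE \<tau>]) (use N in \<open>simp_all add: a_def\<close>)
  obtain M where M: "M > 0" "\<And>s x. s \<in> I \<Longrightarrow> \<bar>W s x\<bar> \<le> M" by (rule ucb_bounded[OF ucb_W], rule that)
  obtain B where B: "B > 0" "\<And>s x. s \<in> I \<Longrightarrow> \<bar>V s x\<bar> \<le> B" by (rule ucb_bounded[OF ucb_V], rule that)
  obtain B' where B': "B' > 0" "\<And>s x. s \<in> I \<Longrightarrow> \<bar>Y s x\<bar> \<le> B'" by (rule ucb_bounded[OF ucb_Y], rule that)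
  have P: "\<bar>?P s y\<bar> \<le> M * B\<^sup>2" if "s \<in> I" for s y
  proof -
    have "\<bar>V s y\<bar>\<^sup>2 \<le> B\<^sup>2" by (intro power_mono B that) simp
    then show ?thesis unfolding abs_mult using M that by (intro mult_mono) auto
  qed
  have "(\<lambda>n. integral {0..\<tau>} (\<lambda>s. ?P s (a n) - ?P s x)) \<longlonglongrightarrow> integral {0..\<tau>} (\<lambda>s. - ?P s x)"
  proof (rule dominated_convergence(2))
    show "(\<lambda>s. ?P s (a n) - ?P s x) integrable_on {0..\<tau>}" for n using hi by blast
    show "(\<lambda>s. 2 * (M * B\<^sup>2)) integrable_on {0..\<tau>}" by (rule integrable_const_ivl)
    fix s assume "s \<in> {0..\<tau>}"
    then have s: "s \<in> I" using \<tau> by simp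
    show "norm (?P s (a n) - ?P s x) \<le> 2 * (M * B\<^sup>2)" for n using P[OF s, of "a n"] P[OF s, of x] unfolding real_norm_def by linarith
    have "(\<lambda>n. (V s (- real n))\<^sup>2) \<longlonglongrightarrow> 0" by (rule square_integrable_vanish[OF V_deriv(1)[OF s] B(2)[OF s] B'(2)[OF s] V_sq[OF s]])
    from LIMSEQ_ignore_initial_segment[OF this, of N] have v: "(\<lambda>n. (V s (a n))\<^sup>2) \<longlonglongrightarrow> 0" by (simp add: a_def)
    have "(\<lambda>n. ?P s (a n)) \<longlonglongrightarrow> 0"
    proof (rule Lim_null_comparison)
      show "\<forall>\<^sub>F n in sequentially. norm (?P s (a n)) \<le> M * (V s (a n))\<^sup>2"
        using M(2)[OF s] by (intro always_eventually allI) (simp add: abs_mult mult_right_mono)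
      show "(\<lambda>n. M * (V s (a n))\<^sup>2) \<longlonglongrightarrow> 0" using tendsto_mult[OF tendsto_const v, of M] by simp
    qed
    from tendsto_diff[OF this tendsto_const, of "?P s x"] show "(\<lambda>n. ?P s (a n) - ?P s x) \<longlonglongrightarrow> - ?P s x" by simp
  qed
  moreover have Ha: "(\<lambda>n. H s (a n)) \<longlonglongrightarrow> 0" if "s \<in> I" for s
    using LIMSEQ_ignore_initial_segment[OF half_line_tail[OF V_sq[OF that], of 0], of N] by (simp add: H_def a_def)
  have z: "0 \<in> I" using T by simp
  have "(\<lambda>n. (H \<tau> x - H \<tau> (a n)) - (H 0 x - H 0 (a n))) \<longlonglongrightarrow> (H \<tau> x - 0) - (H 0 x - 0)"
    by (intro tendsto_intros Ha \<tau> z)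
  then have "(\<lambda>n. integral {0..\<tau>} (\<lambda>s. ?P s (a n) - ?P s x)) \<longlonglongrightarrow> (H \<tau> x - 0) - (H 0 x - 0)"
    unfolding integral_unique[OF hi] .
  ultimately show "H \<tau> x = H 0 x + integral {0..\<tau>} (\<lambda>s. - ?P s x)" using LIMSEQ_unique by fastforce
qed

lemma H_0: "H 0 x = h x"
proof -
  have "V 0 = v0" unfolding V_def W_0 using u0d by (auto intro: DERIV_imp_deriv)
  then show ?thesis by (simp add: H_def h_def)
qed

text \<open>The label \<open>A t x\<close> of the particle at \<open>x\<close>, read off the explicit flow \<open>q\<close> with the
  unknown solution in place of the Lagrangian velocity and energy.\<close>

definition A :: "real \<Rightarrow> real \<Rightarrow> real" where "A t x = x - t * W t x + t\<^sup>2 / 4 * H t x + C1 t"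

section \<open>Labels of an arbitrary solution and identification with the explicit one\<close>

lemma A_0: "A 0 x = x" by (simp add: A_def C1_def)

text \<open>The common factor is \<open>(1 - t * V t x / 2)\<^sup>2\<close>. It shows A_t + W A_x =
  0, so labels are constant along the flow of \<open>W\<close>; in the time derivative the
  contributions of \<open>H\<close> and of \<open>g\<close> cancel, which is the reason for the form
  of \<open>A\<close>.\<close>

lemma A_deriv:
  assumes t: "t \<in> I"
  shows "((\<lambda>s. A s x) has_real_derivative - W t x * (1 - t * V t x + t\<^sup>2 / 4 * (V t x)\<^sup>2)) (at t within I)"
    "(A t has_real_derivative 1 - t * V t x + t\<^sup>2 / 4 * (V t x)\<^sup>2) (at x)"
proof -
  have "((\<lambda>s. x - s * W s x + s\<^sup>2 / 4 * H s x + C1 s) has_real_derivative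
     0 - (W t x + Wt t x * t) + (t / 2 * H t x + - (W t x * (V t x)\<^sup>2) * (t\<^sup>2 / 4)) + t * g t) (at t within I)"
    by (rule derivative_eq_intros W_time_deriv[OF t] H_time_deriv[OF t] C1_deriv[OF t] refl | simp)+
  moreover have "0 - (W t x + Wt t x * t) + (t / 2 * H t x + - (W t x * (V t x)\<^sup>2) * (t\<^sup>2 / 4)) + t * g t
      = - W t x * (1 - t * V t x + t\<^sup>2 / 4 * (V t x)\<^sup>2)"
    by (simp add: Wt_def algebra_simps)
  ultimately show "((\<lambda>s. A s x) has_real_derivative - W t x * (1 - t * V t x + t\<^sup>2 / 4 * (V t x)\<^sup>2)) (at t within I)"
    by (simp add: A_def)
  have "((\<lambda>x. x - t * W t x + t\<^sup>2 / 4 * H t x + C1 t) has_real_derivative 1 - t * V t x + t\<^sup>2 / 4 * (V t x)\<^sup>2) (at x)"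
    by (rule derivative_eq_intros W_space(1)[OF t] H_deriv[OF t] refl | simp)+
  then show "(A t has_real_derivative 1 - t * V t x + t\<^sup>2 / 4 * (V t x)\<^sup>2) (at x)" by (simp add: A_def[abs_def])
qed

lemma C1_continuous: "continuous_on I C1"
  by (rule DERIV_continuous_on[OF C1_deriv])

lemma A_joint: "continuous_on (I \<times> UNIV) (\<lambda>z. A (fst z) (snd z))"
proof -
  have "continuous_on (I \<times> (UNIV :: real set)) (\<lambda>z. C1 (fst z))"
    by (rule continuous_on_compose2[OF C1_continuous]) (auto intro!: continuous_intros)
  then show ?thesis unfolding A_def by (intro continuous_intros joint) auto
qed

lemma W_bound: obtains M where "M > 0" "\<And>t x. t \<in> I \<Longrightarrow> \<bar>W t x\<bar> \<le> M"
  by (rule ucb_bounded[OF ucb_W], rule that)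

text \<open>The given solution conserves the energy to the left of a particle as well:
  \<open>H\<close> and \<open>h\<close> composed with \<open>A\<close> solve the same transport
  equation with velocity \<open>W\<close> and agree at time 0.\<close>

lemma H_eq: assumes t: "t \<in> I" shows "H t x - h (A t x) = 0"
proof (rule W_bound)
  fix M assume M: "M > 0" "\<And>t x. t \<in> I \<Longrightarrow> \<bar>W t x\<bar> \<le> M"
  obtain B where B: "B > 0" "\<And>s x. s \<in> I \<Longrightarrow> \<bar>H s x\<bar> \<le> B" by (rule ucb_bounded[OF ucb_H], rule that)
  let ?a = "\<lambda>t x. 1 - t * V t x + t\<^sup>2 / 4 * (V t x)\<^sup>2"
  show ?thesis
  proof (rule transport_zero[where F = "\<lambda>t x. H t x - h (A t x)" and Ft = "\<lambda>t x. - (W t x * (V t x)\<^sup>2) - (v0 (A t x))\<^sup>2 * (- W t x * ?a t x)"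
        and Fx = "\<lambda>t x. (V t x)\<^sup>2 - (v0 (A t x))\<^sup>2 * ?a t x" and W = W and M = M and T = T and B = "B + H0"])
    have "continuous_on (I \<times> UNIV) (\<lambda>z. H (fst z) (snd z) - h (A (fst z) (snd z)))"
      by (intro continuous_on_diff joint continuous_on_compose2[OF hc A_joint]) auto
    then show "continuous_on (I \<times> UNIV) (\<lambda>(s, x). H s x - h (A s x))" by (simp add: case_prod_beta')
    fix t x assume t: "t \<in> I"
    show "\<bar>H t x - h (A t x)\<bar> \<le> B + H0" using B(2)[OF t, of x] h_bounds(3)[of "A t x"] by linarith
    show "((\<lambda>s. H s x - h (A s x)) has_real_derivative - (W t x * (V t x)\<^sup>2) - (v0 (A t x))\<^sup>2 * (- W t x * ?a t x)) (at t within I)"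
      by (intro DERIV_diff H_time_deriv t DERIV_chain2[OF h_deriv A_deriv(1)[OF t]])
    show "((\<lambda>x. H t x - h (A t x)) has_real_derivative (V t x)\<^sup>2 - (v0 (A t x))\<^sup>2 * ?a t x) (at x)"
      by (intro DERIV_diff H_deriv t DERIV_chain2[OF h_deriv A_deriv(2)[OF t]])
    show "- (W t x * (V t x)\<^sup>2) - (v0 (A t x))\<^sup>2 * (- W t x * ?a t x) + W t x * ((V t x)\<^sup>2 - (v0 (A t x))\<^sup>2 * ?a t x) = 0"
      by (simp add: algebra_simps)
  qed (use M t in \<open>auto simp: H_0 A_0\<close>)
qed

text \<open>Along the flow of \<open>W\<close> the velocity grows at the rate
  \<open>H / 2 + g\<close> while \<open>H\<close> stays constant. Hence
  \<open>W - t / 2 * H - G\<close> is transported, as is \<open>u0\<close> composed with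
  \<open>A\<close>, and both start from \<open>u0\<close>.\<close>

lemma W_eq: assumes t: "t \<in> I" shows "W t x - t / 2 * H t x - G t - u0 (A t x) = 0"
proof (rule W_bound)
  fix M assume M: "M > 0" "\<And>t x. t \<in> I \<Longrightarrow> \<bar>W t x\<bar> \<le> M"
  have Gc: "continuous_on (I \<times> (UNIV :: real set)) (\<lambda>z. G (fst z))"
    by (rule continuous_on_compose2[OF G_cont]) (auto intro!: continuous_intros)
  have ub: "ucb I (\<lambda>t x. (W t x + (- t / 2) * H t x) + (- G t))"
    by (intro ucb_mult ucb_add ucb_time ucb_W ucb_H compact_Icc continuous_intros G_cont) simp
  obtain B where B: "\<And>t x. t \<in> I \<Longrightarrow> \<bar>(W t x + (- t / 2) * H t x) + (- G t)\<bar> \<le> B"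
    by (rule ucb_bounded[OF ub], rule that)
  let ?a = "\<lambda>t x. 1 - t * V t x + t\<^sup>2 / 4 * (V t x)\<^sup>2"
  show ?thesis
  proof (rule transport_zero[where F = "\<lambda>t x. W t x - t / 2 * H t x - G t - u0 (A t x)"
        and Ft = "\<lambda>t x. Wt t x - (H t x / 2 + - (W t x * (V t x)\<^sup>2) * (t / 2)) - g t - v0 (A t x) * (- W t x * ?a t x)"
        and Fx = "\<lambda>t x. V t x - t / 2 * (V t x)\<^sup>2 - 0 - v0 (A t x) * ?a t x" and W = W and M = M and T = T and B = "B + K0"])
    have "continuous_on (I \<times> UNIV) (\<lambda>z. W (fst z) (snd z) - fst z / 2 * H (fst z) (snd z) - G (fst z) - u0 (A (fst z) (snd z)))"
      by (intro continuous_intros joint Gc continuous_on_compose2[OF v0c(3) A_joint]) auto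
    then show "continuous_on (I \<times> UNIV) (\<lambda>(s, x). W s x - s / 2 * H s x - G s - u0 (A s x))" by (simp add: case_prod_beta')
    fix t x assume t: "t \<in> I"
    show "\<bar>W t x - t / 2 * H t x - G t - u0 (A t x)\<bar> \<le> B + K0" using B[OF t, of x] u0b[of "A t x"] by (simp add: abs_le_iff)
    have "((\<lambda>s. s / 2 * H s x) has_real_derivative H t x / 2 + - (W t x * (V t x)\<^sup>2) * (t / 2)) (at t within I)"
      by (rule derivative_eq_intros H_time_deriv[OF t] refl | simp)+
    then show "((\<lambda>s. W s x - s / 2 * H s x - G s - u0 (A s x)) has_real_derivative
        Wt t x - (H t x / 2 + - (W t x * (V t x)\<^sup>2) * (t / 2)) - g t - v0 (A t x) * (- W t x * ?a t x)) (at t within I)"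
      by (intro DERIV_diff W_time_deriv t G_deriv DERIV_chain2[OF u0d A_deriv(1)[OF t]])
    show "((\<lambda>x. W t x - t / 2 * H t x - G t - u0 (A t x)) has_real_derivative V t x - t / 2 * (V t x)\<^sup>2 - 0 - v0 (A t x) * ?a t x) (at x)"
      by (intro DERIV_diff DERIV_const DERIV_cmult W_space H_deriv t DERIV_chain2[OF u0d A_deriv(2)[OF t]])
    show "Wt t x - (H t x / 2 + - (W t x * (V t x)\<^sup>2) * (t / 2)) - g t - v0 (A t x) * (- W t x * ?a t x)
        + W t x * (V t x - t / 2 * (V t x)\<^sup>2 - 0 - v0 (A t x) * ?a t x) = 0"
      by (simp add: Wt_def algebra_simps)
  qed (use M t in \<open>auto simp: H_0 A_0 W_0 G_def\<close>)
qed

text \<open>Inserting the two identities into the definition of \<open>A\<close> gives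
  \<open>q t (A t x) = x\<close>. So \<open>A t\<close> is the inverse of the explicit flow, and
  \<open>W\<close> is the explicit velocity at the explicit label.\<close>

lemma solution_unique: assumes t: "t \<in> I" shows "W t = u t"
proof
  fix x
  let ?y = "A t x"
  have H: "H t x = h ?y" and W: "W t x = U t ?y" using H_eq[OF t, of x] W_eq[OF t, of x] by (simp_all add: U_def)
  have "q t ?y = x"
  proof -
    have "A t x = x - t * U t ?y + t\<^sup>2 / 4 * h ?y + C1 t" using A_def[of t x] H W by simp
    then show ?thesis by (simp add: q_def U_def \<Gamma>_def power2_eq_square algebra_simps)
  qed
  then have "p t x = ?y" using pq[OF t, of ?y] by simp
  then show "W t x = u t x" using W by (simp add: u_def)
qed

end

section \<open>Global existence for unimodal initial slopes\<close>

lemma (in hunter_saxton) explicit_corresponding_solution: "corresponding_solution g (r + 1) u0 T u"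
  unfolding corresponding_solution_def
proof (intro conjI allI impI ballI)
  show "is_solution g (r + 1) u0 T u" by (rule explicit_is_solution)
  fix z t assume z: "is_solution g (r + 1) u0 T z" and t: "t \<in> I"
  interpret hunter_saxton_solution u0 v0 v0' g r T K0 K1 K2 z by unfold_locales (rule z)
  show "z t = u t" by (rule solution_unique[OF t])
qed

text \<open>Square integrability rules out a negative limit at either end.\<close>

lemma unimodal_square_integrable_nonneg:
  fixes f f' :: "real \<Rightarrow> real"
  assumes d: "\<And>x. (f has_real_derivative f' x) (at x)" and i: "integrable lborel (\<lambda>x. (f x)\<^sup>2)"
    and inc: "\<And>x. x \<le> x0 \<Longrightarrow> f' x \<ge> 0" and dec: "\<And>x. x \<ge> x0 \<Longrightarrow> f' x \<le> 0"
  shows "0 \<le> f x"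
proof (rule ccontr)
  assume "\<not> 0 \<le> f x"
  then have neg: "f x < 0" by simp
  have l: "f y \<le> f z" if "y \<le> z" "z \<le> x0" for y z
    by (rule DERIV_nonneg_imp_nondecreasing[OF that(1)]) (use d inc that(2) in \<open>meson order_trans\<close>)
  have r: "f z \<le> f y" if "y \<le> z" "x0 \<le> y" for y z
    by (rule DERIV_nonpos_imp_nonincreasing[OF that(1)]) (use d dec that(2) in \<open>meson order_trans\<close>)
  \<comment> \<open>Monotonicity keeps \<open>f\<close> below the negative value \<open>f x\<close>
    on one whole side of \<open>x\<close>, the left one if \<open>x \<le> x0\<close> and the right
    one otherwise, so intervals of any length are available.\<close>
  have c: "\<exists>a. \<forall>y\<in>{a..a + real n}. f y \<le> f x" for n
  proof (cases "x \<le> x0")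
    case True
    have "\<forall>y\<in>{x - real n..x - real n + real n}. f y \<le> f x" using l[of _ x] True by auto
    then show ?thesis by blast
  next
    case False
    have "\<forall>y\<in>{x..x + real n}. f y \<le> f x" using r[of x] False by auto
    then show ?thesis by blast
  qed
  obtain n :: nat where n: "(LINT x|lborel. (f x)\<^sup>2) < real n * (f x)\<^sup>2"
    using reals_Archimedean3[of "(f x)\<^sup>2"] neg by auto
  obtain a where a: "\<And>y. y \<in> {a..a + real n} \<Longrightarrow> f y \<le> f x" using c[of n] by blast
  have "real n * (f x)\<^sup>2 = (LINT y|lborel. indicator {a..a + real n} y * (f x)\<^sup>2)" by simp
  also have "\<dots> \<le> (LINT y|lborel. (f y)\<^sup>2)"
  proof (rule integral_mono[OF _ i])
    show "integrable lborel (\<lambda>y. indicator {a..a + real n} y * (f x)\<^sup>2)" by simp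
    show "indicator {a..a + real n} y * (f x)\<^sup>2 \<le> (f y)\<^sup>2" for y
      using a[of y] neg abs_le_square_iff[of "f x" "f y"] by (cases "y \<in> {a..a + real n}") auto
  qed
  finally show False using n by simp
qed

theorem theorem4p4:
  fixes g :: "real \<Rightarrow> real" and s :: real and u0 :: "real \<Rightarrow> real" and x0 :: real
  assumes "bounded (g ` {0..})" and "continuous_on {0..} g"
    and "s > 5/2"
    and "u0 \<in> E_space s"
    and "\<And>x. x \<le> x0 \<Longrightarrow> deriv (deriv u0) x \<ge> 0"
    and "\<And>x. x \<ge> x0 \<Longrightarrow> deriv (deriv u0) x \<le> 0"
    and "deriv u0 x0 > 0"
  shows "max_existence_time g s u0 = \<infinity>"
proof -
  define r where "r = s - 1"
  have rs: "r > 3/2" "s = r + 1" using assms(3) by (simp_all add: r_def)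
  obtain K0 where K0: "\<And>x. \<bar>u0 x\<bar> \<le> K0" using assms(4) by (auto simp: E_space_def bounded_iff)
  obtain D where D: "\<And>x. (u0 has_real_derivative D x) (at x)" "continuous_on UNIV D"
    using assms(4) unfolding E_space_def C1_differentiable_on_def by (auto simp: has_real_derivative_iff_has_vector_derivative)
  have D': "deriv u0 = D" using D(1) by (auto intro: DERIV_imp_deriv)
  have "D \<in> sobolev r" using assms(4) by (simp add: E_space_def D' r_def)
  from sobolev_CL2[OF D(2) this] have v0: "CL2 D" "Sq r D < \<infinity>" .
  obtain D2 where D2: "\<And>x. (D has_real_derivative D2 x) (at x)" "CL2 D2" "Sq (r - 1) D2 < \<infinity>"
    by (rule Sq_C1[OF v0(1) rs(1) v0(2)], rule that)
  have D2': "deriv D = D2" using D2(1) by (auto intro: DERIV_imp_deriv)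
  have nn: "0 \<le> D x" for x
    by (rule unimodal_square_integrable_nonneg[OF D2(1) CL2_integrable_sq[OF v0(1)], of x0]) (use assms(5,6) in \<open>simp_all add: D' D2'\<close>)
  obtain K1 where K1: "\<And>x. \<bar>D x\<bar> \<le> K1" by (rule Sq_bounded[OF v0(1) _ v0(2)]) (use rs in auto)
  obtain K2 where K2: "\<And>x. \<bar>D2 x\<bar> \<le> K2" by (rule Sq_bounded[OF D2(2) _ D2(3)]) (use rs in auto)
  have ex: "\<exists>u. corresponding_solution g s u0 T u" if T: "T > 0" for T
  proof -
    interpret hunter_saxton u0 D D2 g r T K0 K1 K2
      by unfold_locales (use D(1) K0 D2 v0 rs nn K1 K2 assms(2) T in \<open>auto simp: abs_le_iff\<close>)
    show ?thesis using explicit_corresponding_solution rs(2) by auto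
  qed
  show ?thesis unfolding max_existence_time_def
  proof (rule ereal_top)
    fix B :: real
    have "0 < max B 1" by simp
    with ex[OF this] have mem: "ereal (max B 1) \<in> {ereal T |T. 0 < T \<and> (\<exists>u. corresponding_solution g s u0 T u)}" by blast
    have "ereal B \<le> ereal (max B 1)" by simp
    also have "\<dots> \<le> Sup {ereal T |T. 0 < T \<and> (\<exists>u. corresponding_solution g s u0 T u)}"
      by (rule Sup_upper[OF mem])
    finally show "ereal B \<le> Sup {ereal T |T. 0 < T \<and> (\<exists>u. corresponding_solution g s u0 T u)}" .
  qed
qed

end
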